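(* Let $H,G^1,\dots,G^d:\mathbb{R}^d\to\mathbb{R}^d$ be bounded, locally Lipschitz and of sub-linear growth ($|H(\xi)|\le C_H(1+|\xi|)$, $|G^\ell(\xi)|\le C_G^\ell(1+|\xi|)$), and let $\mathcal{L}:\mathbb{R}^{dm}\times\mathcal{P}_1(\mathbb{R}^d)\to[0,\infty)$ be a continuous function such that whenever $(\mu_j)_{j\in\mathbb{N}}$ converges narrowly to $\mu$, then $\mathcal{L}(Y,\mu_j)\to\mathcal{L}(Y,\mu)$ uniformly. Let $\mathcal{U}\subset\mathbb{R}^{md}$ be nonempty and compact, and let an initial datum $(Y^0,\mu^0)\in\chi$ with $\mu^0$ compactly supported be given. Then the optimal control problem $$\min_{(\mathbf{u}_1,\dots,\mathbf{u}_m)\in L^\infty([0,T],\mathcal{U})}\int_0^T\Big(\mathcal{L}(Y(t),\mu(t))+\sum_{k=1}^m|\mathbf{u}_k(t)|^2\Big)dt$$ has a solution, where $(Y,\mu)$ is the solution with initial datum $(Y^0,\mu^0)$ and control $\mathbf{u}$ of $$\begin{cases}\dot Y_k=\mathbf{u}_k,& k=1,\dots,m,\\ \partial_t\mu+\nabla\cdot\Big[\big(H*\mu+\sum_{\ell=1}^dG^\ell*\mu_{m\,\ell}\big)\mu\Big]=0.\end{cases}$$ Moreover this solution can be built as a limit $\mathbf{u}^*$ (in $L^\infty([0,T],\mathcal{U})$) of a sequence of optimal controls $\mathbf{u}_N^*$ of the finite-dimensional problems $$\min_{(\mathbf{u}_1,\dots,\mathbf{u}_m)\in L^\infty([0,T],\mathcal{U})}\int_0^T\Big(\mathcal{L}(Y_N(t),\mu_N(t))+\sum_{k=1}^m|\mathbf{u}_k(t)|^2\Big)dt,$$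 where $\mu_N=\frac1N\sum_{i=1}^N\delta_{X_{i,N}}$ and $\mu_{m\,\ell}=\frac1m\sum_{k=1}^m u_{k\,\ell}\delta_{Y_k}$ are the measures supported on the trajectories of $$\begin{cases}\dot Y_k=\mathbf{u}_k,& k=1,\dots,m,\\ \dot X_i=(H*\mu_N)(X_i)+\sum_{\ell=1}^d(G^\ell*\mu_{m\,\ell})(X_i),& i=1,\dots,N,\end{cases}$$ with initial datum $(Y^0,X_N^0)$ and control $\mathbf{u}$, and where $\mu_N^0=\frac1N\sum_{i=1}^N\delta_{X^0_{i,N}}$ is such that $\mathcal{W}_1(\mu_N^0,\mu^0)\to0$ as $N\to+\infty$.
   Context: $\mathcal{P}_1(\mathbb{R}^d)$: Borel probability measures with finite first moment; $\mathcal{W}_1$: 1-Wasserstein distance; $\chi:=\mathbb{R}^{dm}\times\mathcal{P}_1(\mathbb{R}^d)$ with the metric $\|(Y,\mu)-(Y',\mu')\|_\chi:=\frac1m\sum_{k=1}^m|Y_k-Y_k'|+\mathcal{W}_1(\mu,\mu')$. Write $\mathbf{u}_k=(u_{k\,1},\dots,u_{k\,d})\in\mathbb{R}^d$, $\mu_{m\,\ell}(t)=\frac1m\sum_{k=1}^m u_{k\,\ell}(t)\,\delta_{Y_k(t)}$, $X_N^0=(X^0_{1,N},\dots,X^0_{N,N})$, and $(F*\nu)(x)=\int F(x-\xi)\,d\nu(\xi)$. Approximating sequences $\mu_N^0$ of $\mu^0$ are taken equi-compactly supported. Solutions of the finite-dimensional system are Carathéodory solutions. Solution of the PDE system: for a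 control $\mathbf{u}\in L^\infty([0,T],\mathcal{U})$, a map $(Y,\mu):[0,T]\to\chi$ is a solution if: (i) there is $R>0$ with $\mathrm{supp}\,\mu(t)\subset B(0,R)$ for all $t\in[0,T]$; (ii) it is continuous in time with respect to $\|\cdot\|_\chi$; (iii) $Y$ is a Carathéodory solution of $\dot Y_k=\mathbf{u}_k$; (iv) for every $\varphi\in C_c^\infty(\mathbb{R}^d)$, $\frac{d}{dt}\int\varphi\,d\mu(t)=\int\nabla\varphi(x)\cdot\big((H*\mu(t))(x)+\sum_{\ell=1}^d(G^\ell*\mu_{m\,\ell}(t))(x)\big)\,d\mu(t)(x)$.
   Formalization: The set U is assumed convex in addition to nonempty and compact; without convexity the existence claim fails (d=m=1, H=G=0, U={-1,1}, L=|Y|^2, Y^0=0: the infimum T is not attained). *)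

theory Defs
  imports "HOL-Probability.Probability"
begin

subsection \<open>Probability measures and the 1-Wasserstein distance\<close>

definition P1 :: "'a::euclidean_space measure set" where
  "P1 = {\<mu>. prob_space \<mu> \<and> sets \<mu> = sets borel \<and> integrable \<mu> norm}"

definition couplings :: "'a::euclidean_space measure \<Rightarrow> 'a measure \<Rightarrow> ('a \<times> 'a) measure set" where
  "couplings \<mu> \<nu> = {\<pi>. sets \<pi> = sets (borel \<Otimes>\<^sub>M borel) \<and> distr \<pi> borel fst = \<mu> \<and> distr \<pi> borel snd = \<nu>}"

text \<open>On \<open>P1\<close> the infimum is finite, so the conversion to \<open>real\<close> loses nothing there.\<close>

definition W1 :: "'a::euclidean_space measure \<Rightarrow> 'a measure \<Rightarrow> real" where
  "W1 \<mu> \<nu> = enn2real (INF \<pi>\<in>couplings \<mu> \<nu>. \<integral>\<^sup>+ z. ennreal (dist (fst z) (snd z)) \<partial>\<pi>)"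

definition msupport :: "'a::topological_space measure \<Rightarrow> 'a set" where
  "msupport \<mu> = {x. \<forall>V. open V \<and> x \<in> V \<longrightarrow> emeasure \<mu> V > 0}"

definition narrow_converges :: "(nat \<Rightarrow> 'a::topological_space measure) \<Rightarrow> 'a measure \<Rightarrow> bool" where
  "narrow_converges \<mu>s \<mu> \<longleftrightarrow>
     (\<forall>f :: 'a \<Rightarrow> real. continuous_on UNIV f \<and> bounded (range f) \<longrightarrow>
        (\<lambda>j. \<integral>x. f x \<partial>\<mu>s j) \<longlonglongrightarrow> (\<integral>x. f x \<partial>\<mu>))"

text \<open>The measure \<open>(1/N) (\<delta>\<^bsub>x 1\<^esub> + \<dots> + \<delta>\<^bsub>x N\<^esub>)\<close>, as the image under \<open>x\<close> of the uniform
  probability on \<open>{1..N}\<close>.\<close>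

definition empirical :: "nat \<Rightarrow> (nat \<Rightarrow> 'a::topological_space) \<Rightarrow> 'a measure" where
  "empirical N x = distr (uniform_count_measure {1..N}) borel x"

definition chi_dist ::
  "(real^'d)^'m \<Rightarrow> (real^'d) measure \<Rightarrow> (real^'d)^'m \<Rightarrow> (real^'d) measure \<Rightarrow> real" where
  "chi_dist Y \<mu> Y' \<mu>' =
     (1 / real CARD('m)) * (\<Sum>k\<in>UNIV. norm (Y $ k - Y' $ k)) + W1 \<mu> \<mu>'"

text \<open>Continuity with respect to \<open>chi_dist\<close> of functionals on \<open>UNIV \<times> P1\<close> and of curves
  \<open>[0,T] \<rightarrow> UNIV \<times> P1\<close>.\<close>

definition chi_continuous :: "((real^'d)^'m \<Rightarrow> (real^'d) measure \<Rightarrow> real) \<Rightarrow> bool" where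
  "chi_continuous L \<longleftrightarrow>
     (\<forall>Y. \<forall>\<mu>\<in>P1. \<forall>e>0. \<exists>\<delta>>0. \<forall>Y'. \<forall>\<mu>'\<in>P1.
        chi_dist Y' \<mu>' Y \<mu> < \<delta> \<longrightarrow> \<bar>L Y' \<mu>' - L Y \<mu>\<bar> < e)"

definition chi_continuous_curve ::
  "real \<Rightarrow> (real \<Rightarrow> (real^'d)^'m) \<Rightarrow> (real \<Rightarrow> (real^'d) measure) \<Rightarrow> bool" where
  "chi_continuous_curve T Y \<mu> \<longleftrightarrow>
     (\<forall>t\<in>{0..T}. \<forall>e>0. \<exists>\<delta>>0. \<forall>s\<in>{0..T}. \<bar>s - t\<bar> < \<delta> \<longrightarrow> chi_dist (Y s) (\<mu> s) (Y t) (\<mu> t) < e)"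

definition locally_lipschitz :: "('a::metric_space \<Rightarrow> 'b::metric_space) \<Rightarrow> bool" where
  "locally_lipschitz F \<longleftrightarrow> (\<forall>x. \<exists>e>0. \<exists>C. C-lipschitz_on (cball x e) F)"


subsection \<open>Test functions\<close>

primrec C_k :: "nat \<Rightarrow> (real^'d \<Rightarrow> real) \<Rightarrow> bool" where
  "C_k 0 \<phi> \<longleftrightarrow> continuous_on UNIV \<phi>"
| "C_k (Suc n) \<phi> \<longleftrightarrow> (\<exists>g. (\<forall>x. GDERIV \<phi> x :> g x) \<and> (\<forall>i. C_k n (\<lambda>x. g x $ i)))"

definition test_function :: "(real^'d \<Rightarrow> real) \<Rightarrow> bool" where
  "test_function \<phi> \<longleftrightarrow> (\<forall>n. C_k n \<phi>) \<and> compact (closure {x. \<phi> x \<noteq> 0})"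


subsection \<open>Controls\<close>

text \<open>Representatives of the elements of \<open>L\<^sup>\<infinity>([0,T],U)\<close>.\<close>

definition Linf :: "real \<Rightarrow> 'a::euclidean_space set \<Rightarrow> (real \<Rightarrow> 'a) set" where
  "Linf T U = {u \<in> borel_measurable (lebesgue_on {0..T}).
     (\<exists>B. AE t in lebesgue_on {0..T}. norm (u t) \<le> B) \<and> (AE t in lebesgue_on {0..T}. u t \<in> U)}"

text \<open>Weak-* convergence in \<open>L\<^sup>\<infinity>\<close>, regarded as the dual of \<open>L\<^sup>1\<close>.\<close>

definition weak_star_converges ::
  "real \<Rightarrow> (nat \<Rightarrow> real \<Rightarrow> 'a::euclidean_space) \<Rightarrow> (real \<Rightarrow> 'a) \<Rightarrow> bool" where
  "weak_star_converges T us u \<longleftrightarrow>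
     (\<forall>\<psi>. \<psi> absolutely_integrable_on {0..T} \<longrightarrow>
        (\<lambda>n. integral {0..T} (\<lambda>t. us n t \<bullet> \<psi> t)) \<longlonglongrightarrow> integral {0..T} (\<lambda>t. u t \<bullet> \<psi> t))"


subsection \<open>The controlled systems\<close>

text \<open>\<open>z\<close> is an absolutely continuous solution on \<open>[0,T]\<close> of \<open>z'(t) = F t (z t)\<close> for almost every
  \<open>t\<close>, with \<open>z 0 = z0\<close>, in the equivalent integrated form.\<close>

definition caratheodory :: "real \<Rightarrow> (real \<Rightarrow> 'a \<Rightarrow> 'a) \<Rightarrow> 'a::euclidean_space \<Rightarrow> (real \<Rightarrow> 'a) \<Rightarrow> bool" where
  "caratheodory T F z0 z \<longleftrightarrow>
     (\<lambda>s. F s (z s)) absolutely_integrable_on {0..T} \<and>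
     (\<forall>t\<in>{0..T}. z t = z0 + integral {0..t} (\<lambda>s. F s (z s)))"

definition conv :: "(real^'d \<Rightarrow> real^'d) \<Rightarrow> (real^'d) measure \<Rightarrow> real^'d \<Rightarrow> real^'d" where
  "conv F \<nu> x = (\<integral>\<xi>. F (x - \<xi>) \<partial>\<nu>)"

text \<open>Convolution of \<open>F\<close> with the signed measure \<open>(1/m) \<Sum>\<^sub>k w\<^sub>k \<delta>\<^bsub>Y\<^sub>k\<^esub>\<close>; with \<open>w\<^sub>k = u\<^sub>k\<^sub>l\<close> this
  measure is \<open>\<mu>\<^sub>m\<^sub>l\<close>.\<close>

definition conv_atomic :: "(real^'d \<Rightarrow> real^'d) \<Rightarrow> real^'m \<Rightarrow> (real^'d)^'m \<Rightarrow> real^'d \<Rightarrow> real^'d" where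
  "conv_atomic F w Y x = (1 / real CARD('m)) *\<^sub>R (\<Sum>k\<in>UNIV. (w $ k) *\<^sub>R F (x - Y $ k))"

definition velocity ::
  "(real^'d \<Rightarrow> real^'d) \<Rightarrow> ('d \<Rightarrow> real^'d \<Rightarrow> real^'d) \<Rightarrow> (real^'d)^'m \<Rightarrow> (real^'d)^'m
    \<Rightarrow> (real^'d) measure \<Rightarrow> real^'d \<Rightarrow> real^'d" where
  "velocity H G u Y \<mu> x = conv H \<mu> x + (\<Sum>l\<in>UNIV. conv_atomic (G l) (\<chi> k. u $ k $ l) Y x)"

text \<open>In the continuity equation the time derivative is taken in the same sense as for
  \<open>caratheodory\<close>, since its right-hand side is only measurable in time.\<close>

definition mean_field_solution ::
  "real \<Rightarrow> (real^'d \<Rightarrow> real^'d) \<Rightarrow> ('d \<Rightarrow> real^'d \<Rightarrow> real^'d) \<Rightarrow> (real^'d)^'m \<Rightarrow> (real^'d) measure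
    \<Rightarrow> (real \<Rightarrow> (real^'d)^'m) \<Rightarrow> (real \<Rightarrow> (real^'d)^'m) \<Rightarrow> (real \<Rightarrow> (real^'d) measure) \<Rightarrow> bool" where
  "mean_field_solution T H G Y0 \<mu>0 u Y \<mu> \<longleftrightarrow>
     (\<forall>t\<in>{0..T}. \<mu> t \<in> P1) \<and>
     (\<exists>R>0. \<forall>t\<in>{0..T}. msupport (\<mu> t) \<subseteq> ball 0 R) \<and>
     chi_continuous_curve T Y \<mu> \<and>
     caratheodory T (\<lambda>t _. u t) Y0 Y \<and>
     \<mu> 0 = \<mu>0 \<and>
     (\<forall>\<phi> g. test_function \<phi> \<and> (\<forall>x. GDERIV \<phi> x :> g x) \<longrightarrow>
        caratheodory T (\<lambda>t _. \<integral>x. g x \<bullet> velocity H G (u t) (Y t) (\<mu> t) x \<partial>\<mu> t)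
          (\<integral>x. \<phi> x \<partial>\<mu>0) (\<lambda>t. \<integral>x. \<phi> x \<partial>\<mu> t))"

definition particle_solution ::
  "real \<Rightarrow> (real^'d \<Rightarrow> real^'d) \<Rightarrow> ('d \<Rightarrow> real^'d \<Rightarrow> real^'d) \<Rightarrow> nat \<Rightarrow> (real^'d)^'m \<Rightarrow> (nat \<Rightarrow> real^'d)
    \<Rightarrow> (real \<Rightarrow> (real^'d)^'m) \<Rightarrow> (real \<Rightarrow> (real^'d)^'m) \<Rightarrow> (nat \<Rightarrow> real \<Rightarrow> real^'d) \<Rightarrow> bool" where
  "particle_solution T H G N Y0 X0 u Y X \<longleftrightarrow>
     caratheodory T (\<lambda>t _. u t) Y0 Y \<and>
     (\<forall>i\<in>{1..N}. caratheodory T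
        (\<lambda>t x. velocity H G (u t) (Y t) (empirical N (\<lambda>j. X j t)) x) (X0 i) (X i))"

definition empirical_solution ::
  "real \<Rightarrow> (real^'d \<Rightarrow> real^'d) \<Rightarrow> ('d \<Rightarrow> real^'d \<Rightarrow> real^'d) \<Rightarrow> nat \<Rightarrow> (real^'d)^'m \<Rightarrow> (nat \<Rightarrow> real^'d)
    \<Rightarrow> (real \<Rightarrow> (real^'d)^'m) \<Rightarrow> (real \<Rightarrow> (real^'d)^'m) \<Rightarrow> (real \<Rightarrow> (real^'d) measure) \<Rightarrow> bool" where
  "empirical_solution T H G N Y0 X0 u Y \<mu> \<longleftrightarrow>
     (\<exists>X. particle_solution T H G N Y0 X0 u Y X \<and> \<mu> = (\<lambda>t. empirical N (\<lambda>i. X i t)))"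

text \<open>\<open>X0 N i\<close>, for \<open>i \<in> {1..N}\<close>, are the initial positions of the \<open>N\<close>-particle system.\<close>

definition approximates :: "(nat \<Rightarrow> nat \<Rightarrow> real^'d) \<Rightarrow> (real^'d) measure \<Rightarrow> bool" where
  "approximates X0 \<mu>0 \<longleftrightarrow>
     (\<exists>K. compact K \<and> (\<forall>N\<ge>1. msupport (empirical N (X0 N)) \<subseteq> K)) \<and>
     (\<lambda>N. W1 (empirical N (X0 N)) \<mu>0) \<longlonglongrightarrow> 0"


subsection \<open>Optimal controls\<close>

definition cost ::
  "real \<Rightarrow> ((real^'d)^'m \<Rightarrow> (real^'d) measure \<Rightarrow> real) \<Rightarrow> (real \<Rightarrow> (real^'d)^'m)
    \<Rightarrow> (real \<Rightarrow> (real^'d)^'m) \<Rightarrow> (real \<Rightarrow> (real^'d) measure) \<Rightarrow> real" where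
  "cost T L u Y \<mu> = integral {0..T} (\<lambda>t. L (Y t) (\<mu> t) + (\<Sum>k\<in>UNIV. (norm (u t $ k))\<^sup>2))"

text \<open>\<open>S u Y \<mu>\<close> says that \<open>(Y, \<mu>)\<close> is a trajectory of the control \<open>u\<close>. Every admissible control is
  required to have a trajectory, and the comparison ranges over all trajectories, so that no choice
  of a trajectory enters; in particular the cost of an optimal \<open>u\<close> does not depend on it.\<close>

definition optimal_control ::
  "real \<Rightarrow> ((real^'d)^'m \<Rightarrow> (real^'d) measure \<Rightarrow> real) \<Rightarrow> ((real^'d)^'m) set
    \<Rightarrow> ((real \<Rightarrow> (real^'d)^'m) \<Rightarrow> (real \<Rightarrow> (real^'d)^'m) \<Rightarrow> (real \<Rightarrow> (real^'d) measure) \<Rightarrow> bool)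
    \<Rightarrow> (real \<Rightarrow> (real^'d)^'m) \<Rightarrow> bool" where
  "optimal_control T L U S u \<longleftrightarrow>
     u \<in> Linf T U \<and>
     (\<forall>v\<in>Linf T U. \<exists>Y \<mu>. S v Y \<mu>) \<and>
     (\<forall>v\<in>Linf T U. \<forall>Y \<mu> Y' \<mu>'. S u Y \<mu> \<longrightarrow> S v Y' \<mu>' \<longrightarrow> cost T L u Y \<mu> \<le> cost T L v Y' \<mu>')"

end

theory Submission
  imports Defs "HOL-Complex_Analysis.Great_Picard"
begin

text \<open>
The proof is the direct method of the calculus of variations. By \<open>weak_star_sequentially_compact\<close>, controls with
values in a compact convex set have weak-* convergent subsequences, and the control cost is weak-* lower semicontinuous, being
convex. What remains is that trajectories depend continuously, uniformly in time, on the control in the weak-* sense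
and on the initial measure in W1, jointly. Then \<open>nearly_optimal_compactness\<close> gives both claims: a
subsequence of a minimising sequence converges to an optimal control, and so does one of the optimal controls of the particle
systems, whose initial measures converge.

For this continuity both systems are written in the same way. Let P be the initial measure, which for particles is
their empirical measure, and let \<open>Z t x\<close> be the position at time t of the mass that started at x. A solution is
\<open>\<mu> t = distr P borel (Z t)\<close>, where Z follows the velocity generated by \<open>\<mu>\<close>. Given a coupling of two initial
measures, the lemma \<open>stability\<close> bounds the mean distance of the two flows under the coupling, hence the distance of the
solutions in W1, by the cost of the coupling and by the effect of exchanging the controls along one fixed flow. As the velocity is
linear in the control, this effect is the integral of the difference of the controls against a fixed continuous function,
up to the motion of the agents, and \<open>kernel_error_uniform\<close> shows that it tends to zero uniformly under weak-* convergence.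

Solutions of the continuity equation are defined by test functions, and it has to be proved that they have this form
(\<open>weak_solution_unique\<close>). The field is Lipschitz in space but only measurable in time, through the control. The measure and
the flow are compared along Euler schemes, by duality with functions that have a Lipschitz derivative; mollification
of the field keeps this class invariant, and averaging the control over a time step deals with its lack of regularity.

Since H and G are bounded, all solutions issuing from a ball remain in a larger ball. So the kernels may be
composed with the projection to a ball, which makes them globally Lipschitz. The lemmas \<open>mean_field_represents\<close> and
\<open>particle_represents\<close> combine this with the uniqueness result.
\<close>

section \<open>Integral inequalities, couplings and measures of bounded support\<close>

abbreviation time_measurable :: "real \<Rightarrow> (real \<Rightarrow> 'a::euclidean_space) \<Rightarrow> bool" where
  "time_measurable T f \<equiv> f \<in> borel_measurable (lebesgue_on {0..T})"

lemmas hk_integral_diff = Henstock_Kurzweil_Integration.integral_diff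
  and hk_integral_add = Henstock_Kurzweil_Integration.integral_add

text \<open>Divide D by \<open>exp (2 K t)\<close>. If S is the supremum of the quotient, the integral term contributes at most
\<open>S / 2\<close>, so that \<open>S \<le> a + S / 2\<close>. The bound B makes S finite.\<close>

lemma gronwall_bounded:
  fixes D :: "real \<Rightarrow> real"
  assumes K: "0 \<le> K" and a: "0 \<le> a"
    and bdd: "\<And>t. t \<in> {0..T} \<Longrightarrow> D t \<le> B"
    and int: "D integrable_on {0..T}"
    and ineq: "\<And>t. t \<in> {0..T} \<Longrightarrow> D t \<le> a + K * integral {0..t} D"
    and t: "t \<in> {0..T}"
  shows "D t \<le> 2 * a * exp (2 * K * t)"
proof (cases "K = 0")
  case True
  then show ?thesis using ineq[OF t] a by simp
next
  case False
  then have K: "K > 0" using K by simp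
  define E where "E t = exp (- (2 * K * t)) * D t" for t
  define S where "S = (SUP t\<in>{0..T}. E t)"
  have bddE: "bdd_above (E ` {0..T})"
  proof (rule bdd_aboveI2)
    fix s assume s: "s \<in> {0..T}"
    have "E s \<le> exp (- (2 * K * s)) * \<bar>B\<bar>"
      unfolding E_def using bdd[OF s] by (intro mult_left_mono) auto
    also have "\<dots> \<le> 1 * \<bar>B\<bar>" using K s by (intro mult_right_mono) auto
    finally show "E s \<le> \<bar>B\<bar>" by simp
  qed
  have ES: "E s \<le> S" if "s \<in> {0..T}" for s
    unfolding S_def by (rule cSUP_upper[OF that bddE])
  have DS: "D s \<le> S * exp (2 * K * s)" if "s \<in> {0..T}" for s
    using ES[OF that] unfolding E_def by (simp add: exp_minus field_simps)
  show ?thesis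
  proof (cases "S < 0")
    case True
    then have "D t \<le> 0" using DS[OF t] by (meson exp_gt_zero mult_neg_pos order_trans less_imp_le)
    moreover have "0 \<le> 2 * a * exp (2 * K * t)" using a by simp
    ultimately show ?thesis by linarith
  next
    case False
    have E2: "E s \<le> a + S / 2" if s: "s \<in> {0..T}" for s
    proof -
      have hi: "((\<lambda>r. S * exp (2 * K * r)) has_integral (S * exp (2 * K * s) / (2 * K) - S * exp (2 * K * 0) / (2 * K))) {0..s}"
        using s K by (intro fundamental_theorem_of_calculus)
          (auto intro!: derivative_eq_intros simp: has_real_derivative_iff_has_vector_derivative[symmetric])
      have "integral {0..s} D \<le> integral {0..s} (\<lambda>r. S * exp (2 * K * r))"
      proof (rule integral_le)
        show "D integrable_on {0..s}"
          by (rule integrable_on_subinterval[OF int]) (use s in auto)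
        show "(\<lambda>r. S * exp (2 * K * r)) integrable_on {0..s}" using hi by blast
      qed (use DS s in auto)
      also have "\<dots> = S * exp (2 * K * s) / (2 * K) - S / (2 * K)" using integral_unique[OF hi] by simp
      also have "\<dots> \<le> S * exp (2 * K * s) / (2 * K)" using False K by simp
      finally have "K * integral {0..s} D \<le> S * exp (2 * K * s) / 2"
        using K by (simp add: field_simps)
      then have "D s \<le> a + S * exp (2 * K * s) / 2" using ineq[OF s] by linarith
      then have "E s \<le> exp (- (2 * K * s)) * (a + S * exp (2 * K * s) / 2)"
        unfolding E_def by (intro mult_left_mono) auto
      also have "\<dots> = exp (- (2 * K * s)) * a + S / 2" by (simp add: algebra_simps exp_minus)
      also have "\<dots> \<le> 1 * a + S / 2" using a K s by (intro add_right_mono mult_right_mono) auto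
      finally show ?thesis by simp
    qed
    have "S \<le> a + S / 2" unfolding S_def
      by (rule cSUP_least) (use t E2 in \<open>auto simp: S_def\<close>)
    then have "S \<le> 2 * a" by simp
    then have "S * exp (2 * K * t) \<le> 2 * a * exp (2 * K * t)" by (intro mult_right_mono) auto
    then show ?thesis using DS[OF t] by linarith
  qed
qed

lemma integral_increment:
  fixes f :: "real \<Rightarrow> 'a::euclidean_space"
  assumes "f integrable_on {0..T}" "0 \<le> s" "s \<le> t" "t \<le> T"
  shows "integral {0..t} f - integral {0..s} f = integral {s..t} f"
proof -
  have "f integrable_on {0..t}" by (rule integrable_on_subinterval[OF assms(1)]) (use assms in auto)
  from Henstock_Kurzweil_Integration.integral_combine[OF assms(2,3) this]
  show ?thesis by (simp add: algebra_simps)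
qed

lemma integral_norm_le:
  fixes f :: "real \<Rightarrow> 'a::euclidean_space"
  assumes "f integrable_on {0..T}" "0 \<le> s" "s \<le> t" "t \<le> T" "\<And>r. r \<in> {0..T} \<Longrightarrow> norm (f r) \<le> C"
  shows "norm (integral {s..t} f) \<le> C * (t - s)"
proof -
  have "norm (integral {s..t} f) \<le> integral {s..t} (\<lambda>_. C)"
    by (rule integral_norm_bound_integral)
       (use assms in \<open>auto intro: integrable_on_subinterval[OF assms(1)]\<close>)
  then show ?thesis using assms by (simp add: mult.commute)
qed

lemma integral_lipschitz:
  fixes f :: "real \<Rightarrow> 'a::euclidean_space"
  assumes f: "f integrable_on {0..T}" and b: "\<And>r. r \<in> {0..T} \<Longrightarrow> norm (f r) \<le> C"
    and s: "s \<in> {0..T}" and t: "t \<in> {0..T}"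
  shows "norm (integral {0..t} f - integral {0..s} f) \<le> C * \<bar>t - s\<bar>"
proof (cases "s \<le> t")
  case True
  then show ?thesis using integral_increment[OF f, of s t] integral_norm_le[OF f _ True _ b] s t by simp
next
  case False
  then show ?thesis using integral_increment[OF f, of t s] integral_norm_le[OF f, of t s C] b s t
    by (simp add: norm_minus_commute)
qed

lemma abs_integrable_bounded:
  fixes f :: "real \<Rightarrow> 'a::euclidean_space"
  assumes "f \<in> borel_measurable (lebesgue_on {a..b})" "\<And>x. x \<in> {a..b} \<Longrightarrow> norm (f x) \<le> C"
  shows "f absolutely_integrable_on {a..b}"
  by (rule measurable_bounded_by_integrable_imp_absolutely_integrable[where g="\<lambda>_. C"])
     (use assms in auto)

lemma AE_msupport:
  fixes \<mu> :: "'a::second_countable_topology measure"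
  assumes "sets \<mu> = sets borel"
  shows "AE x in \<mu>. x \<in> msupport \<mu>"
proof -
  define F where "F = {V. open V \<and> emeasure \<mu> V = 0}"
  obtain F' where F': "F' \<subseteq> F" "countable F'" "\<Union>F' = \<Union>F"
    using Lindelof[of F] unfolding F_def by auto
  have "\<Union>F' \<in> null_sets \<mu>"
    using F'(1,2) assms unfolding F_def by (intro null_sets_UN'[where N=id, simplified]) (auto simp: null_sets_def)
  moreover have "x \<in> msupport \<mu>" if "x \<notin> \<Union>F'" for x
    using that unfolding F'(3) F_def msupport_def by (auto simp: zero_less_iff_neq_zero)
  ultimately show ?thesis by (intro AE_I'[of "\<Union>F'"]) auto
qed

lemma P1_D:
  assumes "\<mu> \<in> P1"
  shows "prob_space \<mu>" "sets \<mu> = sets borel" "integrable \<mu> norm" "space \<mu> = UNIV"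
  using assms sets_eq_imp_space_eq[of \<mu> borel] unfolding P1_def by auto

lemma P1_bounded_support:
  fixes \<mu> :: "'a::euclidean_space measure"
  assumes "prob_space \<mu>" "sets \<mu> = sets borel" "AE x in \<mu>. norm x \<le> R"
  shows "\<mu> \<in> P1"
proof -
  interpret prob_space \<mu> by fact
  show ?thesis unfolding P1_def using assms
    by (auto intro!: integrable_const_bound[where B=R] simp: measurable_cong_sets[OF assms(2) refl])
qed

lemma msupport_subset_cball:
  fixes \<mu> :: "'a::euclidean_space measure"
  assumes "sets \<mu> = sets borel" "AE x in \<mu>. norm x \<le> R"
  shows "msupport \<mu> \<subseteq> cball 0 R"
proof
  fix x assume x: "x \<in> msupport \<mu>"
  show "x \<in> cball 0 R"
  proof (rule ccontr)
    assume "x \<notin> cball 0 R"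
    then have "x \<in> - cball 0 R" "open (- cball (0::'a) R)" by auto
    then have "emeasure \<mu> (- cball 0 R) > 0" using x unfolding msupport_def by blast
    moreover have "emeasure \<mu> (- cball 0 R) = 0"
    proof (rule emeasure_eq_0_AE[where P="\<lambda>x. x \<notin> cball 0 R", THEN trans[rotated]])
      show "AE x in \<mu>. \<not> x \<notin> cball 0 R" using assms(2) by simp
      show "emeasure \<mu> (- cball 0 R) = emeasure \<mu> {x \<in> space \<mu>. x \<notin> cball 0 R}"
        using sets_eq_imp_space_eq[OF assms(1)] by (intro arg_cong[where f="emeasure \<mu>"]) auto
    qed
    ultimately show False by simp
  qed
qed

lemma W1_nonneg: "0 \<le> W1 \<mu> \<nu>"
  unfolding W1_def by simp

lemma W1_le_coupling:
  fixes \<pi> :: "('a::euclidean_space \<times> 'a) measure"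
  assumes "\<pi> \<in> couplings \<mu> \<nu>" "integrable \<pi> (\<lambda>z. dist (fst z) (snd z))"
  shows "W1 \<mu> \<nu> \<le> (\<integral>z. dist (fst z) (snd z) \<partial>\<pi>)"
proof -
  have eq: "(\<integral>\<^sup>+ z. ennreal (dist (fst z) (snd z)) \<partial>\<pi>) = ennreal (\<integral>z. dist (fst z) (snd z) \<partial>\<pi>)"
    by (rule nn_integral_eq_integral) (use assms in auto)
  have "W1 \<mu> \<nu> \<le> enn2real (ennreal (\<integral>z. dist (fst z) (snd z) \<partial>\<pi>))"
    unfolding W1_def using assms(1) by (intro enn2real_mono) (auto intro!: INF_lower2 simp: eq)
  then show ?thesis by (simp add: integral_nonneg_AE)
qed

lemma couplings_D:
  fixes \<pi> :: "('a::euclidean_space \<times> 'a) measure"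
  assumes "\<pi> \<in> couplings \<mu> \<nu>"
  shows "sets \<pi> = sets borel" "space \<pi> = UNIV" "fst \<in> measurable \<pi> borel" "snd \<in> measurable \<pi> borel"
   "distr \<pi> borel fst = \<mu>" "distr \<pi> borel snd = \<nu>"
proof -
  have "sets \<pi> = sets (borel \<Otimes>\<^sub>M borel)" using assms unfolding couplings_def by simp
  then show s: "sets \<pi> = sets borel" unfolding borel_prod .
  show "space \<pi> = UNIV" using sets_eq_imp_space_eq[OF s] by simp
  show "fst \<in> measurable \<pi> borel" "snd \<in> measurable \<pi> borel"
    unfolding measurable_cong_sets[OF s refl] by (auto intro!: borel_measurable_continuous_onI continuous_intros)
  show "distr \<pi> borel fst = \<mu>" "distr \<pi> borel snd = \<nu>" using assms unfolding couplings_def by auto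
qed

lemma couplings_prob:
  assumes "\<pi> \<in> couplings \<mu> \<nu>" "prob_space \<mu>"
  shows "prob_space \<pi>"
  using assms couplings_D[OF assms(1)] prob_space_distrD by metis

text \<open>The product measure is a coupling of finite cost, so the infimum in W1 is a real number. Couplings of
almost minimal cost serve in place of optimal ones throughout.\<close>

lemma W1_near_optimal_coupling:
  fixes \<mu> \<nu> :: "'a::euclidean_space measure"
  assumes \<mu>: "\<mu> \<in> P1" and \<nu>: "\<nu> \<in> P1" and e: "e > 0"
  obtains \<pi> where "\<pi> \<in> couplings \<mu> \<nu>" "integrable \<pi> (\<lambda>z. dist (fst z) (snd z))"
    "(\<integral>z. dist (fst z) (snd z) \<partial>\<pi>) < W1 \<mu> \<nu> + e"
proof -
  note m = P1_D[OF \<mu>] and n = P1_D[OF \<nu>]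
  interpret M: prob_space \<mu> by fact
  interpret N: prob_space \<nu> by fact
  interpret pair_prob_space \<mu> \<nu> ..
  define c where "c \<pi> = (\<integral>\<^sup>+ z. ennreal (dist (fst z) (snd z)) \<partial>\<pi>)" for \<pi> :: "('a \<times> 'a) measure"
  have sp: "sets (\<mu> \<Otimes>\<^sub>M \<nu>) = sets (borel \<Otimes>\<^sub>M borel)" by (rule sets_pair_measure_cong) (use m n in auto)
  have d1: "distr (\<mu> \<Otimes>\<^sub>M \<nu>) borel fst = \<mu>"
    using N.distr_pair_fst[of \<mu>] m(2) by (metis distr_cong)
  have d2: "distr (\<mu> \<Otimes>\<^sub>M \<nu>) borel snd = \<nu>"
  proof (rule measure_eqI)
    fix A assume A: "A \<in> sets (distr (\<mu> \<Otimes>\<^sub>M \<nu>) borel snd)"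
    have "snd \<in> measurable (\<mu> \<Otimes>\<^sub>M \<nu>) borel" using n(2) measurable_snd[of \<mu> \<nu>] by (metis measurable_cong_sets)
    then have "emeasure (distr (\<mu> \<Otimes>\<^sub>M \<nu>) borel snd) A = emeasure (\<mu> \<Otimes>\<^sub>M \<nu>) (space \<mu> \<times> A)"
      using A m n by (subst emeasure_distr) (auto intro!: arg_cong[where f="emeasure (\<mu> \<Otimes>\<^sub>M \<nu>)"] simp: space_pair_measure)
    also have "\<dots> = emeasure \<nu> A" using A n(2) M.emeasure_space_1 by (subst N.emeasure_pair_measure_Times) auto
    finally show "emeasure (distr (\<mu> \<Otimes>\<^sub>M \<nu>) borel snd) A = emeasure \<nu> A" .
  qed (use n in auto)
  have prod: "\<mu> \<Otimes>\<^sub>M \<nu> \<in> couplings \<mu> \<nu>" using sp d1 d2 unfolding couplings_def by auto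
  note pD = couplings_D[OF prod]
  have "c (\<mu> \<Otimes>\<^sub>M \<nu>) \<le> (\<integral>\<^sup>+ z. ennreal (norm (fst z)) + ennreal (norm (snd z)) \<partial>(\<mu> \<Otimes>\<^sub>M \<nu>))"
    unfolding c_def by (intro nn_integral_mono) (metis dist_norm ennreal_leI ennreal_plus norm_ge_zero norm_triangle_ineq4)
  also have "\<dots> = (\<integral>\<^sup>+ z. ennreal (norm (fst z)) \<partial>(\<mu> \<Otimes>\<^sub>M \<nu>)) + (\<integral>\<^sup>+ z. ennreal (norm (snd z)) \<partial>(\<mu> \<Otimes>\<^sub>M \<nu>))"
    using pD(3,4) by (intro nn_integral_add) (auto intro: measurable_compose)
  also have "(\<integral>\<^sup>+ z. ennreal (norm (fst z)) \<partial>(\<mu> \<Otimes>\<^sub>M \<nu>)) = (\<integral>\<^sup>+ x. ennreal (norm x) \<partial>\<mu>)"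
    using nn_integral_distr[OF pD(3), of "\<lambda>x. ennreal (norm x)"] borel_measurable_integrable[OF m(3)] unfolding pD(5) by simp
  also have "(\<integral>\<^sup>+ z. ennreal (norm (snd z)) \<partial>(\<mu> \<Otimes>\<^sub>M \<nu>)) = (\<integral>\<^sup>+ x. ennreal (norm x) \<partial>\<nu>)"
    using nn_integral_distr[OF pD(4), of "\<lambda>x. ennreal (norm x)"] borel_measurable_integrable[OF n(3)] unfolding pD(6) by simp
  also have "(\<integral>\<^sup>+ x. ennreal (norm x) \<partial>\<mu>) + (\<integral>\<^sup>+ x. ennreal (norm x) \<partial>\<nu>) < \<infinity>"
    using m(3) n(3) by (simp add: nn_integral_eq_integral)
  finally have fin: "c (\<mu> \<Otimes>\<^sub>M \<nu>) < \<infinity>" .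
  define I where "I = (INF \<pi>\<in>couplings \<mu> \<nu>. c \<pi>)"
  have "I \<le> c (\<mu> \<Otimes>\<^sub>M \<nu>)" unfolding I_def by (rule INF_lower[OF prod])
  then have "I < \<infinity>" using fin by (simp add: order_le_less_trans)
  moreover have "W1 \<mu> \<nu> = enn2real I" unfolding I_def W1_def c_def ..
  ultimately have "I = ennreal (W1 \<mu> \<nu>)" by (simp add: ennreal_enn2real_if)
  then have "I < ennreal (W1 \<mu> \<nu> + e)" using e W1_nonneg[of \<mu> \<nu>] by (simp add: ennreal_less_iff)
  then obtain \<pi> where \<pi>: "\<pi> \<in> couplings \<mu> \<nu>" "c \<pi> < ennreal (W1 \<mu> \<nu> + e)"
    unfolding I_def INF_less_iff by auto
  note D = couplings_D[OF \<pi>(1)]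
  have meas: "(\<lambda>z. dist (fst z) (snd z)) \<in> borel_measurable \<pi>" using D(3,4) by measurable
  have int: "integrable \<pi> (\<lambda>z. dist (fst z) (snd z))"
    using \<pi>(2) meas unfolding c_def by (intro integrableI_nonneg) (auto simp: top.not_eq_extremum intro: order_less_trans)
  have "ennreal (\<integral>z. dist (fst z) (snd z) \<partial>\<pi>) < ennreal (W1 \<mu> \<nu> + e)"
    using \<pi>(2) unfolding c_def by (subst nn_integral_eq_integral[symmetric]) (use int in auto)
  then have "(\<integral>z. dist (fst z) (snd z) \<partial>\<pi>) < W1 \<mu> \<nu> + e"
    by (simp add: ennreal_less_iff integral_nonneg_AE)
  with that \<pi> int show ?thesis by blast
qed

section \<open>Picard iteration for flows\<close>

abbreviation jointly_continuous :: "('a::topological_space \<Rightarrow> 'b::topological_space \<Rightarrow> 'c::topological_space) \<Rightarrow> bool" where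
  "jointly_continuous Z \<equiv> continuous_on UNIV (\<lambda>(s, x). Z s x)"

text \<open>The unknown is the whole flow Z rather than one trajectory, because the field \<open>A Z s\<close> may depend on the
law of \<open>Z s\<close>, that is, on the values of \<open>Z s\<close> at all points. Written as \<open>Z t x = x + exp (la t) v (t, x)\<close> with a
bounded continuous v, the equation is a fixed point problem for a contraction in the supremum norm as soon
as la exceeds \<open>4 K\<close>.\<close>

lemma picard_flow:
  fixes A :: "(real \<Rightarrow> 'x \<Rightarrow> 'x) \<Rightarrow> real \<Rightarrow> 'x \<Rightarrow> 'x::euclidean_space"
  assumes T: "0 \<le> T" and K: "0 \<le> K"
    and bd: "\<And>Z s x. jointly_continuous Z \<Longrightarrow> s \<in> {0..T} \<Longrightarrow> norm (A Z s x) \<le> C"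
    and lip: "\<And>Z Z' s x x' d. jointly_continuous Z \<Longrightarrow> jointly_continuous Z' \<Longrightarrow>
       s \<in> {0..T} \<Longrightarrow> (\<And>\<xi>. norm (Z s \<xi> - Z' s \<xi>) \<le> d) \<Longrightarrow> norm (A Z s x - A Z' s x') \<le> K * (norm (x - x') + d)"
    and int: "\<And>Z x. jointly_continuous Z \<Longrightarrow> (\<lambda>s. A Z s (Z s x)) integrable_on {0..T}"
  obtains Z where "jointly_continuous Z"
    "\<And>t x. t \<in> {0..T} \<Longrightarrow> Z t x = x + integral {0..t} (\<lambda>s. A Z s (Z s x))"
proof -
  define la where "la = 4 * K + 1"
  have lam: "la > 0" "2 * K / la \<le> 1 / 2" using K unfolding la_def by (auto simp: field_simps)
  (* Freezing time outside [0,T] gives a flow that is continuous for all real times. *)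
  define cl where "cl t = max 0 (min T t)" for t
  have cl: "cl t \<in> {0..T}" for t using T unfolding cl_def by auto
  have cl_id: "cl t = t" if "t \<in> {0..T}" for t using that unfolding cl_def by auto
  have cl_cont: "continuous_on S cl" for S unfolding cl_def by (intro continuous_intros)
  define ZZ :: "((real \<times> 'x) \<Rightarrow>\<^sub>C 'x) \<Rightarrow> real \<Rightarrow> 'x \<Rightarrow> 'x"
    where "ZZ v t x = x + exp (la * cl t) *\<^sub>R apply_bcontfun v (t, x)" for v t x
  have contZ: "jointly_continuous (ZZ v)" for v
    unfolding ZZ_def split_beta cl_def
    by (intro continuous_intros continuous_on_compose2[OF continuous_on_apply_bcontfun[of UNIV v]]) auto
  define I where "I v t x = integral {0..cl t} (\<lambda>s. A (ZZ v) s (ZZ v s x))" for v t x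
  have intZ: "(\<lambda>s. A (ZZ v) s (ZZ v s x)) integrable_on {0..T}" for v x
    by (rule int[OF contZ])
  have intZ': "(\<lambda>s. A (ZZ v) s (ZZ v s x)) integrable_on {0..cl t}" for v x t
    by (rule integrable_on_subinterval[OF intZ]) (use cl[of t] in auto)
  have C: "0 \<le> C" using bd[OF contZ, of 0 undefined undefined] T norm_ge_zero order_trans by (metis atLeastAtMost_iff order_refl)
  have I_bound: "norm (I v t x) \<le> C * T" for v t x
  proof -
    have "norm (I v t x) \<le> C * (cl t - 0)" unfolding I_def
      by (rule integral_norm_le[OF intZ]) (use cl[of t] bd[OF contZ] in auto)
    also have "\<dots> \<le> C * T" using C cl[of t] by (intro mult_left_mono) auto
    finally show ?thesis .
  qed
  have I_cont: "continuous_on UNIV (\<lambda>(t, x). I v t x)" for v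
  proof (unfold continuous_on_iff, intro ballI allI impI)
    fix p :: "real \<times> 'x" and e :: real
    assume e: "e > 0"
    obtain t0 x0 where p: "p = (t0, x0)" by (cases p)
    have tk: "T * K + 1 > 0" using T K by (simp add: add_nonneg_pos)
    define e1 where "e1 = e / (2 * (T * K + 1))"
    have e1: "e1 > 0" using e tk unfolding e1_def by simp
    have "uniformly_continuous_on ({0..T} \<times> cball x0 1) (\<lambda>(s, x). ZZ v s x)"
      by (intro compact_uniformly_continuous continuous_on_subset[OF contZ] compact_Times) auto
    then obtain d where d: "d > 0" "\<And>q q'. q \<in> {0..T} \<times> cball x0 1 \<Longrightarrow> q' \<in> {0..T} \<times> cball x0 1 \<Longrightarrow>
        dist q q' < d \<Longrightarrow> dist (case q of (s, x) \<Rightarrow> ZZ v s x) (case q' of (s, x) \<Rightarrow> ZZ v s x) < e1"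
      unfolding uniformly_continuous_on_def using e1 by (metis dist_commute)
    define dd where "dd = min (min d 1) (e / (2 * (C + 1)))"
    have dd: "dd > 0" using d e C unfolding dd_def by auto
    have "dist (case q of (t, x) \<Rightarrow> I v t x) (I v t0 x0) < e" if q: "dist q p < dd" for q
    proof -
      obtain t x where qq: "q = (t, x)" by (cases q)
      have dt: "\<bar>t - t0\<bar> < dd" and dx: "dist x x0 < dd"
        using q unfolding p qq by (auto simp: dist_Pair_Pair dist_real_def
          intro: order_le_less_trans[OF real_sqrt_sum_squares_ge1] order_le_less_trans[OF real_sqrt_sum_squares_ge2])
      have "norm (I v t x - I v t x0) = norm (integral {0..cl t} (\<lambda>s. A (ZZ v) s (ZZ v s x) - A (ZZ v) s (ZZ v s x0)))"
        unfolding I_def by (subst hk_integral_diff[OF intZ' intZ']) simp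
      also have "\<dots> \<le> (K * e1) * (cl t - 0)"
      proof (rule integral_norm_le[where T=T])
        show "(\<lambda>s. A (ZZ v) s (ZZ v s x) - A (ZZ v) s (ZZ v s x0)) integrable_on {0..T}"
          by (intro integrable_diff intZ)
        show "norm (A (ZZ v) r (ZZ v r x) - A (ZZ v) r (ZZ v r x0)) \<le> K * e1" if r: "r \<in> {0..T}" for r
        proof -
          have "dist (r, x) (r, x0) < d" using dx unfolding dd_def by (simp add: dist_Pair_Pair)
          moreover have "x \<in> cball x0 1" "x0 \<in> cball x0 1" using dx dist_commute[of x x0] unfolding dd_def by simp_all
          ultimately have "norm (ZZ v r x - ZZ v r x0) \<le> e1"
            using d(2)[of "(r,x)" "(r,x0)"] r by (simp add: dist_norm)
          moreover have "norm (A (ZZ v) r (ZZ v r x) - A (ZZ v) r (ZZ v r x0)) \<le> K * (norm (ZZ v r x - ZZ v r x0) + 0)"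
            by (rule lip[OF contZ contZ r]) simp
          moreover have "K * norm (ZZ v r x - ZZ v r x0) \<le> K * e1" using calculation(1) K by (rule mult_left_mono)
          ultimately show ?thesis by simp
        qed
      qed (use cl[of t] in auto)
      also have "\<dots> \<le> (K * e1) * T" using cl[of t] K e1 by (intro mult_left_mono) auto
      also have "\<dots> \<le> (T * K + 1) * e1" using e1 by (simp add: algebra_simps)
      also have "\<dots> = e / 2" unfolding e1_def using tk by (simp add: field_simps)
      finally have 1: "norm (I v t x - I v t x0) \<le> e / 2" .
      have "norm (I v t x0 - I v t0 x0) \<le> C * \<bar>cl t - cl t0\<bar>"
        unfolding I_def by (rule integral_lipschitz[OF intZ]) (use bd[OF contZ] cl in auto)
      also have "\<dots> \<le> C * \<bar>t - t0\<bar>" using C unfolding cl_def by (intro mult_left_mono) auto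
      also have "\<dots> \<le> C * (e / (2 * (C + 1)))" using C dt unfolding dd_def by (intro mult_left_mono) auto
      also have "\<dots> < e / 2" using C e by (simp add: field_simps)
      finally have 2: "norm (I v t x0 - I v t0 x0) < e / 2" .
      have "norm (I v t x - I v t0 x0) < e"
        using 1 2 norm_triangle_ineq[of "I v t x - I v t x0" "I v t x0 - I v t0 x0"] by simp
      then show ?thesis unfolding qq by (simp add: dist_norm)
    qed
    then show "\<exists>d>0. \<forall>x'\<in>UNIV. dist x' p < d \<longrightarrow> dist (case x' of (t, x) \<Rightarrow> I v t x) (case p of (t, x) \<Rightarrow> I v t x) < e"
      using dd p by auto
  qed
  define g where "g v = (\<lambda>p. exp (- (la * cl (fst p))) *\<^sub>R (case p of (t, x) \<Rightarrow> I v t x))" for v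
  have g_bc: "g v \<in> bcontfun" for v
  proof (rule bcontfun_normI)
    show "continuous_on UNIV (g v)" unfolding g_def
      by (intro continuous_intros I_cont continuous_on_compose2[OF cl_cont[of UNIV]]) auto
    show "norm (g v p) \<le> C * T" for p
    proof -
      have "norm (g v p) = exp (- (la * cl (fst p))) * norm (I v (fst p) (snd p))"
        unfolding g_def by (simp add: split_beta)
      also have "\<dots> \<le> 1 * (C * T)" using I_bound lam cl[of "fst p"] by (intro mult_mono) auto
      finally show ?thesis by simp
    qed
  qed
  define \<Gamma> where "\<Gamma> v = Bcontfun (g v)" for v
  have \<Gamma>: "apply_bcontfun (\<Gamma> v) = g v" for v unfolding \<Gamma>_def using g_bc by (rule Bcontfun_inverse)
  have contr: "dist (\<Gamma> v) (\<Gamma> v') \<le> (1/2) * dist v v'" for v v'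
  proof (rule dist_bound)
    fix p :: "real \<times> 'x"
    obtain t x where p: "p = (t, x)" by (cases p)
    define D where "D = dist v v'"
    have D: "D \<ge> 0" unfolding D_def by simp
    have hi: "((\<lambda>r. 2 * K * exp (la * r) * D) has_integral (2 * K * exp (la * cl t) * D / la - 2 * K * exp (la * 0) * D / la)) {0..cl t}"
        using cl[of t] lam by (intro fundamental_theorem_of_calculus)
          (auto intro!: derivative_eq_intros simp: has_real_derivative_iff_has_vector_derivative[symmetric])
    have "norm (I v t x - I v' t x) = norm (integral {0..cl t} (\<lambda>s. A (ZZ v) s (ZZ v s x) - A (ZZ v') s (ZZ v' s x)))"
      unfolding I_def by (subst hk_integral_diff[OF intZ' intZ']) simp
    also have "\<dots> \<le> integral {0..cl t} (\<lambda>r. 2 * K * exp (la * r) * D)"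
    proof (rule integral_norm_bound_integral)
      show "(\<lambda>s. A (ZZ v) s (ZZ v s x) - A (ZZ v') s (ZZ v' s x)) integrable_on {0..cl t}"
        by (intro integrable_diff intZ')
      show "(\<lambda>r. 2 * K * exp (la * r) * D) integrable_on {0..cl t}" using hi by blast
      fix s assume s: "s \<in> {0..cl t}"
      then have s': "s \<in> {0..T}" using cl[of t] by auto
      have dz: "norm (ZZ v s \<xi> - ZZ v' s \<xi>) \<le> exp (la * s) * D" for \<xi>
      proof -
        have "norm (ZZ v s \<xi> - ZZ v' s \<xi>) = exp (la * s) * dist (apply_bcontfun v (s, \<xi>)) (apply_bcontfun v' (s, \<xi>))"
          unfolding ZZ_def cl_id[OF s'] by (simp add: dist_norm scaleR_diff_right[symmetric])
        also have "\<dots> \<le> exp (la * s) * D" unfolding D_def by (intro mult_left_mono dist_bounded) auto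
        finally show ?thesis .
      qed
      have "norm (A (ZZ v) s (ZZ v s x) - A (ZZ v') s (ZZ v' s x)) \<le> K * (norm (ZZ v s x - ZZ v' s x) + exp (la * s) * D)"
        by (rule lip[OF contZ contZ s' dz])
      also have "\<dots> \<le> K * (exp (la * s) * D + exp (la * s) * D)"
        by (intro mult_left_mono add_mono dz K order_refl)
      finally show "norm (A (ZZ v) s (ZZ v s x) - A (ZZ v') s (ZZ v' s x)) \<le> 2 * K * exp (la * s) * D"
        by (simp add: algebra_simps)
    qed
    also have "\<dots> = 2 * K * exp (la * cl t) * D / la - 2 * K * D / la" using integral_unique[OF hi] by simp
    also have "\<dots> \<le> 2 * K * exp (la * cl t) * D / la" using K D lam(1) by simp
    also have "\<dots> = (2 * K / la) * (exp (la * cl t) * D)" by simp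
    also have "\<dots> \<le> (1 / 2) * (exp (la * cl t) * D)" using lam D by (intro mult_right_mono) auto
    finally have le: "norm (I v t x - I v' t x) \<le> (1 / 2) * (exp (la * cl t) * D)" .
    have "dist (g v p) (g v' p) = exp (- (la * cl t)) * norm (I v t x - I v' t x)"
      unfolding g_def p by (simp add: dist_norm scaleR_diff_right[symmetric])
    also have "\<dots> \<le> exp (- (la * cl t)) * ((1 / 2) * (exp (la * cl t) * D))"
      using le by (intro mult_left_mono) auto
    also have "\<dots> = (1/2) * D" by (simp add: exp_minus)
    finally show "dist (apply_bcontfun (\<Gamma> v) p) (apply_bcontfun (\<Gamma> v') p) \<le> (1/2) * dist v v'"
      unfolding \<Gamma> D_def .
  qed
  have "\<exists>!v. \<Gamma> v = v" by (rule banach_fix_type[of "1/2"]) (use contr in auto)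
  then obtain v where v: "\<Gamma> v = v" by auto
  show thesis
  proof (rule that[OF contZ[of v]])
    fix t x assume t: "t \<in> {0..T}"
    have "apply_bcontfun v (t, x) = g v (t, x)" using \<Gamma>[of v] v by metis
    then show "ZZ v t x = x + integral {0..t} (\<lambda>s. A (ZZ v) s (ZZ v s x))"
      unfolding ZZ_def[of v t x] g_def I_def by (simp add: cl_id[OF t] exp_minus)
  qed
qed

section \<open>The velocity field\<close>

text \<open>The part of the velocity that is linear in the control: the average over the m agents of the values \<open>c l k\<close>
of the kernels, weighted by the components of w. This linearity is what weak-* convergence of controls needs.\<close>

definition kernel_sum :: "(real^'d)^'m \<Rightarrow> ('d \<Rightarrow> 'm \<Rightarrow> real^'d) \<Rightarrow> real^'d" where
  "kernel_sum w c = (\<Sum>l\<in>UNIV. \<Sum>k\<in>UNIV. (w $ k $ l) *\<^sub>R ((1 / real CARD('m)) *\<^sub>R c l k))"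

lemma velocity_eq: "velocity H G w Y \<mu> x = conv H \<mu> x + kernel_sum w (\<lambda>l k. G l (x - Y $ k))"
  unfolding velocity_def conv_atomic_def kernel_sum_def
  by (simp add: scaleR_sum_right mult.commute)

lemma kernel_sum_bound:
  fixes w :: "(real^'d)^'m"
  assumes "\<And>l k. norm (c l k) \<le> b"
  shows "norm (kernel_sum w c) \<le> real CARD('d) * norm w * b"
proof -
  have b: "b \<ge> 0" using assms norm_ge_zero order_trans by blast
  have "norm (kernel_sum w c) \<le> (\<Sum>l\<in>(UNIV::'d set). \<Sum>k\<in>(UNIV::'m set). norm w * (1 / real CARD('m) * b))"
    unfolding kernel_sum_def
  proof (intro sum_norm_le)
    fix l :: 'd and k :: 'm
    have "norm ((w $ k $ l) *\<^sub>R ((1 / real CARD('m)) *\<^sub>R c l k)) = \<bar>w $ k $ l\<bar> * (1 / real CARD('m) * norm (c l k))"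
      by simp
    also have "\<dots> \<le> norm w * (1 / real CARD('m) * b)"
      using assms[of l k] b by (intro mult_mono order_trans[OF component_le_norm_cart Finite_Cartesian_Product.norm_nth_le]) (auto intro: divide_right_mono)
    finally show "norm ((w $ k $ l) *\<^sub>R ((1 / real CARD('m)) *\<^sub>R c l k)) \<le> norm w * (1 / real CARD('m) * b)" .
  qed
  also have "\<dots> = real CARD('d) * norm w * b" by simp
  finally show ?thesis .
qed

lemma kernel_sum_diff: "kernel_sum w c - kernel_sum w c' = kernel_sum w (\<lambda>l k. c l k - c' l k)"
  unfolding kernel_sum_def by (simp add: sum_subtractf scaleR_diff_right)

text \<open>The pairing of the control with a function of time, in the form in which weak-* convergence is tested.\<close>

lemma kernel_sum_inner: 
  fixes w :: "(real^'d)^'m"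
  shows "kernel_sum w c \<bullet> v = w \<bullet> (\<chi> k. \<chi> l. (1 / real CARD('m)) * (c l k \<bullet> v))"
proof -
  have "kernel_sum w c \<bullet> v = (\<Sum>l\<in>UNIV. \<Sum>k\<in>UNIV. w $ k $ l * ((1 / real CARD('m)) * (c l k \<bullet> v)))"
    unfolding kernel_sum_def by (simp add: inner_sum_left)
  also have "\<dots> = (\<Sum>k\<in>UNIV. \<Sum>l\<in>UNIV. w $ k $ l * ((1 / real CARD('m)) * (c l k \<bullet> v)))"
    by (rule sum.swap)
  finally show ?thesis by (simp add: inner_vec_def)
qed

lemma linear_kernel_sum: "linear (\<lambda>w. kernel_sum w c)"
  unfolding kernel_sum_def
  by (rule linearI) (simp_all add: scaleR_add_left add_divide_distrib sum.distrib scaleR_sum_right)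

lemma lip_continuous_on:
  fixes F :: "'a::real_normed_vector \<Rightarrow> 'b::real_normed_vector"
  assumes "\<And>x y. x \<in> S \<Longrightarrow> y \<in> S \<Longrightarrow> norm (F x - F y) \<le> L * norm (x - y)"
  shows "continuous_on S F"
proof -
  have "\<bar>L\<bar>-lipschitz_on S F"
  proof (rule lipschitz_onI)
    fix x y assume "x \<in> S" "y \<in> S"
    then have "norm (F x - F y) \<le> L * norm (x - y)" by (rule assms)
    also have "\<dots> \<le> \<bar>L\<bar> * norm (x - y)" by (intro mult_right_mono) auto
    finally show "dist (F x) (F y) \<le> \<bar>L\<bar> * dist x y" by (simp add: dist_norm)
  qed simp
  then show ?thesis by (rule lipschitz_on_continuous_on)
qed

lemma prob_norm_integral_le:
  fixes f :: "'a \<Rightarrow> 'b::{banach,second_countable_topology}"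
  assumes "prob_space M" "integrable M f" "AE x in M. norm (f x) \<le> c"
  shows "norm (integral\<^sup>L M f) \<le> c"
proof -
  interpret prob_space M by fact
  have "norm (integral\<^sup>L M f) \<le> (\<integral>x. norm (f x) \<partial>M)" by (rule integral_norm_bound)
  also have "\<dots> \<le> (\<integral>x. c \<partial>M)" using assms by (intro integral_mono_AE) auto
  finally show ?thesis by (simp add: prob_space)
qed

lemma conv_integrable:
  fixes F :: "'a::euclidean_space \<Rightarrow> 'b::euclidean_space"
  assumes "\<And>x. norm (F x) \<le> B" "\<And>x y. norm (F x - F y) \<le> L * norm (x - y)"
    and "prob_space \<nu>" "sets \<nu> = sets borel"
  shows "integrable \<nu> (\<lambda>\<xi>. F (x - \<xi>))"
proof -
  interpret prob_space \<nu> by fact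
  have "continuous_on UNIV F" by (rule lip_continuous_on) (rule assms(2))
  then have "(\<lambda>\<xi>. F (x - \<xi>)) \<in> borel_measurable borel"
    by (intro borel_measurable_continuous_onI continuous_on_compose2[of UNIV F UNIV "\<lambda>\<xi>. x - \<xi>"] continuous_on_diff continuous_on_const continuous_on_id) auto
  then have "(\<lambda>\<xi>. F (x - \<xi>)) \<in> borel_measurable \<nu>" unfolding measurable_cong_sets[OF assms(4) refl] .
  then show ?thesis by (rule integrable_const_bound[where B=B, rotated]) (use assms in auto)
qed

lemma conv_bound:
  assumes "\<And>x. norm (F x) \<le> B" "\<And>x y. norm (F x - F y) \<le> L * norm (x - y)"
    and "prob_space \<nu>" "sets \<nu> = sets borel"
  shows "norm (conv F \<nu> x) \<le> B"
  unfolding conv_def by (rule prob_norm_integral_le[OF assms(3) conv_integrable[OF assms]]) (use assms(1) in auto)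

lemma conv_lip:
  assumes "\<And>x. norm (F x) \<le> B" "\<And>x y. norm (F x - F y) \<le> L * norm (x - y)"
    and "prob_space \<nu>" "sets \<nu> = sets borel"
  shows "norm (conv F \<nu> x - conv F \<nu> y) \<le> L * norm (x - y)"
proof -
  note i = conv_integrable[OF assms]
  have "norm (F (x - \<xi>) - F (y - \<xi>)) \<le> L * norm (x - y)" for \<xi>
    using assms(2)[of "x - \<xi>" "y - \<xi>"] by simp
  then show ?thesis unfolding conv_def Bochner_Integration.integral_diff[OF i i, symmetric]
    by (intro prob_norm_integral_le[OF assms(3)]) (use i in auto)
qed

lemma conv_distr:
  assumes "\<And>x y. norm (F x - F y) \<le> L * norm (x - y)" "z \<in> borel_measurable P"
  shows "conv F (distr P borel z) x = (\<integral>\<xi>. F (x - z \<xi>) \<partial>P)"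
proof -
  have "continuous_on UNIV F" by (rule lip_continuous_on) (rule assms(1))
  then have "(\<lambda>\<xi>. F (x - \<xi>)) \<in> borel_measurable borel"
    by (intro borel_measurable_continuous_onI continuous_on_compose2[of UNIV F UNIV "\<lambda>\<xi>. x - \<xi>"] continuous_on_diff continuous_on_const continuous_on_id) auto
  then show ?thesis unfolding conv_def by (intro integral_distr assms(2))
qed

text \<open>The dimension, as a function of a field on the space: the constants below would otherwise not mention the
type \<open>'d\<close> in their arguments.\<close>

definition dim_real :: "(real^'d \<Rightarrow> real^'d) \<Rightarrow> real" where
  "dim_real F = real CARD('d)"

locale interaction =
  fixes H :: "real^'d \<Rightarrow> real^'d" and G :: "'d \<Rightarrow> real^'d \<Rightarrow> real^'d" and B Lp :: real
  assumes H_bound: "\<And>x. norm (H x) \<le> B" and G_bound: "\<And>l x. norm (G l x) \<le> B"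
    and H_lip: "\<And>x y. norm (H x - H y) \<le> Lp * norm (x - y)"
    and G_lip: "\<And>l x y. norm (G l x - G l y) \<le> Lp * norm (x - y)"
begin

lemma B_nonneg: "0 \<le> B" using H_bound norm_ge_zero order_trans by blast

lemma Lp_nonneg: "0 \<le> Lp"
proof -
  obtain b :: "real^'d" where b: "b \<in> Basis" using nonempty_Basis by blast
  have "0 \<le> norm (H b - H 0)" by simp
  also have "\<dots> \<le> Lp * norm (b - 0)" by (rule H_lip)
  finally show ?thesis using b by simp
qed

lemma continuous_G: "continuous_on UNIV (G l)" by (rule lip_continuous_on) (rule G_lip)

abbreviation control_field :: "(real^'d)^'m \<Rightarrow> (real^'d)^'m \<Rightarrow> real^'d \<Rightarrow> real^'d" where
  "control_field w y x \<equiv> kernel_sum w (\<lambda>l k. G l (x - y $ k))"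

text \<open>\<open>vel_bd M\<close> and \<open>vel_lip M\<close> are the supremum bound and the Lipschitz constant in space of the velocity, for
controls of norm at most M. They involve neither the measure nor the positions of the agents.\<close>

definition vel_bd :: "real \<Rightarrow> real" where "vel_bd M = B + dim_real H * M * B"
definition vel_lip :: "real \<Rightarrow> real" where "vel_lip M = Lp + dim_real H * M * Lp"

lemma velocity_bound:
  fixes w :: "(real^'d)^'m"
  assumes "prob_space \<nu>" "sets \<nu> = sets borel" "norm w \<le> M"
  shows "norm (velocity H G w Y \<nu> x) \<le> vel_bd M"
proof -
  have "norm (conv H \<nu> x) \<le> B" by (rule conv_bound[OF H_bound H_lip assms(1,2)])
  moreover have "norm (control_field w Y x) \<le> real CARD('d) * norm w * B"
    by (rule kernel_sum_bound) (rule G_bound)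
  moreover have "real CARD('d) * norm w * B \<le> real CARD('d) * M * B"
    using assms(3) B_nonneg by (intro mult_right_mono mult_left_mono) auto
  ultimately show ?thesis unfolding velocity_eq vel_bd_def dim_real_def
    using norm_triangle_ineq[of "conv H \<nu> x" "control_field w Y x"] by linarith
qed

lemma velocity_lip:
  fixes w :: "(real^'d)^'m"
  assumes "prob_space \<nu>" "sets \<nu> = sets borel" "norm w \<le> M"
  shows "norm (velocity H G w Y \<nu> x - velocity H G w Y \<nu> x') \<le> vel_lip M * norm (x - x')"
proof -
  have 1: "norm (conv H \<nu> x - conv H \<nu> x') \<le> Lp * norm (x - x')" by (rule conv_lip[OF H_bound H_lip assms(1,2)])
  have 2: "norm (control_field w Y x - control_field w Y x') \<le> real CARD('d) * norm w * (Lp * norm (x - x'))"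
    unfolding kernel_sum_diff
  proof (rule kernel_sum_bound)
    show "norm (G l (x - Y $ k) - G l (x' - Y $ k)) \<le> Lp * norm (x - x')" for l k
      using G_lip[of l "x - Y $ k" "x' - Y $ k"] by simp
  qed
  have 3: "real CARD('d) * norm w * (Lp * norm (x - x')) \<le> real CARD('d) * M * (Lp * norm (x - x'))"
    using assms(3) Lp_nonneg by (intro mult_right_mono mult_left_mono) auto
  have "velocity H G w Y \<nu> x - velocity H G w Y \<nu> x' = (conv H \<nu> x - conv H \<nu> x') +
     (control_field w Y x - control_field w Y x')"
    unfolding velocity_eq by simp
  then have "norm (velocity H G w Y \<nu> x - velocity H G w Y \<nu> x') \<le> Lp * norm (x - x') + real CARD('d) * M * (Lp * norm (x - x'))"
    using norm_triangle_mono[OF 1 order_trans[OF 2 3]] by simp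
  then show ?thesis unfolding vel_lip_def dim_real_def by (simp add: algebra_simps)
qed

lemma kernel_sum_Y:
  fixes w :: "(real^'d)^'m"
  assumes "norm w \<le> M"
  shows "norm (control_field w Y x - control_field w Y' x)
    \<le> real CARD('d) * M * (Lp * norm (Y - Y'))"
proof -
  have "norm (control_field w Y x - control_field w Y' x)
    \<le> real CARD('d) * norm w * (Lp * norm (Y - Y'))"
    unfolding kernel_sum_diff
  proof (rule kernel_sum_bound)
    fix l k
    have "norm (G l (x - Y $ k) - G l (x - Y' $ k)) \<le> Lp * norm ((Y' - Y) $ k)"
      using G_lip[of l "x - Y $ k" "x - Y' $ k"] by simp
    also have "\<dots> \<le> Lp * norm (Y - Y')" using Lp_nonneg Finite_Cartesian_Product.norm_nth_le[of "Y' - Y" k]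
      by (intro mult_left_mono) (auto simp: norm_minus_commute)
    finally show "norm (G l (x - Y $ k) - G l (x - Y' $ k)) \<le> Lp * norm (Y - Y')" .
  qed
  also have "\<dots> \<le> real CARD('d) * M * (Lp * norm (Y - Y'))"
    using assms Lp_nonneg by (intro mult_right_mono mult_left_mono) auto
  finally show ?thesis .
qed

text \<open>The Lipschitz function H is integrated against both marginals of the image of the coupling under
\<open>(z, z')\<close>; hence the difference is at most Lp times the cost of that image.\<close>

lemma conv_coupling:
  assumes \<pi>: "\<pi> \<in> couplings P P'" and P: "prob_space P" "sets P = sets borel" "sets P' = sets borel"
    and z: "z \<in> borel_measurable borel" "z' \<in> borel_measurable borel"
    and i: "integrable \<pi> (\<lambda>p. norm (z (fst p) - z' (snd p)))"
  shows "norm (conv H (distr P borel z) x - conv H (distr P' borel z') x) \<le> Lp * (\<integral>p. norm (z (fst p) - z' (snd p)) \<partial>\<pi>)"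
proof -
  note D = couplings_D[OF \<pi>]
  interpret \<pi>: prob_space \<pi> by (rule couplings_prob[OF \<pi> P(1)])
  have cH: "continuous_on UNIV H" by (rule lip_continuous_on) (rule H_lip)
  have Hm: "H \<in> borel_measurable borel" by (rule borel_measurable_continuous_onI[OF cH])
  have m1: "(\<lambda>\<xi>. H (x - z \<xi>)) \<in> borel_measurable borel" "(\<lambda>\<xi>. H (x - z' \<xi>)) \<in> borel_measurable borel"
    using Hm z by measurable
  have "conv H (distr P borel z) x = (\<integral>\<xi>. H (x - z \<xi>) \<partial>P)"
    using z(1) P(2) by (intro conv_distr[OF H_lip]) (simp add: measurable_cong_sets[OF P(2) refl])
  also have "\<dots> = (\<integral>p. H (x - z (fst p)) \<partial>\<pi>)"
    using integral_distr[OF D(3) m1(1)] unfolding D(5) .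
  finally have e1: "conv H (distr P borel z) x = (\<integral>p. H (x - z (fst p)) \<partial>\<pi>)" .
  have "conv H (distr P' borel z') x = (\<integral>\<xi>. H (x - z' \<xi>) \<partial>P')"
    using z(2) P(3) by (intro conv_distr[OF H_lip]) (simp add: measurable_cong_sets[OF P(3) refl])
  also have "\<dots> = (\<integral>p. H (x - z' (snd p)) \<partial>\<pi>)"
    using integral_distr[OF D(4) m1(2)] unfolding D(6) .
  finally have e2: "conv H (distr P' borel z') x = (\<integral>p. H (x - z' (snd p)) \<partial>\<pi>)" .
  have i1: "integrable \<pi> (\<lambda>p. H (x - z (fst p)))"
    by (rule \<pi>.integrable_const_bound[where B=B]) (use H_bound measurable_compose[OF D(3) m1(1)] in auto)
  have i2: "integrable \<pi> (\<lambda>p. H (x - z' (snd p)))"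
    by (rule \<pi>.integrable_const_bound[where B=B]) (use H_bound measurable_compose[OF D(4) m1(2)] in auto)
  have "norm (conv H (distr P borel z) x - conv H (distr P' borel z') x) = norm (\<integral>p. H (x - z (fst p)) - H (x - z' (snd p)) \<partial>\<pi>)"
    unfolding e1 e2 using i1 i2 by simp
  also have "\<dots> \<le> (\<integral>p. norm (H (x - z (fst p)) - H (x - z' (snd p))) \<partial>\<pi>)" by (rule integral_norm_bound)
  also have "\<dots> \<le> (\<integral>p. Lp * norm (z (fst p) - z' (snd p)) \<partial>\<pi>)"
  proof (rule integral_mono)
    show "norm (H (x - z (fst p)) - H (x - z' (snd p))) \<le> Lp * norm (z (fst p) - z' (snd p))" for p
      using H_lip[of "x - z (fst p)" "x - z' (snd p)"] by (simp add: norm_minus_commute)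
  qed (use i1 i2 i in auto)
  finally show ?thesis by simp
qed

lemma conv_distr_close:
  assumes P: "prob_space P" "sets P = sets borel"
    and z: "z \<in> borel_measurable borel" "z' \<in> borel_measurable borel"
    and d: "AE \<xi> in P. norm (z \<xi> - z' \<xi>) \<le> d"
  shows "norm (conv H (distr P borel z) x - conv H (distr P borel z') x) \<le> Lp * d"
proof -
  interpret P: prob_space P by fact
  have cH: "continuous_on UNIV H" by (rule lip_continuous_on) (rule H_lip)
  have Hm: "H \<in> borel_measurable borel" by (rule borel_measurable_continuous_onI[OF cH])
  have z': "z \<in> borel_measurable P" "z' \<in> borel_measurable P" using z by (simp_all add: measurable_cong_sets[OF P(2) refl])
  have m1: "(\<lambda>\<xi>. H (x - z \<xi>)) \<in> borel_measurable P" "(\<lambda>\<xi>. H (x - z' \<xi>)) \<in> borel_measurable P"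
    using Hm z' by measurable
  have i: "integrable P (\<lambda>\<xi>. H (x - z \<xi>))" "integrable P (\<lambda>\<xi>. H (x - z' \<xi>))"
    by (rule P.integrable_const_bound[where B=B]; use H_bound m1 in auto)+
  have "AE \<xi> in P. norm (H (x - z \<xi>) - H (x - z' \<xi>)) \<le> Lp * d"
    using d
  proof eventually_elim
    fix \<xi> assume "norm (z \<xi> - z' \<xi>) \<le> d"
    then have "Lp * norm (z \<xi> - z' \<xi>) \<le> Lp * d" using Lp_nonneg by (rule mult_left_mono)
    then show "norm (H (x - z \<xi>) - H (x - z' \<xi>)) \<le> Lp * d"
      using H_lip[of "x - z \<xi>" "x - z' \<xi>"] by (simp add: norm_minus_commute)
  qed
  then have "norm (\<integral>\<xi>. H (x - z \<xi>) - H (x - z' \<xi>) \<partial>P) \<le> Lp * d"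
    using i by (intro prob_norm_integral_le[OF P(1)]) auto
  then show ?thesis using i by (simp add: conv_distr[OF H_lip z'(1)] conv_distr[OF H_lip z'(2)])
qed

end

section \<open>Lagrangian solutions for globally Lipschitz kernels\<close>

locale controlled = interaction H G B Lp
  for H :: "real^'d \<Rightarrow> real^'d" and G :: "'d \<Rightarrow> real^'d \<Rightarrow> real^'d" and B Lp :: real +
  fixes T M :: real and u Y :: "real \<Rightarrow> (real^'d)^'m" and Y0 :: "(real^'d)^'m"
  assumes T_pos: "T > 0"
    and u_meas: "time_measurable T u"
    and u_bound: "\<And>t. norm (u t) \<le> M"
    and Y_eq: "\<And>t. t \<in> {0..T} \<Longrightarrow> Y t = Y0 + integral {0..t} u"
begin

abbreviation "Cv \<equiv> vel_bd M"
abbreviation "Kv \<equiv> vel_lip M"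

lemma M_nonneg: "0 \<le> M" using u_bound norm_ge_zero order_trans by blast
lemma Cv_nonneg: "0 \<le> Cv" unfolding vel_bd_def dim_real_def using B_nonneg M_nonneg by simp
lemma Kv_nonneg: "0 \<le> Kv" unfolding vel_lip_def dim_real_def using Lp_nonneg M_nonneg by simp

lemma u_abs_int: "u absolutely_integrable_on {0..T}"
  by (rule abs_integrable_bounded[OF u_meas]) (rule u_bound)

lemma u_int: "u integrable_on {0..T}"
  using u_abs_int by (simp add: absolutely_integrable_on_def)

lemma Y_lip: "s \<in> {0..T} \<Longrightarrow> t \<in> {0..T} \<Longrightarrow> norm (Y t - Y s) \<le> M * \<bar>t - s\<bar>"
  using integral_lipschitz[OF u_int u_bound, of s t] Y_eq by simp

lemma Y_cont: "continuous_on {0..T} Y"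
  by (rule lip_continuous_on[where L=M]) (use Y_lip in auto)

lemma control_field_integrable:
  fixes w y :: "real \<Rightarrow> (real^'d)^'m"
  assumes w: "time_measurable T w" "\<And>s. norm (w s) \<le> M"
    and y: "continuous_on {0..T} y" and z: "continuous_on {0..T} z"
  shows "(\<lambda>s. control_field (w s) (y s) (z s)) absolutely_integrable_on {0..T}"
proof (rule abs_integrable_bounded)
  have c: "continuous_on {0..T} (\<lambda>s. G l (z s - y s $ k))" for l k
    using z y by (intro continuous_on_compose2[OF continuous_G]) (auto intro!: continuous_intros)
  have [measurable]: "time_measurable T (\<lambda>s. G l (z s - y s $ k))" for l k
    by (rule continuous_imp_measurable_on_sets_lebesgue[OF c]) simp
  have nth: "(\<lambda>v::(real^'d)^'m. v $ k $ l) \<in> borel_measurable borel" for k l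
    by (intro borel_measurable_continuous_onI continuous_intros)
  have [measurable]: "time_measurable T (\<lambda>s. w s $ k $ l)" for k l
    by (rule measurable_compose[OF w(1) nth])
  show "time_measurable T (\<lambda>s. control_field (w s) (y s) (z s))"
    unfolding kernel_sum_def by measurable
  fix s
  have "norm (control_field (w s) (y s) (z s)) \<le> real CARD('d) * norm (w s) * B"
    by (rule kernel_sum_bound) (rule G_bound)
  also have "\<dots> \<le> real CARD('d) * M * B"
    using w(2) B_nonneg by (intro mult_right_mono mult_left_mono) auto
  finally show "norm (control_field (w s) (y s) (z s)) \<le> real CARD('d) * M * B" .
qed

lemmas kernel_time = control_field_integrable[OF u_meas u_bound Y_cont]

text \<open>Enough regularity in time for the velocity along a continuous path to be integrable.\<close>

definition good_curve :: "(real \<Rightarrow> (real^'d) measure) \<Rightarrow> bool" where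
  "good_curve \<nu> \<longleftrightarrow> (\<forall>s\<in>{0..T}. prob_space (\<nu> s) \<and> sets (\<nu> s) = sets borel) \<and> (\<forall>x. continuous_on {0..T} (\<lambda>s. conv H (\<nu> s) x))"

lemma conv_time:
  assumes \<nu>: "good_curve \<nu>" and z: "continuous_on {0..T} z"
  shows "continuous_on {0..T} (\<lambda>s. conv H (\<nu> s) (z s))"
  unfolding continuous_on_def
proof
  fix s assume s: "s \<in> {0..T}"
  have "((\<lambda>r. Lp * norm (z r - z s)) \<longlongrightarrow> Lp * norm (z s - z s)) (at s within {0..T})"
    using z s unfolding continuous_on_def by (intro tendsto_intros) auto
  then have 0: "((\<lambda>r. Lp * norm (z r - z s)) \<longlongrightarrow> 0) (at s within {0..T})" by simp
  have 1: "((\<lambda>r. conv H (\<nu> r) (z r) - conv H (\<nu> r) (z s)) \<longlongrightarrow> 0) (at s within {0..T})"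
  proof (rule Lim_null_comparison[OF _ 0])
    show "\<forall>\<^sub>F r in at s within {0..T}. norm (conv H (\<nu> r) (z r) - conv H (\<nu> r) (z s)) \<le> Lp * norm (z r - z s)"
      unfolding eventually_at_filter using \<nu> unfolding good_curve_def
      by (intro always_eventually) (auto intro!: conv_lip[OF H_bound H_lip])
  qed
  have "((\<lambda>r. conv H (\<nu> r) (z s)) \<longlongrightarrow> conv H (\<nu> s) (z s)) (at s within {0..T})"
    using \<nu> s unfolding good_curve_def continuous_on_def by auto
  from tendsto_add[OF 1 this] show "((\<lambda>r. conv H (\<nu> r) (z r)) \<longlongrightarrow> conv H (\<nu> s) (z s)) (at s within {0..T})" by simp
qed

abbreviation vel :: "(real \<Rightarrow> (real^'d) measure) \<Rightarrow> real \<Rightarrow> real^'d \<Rightarrow> real^'d" where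
  "vel \<nu> s \<equiv> velocity H G (u s) (Y s) (\<nu> s)"

lemma velocity_time:
  assumes \<nu>: "good_curve \<nu>" and z: "continuous_on {0..T} z"
  shows "(\<lambda>s. vel \<nu> s (z s)) absolutely_integrable_on {0..T}"
  unfolding velocity_eq
  by (intro set_integral_add kernel_time[OF z] absolutely_integrable_continuous_real conv_time[OF \<nu> z])

lemma velocity_le: "good_curve \<nu> \<Longrightarrow> s \<in> {0..T} \<Longrightarrow> norm (vel \<nu> s x) \<le> Cv"
  unfolding good_curve_def by (rule velocity_bound) (auto simp: u_bound)

definition flow_line :: "(real \<Rightarrow> (real^'d) measure) \<Rightarrow> (real^'d) \<Rightarrow> (real \<Rightarrow> real^'d) \<Rightarrow> bool" where
  "flow_line \<nu> x z \<longleftrightarrow> continuous_on {0..T} z \<and>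
     (\<forall>t\<in>{0..T}. z t = x + integral {0..t} (\<lambda>s. vel \<nu> s (z s)))"

lemma flow_line_lip:
  assumes "good_curve \<nu>" "flow_line \<nu> x z" "s \<in> {0..T}" "t \<in> {0..T}"
  shows "norm (z t - z s) \<le> Cv * \<bar>t - s\<bar>"
proof -
  have "(\<lambda>s. vel \<nu> s (z s)) integrable_on {0..T}"
    using velocity_time[OF assms(1)] assms(2) unfolding flow_line_def by (auto simp: absolutely_integrable_on_def)
  from integral_lipschitz[OF this velocity_le[OF assms(1)] assms(3,4)] show ?thesis
    using assms unfolding flow_line_def by simp
qed

lemma flow_line_close:
  assumes \<nu>: "good_curve \<nu>" and z: "flow_line \<nu> x z" and z': "flow_line \<nu> x' z'" and t: "t \<in> {0..T}"
  shows "norm (z t - z' t) \<le> 2 * norm (x - x') * exp (2 * Kv * T)"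
proof -
  have c: "continuous_on {0..T} z" "continuous_on {0..T} z'" using z z' unfolding flow_line_def by auto
  have i: "(\<lambda>s. vel \<nu> s (z s)) integrable_on {0..T}"
     "(\<lambda>s. vel \<nu> s (z' s)) integrable_on {0..T}"
    using velocity_time[OF \<nu>] c by (auto simp: absolutely_integrable_on_def)
  have n: "(\<lambda>s. norm (z s - z' s)) integrable_on {0..r}" if "r \<in> {0..T}" for r
    using that c by (intro integrable_continuous_real continuous_intros) (auto elim: continuous_on_subset)
  have "compact ((\<lambda>s. norm (z s - z' s)) ` {0..T})"
    using c by (intro compact_continuous_image continuous_intros) auto
  from bounded_imp_bdd_above[OF compact_imp_bounded[OF this]]
  obtain b where b: "\<And>s. s \<in> {0..T} \<Longrightarrow> norm (z s - z' s) \<le> b"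
    unfolding bdd_above_def by (metis imageI)
  have "norm (z t - z' t) \<le> 2 * norm (x - x') * exp (2 * Kv * t)"
  proof (rule gronwall_bounded[OF Kv_nonneg _ b n _ t])
    fix r assume r: "r \<in> {0..T}"
    have ir: "(\<lambda>s. vel \<nu> s (z s)) integrable_on {0..r}"
     "(\<lambda>s. vel \<nu> s (z' s)) integrable_on {0..r}"
      using i r by (auto elim: integrable_on_subinterval)
    have "z r - z' r = (x - x') + integral {0..r} (\<lambda>s. vel \<nu> s (z s) - vel \<nu> s (z' s))"
      using z z' r unfolding flow_line_def by (simp add: hk_integral_diff[OF ir])
    then have "norm (z r - z' r) \<le> norm (x - x') + norm (integral {0..r} (\<lambda>s. vel \<nu> s (z s) - vel \<nu> s (z' s)))"
      by (simp add: norm_triangle_ineq)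
    also have "norm (integral {0..r} (\<lambda>s. vel \<nu> s (z s) - vel \<nu> s (z' s)))
      \<le> integral {0..r} (\<lambda>s. Kv * norm (z s - z' s))"
    proof (rule integral_norm_bound_integral)
      show "(\<lambda>s. Kv * norm (z s - z' s)) integrable_on {0..r}" using n[OF r] by (rule integrable_on_mult_right)
      fix s assume "s \<in> {0..r}"
      then show "norm (vel \<nu> s (z s) - vel \<nu> s (z' s)) \<le> Kv * norm (z s - z' s)"
        using \<nu> r unfolding good_curve_def by (intro velocity_lip u_bound) auto
    qed (use ir in \<open>auto intro: integrable_diff\<close>)
    also have "\<dots> = Kv * integral {0..r} (\<lambda>s. norm (z s - z' s))" by simp
    finally show "norm (z r - z' r) \<le> norm (x - x') + Kv * integral {0..r} (\<lambda>s. norm (z s - z' s))" by simp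
  qed (use T_pos in auto)
  also have "\<dots> \<le> 2 * norm (x - x') * exp (2 * Kv * T)"
    using t Kv_nonneg by (intro mult_left_mono) (auto intro: mult_left_mono)
  finally show ?thesis .
qed

lemma linear_flow_exists:
  assumes \<nu>: "good_curve \<nu>"
  obtains \<Phi> where "jointly_continuous \<Phi>" "\<And>x. flow_line \<nu> x (\<lambda>t. \<Phi> t x)"
proof -
  have sec: "continuous_on {0..T} (\<lambda>s. Z s x)" if "jointly_continuous Z" for Z :: "real \<Rightarrow> real^'d \<Rightarrow> real^'d" and x
    using continuous_on_compose2[OF that, of "{0..T}" "\<lambda>s. (s, x)"] by (simp add: continuous_on_Pair)
  obtain \<Phi> where \<Phi>: "jointly_continuous \<Phi>"
    "\<And>t x. t \<in> {0..T} \<Longrightarrow> \<Phi> t x = x + integral {0..t} (\<lambda>s. vel \<nu> s (\<Phi> s x))"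
  proof (rule picard_flow[of T Kv "\<lambda>Z s x. vel \<nu> s x" Cv])
    fix Z Z' :: "real \<Rightarrow> real^'d \<Rightarrow> real^'d" and s x x' d
    assume a: "s \<in> {0..T}" and d: "\<And>\<xi>. norm (Z s \<xi> - Z' s \<xi>) \<le> d"
    have "norm (vel \<nu> s x - vel \<nu> s x') \<le> Kv * norm (x - x')"
      using \<nu> a unfolding good_curve_def by (intro velocity_lip u_bound) auto
    moreover have "0 \<le> Kv * d" using Kv_nonneg order_trans[OF norm_ge_zero d] by simp
    ultimately show "norm (vel \<nu> s x - vel \<nu> s x') \<le> Kv * (norm (x - x') + d)"
      by (simp add: distrib_left)
  next
    fix Z :: "real \<Rightarrow> real^'d \<Rightarrow> real^'d" and x assume "jointly_continuous Z"
    from velocity_time[OF \<nu> sec[OF this]] show "(\<lambda>s. vel \<nu> s (Z s x)) integrable_on {0..T}"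
      by (simp add: absolutely_integrable_on_def)
  qed (use T_pos Kv_nonneg velocity_le[OF \<nu>] in auto)
  show thesis by (rule that[OF \<Phi>(1)]) (use \<Phi> sec in \<open>auto simp: flow_line_def\<close>)
qed

text \<open>Z is a flow moved by the velocity that its own law generates, when the starting points are distributed
according to P. The flow equation is asked for starting points in S only: for kernels that have been cut off
it is the equation of the original problem just on a bounded set carrying P.\<close>

definition lagrangian :: "(real^'d) set \<Rightarrow> (real^'d) measure \<Rightarrow> (real \<Rightarrow> real^'d \<Rightarrow> real^'d) \<Rightarrow> bool" where
  "lagrangian S P Z \<longleftrightarrow> good_curve (\<lambda>t. distr P borel (Z t)) \<and> (\<forall>t\<in>{0..T}. Z t \<in> borel_measurable borel) \<and>
     (\<forall>x\<in>S. flow_line (\<lambda>t. distr P borel (Z t)) x (\<lambda>t. Z t x))"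

lemma good_curve_distr:
  assumes P: "prob_space P" "sets P = sets borel" and Z: "\<And>t. t \<in> {0..T} \<Longrightarrow> Z t \<in> borel_measurable borel"
    and c: "AE \<xi> in P. continuous_on {0..T} (\<lambda>t. Z t \<xi>)"
  shows "good_curve (\<lambda>t. distr P borel (Z t))"
proof -
  interpret P: prob_space P by fact
  have Z': "Z t \<in> borel_measurable P" if "t \<in> {0..T}" for t
    using Z[OF that] by (simp add: measurable_cong_sets[OF P(2) refl])
  have cH: "continuous_on UNIV H" by (rule lip_continuous_on) (rule H_lip)
  have Hm: "H \<in> borel_measurable borel" by (rule borel_measurable_continuous_onI[OF cH])
  have m: "(\<lambda>\<xi>. H (x - Z t \<xi>)) \<in> borel_measurable P" if "t \<in> {0..T}" for t x
    using Hm Z'[OF that] by measurable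
  have "continuous_on {0..T} (\<lambda>s. conv H (distr P borel (Z s)) x)" for x
    unfolding continuous_on_sequentially
  proof (intro allI ballI impI)
    fix ts t assume t: "t \<in> {0..T}" and ts: "(\<forall>n. ts n \<in> {0..T}) \<and> ts \<longlonglongrightarrow> t"
    have "(\<lambda>n. \<integral>\<xi>. H (x - Z (ts n) \<xi>) \<partial>P) \<longlonglongrightarrow> (\<integral>\<xi>. H (x - Z t \<xi>) \<partial>P)"
    proof (rule integral_dominated_convergence[where w="\<lambda>_. B"])
      show "AE \<xi> in P. (\<lambda>n. H (x - Z (ts n) \<xi>)) \<longlonglongrightarrow> H (x - Z t \<xi>)"
        using c
      proof eventually_elim
        fix \<xi> assume "continuous_on {0..T} (\<lambda>t. Z t \<xi>)"
        then have "(\<lambda>n. Z (ts n) \<xi>) \<longlonglongrightarrow> Z t \<xi>"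
          using t ts unfolding continuous_on_sequentially comp_def by blast
        then have "(\<lambda>n. x - Z (ts n) \<xi>) \<longlonglongrightarrow> x - Z t \<xi>" by (intro tendsto_intros)
        then show "(\<lambda>n. H (x - Z (ts n) \<xi>)) \<longlonglongrightarrow> H (x - Z t \<xi>)"
          by (rule continuous_on_tendsto_compose[OF cH]) auto
      qed
    qed (use m t ts H_bound in auto)
    then show "((\<lambda>s. conv H (distr P borel (Z s)) x) \<circ> ts) \<longlonglongrightarrow> conv H (distr P borel (Z t)) x"
      using t ts by (simp add: comp_def conv_distr[OF H_lip Z'])
  qed
  then show ?thesis unfolding good_curve_def using Z' by (auto intro!: P.prob_space_distr)
qed

text \<open>The field depends on Z through its law, and by \<open>conv_distr_close\<close> this dependence is Lipschitz in the
supremum norm, as \<open>picard_flow\<close> asks.\<close>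

lemma lagrangian_exists:
  assumes P: "prob_space P" "sets P = sets borel"
  obtains Z where "jointly_continuous Z" "lagrangian UNIV P Z"
proof -
  have sec: "continuous_on {0..T} (\<lambda>s. Z s x)" if "jointly_continuous Z" for Z :: "real \<Rightarrow> real^'d \<Rightarrow> real^'d" and x
    using continuous_on_compose2[OF that, of "{0..T}" "\<lambda>s. (s, x)"] by (simp add: continuous_on_Pair)
  have me: "Z s \<in> borel_measurable borel" if "jointly_continuous Z" for Z :: "real \<Rightarrow> real^'d \<Rightarrow> real^'d" and s
    using continuous_on_compose2[OF that, of UNIV "\<lambda>x. (s, x)"]
    by (intro borel_measurable_continuous_onI) (simp add: continuous_on_Pair)
  have gc: "good_curve (\<lambda>t. distr P borel (Z t))" if "jointly_continuous Z" for Z :: "real \<Rightarrow> real^'d \<Rightarrow> real^'d"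
    by (rule good_curve_distr[OF P me[OF that]]) (use sec[OF that] in auto)
  obtain Z where Z: "jointly_continuous Z"
    "\<And>t x. t \<in> {0..T} \<Longrightarrow> Z t x = x + integral {0..t} (\<lambda>s. velocity H G (u s) (Y s) (distr P borel (Z s)) (Z s x))"
  proof (rule picard_flow[of T "Kv + Lp" "\<lambda>Z s x. velocity H G (u s) (Y s) (distr P borel (Z s)) x" Cv])
    fix Z Z' :: "real \<Rightarrow> real^'d \<Rightarrow> real^'d" and s x x' d
    assume cZ: "jointly_continuous Z" "jointly_continuous Z'"
      and a: "s \<in> {0..T}" and d: "\<And>\<xi>. norm (Z s \<xi> - Z' s \<xi>) \<le> d"
    have d0: "0 \<le> d" using order_trans[OF norm_ge_zero d] .
    have 1: "norm (velocity H G (u s) (Y s) (distr P borel (Z s)) x - velocity H G (u s) (Y s) (distr P borel (Z s)) x') \<le> Kv * norm (x - x')"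
      using gc[OF cZ(1)] a unfolding good_curve_def by (intro velocity_lip u_bound) auto
    have "norm (conv H (distr P borel (Z s)) x' - conv H (distr P borel (Z' s)) x') \<le> Lp * d"
      by (rule conv_distr_close[OF P me[OF cZ(1)] me[OF cZ(2)]]) (use d in auto)
    then have 2: "norm (velocity H G (u s) (Y s) (distr P borel (Z s)) x' - velocity H G (u s) (Y s) (distr P borel (Z' s)) x') \<le> Lp * d"
      unfolding velocity_eq by simp
    have "norm (velocity H G (u s) (Y s) (distr P borel (Z s)) x - velocity H G (u s) (Y s) (distr P borel (Z' s)) x') \<le> Kv * norm (x - x') + Lp * d"
      using norm_triangle_mono[OF 1 2] by simp
    also have "\<dots> \<le> (Kv + Lp) * (norm (x - x') + d)" using d0 Kv_nonneg Lp_nonneg by (simp add: algebra_simps)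
    finally show "norm (velocity H G (u s) (Y s) (distr P borel (Z s)) x - velocity H G (u s) (Y s) (distr P borel (Z' s)) x') \<le> (Kv + Lp) * (norm (x - x') + d)" .
  next
    fix Z :: "real \<Rightarrow> real^'d \<Rightarrow> real^'d" and s x assume "jointly_continuous Z" "s \<in> {0..T}"
    then show "norm (velocity H G (u s) (Y s) (distr P borel (Z s)) x) \<le> Cv" by (rule velocity_le[OF gc])
  next
    fix Z :: "real \<Rightarrow> real^'d \<Rightarrow> real^'d" and x assume cZ: "jointly_continuous Z"
    from velocity_time[OF gc[OF cZ] sec[OF cZ]] show "(\<lambda>s. velocity H G (u s) (Y s) (distr P borel (Z s)) (Z s x)) integrable_on {0..T}"
      by (simp add: absolutely_integrable_on_def)
  qed (use T_pos Kv_nonneg Lp_nonneg in auto)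
  show thesis by (rule that[OF Z(1)]) (use Z sec me gc in \<open>auto simp: lagrangian_def flow_line_def\<close>)
qed

end

section \<open>Stability under change of control and initial measure\<close>

lemma W1_distr_le:
  fixes z z' :: "'a::euclidean_space \<Rightarrow> 'a"
  assumes \<pi>: "\<pi> \<in> couplings P P'"
    and z: "z \<in> borel_measurable borel" "z' \<in> borel_measurable borel"
    and i: "integrable \<pi> (\<lambda>p. norm (z (fst p) - z' (snd p)))"
  shows "W1 (distr P borel z) (distr P' borel z') \<le> (\<integral>p. norm (z (fst p) - z' (snd p)) \<partial>\<pi>)"
proof -
  note D = couplings_D[OF \<pi>]
  define f where "f p = (z (fst p), z' (snd p))" for p
  have m: "(\<lambda>p. z (fst p)) \<in> borel_measurable \<pi>" "(\<lambda>p. z' (snd p)) \<in> borel_measurable \<pi>"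
    using measurable_compose[OF D(3) z(1)] measurable_compose[OF D(4) z(2)] by simp_all
  then have f: "f \<in> measurable \<pi> (borel \<Otimes>\<^sub>M borel)" unfolding f_def by (rule measurable_Pair)
  define \<rho> where "\<rho> = distr \<pi> (borel \<Otimes>\<^sub>M borel) f"
  have c: "\<rho> \<in> couplings (distr P borel z) (distr P' borel z')"
  proof -
    have "distr \<rho> borel fst = distr \<pi> borel (\<lambda>p. z (fst p))"
      unfolding \<rho>_def by (subst distr_distr[OF measurable_fst f]) (simp add: comp_def f_def)
    also have "\<dots> = distr (distr \<pi> borel fst) borel z"
      by (subst distr_distr[OF z(1) D(3)]) (simp add: comp_def)
    finally have 1: "distr \<rho> borel fst = distr P borel z" unfolding D(5) .
    have "distr \<rho> borel snd = distr \<pi> borel (\<lambda>p. z' (snd p))"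
      unfolding \<rho>_def by (subst distr_distr[OF measurable_snd f]) (simp add: comp_def f_def)
    also have "\<dots> = distr (distr \<pi> borel snd) borel z'"
      by (subst distr_distr[OF z(2) D(4)]) (simp add: comp_def)
    finally have 2: "distr \<rho> borel snd = distr P' borel z'" unfolding D(6) .
    show ?thesis unfolding couplings_def using 1 2 by (simp add: \<rho>_def)
  qed
  have dm: "(\<lambda>q. dist (fst q) (snd q)) \<in> borel_measurable (borel \<Otimes>\<^sub>M (borel :: 'a measure))" by measurable
  have "integrable \<rho> (\<lambda>q. dist (fst q) (snd q))"
    unfolding \<rho>_def using i by (subst integrable_distr_eq[OF f dm]) (simp add: f_def dist_norm)
  from W1_le_coupling[OF c this] show ?thesis
    unfolding \<rho>_def by (subst (asm) integral_distr[OF f dm]) (simp add: f_def dist_norm)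
qed

context controlled begin

lemma flow_line_0: "flow_line \<nu> x z \<Longrightarrow> z 0 = x"
  unfolding flow_line_def using T_pos by (auto dest!: bspec[where x=0])

definition stab_const :: real where
  "stab_const = 4 * exp (2 * Kv * T) * exp (4 * exp (2 * Kv * T) * Lp * T)"

text \<open>Two nested Gronwall arguments. For a fixed pair of starting points the distance of the two flow lines
satisfies a Gronwall inequality with constant Kv, in which the error e and the discrepancy of the two
laws act as sources. The latter is at most Lp times the mean distance D of the flow lines under the coupling, so
integrating over the coupling gives a Gronwall inequality for D.

In the assumption on e both kernel sums are evaluated along the second flow: when u' is a fixed weak-* limit
and u runs through a sequence, only the controls and the positions of the agents vary there, and no flow
that is yet to be estimated.\<close>

lemma stability:
  assumes c2: "controlled H G B Lp T M u' Y' Y0'"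
    and P: "prob_space P" "sets P = sets borel" "AE x in P. x \<in> S"
    and P': "prob_space P'" "sets P' = sets borel" "AE x in P'. x \<in> S"
    and Z: "lagrangian S P Z" and Z': "controlled.lagrangian H G T u' Y' S P' Z'"
    and \<pi>: "\<pi> \<in> couplings P P'" "integrable \<pi> (\<lambda>p. dist (fst p) (snd p))"
    and e: "0 \<le> e" "\<And>t x. t \<in> {0..T} \<Longrightarrow> x \<in> S \<Longrightarrow>
       norm (integral {0..t} (\<lambda>s. control_field (u s) (Y s) (Z' s x)
          - control_field (u' s) (Y' s) (Z' s x))) \<le> e"
    and t: "t \<in> {0..T}"
  shows "integrable \<pi> (\<lambda>p. norm (Z t (fst p) - Z' t (snd p)))"
    and "(\<integral>p. norm (Z t (fst p) - Z' t (snd p)) \<partial>\<pi>) \<le> stab_const * ((\<integral>p. dist (fst p) (snd p) \<partial>\<pi>) + e)"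
proof -
  interpret c2: controlled H G B Lp T M u' Y' Y0' by fact
  note CD = couplings_D[OF \<pi>(1)]
  interpret \<pi>: prob_space \<pi> by (rule couplings_prob[OF \<pi>(1) P(1)])
  define \<nu> where "\<nu> t = distr P borel (Z t)" for t
  define \<nu>' where "\<nu>' t = distr P' borel (Z' t)" for t
  have \<nu>: "good_curve \<nu>" and Zm: "\<And>t. t \<in> {0..T} \<Longrightarrow> Z t \<in> borel_measurable borel"
    and Zf: "\<And>x. x \<in> S \<Longrightarrow> flow_line \<nu> x (\<lambda>t. Z t x)"
    using Z unfolding lagrangian_def \<nu>_def by auto
  have \<nu>': "c2.good_curve \<nu>'" and Zm': "\<And>t. t \<in> {0..T} \<Longrightarrow> Z' t \<in> borel_measurable borel"
    and Zf': "\<And>x. x \<in> S \<Longrightarrow> c2.flow_line \<nu>' x (\<lambda>t. Z' t x)"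
    using Z' unfolding c2.lagrangian_def \<nu>'_def by auto
  define d where "d p t = norm (Z t (fst p) - Z' t (snd p))" for p t
  define D where "D t = (\<integral>p. d p t \<partial>\<pi>)" for t
  have "AE x in distr \<pi> borel fst. x \<in> S" unfolding CD(5) by (rule P(3))
  then have "AE p in \<pi>. fst p \<in> S" by (rule AE_distrD[OF CD(3)])
  moreover have "AE x in distr \<pi> borel snd. x \<in> S" unfolding CD(6) by (rule P'(3))
  then have "AE p in \<pi>. snd p \<in> S" by (rule AE_distrD[OF CD(4)])
  ultimately have AES: "AE p in \<pi>. fst p \<in> S \<and> snd p \<in> S" by eventually_elim simp
  have T0: "0 \<in> {0..T}" using T_pos by simp
  have dm: "(\<lambda>p. d p t) \<in> borel_measurable \<pi>" if "t \<in> {0..T}" for t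
    unfolding d_def using measurable_compose[OF CD(3) Zm[OF that]] measurable_compose[OF CD(4) Zm'[OF that]] by measurable
  have dlip: "\<bar>d p t - d p s\<bar> \<le> 2 * Cv * \<bar>t - s\<bar>"
    if "fst p \<in> S" "snd p \<in> S" "t \<in> {0..T}" "s \<in> {0..T}" for p s t
  proof -
    have 1: "norm (Z t (fst p) - Z s (fst p)) \<le> Cv * \<bar>t - s\<bar>" by (rule flow_line_lip[OF \<nu> Zf]) (use that in auto)
    have 2: "norm (Z' t (snd p) - Z' s (snd p)) \<le> Cv * \<bar>t - s\<bar>" by (rule c2.flow_line_lip[OF \<nu>' Zf']) (use that in auto)
    have "\<bar>d p t - d p s\<bar> \<le> norm ((Z t (fst p) - Z' t (snd p)) - (Z s (fst p) - Z' s (snd p)))"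
      unfolding d_def by (rule norm_triangle_ineq3)
    also have "\<dots> = norm ((Z t (fst p) - Z s (fst p)) - (Z' t (snd p) - Z' s (snd p)))" by (simp add: algebra_simps)
    also have "\<dots> \<le> norm (Z t (fst p) - Z s (fst p)) + norm (Z' t (snd p) - Z' s (snd p))" by (rule norm_triangle_ineq4)
    finally show ?thesis using 1 2 by linarith
  qed
  have d0: "d p 0 = dist (fst p) (snd p)" if "fst p \<in> S" "snd p \<in> S" for p
    using flow_line_0[OF Zf] c2.flow_line_0[OF Zf'] that unfolding d_def by (simp add: dist_norm)
  have di: "integrable \<pi> (\<lambda>p. d p t)" if t: "t \<in> {0..T}" for t
  proof (rule Bochner_Integration.integrable_bound[where f="\<lambda>p. dist (fst p) (snd p) + 2 * Cv * T"])
    show "AE p in \<pi>. norm (d p t) \<le> norm (dist (fst p) (snd p) + 2 * Cv * T)"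
      using AES
    proof eventually_elim
      case (elim p)
      have "d p t \<le> dist (fst p) (snd p) + 2 * Cv * \<bar>t - 0\<bar>"
        using dlip[of p t 0] elim t T0 d0[of p] by linarith
      also have "\<dots> \<le> dist (fst p) (snd p) + 2 * Cv * T"
        using t Cv_nonneg by (intro add_left_mono mult_left_mono) auto
      finally show ?case unfolding d_def by simp
    qed
  qed (use \<pi>(2) dm[OF t] in auto)
  show "integrable \<pi> (\<lambda>p. norm (Z t (fst p) - Z' t (snd p)))" using di[OF t] unfolding d_def .
  have Dlip: "norm (D t - D s) \<le> 2 * Cv * \<bar>t - s\<bar>" if t: "t \<in> {0..T}" and s: "s \<in> {0..T}" for t s
    unfolding D_def Bochner_Integration.integral_diff[OF di[OF t] di[OF s], symmetric]
  proof (rule prob_norm_integral_le[OF \<pi>.prob_space_axioms])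
    show "AE p in \<pi>. norm (d p t - d p s) \<le> 2 * Cv * \<bar>t - s\<bar>"
      using AES by eventually_elim (use dlip t s in auto)
  qed (use di t s in auto)
  have Dc: "continuous_on {0..T} D" by (rule lip_continuous_on[where L="2 * Cv"]) (use Dlip in auto)
  have Di: "D integrable_on {0..r}" if "r \<in> {0..T}" for r
    using that by (intro integrable_continuous_real continuous_on_subset[OF Dc]) auto
  have D_nonneg: "0 \<le> D t" for t unfolding D_def d_def by (intro integral_nonneg_AE) auto
  have ID: "0 \<le> integral {0..r} D" if "r \<in> {0..T}" for r
    by (rule Henstock_Kurzweil_Integration.integral_nonneg[OF Di[OF that]]) (rule D_nonneg)
  define c where "c = 2 * exp (2 * Kv * T)"
  have c: "0 \<le> c" unfolding c_def by simp
  (* The inner Gronwall inequality, for a fixed pair p of starting points. *)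
  have point: "d p t0 \<le> c * (dist (fst p) (snd p) + e + Lp * integral {0..t0} D)"
    if p: "fst p \<in> S" "snd p \<in> S" and t0: "t0 \<in> {0..T}" for p t0
  proof -
    define a where "a = dist (fst p) (snd p) + e + Lp * integral {0..t0} D"
    have a: "0 \<le> a" unfolding a_def using e ID[OF t0] Lp_nonneg by simp
    have cz: "continuous_on {0..T} (\<lambda>t. Z t (fst p))" "continuous_on {0..T} (\<lambda>t. Z' t (snd p))"
      using Zf[OF p(1)] Zf'[OF p(2)] unfolding flow_line_def c2.flow_line_def by auto
    have cd: "continuous_on {0..T} (d p)" unfolding d_def by (intro continuous_intros cz)
    have sub: "{0..r} \<subseteq> {0..T}" if "r \<in> {0..t0}" for r using that t0 by auto
    have d_i: "d p integrable_on {0..r}" if "r \<in> {0..t0}" for r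
      by (intro integrable_continuous_real continuous_on_subset[OF cd sub[OF that]])
    (* f1 and f3 are the two velocities, k is the exchange of controls and positions along Z'. *)
    define f1 where "f1 s = vel \<nu> s (Z s (fst p))" for s
    define f3 where "f3 s = velocity H G (u' s) (Y' s) (\<nu>' s) (Z' s (snd p))" for s
    define k where "k s = control_field (u s) (Y s) (Z' s (snd p)) - control_field (u' s) (Y' s) (Z' s (snd p))" for s
    have i1: "f1 integrable_on {0..T}" unfolding f1_def
      using velocity_time[OF \<nu> cz(1)] by (simp add: absolutely_integrable_on_def)
    have i3: "f3 integrable_on {0..T}" unfolding f3_def
      using c2.velocity_time[OF \<nu>' cz(2)] by (simp add: absolutely_integrable_on_def)
    have ik: "k integrable_on {0..T}" unfolding k_def
      using kernel_time[OF cz(2)] c2.kernel_time[OF cz(2)] by (intro integrable_diff) (simp_all add: absolutely_integrable_on_def)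
    have "d p t0 \<le> 2 * a * exp (2 * Kv * t0)"
    proof (rule gronwall_bounded[OF Kv_nonneg a _ d_i])
      show "d p r \<le> dist (fst p) (snd p) + 2 * Cv * T" if "r \<in> {0..t0}" for r
      proof -
        have "d p r \<le> dist (fst p) (snd p) + 2 * Cv * \<bar>r - 0\<bar>"
          using dlip[of p r 0] p T0 d0[of p] that t0 by fastforce
        also have "\<dots> \<le> dist (fst p) (snd p) + 2 * Cv * T"
          using t0 that Cv_nonneg by (intro add_left_mono mult_left_mono) auto
        finally show ?thesis .
      qed
      fix r assume r: "r \<in> {0..t0}"
      then have rT: "r \<in> {0..T}" using t0 by auto
      have ir: "f1 integrable_on {0..r}" "f3 integrable_on {0..r}" "k integrable_on {0..r}"
        using i1 i3 ik sub[OF r] by (auto elim: integrable_on_subinterval)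
      have f13: "f1 s - f3 s - k s = (f1 s - vel \<nu> s (Z' s (snd p))) +
          (conv H (\<nu> s) (Z' s (snd p)) - conv H (\<nu>' s) (Z' s (snd p)))" for s
        unfolding f3_def k_def velocity_eq by simp
      have nb: "norm (f1 s - f3 s - k s) \<le> Kv * d p s + Lp * D s" if s: "s \<in> {0..r}" for s
      proof -
        have sT: "s \<in> {0..T}" using s sub[OF r] by auto
        have "norm (f1 s - vel \<nu> s (Z' s (snd p))) \<le> Kv * norm (Z s (fst p) - Z' s (snd p))"
          unfolding f1_def using \<nu> sT unfolding good_curve_def by (intro velocity_lip u_bound) auto
        moreover have "norm (conv H (\<nu> s) (Z' s (snd p)) - conv H (\<nu>' s) (Z' s (snd p))) \<le> Lp * D s"
          unfolding \<nu>_def \<nu>'_def D_def d_def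
          by (rule conv_coupling[OF \<pi>(1) P(1,2) P'(2) Zm[OF sT] Zm'[OF sT]]) (use di[OF sT] in \<open>simp add: d_def\<close>)
        ultimately show ?thesis unfolding f13 d_def by (rule norm_triangle_mono)
      qed
      have ieq: "integral {0..r} f1 - integral {0..r} f3 = integral {0..r} (\<lambda>s. f1 s - f3 s - k s) + integral {0..r} k"
        using ir by (simp add: hk_integral_diff integrable_diff)
      have "Z r (fst p) - Z' r (snd p) = (fst p - snd p) + (integral {0..r} f1 - integral {0..r} f3)"
        using Zf[OF p(1)] Zf'[OF p(2)] rT unfolding flow_line_def c2.flow_line_def f1_def f3_def by simp
      then have "Z r (fst p) - Z' r (snd p) = (fst p - snd p) + (integral {0..r} k + integral {0..r} (\<lambda>s. f1 s - f3 s - k s))"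
        unfolding ieq by (simp add: add.commute)
      moreover have "norm (integral {0..r} k) \<le> e" unfolding k_def by (rule e(2)[OF rT p(2)])
      moreover have "norm (integral {0..r} (\<lambda>s. f1 s - f3 s - k s)) \<le> integral {0..r} (\<lambda>s. Kv * d p s + Lp * D s)"
        by (rule integral_norm_bound_integral)
           (use ir nb d_i[OF r] Di[OF rT] in \<open>auto intro!: integrable_diff integrable_add integrable_on_mult_right\<close>)
      moreover have "integral {0..r} (\<lambda>s. Kv * d p s + Lp * D s) = Kv * integral {0..r} (d p) + Lp * integral {0..r} D"
        using d_i[OF r] Di[OF rT] by (subst hk_integral_add) (auto intro: integrable_on_mult_right)
      ultimately have "d p r \<le> dist (fst p) (snd p) + (e + (Kv * integral {0..r} (d p) + Lp * integral {0..r} D))"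
        unfolding d_def[of p r] dist_norm by (simp add: norm_triangle_mono)
      moreover have "integral {0..r} D \<le> integral {0..t0} D"
        using r by (intro integral_subset_le Di[OF rT] Di[OF t0]) (auto simp: D_nonneg)
      ultimately show "d p r \<le> a + Kv * integral {0..r} (d p)"
        unfolding a_def using mult_left_mono[OF _ Lp_nonneg] by fastforce
    qed (use t0 in auto)
    also have "\<dots> \<le> 2 * a * exp (2 * Kv * T)" using t0 a Kv_nonneg by (intro mult_left_mono) (auto intro: mult_left_mono)
    finally show ?thesis unfolding a_def c_def by (simp add: algebra_simps)
  qed
  define D0 where "D0 = (\<integral>p. dist (fst p) (snd p) \<partial>\<pi>)"
  have D0: "0 \<le> D0" unfolding D0_def by (intro integral_nonneg_AE) auto
  (* The outer Gronwall inequality, integrated over the coupling. *)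
  have Dg: "D t0 \<le> c * (D0 + e) + c * Lp * integral {0..t0} D" if t0: "t0 \<in> {0..T}" for t0
  proof -
    have "D t0 \<le> (\<integral>p. c * (dist (fst p) (snd p) + e + Lp * integral {0..t0} D) \<partial>\<pi>)"
      unfolding D_def[of t0]
    proof (rule integral_mono_AE[OF di[OF t0]])
      show "AE p in \<pi>. d p t0 \<le> c * (dist (fst p) (snd p) + e + Lp * integral {0..t0} D)"
        using AES by eventually_elim (use point t0 in auto)
    qed (use \<pi>(2) in auto)
    also have "\<dots> = c * (D0 + e + Lp * integral {0..t0} D)"
      unfolding D0_def using \<pi>(2) by (simp add: \<pi>.prob_space)
    finally show ?thesis by (simp add: algebra_simps)
  qed
  obtain b where b: "\<And>s. s \<in> {0..T} \<Longrightarrow> D s \<le> b"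
    using bounded_imp_bdd_above[OF compact_imp_bounded[OF compact_continuous_image[OF Dc compact_Icc]]]
    unfolding bdd_above_def by (metis imageI)
  have TT: "T \<in> {0..T}" using T_pos by simp
  have "D t \<le> 2 * (c * (D0 + e)) * exp (2 * (c * Lp) * t)"
    by (rule gronwall_bounded[OF _ _ b Di[OF TT] Dg t]) (use c D0 e Lp_nonneg in auto)
  also have "\<dots> \<le> 2 * (c * (D0 + e)) * exp (2 * (c * Lp) * T)"
    using t c D0 e Lp_nonneg by (intro mult_left_mono) (auto intro!: mult_left_mono)
  also have "\<dots> = stab_const * (D0 + e)" unfolding stab_const_def c_def by (simp add: algebra_simps)
  finally show "(\<integral>p. norm (Z t (fst p) - Z' t (snd p)) \<partial>\<pi>) \<le> stab_const * ((\<integral>p. dist (fst p) (snd p) \<partial>\<pi>) + e)"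
    unfolding D_def d_def D0_def .
qed

end

lemma equilipschitz_uniform:
  fixes f :: "nat \<Rightarrow> 'a::metric_space \<Rightarrow> 'b::real_normed_vector"
  assumes S: "compact S" and L: "\<And>n x y. x \<in> S \<Longrightarrow> y \<in> S \<Longrightarrow> norm (f n x - f n y) \<le> L * dist x y"
    and pw: "\<And>x. x \<in> S \<Longrightarrow> (\<lambda>n. f n x) \<longlonglongrightarrow> 0" and e: "e > 0"
  shows "\<exists>N. \<forall>n\<ge>N. \<forall>x\<in>S. norm (f n x) < e"
proof -
  define r where "r = e / (2 * (\<bar>L\<bar> + 1))"
  have r: "r > 0" "\<bar>L\<bar> * r \<le> e / 2" using e unfolding r_def by (auto simp: field_simps)
  obtain C where C: "C \<subseteq> S" "finite C" "S \<subseteq> (\<Union>c\<in>C. ball c r)"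
    using compactE_image[OF S, of S "\<lambda>x. ball x r"] r by (metis UN_I centre_in_ball open_ball subsetI)
  have "\<forall>c\<in>C. \<exists>N. \<forall>n\<ge>N. norm (f n c) < e / 2"
    using pw C(1) e by (metis LIMSEQ_D diff_zero half_gt_zero subsetD)
  then obtain N where N: "\<And>c n. c \<in> C \<Longrightarrow> n \<ge> N c \<Longrightarrow> norm (f n c) < e / 2" by metis
  define N0 where "N0 = Max (insert 0 (N ` C))"
  have "norm (f n x) < e" if n: "n \<ge> N0" and x: "x \<in> S" for n x
  proof -
    obtain c where c: "c \<in> C" "dist c x < r" using C(3) x by auto
    have "N c \<le> N0" unfolding N0_def using c C(2) by (intro Max_ge) auto
    then have 1: "norm (f n c) < e / 2" using N c n by auto
    have "norm (f n x - f n c) \<le> L * dist x c" using L x c C by auto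
    also have "\<dots> \<le> \<bar>L\<bar> * r" using c by (intro mult_mono) (auto simp: dist_commute)
    also have "\<dots> \<le> e / 2" by (rule r)
    finally have 2: "norm (f n x - f n c) \<le> e / 2" .
    show ?thesis using norm_triangle_sub[of "f n x" "f n c"] 1 2 by linarith
  qed
  then show ?thesis by blast
qed

lemma weak_star_integral:
  fixes \<psi> :: "real \<Rightarrow> 'a::euclidean_space"
  assumes w: "weak_star_converges T us u" and \<psi>: "continuous_on {0..T} \<psi>" and t: "t \<in> {0..T}"
  shows "(\<lambda>n. integral {0..t} (\<lambda>s. us n s \<bullet> \<psi> s)) \<longlonglongrightarrow> integral {0..t} (\<lambda>s. u s \<bullet> \<psi> s)"
proof -
  define \<psi>' where "\<psi>' s = (if s \<in> {0..t} then \<psi> s else 0)" for s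
  have eq: "integral {0..T} (\<lambda>s. v s \<bullet> \<psi>' s) = integral {0..t} (\<lambda>s. v s \<bullet> \<psi> s)" for v
  proof -
    have "(\<lambda>s. v s \<bullet> \<psi>' s) = (\<lambda>s. if s \<in> {0..t} then v s \<bullet> \<psi> s else 0)" unfolding \<psi>'_def by auto
    moreover have "integral {0..T} (\<lambda>s. if s \<in> {0..t} then v s \<bullet> \<psi> s else 0) = integral ({0..T} \<inter> {0..t}) (\<lambda>s. v s \<bullet> \<psi> s)"
      by (simp only: integral_restrict_Int Int_commute)
    moreover have "{0..T} \<inter> {0..t} = {0..t}" using t by auto
    ultimately show ?thesis by (simp only:)
  qed
  have "\<psi> absolutely_integrable_on {0..t}"
    by (rule absolutely_integrable_continuous_real[OF continuous_on_subset[OF \<psi>]]) (use t in auto)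
  then have "\<psi>' absolutely_integrable_on UNIV"
    unfolding \<psi>'_def using absolutely_integrable_restrict_UNIV by blast
  then have "\<psi>' absolutely_integrable_on {0..T}" by (rule set_integrable_subset) auto
  then show ?thesis using w unfolding weak_star_converges_def eq[symmetric] by blast
qed

context controlled begin

lemma kernel_bound_M: 
  assumes "norm w \<le> M"
  shows "norm (kernel_sum (w::(real^'d)^'m) (\<lambda>l k. G l (c l k))) \<le> real CARD('d) * M * B"
proof -
  have "norm (kernel_sum w (\<lambda>l k. G l (c l k))) \<le> real CARD('d) * norm w * B" by (rule kernel_sum_bound) (rule G_bound)
  also have "\<dots> \<le> real CARD('d) * M * B" using assms B_nonneg by (intro mult_right_mono mult_left_mono) auto
  finally show ?thesis .
qed

lemma kernel_sum_x:
  assumes "norm w \<le> M"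
  shows "norm (control_field (w::(real^'d)^'m) y x - control_field w y x')
    \<le> real CARD('d) * M * (Lp * norm (x - x'))"
proof -
  have "norm (control_field w y x - control_field w y x')
    \<le> real CARD('d) * norm w * (Lp * norm (x - x'))"
    unfolding kernel_sum_diff
  proof (rule kernel_sum_bound)
    show "norm (G l (x - y $ k) - G l (x' - y $ k)) \<le> Lp * norm (x - x')" for l k
      using G_lip[of l "x - y $ k" "x' - y $ k"] by simp
  qed
  also have "\<dots> \<le> real CARD('d) * M * (Lp * norm (x - x'))"
    using assms Lp_nonneg by (intro mult_right_mono mult_left_mono) auto
  finally show ?thesis .
qed

lemma weak_star_Y_uniform:
  assumes c: "\<And>n. controlled H G B Lp T M (us n) (Ys n) Y0" and w: "weak_star_converges T us u" and e: "e > 0"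
  shows "\<exists>N. \<forall>n\<ge>N. \<forall>t\<in>{0..T}. norm (Ys n t - Y t) < e"
proof (rule equilipschitz_uniform[where L="2 * M"])
  fix n s t assume st: "s \<in> {0..T}" "t \<in> {0..T}"
  have "norm (Ys n s - Ys n t) \<le> M * \<bar>s - t\<bar>" "norm (Y s - Y t) \<le> M * \<bar>s - t\<bar>"
    using controlled.Y_lip[OF c] Y_lip st by auto
  then have "norm ((Ys n s - Ys n t) - (Y s - Y t)) \<le> M * \<bar>s - t\<bar> + M * \<bar>s - t\<bar>"
    by (rule order_trans[OF norm_triangle_ineq4 add_mono])
  then show "norm (Ys n s - Y s - (Ys n t - Y t)) \<le> 2 * M * dist s t"
    by (simp add: algebra_simps dist_real_def)
next
  fix t assume t: "t \<in> {0..T}"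
  have "(\<lambda>n. integral {0..t} (us n)) \<longlonglongrightarrow> integral {0..t} u"
    unfolding tendsto_componentwise_iff[of _ "integral {0..t} u"]
  proof
    fix b :: "(real^'d)^'m" assume b: "b \<in> Basis"
    have ib: "integral {0..t} v \<bullet> b = integral {0..t} (\<lambda>s. v s \<bullet> b)" if "v integrable_on {0..T}" for v :: "real \<Rightarrow> (real^'d)^'m"
    proof -
      have "v integrable_on {0..t}" by (rule integrable_on_subinterval[OF that]) (use t in auto)
      from integral_linear[OF this bounded_linear_inner_left[of b]] show ?thesis by (simp add: comp_def)
    qed
    have "(\<lambda>n. integral {0..t} (\<lambda>s. us n s \<bullet> b)) \<longlonglongrightarrow> integral {0..t} (\<lambda>s. u s \<bullet> b)"
      by (rule weak_star_integral[OF w _ t]) simp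
    then show "(\<lambda>n. integral {0..t} (us n) \<bullet> b) \<longlonglongrightarrow> integral {0..t} u \<bullet> b"
      using ib[OF controlled.u_int[OF c]] ib[OF u_int] by simp
  qed
  then have "(\<lambda>n. integral {0..t} (us n) - integral {0..t} u) \<longlonglongrightarrow> 0" by (simp add: LIM_zero)
  then show "(\<lambda>n. Ys n t - Y t) \<longlonglongrightarrow> 0" using controlled.Y_eq[OF c t] Y_eq[OF t] by simp
qed (use e in auto)

text \<open>The error is equi-Lipschitz in \<open>(t, x)\<close>, so that pointwise convergence on a compact set is enough. At a fixed point it
splits into k1, where the positions of the agents are exchanged, and k2, where the controls are: the first tends to zero since
the positions converge uniformly, the second since it is the integral of \<open>us n - u\<close> against a fixed
continuous function.\<close>

lemma kernel_error_uniform: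
  assumes c: "\<And>n. controlled H G B Lp T M (us n) (Ys n) Y0" and w: "weak_star_converges T us u"
    and S: "compact S" and Zc: "\<And>x. x \<in> S \<Longrightarrow> continuous_on {0..T} (\<lambda>t. Z t x)"
    and ZL: "\<And>t x y. t \<in> {0..T} \<Longrightarrow> x \<in> S \<Longrightarrow> y \<in> S \<Longrightarrow> norm (Z t x - Z t y) \<le> LZ * norm (x - y)"
    and e: "e > 0"
  shows "\<exists>N. \<forall>n\<ge>N. \<forall>t\<in>{0..T}. \<forall>x\<in>S. norm (integral {0..t} (\<lambda>s. control_field (us n s) (Ys n s) (Z s x)
          - control_field (u s) (Y s) (Z s x))) < e"
proof -
  define k where "k n x s = control_field (us n s) (Ys n s) (Z s x) - control_field (u s) (Y s) (Z s x)" for n x s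
  define d where "d = real CARD('d)"
  define E where "E n p = integral {0..fst p} (k n (snd p))" for n p
  have ik: "k n x integrable_on {0..T}" if "x \<in> S" for n x
    unfolding k_def using controlled.kernel_time[OF c Zc[OF that]] kernel_time[OF Zc[OF that]]
    by (intro integrable_diff) (simp_all add: absolutely_integrable_on_def)
  have ik': "k n x integrable_on {0..t}" if "x \<in> S" "t \<in> {0..T}" for n x t
    by (rule integrable_on_subinterval[OF ik[OF that(1)]]) (use that in auto)
  have kb: "norm (k n x s) \<le> 2 * (d * M * B)" for n x s
  proof -
    have "norm (k n x s) \<le> d * M * B + d * M * B" unfolding k_def d_def
      by (rule order_trans[OF norm_triangle_ineq4 add_mono]) (rule kernel_bound_M controlled.u_bound[OF c] u_bound)+
    then show ?thesis by (simp add: algebra_simps)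
  qed
  have kx: "norm (k n x s - k n y s) \<le> 2 * (d * M * (Lp * (LZ * norm (x - y))))" if "x \<in> S" "y \<in> S" "s \<in> {0..T}" for n x y s
  proof -
    have zz: "d * M * (Lp * norm (Z s x - Z s y)) \<le> d * M * (Lp * (LZ * norm (x - y)))"
      unfolding d_def using that ZL Lp_nonneg M_nonneg by (intro mult_left_mono) auto
    have "norm ((control_field (us n s) (Ys n s) (Z s x) - control_field (us n s) (Ys n s) (Z s y))
      - (control_field (u s) (Y s) (Z s x) - control_field (u s) (Y s) (Z s y)))
      \<le> d * M * (Lp * norm (Z s x - Z s y)) + d * M * (Lp * norm (Z s x - Z s y))"
      unfolding d_def
      by (rule order_trans[OF norm_triangle_ineq4 add_mono]) (rule kernel_sum_x controlled.u_bound[OF c] u_bound)+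
    also have "\<dots> \<le> 2 * (d * M * (Lp * (LZ * norm (x - y))))" using zz by linarith
    finally show ?thesis unfolding k_def by (simp add: algebra_simps)
  qed
  have "\<exists>N. \<forall>n\<ge>N. \<forall>p\<in>{0..T} \<times> S. norm (E n p) < e"
  proof (rule equilipschitz_uniform[where L="2 * (d * M * B) + 2 * (d * M * (Lp * \<bar>LZ\<bar>)) * T"])
    show "compact ({0..T} \<times> S)" using S by (intro compact_Times) auto
    fix n p q assume pq: "p \<in> {0..T} \<times> S" "q \<in> {0..T} \<times> S"
    obtain t x where p: "p = (t, x)" by (cases p)
    obtain s y where q: "q = (s, y)" by (cases q)
    have tx: "t \<in> {0..T}" "x \<in> S" "s \<in> {0..T}" "y \<in> S" using pq p q by auto
    have "norm (E n (t, x) - E n (s, x)) \<le> 2 * (d * M * B) * \<bar>t - s\<bar>"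
      unfolding E_def fst_conv snd_conv by (rule integral_lipschitz[OF ik[OF tx(2)] kb tx(3,1)])
    also have "\<dots> \<le> 2 * (d * M * B) * dist p q"
      using dist_fst_le[of p q] M_nonneg B_nonneg unfolding p q d_def
      by (intro mult_left_mono) (auto simp: dist_real_def)
    finally have 1: "norm (E n (t, x) - E n (s, x)) \<le> 2 * (d * M * B) * dist p q" .
    have "norm (E n (s, x) - E n (s, y)) = norm (integral {0..s} (\<lambda>r. k n x r - k n y r))"
      unfolding E_def fst_conv snd_conv using ik' tx by (subst hk_integral_diff) auto
    also have "\<dots> \<le> 2 * (d * M * (Lp * (LZ * norm (x - y)))) * (s - 0)"
      by (rule integral_norm_le[where T=T]) (use ik tx kx in \<open>auto intro: integrable_diff\<close>)
    also have "\<dots> \<le> 2 * (d * M * (Lp * (\<bar>LZ\<bar> * norm (x - y)))) * T"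
      using tx Lp_nonneg M_nonneg unfolding d_def
      by (intro mult_mono mult_left_mono mult_right_mono mult_nonneg_nonneg) auto
    also have "\<dots> = 2 * (d * M * (Lp * \<bar>LZ\<bar>)) * T * norm (x - y)" by (simp add: algebra_simps)
    also have "\<dots> \<le> 2 * (d * M * (Lp * \<bar>LZ\<bar>)) * T * dist p q"
      using dist_snd_le[of p q] M_nonneg Lp_nonneg T_pos unfolding p q d_def
      by (intro mult_left_mono) (auto simp: dist_norm)
    finally have 2: "norm (E n (s, x) - E n (s, y)) \<le> 2 * (d * M * (Lp * \<bar>LZ\<bar>)) * T * dist p q" .
    show "norm (E n p - E n q) \<le> (2 * (d * M * B) + 2 * (d * M * (Lp * \<bar>LZ\<bar>)) * T) * dist p q"
      using norm_triangle_mono[OF 1 2] unfolding p q by (simp add: algebra_simps)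
  next
    fix p assume "p \<in> {0..T} \<times> S"
    then obtain t x where p: "p = (t, x)" and t: "t \<in> {0..T}" and x: "x \<in> S" by auto
    define k1 where "k1 n s = control_field (us n s) (Ys n s) (Z s x) - control_field (us n s) (Y s) (Z s x)" for n s
    define k2 where "k2 n s = control_field (us n s) (Y s) (Z s x) - control_field (u s) (Y s) (Z s x)" for n s
    have ct: "(\<lambda>s. control_field (us n s) (Y s) (Z s x)) integrable_on {0..T}" for n
      using control_field_integrable[OF controlled.u_meas[OF c] controlled.u_bound[OF c] Y_cont Zc[OF x]]
      by (simp add: absolutely_integrable_on_def)
    have i1: "k1 n integrable_on {0..T}" for n unfolding k1_def
      using controlled.kernel_time[OF c Zc[OF x]] by (intro integrable_diff ct) (simp add: absolutely_integrable_on_def)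
    have i2: "k2 n integrable_on {0..T}" for n unfolding k2_def
      using kernel_time[OF Zc[OF x]] by (intro integrable_diff ct) (simp add: absolutely_integrable_on_def)
    have sub: "f integrable_on {0..T} \<Longrightarrow> f integrable_on {0..t}" for f :: "real \<Rightarrow> real^'d"
      by (rule integrable_on_subinterval) (use t in auto)
    have Eeq: "E n p = integral {0..t} (k1 n) + integral {0..t} (k2 n)" for n
    proof -
      have "k n x = (\<lambda>s. k1 n s + k2 n s)" unfolding k_def k1_def k2_def by auto
      then show ?thesis unfolding E_def p fst_conv snd_conv
        by (simp add: hk_integral_add[OF sub[OF i1] sub[OF i2]])
    qed
    have t1: "(\<lambda>n. integral {0..t} (k1 n)) \<longlonglongrightarrow> 0"
    proof (rule LIMSEQ_I)
      fix r :: real assume r: "r > 0"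
      define r' where "r' = r / (d * M * Lp * T + 1)"
      have pos: "d * M * Lp * T \<ge> 0" unfolding d_def using M_nonneg Lp_nonneg T_pos by simp
      have r': "r' > 0" using r pos unfolding r'_def by simp
      obtain N where N: "\<And>n s. n \<ge> N \<Longrightarrow> s \<in> {0..T} \<Longrightarrow> norm (Ys n s - Y s) < r'"
        using weak_star_Y_uniform[OF c w r'] by blast
      have "norm (integral {0..t} (k1 n)) < r" if n: "n \<ge> N" for n
      proof -
        have "norm (integral {0..t} (k1 n)) \<le> (d * M * (Lp * r')) * (t - 0)"
        proof (rule integral_norm_le[OF i1])
          fix s assume s: "s \<in> {0..T}"
          have "norm (k1 n s) \<le> d * M * (Lp * norm (Ys n s - Y s))"
            unfolding k1_def d_def by (rule kernel_sum_Y) (rule controlled.u_bound[OF c])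
          also have "\<dots> \<le> d * M * (Lp * r')"
            unfolding d_def using N[OF n s] M_nonneg Lp_nonneg by (intro mult_left_mono) auto
          finally show "norm (k1 n s) \<le> d * M * (Lp * r')" .
        qed (use t in auto)
        also have "\<dots> \<le> (d * M * (Lp * r')) * T"
          unfolding d_def using t M_nonneg Lp_nonneg r' by (intro mult_left_mono) auto
        also have "\<dots> = (d * M * Lp * T) * r'" by (simp add: algebra_simps)
        also have "\<dots> < (d * M * Lp * T + 1) * r'" using r' by simp
        also have "\<dots> = r" unfolding r'_def using pos by simp
        finally show ?thesis .
      qed
      then show "\<exists>no. \<forall>n\<ge>no. norm (integral {0..t} (k1 n) - 0) < r" by auto
    qed
    have t2: "(\<lambda>n. integral {0..t} (k2 n)) \<longlonglongrightarrow> 0"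
      unfolding tendsto_componentwise_iff[of _ 0]
    proof
      fix b :: "real^'d" assume "b \<in> Basis"
      define \<psi> :: "real \<Rightarrow> (real^'d)^'m" where "\<psi> s = (\<chi> k. \<chi> l. (1 / real CARD('m)) * (G l (Z s x - Y s $ k) \<bullet> b))" for s
      have cG: "continuous_on {0..T} (\<lambda>s. G l (Z s x - Y s $ k))" for l k
        using Zc[OF x] Y_cont by (intro continuous_on_compose2[OF continuous_G]) (auto intro!: continuous_intros)
      have c\<psi>: "continuous_on {0..T} \<psi>" unfolding \<psi>_def by (intro continuous_intros cG)
      have inn: "control_field v (Y s) (Z s x) \<bullet> b = v \<bullet> \<psi> s" for v s
        unfolding \<psi>_def by (rule kernel_sum_inner)
      have ii: "integral {0..t} (\<lambda>s. control_field (v s) (Y s) (Z s x)) \<bullet> b = integral {0..t} (\<lambda>s. v s \<bullet> \<psi> s)"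
        if "(\<lambda>s. control_field (v s) (Y s) (Z s x)) integrable_on {0..T}" for v
        using integral_linear[OF sub[OF that] bounded_linear_inner_left[of b]] by (simp add: comp_def inn)
      have iu: "(\<lambda>s. control_field (u s) (Y s) (Z s x)) integrable_on {0..T}"
        using kernel_time[OF Zc[OF x]] by (simp add: absolutely_integrable_on_def)
      have "integral {0..t} (k2 n) \<bullet> b = integral {0..t} (\<lambda>s. us n s \<bullet> \<psi> s) - integral {0..t} (\<lambda>s. u s \<bullet> \<psi> s)" for n
        unfolding k2_def hk_integral_diff[OF sub[OF ct] sub[OF iu]] inner_diff_left
        by (simp only: ii[OF ct] ii[OF iu])
      moreover have "(\<lambda>n. integral {0..t} (\<lambda>s. us n s \<bullet> \<psi> s) - integral {0..t} (\<lambda>s. u s \<bullet> \<psi> s)) \<longlonglongrightarrow> 0"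
        by (rule LIM_zero) (rule weak_star_integral[OF w c\<psi> t])
      ultimately show "(\<lambda>n. integral {0..t} (k2 n) \<bullet> b) \<longlonglongrightarrow> 0 \<bullet> b" by simp
    qed
    show "(\<lambda>n. E n p) \<longlonglongrightarrow> 0" unfolding Eeq using tendsto_add[OF t1 t2] by simp
  qed (rule e)
  then show ?thesis unfolding E_def k_def by auto
qed

end

section \<open>Lagrangian solutions solve the continuity equation\<close>

lemma GDERIV_unique:
  assumes "GDERIV f x :> a" "GDERIV f x :> b"
  shows "a = b"
proof -
  have "(\<lambda>h. h \<bullet> a) = (\<lambda>h. h \<bullet> b)"
    using assms unfolding gderiv_def by (rule has_derivative_unique)
  from fun_cong[OF this, of "a - b"] have "(a - b) \<bullet> (a - b) = 0" by (simp add: inner_diff_right)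
  then show ?thesis by simp
qed

lemma GDERIV_continuous: "(\<And>x. GDERIV f x :> g x) \<Longrightarrow> continuous_on S f"
  unfolding gderiv_def by (intro continuous_at_imp_continuous_on) (blast intro: has_derivative_continuous)

lemma C_k_continuous: "C_k n f \<Longrightarrow> continuous_on UNIV f"
  by (cases n) (auto intro: GDERIV_continuous)

lemma test_function_gradient:
  assumes \<phi>: "test_function \<phi>" and g: "\<And>x. GDERIV \<phi> x :> g x"
  shows "continuous_on UNIV g" "\<exists>b. \<forall>x. norm (g x) \<le> b"
proof -
  have "C_k (Suc 0) \<phi>" using \<phi> unfolding test_function_def by blast
  then obtain g' where g': "\<And>x. GDERIV \<phi> x :> g' x" "\<And>i. C_k 0 (\<lambda>x. g' x $ i)" by auto
  have "g' = g" using GDERIV_unique[OF g'(1) g] by auto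
  then have "continuous_on UNIV (\<lambda>x. \<chi> i. g x $ i)" using g'(2) by (intro continuous_on_vec_lambda) simp
  then show c: "continuous_on UNIV g" by simp
  define K where "K = closure {x. \<phi> x \<noteq> 0}"
  have K: "compact K" using \<phi> unfolding test_function_def K_def by simp
  have z: "g x = 0" if "x \<notin> K" for x
  proof (rule GDERIV_unique[OF g])
    have "open (- K)" using K by (simp add: compact_imp_closed open_Compl)
    moreover have "\<phi> y = 0" if "y \<in> - K" for y
      using that closure_subset[of "{x. \<phi> x \<noteq> 0}"] unfolding K_def by blast
    ultimately have "(\<phi> has_derivative (\<lambda>h. 0)) (at x)"
      using that by (intro has_derivative_transform_within_open[of "\<lambda>_. 0" "\<lambda>h. 0" x UNIV "- K" \<phi>]) auto
    then show "GDERIV \<phi> x :> 0" unfolding gderiv_def by simp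
  qed
  have "bounded (g ` K)" using K c by (intro compact_imp_bounded compact_continuous_image) (auto elim: continuous_on_subset)
  then obtain b where b: "\<And>x. x \<in> K \<Longrightarrow> norm (g x) \<le> b" unfolding bounded_iff by auto
  have "norm (g x) \<le> max b 0" for x using b[of x] z[of x] by (cases "x \<in> K") auto
  then show "\<exists>b. \<forall>x. norm (g x) \<le> b" by blast
qed

lemma test_function_bounds:
  assumes "test_function \<phi>"
  obtains b r where "\<And>x. \<bar>\<phi> x\<bar> \<le> b" "\<And>x. norm x > r \<Longrightarrow> \<phi> x = 0"
proof -
  define K where "K = closure {x. \<phi> x \<noteq> 0}"
  have K: "compact K" using assms unfolding test_function_def K_def by simp
  have z: "\<phi> x = 0" if "x \<notin> K" for x using that closure_subset[of "{x. \<phi> x \<noteq> 0}"] unfolding K_def by blast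
  have c: "continuous_on UNIV \<phi>" using assms C_k_continuous unfolding test_function_def by blast
  have "bounded (\<phi> ` K)" using K c by (intro compact_imp_bounded compact_continuous_image) (auto elim: continuous_on_subset)
  then obtain b where b: "\<And>x. x \<in> K \<Longrightarrow> norm (\<phi> x) \<le> b" unfolding bounded_iff by auto
  obtain r where r: "\<And>x. x \<in> K \<Longrightarrow> norm x \<le> r" using compact_imp_bounded[OF K] unfolding bounded_iff by auto
  show thesis
  proof (rule that)
    show "\<bar>\<phi> x\<bar> \<le> max b 0" for x using b[of x] z[of x] by (cases "x \<in> K") auto
    show "\<phi> x = 0" if "norm x > r" for x using r[of x] z[of x] that by (meson not_le)
  qed
qed

lemma integral_lipschitz_local:
  fixes f :: "real \<Rightarrow> 'a::euclidean_space"
  assumes f: "f integrable_on {0..T}"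
    and s: "s \<in> {0..T}" and t: "t \<in> {0..T}" and b: "\<And>r. min s t \<le> r \<Longrightarrow> r \<le> max s t \<Longrightarrow> norm (f r) \<le> C"
  shows "norm (integral {0..t} f - integral {0..s} f) \<le> C * \<bar>t - s\<bar>"
proof -
  have *: "norm (integral {0..t} f - integral {0..s} f) \<le> C * \<bar>t - s\<bar>"
    if "s \<in> {0..T}" "t \<in> {0..T}" "s \<le> t" "\<And>r. s \<le> r \<Longrightarrow> r \<le> t \<Longrightarrow> norm (f r) \<le> C" for s t
  proof -
    have "norm (integral {s..t} f) \<le> integral {s..t} (\<lambda>_. C)"
      by (rule integral_norm_bound_integral)
         (use that in \<open>auto intro: integrable_on_subinterval[OF f]\<close>)
    then show ?thesis using integral_increment[OF f, of s t] that by (simp add: mult.commute)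
  qed
  show ?thesis
  proof (cases "s \<le> t")
    case True
    then show ?thesis using * s t b by simp
  next
    case False
    then show ?thesis using *[of t s] s t b by (simp add: norm_minus_commute abs_minus_commute)
  qed
qed

text \<open>The path z is merely Lipschitz, with a velocity known almost everywhere, so the chain rule is not available
at a given time. But \<open>\<phi> (z s) - \<phi> (z t)\<close> and the increment of the integral both agree with
\<open>g (z t) \<bullet> (z s - z t)\<close> up to \<open>o(s - t)\<close>, the second because g is continuous along z; so their difference has derivative
zero at every time.\<close>

lemma chain_rule_integral:
  fixes z v :: "real \<Rightarrow> real^'d"
  assumes g: "\<And>x. GDERIV \<phi> x :> g x" "continuous_on UNIV g"
    and v: "v integrable_on {0..T}" "\<And>s. s \<in> {0..T} \<Longrightarrow> norm (v s) \<le> C"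
    and z: "\<And>t. t \<in> {0..T} \<Longrightarrow> z t = x + integral {0..t} v"
    and gi: "(\<lambda>s. g (z s) \<bullet> v s) integrable_on {0..T}"
    and t: "t \<in> {0..T}"
  shows "\<phi> (z t) = \<phi> x + integral {0..t} (\<lambda>s. g (z s) \<bullet> v s)"
proof -
  define \<psi> where "\<psi> t = \<phi> (z t) - integral {0..t} (\<lambda>s. g (z s) \<bullet> v s)" for t
  have T: "0 \<in> {0..T}" using t by auto
  have C: "0 \<le> C" using v(2)[OF T] norm_ge_zero order_trans by blast
  have zl: "norm (z t - z s) \<le> C * \<bar>t - s\<bar>" if "s \<in> {0..T}" "t \<in> {0..T}" for s t
    using integral_lipschitz[OF v that] z that by simp
  have zc: "continuous_on {0..T} z" by (rule lip_continuous_on[where L=C]) (use zl in auto)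
  have "\<exists>c. \<forall>t\<in>{0..T}. \<psi> t = c"
  proof (rule has_field_derivative_zero_constant)
    fix t assume t: "t \<in> {0..T}"
    have "(\<psi> has_derivative (\<lambda>h. 0)) (at t within {0..T})"
      unfolding has_derivative_within_alt
    proof (intro conjI allI impI)
      fix e :: real assume e: "e > 0"
      define e1 where "e1 = e / (2 * (C + 1))"
      have e1: "e1 > 0" "e1 * C \<le> e / 2" using e C unfolding e1_def by (auto simp: field_simps)
      have "(\<phi> has_derivative (\<lambda>h. h \<bullet> g (z t))) (at (z t))" using g(1) unfolding gderiv_def .
      then obtain d1 where d1: "d1 > 0" "\<And>y. norm (y - z t) < d1 \<Longrightarrow> norm (\<phi> y - \<phi> (z t) - (y - z t) \<bullet> g (z t)) \<le> e1 * norm (y - z t)"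
        unfolding has_derivative_at_alt using e1(1) by blast
      have "continuous_on {0..T} (\<lambda>s. g (z s))" by (rule continuous_on_compose2[OF g(2) zc]) auto
      then obtain d2 where d2: "d2 > 0" "\<And>s. s \<in> {0..T} \<Longrightarrow> \<bar>s - t\<bar> < d2 \<Longrightarrow> norm (g (z s) - g (z t)) < e1"
        using t e1(1) unfolding continuous_on_iff dist_norm real_norm_def by meson
      define d where "d = min d2 (d1 / (C + 1))"
      have d: "d > 0" "d \<le> d2" unfolding d_def using d1 d2 C by auto
      have "norm (\<psi> s - \<psi> t - 0) \<le> e * norm (s - t)" if s: "s \<in> {0..T}" "norm (s - t) < d" for s
      proof -
        have zz: "norm (z s - z t) \<le> C * \<bar>s - t\<bar>" by (rule zl[OF t s(1)])
        also have "\<dots> \<le> C * (d1 / (C + 1))" using s C unfolding d_def by (intro mult_left_mono) auto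
        also have "\<dots> < d1" using C d1 by (simp add: field_simps)
        finally have "norm (\<phi> (z s) - \<phi> (z t) - (z s - z t) \<bullet> g (z t)) \<le> e1 * norm (z s - z t)"
          by (rule d1(2))
        also have "\<dots> \<le> e1 * (C * \<bar>s - t\<bar>)" using zz e1 by (intro mult_left_mono) auto
        also have "\<dots> \<le> e / 2 * \<bar>s - t\<bar>" using mult_right_mono[OF e1(2), of "\<bar>s - t\<bar>"] by (simp add: mult.assoc)
        finally have A: "norm (\<phi> (z s) - \<phi> (z t) - (z s - z t) \<bullet> g (z t)) \<le> e / 2 * \<bar>s - t\<bar>" .
        define w where "w r = (g (z r) - g (z t)) \<bullet> v r" for r
        have giv: "(\<lambda>r. g (z t) \<bullet> v r) integrable_on {0..T}"
          using integrable_linear[OF v(1) bounded_linear_inner_right[of "g (z t)"]] by (simp add: comp_def)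
        have wi: "w integrable_on {0..T}" unfolding w_def inner_diff_left
          by (intro integrable_diff gi giv)
        have weq: "integral {0..r} w = integral {0..r} (\<lambda>s. g (z s) \<bullet> v s) - g (z t) \<bullet> integral {0..r} v" if r: "r \<in> {0..T}" for r
        proof -
          have sub: "f integrable_on {0..T} \<Longrightarrow> f integrable_on {0..r}" for f :: "real \<Rightarrow> 'b::banach"
            by (rule integrable_on_subinterval) (use r in auto)
          have "integral {0..r} w = integral {0..r} (\<lambda>s. g (z s) \<bullet> v s) - integral {0..r} (\<lambda>s. g (z t) \<bullet> v s)"
            unfolding w_def inner_diff_left by (rule hk_integral_diff[OF sub[OF gi] sub[OF giv]])
          also have "integral {0..r} (\<lambda>s. g (z t) \<bullet> v s) = g (z t) \<bullet> integral {0..r} v"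
            using integral_linear[OF sub[OF v(1)] bounded_linear_inner_right[of "g (z t)"]] by (simp add: comp_def)
          finally show ?thesis .
        qed
        have "norm (integral {0..s} w - integral {0..t} w) \<le> (e1 * C) * \<bar>s - t\<bar>"
        proof (rule integral_lipschitz_local[OF wi t s(1)])
          fix r assume r: "min t s \<le> r" "r \<le> max t s"
          then have rT: "r \<in> {0..T}" "\<bar>r - t\<bar> < d2" using s t d by auto
          have "norm (w r) \<le> norm (g (z r) - g (z t)) * norm (v r)" unfolding w_def by (simp add: Cauchy_Schwarz_ineq2)
          also have "\<dots> \<le> e1 * C" using d2(2)[OF rT] v(2)[OF rT(1)] e1 C by (intro mult_mono) auto
          finally show "norm (w r) \<le> e1 * C" .
        qed
        also have "\<dots> \<le> e / 2 * \<bar>s - t\<bar>" using e1(2) by (intro mult_right_mono) auto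
        finally have B: "norm (integral {0..s} w - integral {0..t} w) \<le> e / 2 * \<bar>s - t\<bar>" .
        have "\<psi> s - \<psi> t = (\<phi> (z s) - \<phi> (z t) - (z s - z t) \<bullet> g (z t)) - (integral {0..s} w - integral {0..t} w)"
          unfolding \<psi>_def weq[OF s(1)] weq[OF t] z[OF s(1)] z[OF t] by (simp add: algebra_simps inner_commute)
        then have "norm (\<psi> s - \<psi> t) \<le> e / 2 * \<bar>s - t\<bar> + e / 2 * \<bar>s - t\<bar>"
          using order_trans[OF norm_triangle_ineq4 add_mono[OF A B]] by simp
        then show ?thesis by simp
      qed
      then show "\<exists>d>0. \<forall>y\<in>{0..T}. norm (y - t) < d \<longrightarrow> norm (\<psi> y - \<psi> t - 0) \<le> e * norm (y - t)"
        using d(1) by blast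
    qed simp
    then show "(\<psi> has_field_derivative 0) (at t within {0..T})" unfolding has_field_derivative_def lambda_zero[symmetric] .
  qed simp
  then have "\<psi> t = \<psi> 0" using t T by metis
  then show ?thesis unfolding \<psi>_def using z[OF T] by simp
qed

lemma distr_cong_id:
  assumes "sets P = sets borel" "\<And>x. f x = x" shows "distr P borel f = P"
proof -
  have "f = (\<lambda>x. x)" using assms(2) by auto
  then show ?thesis using assms(1) by (simp add: distr_id2)
qed

lemma diagonal_coupling:
  fixes P :: "'a::euclidean_space measure"
  assumes "sets P = sets borel"
  shows "distr P (borel \<Otimes>\<^sub>M borel) (\<lambda>x. (x, x)) \<in> couplings P P"
proof -
  have m: "(\<lambda>x. (x, x)) \<in> measurable P (borel \<Otimes>\<^sub>M borel)"
    unfolding measurable_cong_sets[OF assms refl] by measurable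
  show ?thesis unfolding couplings_def
    by (auto simp: distr_distr[OF measurable_fst m] distr_distr[OF measurable_snd m] comp_def intro!: distr_cong_id[OF assms])
qed

lemma W1_distr_same:
  fixes z z' :: "'a::euclidean_space \<Rightarrow> 'a"
  assumes P: "prob_space P" "sets P = sets borel" and z: "z \<in> borel_measurable borel" "z' \<in> borel_measurable borel"
    and d: "AE x in P. norm (z x - z' x) \<le> d"
  shows "W1 (distr P borel z) (distr P borel z') \<le> d"
proof -
  interpret prob_space P by fact
  define \<pi> where "\<pi> = distr P (borel \<Otimes>\<^sub>M borel) (\<lambda>x. (x, x))"
  have m: "(\<lambda>x. (x, x)) \<in> measurable P (borel \<Otimes>\<^sub>M borel)"
    unfolding measurable_cong_sets[OF P(2) refl] by measurable
  have fm: "(\<lambda>p. norm (z (fst p) - z' (snd p))) \<in> borel_measurable (borel \<Otimes>\<^sub>M borel)" using z by measurable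
  have "(\<lambda>x. norm (z x - z' x)) \<in> borel_measurable P"
    unfolding measurable_cong_sets[OF P(2) refl] using z by measurable
  then have i: "integrable P (\<lambda>x. norm (z x - z' x))"
    by (rule integrable_const_bound[where B=d, rotated]) (use d in auto)
  have i2: "integrable \<pi> (\<lambda>p. norm (z (fst p) - z' (snd p)))"
    unfolding \<pi>_def by (subst integrable_distr_eq[OF m fm]) (use i in simp)
  have "W1 (distr P borel z) (distr P borel z') \<le> (\<integral>p. norm (z (fst p) - z' (snd p)) \<partial>\<pi>)"
    by (rule W1_distr_le[OF _ z i2]) (simp add: \<pi>_def diagonal_coupling[OF P(2)])
  also have "\<dots> = (\<integral>x. norm (z x - z' x) \<partial>P)" unfolding \<pi>_def by (subst integral_distr[OF m fm]) simp
  also have "\<dots> \<le> d" using prob_norm_integral_le[OF P(1) i, of d] d by (simp add: abs_le_iff)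
  finally show ?thesis .
qed

lemma chi_dist_le:
  fixes Y Y' :: "(real^'d)^'m"
  assumes "norm (Y - Y') \<le> a" "W1 \<mu> \<mu>' \<le> b"
  shows "chi_dist Y \<mu> Y' \<mu>' \<le> a + b"
proof -
  have "(\<Sum>k\<in>(UNIV::'m set). norm (Y $ k - Y' $ k)) \<le> (\<Sum>k\<in>(UNIV::'m set). a)"
  proof (rule sum_mono)
    fix k show "norm (Y $ k - Y' $ k) \<le> a"
      using order_trans[OF Finite_Cartesian_Product.norm_nth_le assms(1), of k] by simp
  qed
  then have "(1 / real CARD('m)) * (\<Sum>k\<in>(UNIV::'m set). norm (Y $ k - Y' $ k)) \<le> a" by (simp add: field_simps)
  then show ?thesis unfolding chi_dist_def using assms(2) by linarith
qed

context controlled begin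

lemma flow_line_norm: "good_curve \<nu> \<Longrightarrow> flow_line \<nu> x z \<Longrightarrow> t \<in> {0..T} \<Longrightarrow> norm (z t) \<le> norm x + Cv * T"
proof -
  assume a: "good_curve \<nu>" "flow_line \<nu> x z" "t \<in> {0..T}"
  have "norm (z t - z 0) \<le> Cv * \<bar>t - 0\<bar>" by (rule flow_line_lip[OF a(1,2)]) (use a T_pos in auto)
  also have "\<dots> \<le> Cv * T" using a(3) Cv_nonneg by (intro mult_left_mono) auto
  finally show ?thesis using flow_line_0[OF a(2)] norm_triangle_sub[of "z t" x] by simp
qed

lemma lagrangian_bound:
  assumes P: "sets P = sets borel" "AE x in P. x \<in> S \<and> norm x \<le> R" and Z: "lagrangian S P Z" and t: "t \<in> {0..T}"
  shows "AE x in distr P borel (Z t). norm x \<le> R + Cv * T"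
proof -
  have m: "Z t \<in> borel_measurable P" using Z t unfolding lagrangian_def by (simp add: measurable_cong_sets[OF P(1) refl])
  have "AE x in P. norm (Z t x) \<le> R + Cv * T"
    using P(2)
  proof eventually_elim
    case (elim x)
    then have "norm (Z t x) \<le> norm x + Cv * T"
      using Z unfolding lagrangian_def by (intro flow_line_norm[OF _ _ t]) auto
    then show ?case using elim by simp
  qed
  then show ?thesis by (subst AE_distr_iff[OF m]) auto
qed

lemma lagrangian_P1:
  assumes P: "prob_space P" "sets P = sets borel" "AE x in P. x \<in> S \<and> norm x \<le> R" and Z: "lagrangian S P Z" and t: "t \<in> {0..T}"
  shows "distr P borel (Z t) \<in> P1"
proof -
  have "prob_space (distr P borel (Z t))" using Z t unfolding lagrangian_def good_curve_def by auto
  from P1_bounded_support[OF this _ lagrangian_bound[OF P(2,3) Z t]] show ?thesis by simp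
qed

lemma lagrangian_chi_lip:
  assumes P: "prob_space P" "sets P = sets borel" "AE x in P. x \<in> S" and Z: "lagrangian S P Z" and t: "t \<in> {0..T}" and s: "s \<in> {0..T}"
  shows "chi_dist (Y s) (distr P borel (Z s)) (Y t) (distr P borel (Z t)) \<le> (M + Cv) * \<bar>s - t\<bar>"
proof -
  have "W1 (distr P borel (Z s)) (distr P borel (Z t)) \<le> Cv * \<bar>s - t\<bar>"
  proof (rule W1_distr_same[OF P(1,2)])
    show "AE x in P. norm (Z s x - Z t x) \<le> Cv * \<bar>s - t\<bar>"
      using P(3) by eventually_elim (use Z s t in \<open>auto simp: lagrangian_def intro: flow_line_lip\<close>)
  qed (use Z s t in \<open>auto simp: lagrangian_def\<close>)
  from chi_dist_le[OF Y_lip[OF t s] this] show ?thesis by (simp add: algebra_simps)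
qed

lemma lagrangian_chi_curve:
  assumes P: "prob_space P" "sets P = sets borel" "AE x in P. x \<in> S" and Z: "lagrangian S P Z"
  shows "chi_continuous_curve T Y (\<lambda>t. distr P borel (Z t))"
  unfolding chi_continuous_curve_def
proof (intro ballI allI impI)
  fix t and e :: real assume t: "t \<in> {0..T}" and e: "e > 0"
  define d where "d = e / (M + Cv + 1)"
  have mc: "0 \<le> M + Cv" using M_nonneg Cv_nonneg by simp
  have d: "d > 0" "(M + Cv) * d < e" using e mc unfolding d_def by (auto simp: field_simps)
  have "chi_dist (Y s) (distr P borel (Z s)) (Y t) (distr P borel (Z t)) < e" if s: "s \<in> {0..T}" "\<bar>s - t\<bar> < d" for s
  proof -
    have "chi_dist (Y s) (distr P borel (Z s)) (Y t) (distr P borel (Z t)) \<le> (M + Cv) * \<bar>s - t\<bar>"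
      by (rule lagrangian_chi_lip[OF P Z t s(1)])
    also have "\<dots> \<le> (M + Cv) * d" using s mc by (intro mult_left_mono) auto
    finally show ?thesis using d(2) by simp
  qed
  then show "\<exists>\<delta>>0. \<forall>s\<in>{0..T}. \<bar>s - t\<bar> < \<delta> \<longrightarrow> chi_dist (Y s) (distr P borel (Z s)) (Y t) (distr P borel (Z t)) < e"
    using d(1) by blast
qed

text \<open>The chain rule along every flow line, integrated over the starting points. Most of the proof establishes the joint
measurability in time and starting point that Fubini's theorem needs; in time the integrand is Lebesgue measurable only.\<close>

lemma lagrangian_weak_form:
  assumes P: "prob_space P" "sets P = sets borel" and Zc: "jointly_continuous Z" and Z: "lagrangian UNIV P Z"
    and \<phi>: "test_function \<phi>" "\<And>x. GDERIV \<phi> x :> g x"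
  shows "caratheodory T (\<lambda>t _. \<integral>x. g x \<bullet> velocity H G (u t) (Y t) (distr P borel (Z t)) x \<partial>distr P borel (Z t))
          (\<integral>x. \<phi> x \<partial>P) (\<lambda>t. \<integral>x. \<phi> x \<partial>distr P borel (Z t))"
proof -
  interpret P: prob_space P by fact
  define \<nu> where "\<nu> t = distr P borel (Z t)" for t
  have \<nu>: "good_curve \<nu>" and Zm: "\<And>t. t \<in> {0..T} \<Longrightarrow> Z t \<in> borel_measurable borel"
    and Zf: "\<And>x. flow_line \<nu> x (\<lambda>t. Z t x)"
    using Z unfolding lagrangian_def \<nu>_def by auto
  have Zm': "Z t \<in> borel_measurable P" if "t \<in> {0..T}" for t
    using Zm[OF that] by (simp add: measurable_cong_sets[OF P(2) refl])
  note gc = test_function_gradient(1)[OF \<phi>]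
  obtain b where b: "\<And>x. norm (g x) \<le> b" using test_function_gradient(2)[OF \<phi>] by blast
  have b0: "0 \<le> b" using order_trans[OF norm_ge_zero b] .
  have gm: "g \<in> borel_measurable borel" by (rule borel_measurable_continuous_onI[OF gc])
  have \<phi>m: "\<phi> \<in> borel_measurable borel" by (rule borel_measurable_continuous_onI[OF GDERIV_continuous[OF \<phi>(2)]])
  have cH: "continuous_on UNIV H" by (rule lip_continuous_on) (rule H_lip)
  have Hm: "H \<in> borel_measurable borel" by (rule borel_measurable_continuous_onI[OF cH])
  have Gm: "G l \<in> borel_measurable borel" for l by (rule borel_measurable_continuous_onI[OF continuous_G])
  define F where "F s x = g (Z s x) \<bullet> vel \<nu> s (Z s x)" for s x
  have Fb: "norm (F s x) \<le> b * Cv" if "s \<in> {0..T}" for s x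
  proof -
    have "norm (F s x) \<le> norm (g (Z s x)) * norm (vel \<nu> s (Z s x))"
      unfolding F_def by (simp add: Cauchy_Schwarz_ineq2)
    also have "\<dots> \<le> b * Cv" using b b0 velocity_le[OF \<nu> that] by (intro mult_mono) auto
    finally show ?thesis .
  qed
  define L where "L = lebesgue_on {0..T}"
  interpret L: finite_measure L unfolding L_def by (rule finite_measure_lebesgue_on) simp
  interpret LP: pair_sigma_finite L P ..
  have Zj: "(\<lambda>p. Z (fst p) (snd p)) \<in> borel_measurable (borel \<Otimes>\<^sub>M borel)"
    using borel_measurable_continuous_onI[OF Zc] unfolding borel_prod case_prod_beta' .
  have ZZ: "(\<lambda>p. Z (f p) (h p)) \<in> borel_measurable N" if "f \<in> borel_measurable N" "h \<in> borel_measurable N" for f h and N :: "'c measure"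
    using measurable_compose[OF measurable_Pair[OF that] Zj] by simp
  have idL: "(\<lambda>s. s) \<in> measurable L borel"
    unfolding L_def by (rule continuous_imp_measurable_on_sets_lebesgue) auto
  have f1: "fst \<in> measurable (L \<Otimes>\<^sub>M P) borel"
    by (rule measurable_compose[OF measurable_fst[of L P] idL])
  have s1: "snd \<in> measurable (L \<Otimes>\<^sub>M P) borel"
    using measurable_snd[of L P] unfolding measurable_cong_sets[OF refl P(2)] .
  have um: "(\<lambda>p. u (fst p) $ k $ l) \<in> borel_measurable (L \<Otimes>\<^sub>M P)" for k l
  proof -
    have nth: "(\<lambda>v::(real^'d)^'m. v $ k $ l) \<in> borel_measurable borel"
      by (intro borel_measurable_continuous_onI continuous_intros)
    have "(\<lambda>s. u s $ k $ l) \<in> borel_measurable L" unfolding L_def by (rule measurable_compose[OF u_meas nth])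
    from measurable_compose[OF measurable_fst this] show ?thesis .
  qed
  have Ym: "(\<lambda>p. Y (fst p) $ k) \<in> borel_measurable (L \<Otimes>\<^sub>M P)" for k
  proof -
    have "(\<lambda>s. Y s $ k) \<in> borel_measurable L" unfolding L_def
      by (rule continuous_imp_measurable_on_sets_lebesgue) (auto intro!: continuous_intros Y_cont)
    from measurable_compose[OF measurable_fst this] show ?thesis .
  qed
  have Zm1: "(\<lambda>p. Z (fst p) (snd p)) \<in> borel_measurable (L \<Otimes>\<^sub>M P)" by (rule ZZ[OF f1 s1])
  have cm: "(\<lambda>p. \<integral>\<xi>. H (Z (fst p) (snd p) - Z (fst p) \<xi>) \<partial>P) \<in> borel_measurable (L \<Otimes>\<^sub>M P)"
  proof (rule P.borel_measurable_lebesgue_integral)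
    have a: "(\<lambda>q. fst (fst q)) \<in> borel_measurable ((L \<Otimes>\<^sub>M P) \<Otimes>\<^sub>M P)"
      by (rule measurable_compose[OF measurable_fst f1])
    have b: "(\<lambda>q. snd (fst q)) \<in> borel_measurable ((L \<Otimes>\<^sub>M P) \<Otimes>\<^sub>M P)"
      by (rule measurable_compose[OF measurable_fst s1])
    have c: "snd \<in> borel_measurable ((L \<Otimes>\<^sub>M P) \<Otimes>\<^sub>M P)"
      using measurable_snd[of "L \<Otimes>\<^sub>M P" P] unfolding measurable_cong_sets[OF refl P(2)] .
    have "(\<lambda>q. H (Z (fst (fst q)) (snd (fst q)) - Z (fst (fst q)) (snd q))) \<in> borel_measurable ((L \<Otimes>\<^sub>M P) \<Otimes>\<^sub>M P)"
      by (rule measurable_compose[OF borel_measurable_diff[OF ZZ[OF a b] ZZ[OF a c]] Hm])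
    then show "(\<lambda>(p, \<xi>). H (Z (fst p) (snd p) - Z (fst p) \<xi>)) \<in> borel_measurable ((L \<Otimes>\<^sub>M P) \<Otimes>\<^sub>M P)"
      by (simp add: case_prod_beta')
  qed
  have Gm1: "(\<lambda>p. G l (Z (fst p) (snd p) - Y (fst p) $ k)) \<in> borel_measurable (L \<Otimes>\<^sub>M P)" for l k
    by (rule measurable_compose[OF borel_measurable_diff[OF Zm1 Ym] Gm])
  have km: "(\<lambda>p. control_field (u (fst p)) (Y (fst p)) (Z (fst p) (snd p))) \<in> borel_measurable (L \<Otimes>\<^sub>M P)"
    unfolding kernel_sum_def by (intro borel_measurable_sum borel_measurable_scaleR um Gm1 borel_measurable_const)
  have "(\<lambda>p. g (Z (fst p) (snd p)) \<bullet> ((\<integral>\<xi>. H (Z (fst p) (snd p) - Z (fst p) \<xi>) \<partial>P) + control_field (u (fst p)) (Y (fst p)) (Z (fst p) (snd p))))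
     \<in> borel_measurable (L \<Otimes>\<^sub>M P)"
    by (intro borel_measurable_inner borel_measurable_add cm km measurable_compose[OF Zm1 gm])
  then have Fm: "(\<lambda>(s, x). F s x) \<in> borel_measurable (L \<Otimes>\<^sub>M P)"
  proof (rule measurable_cong[THEN iffD1, rotated])
    fix p assume "p \<in> space (L \<Otimes>\<^sub>M P)"
    then have "fst p \<in> {0..T}" unfolding L_def by (auto simp: space_pair_measure space_restrict_space)
    then show "g (Z (fst p) (snd p)) \<bullet> ((\<integral>\<xi>. H (Z (fst p) (snd p) - Z (fst p) \<xi>) \<partial>P) + control_field (u (fst p)) (Y (fst p)) (Z (fst p) (snd p)))
      = (case p of (s, x) \<Rightarrow> F s x)"
      unfolding F_def \<nu>_def velocity_eq by (simp add: split_beta conv_distr[OF H_lip Zm'])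
  qed
  interpret LPf: finite_measure "L \<Otimes>\<^sub>M P" by (rule finite_measure_pair_measure) (unfold_locales)
  have Fi: "integrable (L \<Otimes>\<^sub>M P) (\<lambda>(s, x). F s x)"
  proof (rule LPf.integrable_const_bound[where B="b * Cv"])
    show "AE p in L \<Otimes>\<^sub>M P. norm (case p of (s, x) \<Rightarrow> F s x) \<le> b * Cv"
      using Fb by (intro AE_I2) (auto simp: space_pair_measure L_def space_restrict_space)
  qed (rule Fm)
  have ie: "(\<integral>x. g x \<bullet> vel \<nu> s x \<partial>\<nu> s) = (\<integral>x. F s x \<partial>P)" if s: "s \<in> {0..T}" for s
  proof -
    have "continuous_on UNIV (\<lambda>x. vel \<nu> s x)"
      by (rule lip_continuous_on[where L=Kv]) (use \<nu> s in \<open>auto simp: good_curve_def intro!: velocity_lip u_bound\<close>)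
    then have "(\<lambda>x. vel \<nu> s x) \<in> borel_measurable borel" by (rule borel_measurable_continuous_onI)
    then have "(\<lambda>x. g x \<bullet> vel \<nu> s x) \<in> borel_measurable borel"
      using gm by (intro borel_measurable_inner)
    then show ?thesis unfolding \<nu>_def[of s] F_def by (intro integral_distr Zm'[OF s])
  qed
  have "integrable L (\<lambda>s. \<integral>x. F s x \<partial>P)" using LP.integrable_fst[OF Fi] .
  then have ai: "(\<lambda>s. \<integral>x. F s x \<partial>P) absolutely_integrable_on {0..T}"
    unfolding L_def by (simp add: integrable_restrict_space set_integrable_def)
  have ai': "(\<lambda>t. \<integral>x. g x \<bullet> vel \<nu> t x \<partial>\<nu> t) absolutely_integrable_on {0..T}"
    by (rule absolutely_integrable_spike[OF ai negligible_empty]) (auto simp: ie)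
  have main: "(\<integral>x. \<phi> x \<partial>\<nu> t) = (\<integral>x. \<phi> x \<partial>P) + integral {0..t} (\<lambda>s. \<integral>x. F s x \<partial>P)" if t: "t \<in> {0..T}" for t
  proof -
    define I where "I s x = indicator {0..t} s * F s x" for s x
    have Ii: "integrable (L \<Otimes>\<^sub>M P) (\<lambda>(s, x). I s x)"
    proof (rule Bochner_Integration.integrable_bound[OF Fi])
      have "(\<lambda>p. indicator {0..t} (fst p) :: real) \<in> borel_measurable (L \<Otimes>\<^sub>M P)"
        by (rule measurable_compose[OF f1]) simp
      then show "(\<lambda>(s, x). I s x) \<in> borel_measurable (L \<Otimes>\<^sub>M P)"
        using Fm unfolding I_def case_prod_beta' by (intro borel_measurable_times)
    qed (auto simp: I_def indicator_def)
    have Li: "(\<integral>s. indicator {0..t} s * f s \<partial>L) = integral {0..t} f" if "f absolutely_integrable_on {0..T}" for f :: "real \<Rightarrow> real"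
    proof -
      have f': "f absolutely_integrable_on {0..t}" by (rule absolutely_integrable_on_subinterval[OF that]) (use t in auto)
      have "(\<integral>s. indicator {0..t} s * f s \<partial>L) = (\<integral>s. indicator {0..T} s * (indicator {0..t} s * f s) \<partial>lebesgue)"
        unfolding L_def by (subst integral_restrict_space) auto
      also have "\<dots> = (\<integral>s. indicator {0..t} s * f s \<partial>lebesgue)"
        using t by (intro Bochner_Integration.integral_cong) (auto simp: indicator_def)
      also have "\<dots> = integral {0..t} f"
        using set_lebesgue_integral_eq_integral(2)[OF f'] unfolding set_lebesgue_integral_def by simp
      finally show ?thesis .
    qed
    have pt: "\<phi> (Z t x) = \<phi> x + (\<integral>s. I s x \<partial>L)" for x
    proof -
      have cz: "continuous_on {0..T} (\<lambda>t. Z t x)" using Zf unfolding flow_line_def by auto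
      have vi: "(\<lambda>s. vel \<nu> s (Z s x)) absolutely_integrable_on {0..T}" by (rule velocity_time[OF \<nu> cz])
      have vm: "time_measurable T (\<lambda>s. vel \<nu> s (Z s x))"
        using vi by (simp add: absolutely_integrable_measurable)
      have "continuous_on {0..T} (\<lambda>s. g (Z s x))" by (rule continuous_on_compose2[OF gc cz]) auto
      then have "time_measurable T (\<lambda>s. g (Z s x))"
        by (rule continuous_imp_measurable_on_sets_lebesgue) simp
      then have "time_measurable T (\<lambda>s. F s x)" unfolding F_def using vm by (rule borel_measurable_inner)
      then have Fa: "(\<lambda>s. F s x) absolutely_integrable_on {0..T}" by (rule abs_integrable_bounded[OF _ Fb])
      have "\<phi> (Z t x) = \<phi> x + integral {0..t} (\<lambda>s. F s x)"
        unfolding F_def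
        by (rule chain_rule_integral[OF \<phi>(2) gc _ velocity_le[OF \<nu>] _ _ t])
           (use vi Fa Zf in \<open>auto simp: absolutely_integrable_on_def F_def flow_line_def\<close>)
      then show "\<phi> (Z t x) = \<phi> x + (\<integral>s. I s x \<partial>L)" unfolding I_def Li[OF Fa] .
    qed
    obtain c r where c: "\<And>x. \<bar>\<phi> x\<bar> \<le> c" and "\<And>x. norm x > r \<Longrightarrow> \<phi> x = 0"
      by (rule test_function_bounds[OF \<phi>(1)], rule that)
    have ip: "integrable P \<phi>"
      by (rule P.integrable_const_bound[where B=c]) (use c \<phi>m in \<open>auto simp: measurable_cong_sets[OF P(2) refl]\<close>)
    have "(\<integral>x. \<phi> x \<partial>\<nu> t) = (\<integral>x. \<phi> (Z t x) \<partial>P)" unfolding \<nu>_def by (rule integral_distr[OF Zm'[OF t] \<phi>m])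
    also have "\<dots> = (\<integral>x. \<phi> x + (\<integral>s. I s x \<partial>L) \<partial>P)" using pt by simp
    also have "\<dots> = (\<integral>x. \<phi> x \<partial>P) + (\<integral>x. (\<integral>s. I s x \<partial>L) \<partial>P)"
      by (rule Bochner_Integration.integral_add[OF ip LP.integrable_snd[OF Ii]])
    also have "(\<integral>x. (\<integral>s. I s x \<partial>L) \<partial>P) = (\<integral>s. (\<integral>x. I s x \<partial>P) \<partial>L)" by (rule LP.Fubini_integral[OF Ii])
    also have "\<dots> = integral {0..t} (\<lambda>s. \<integral>x. F s x \<partial>P)"
      unfolding I_def by (simp add: Li[OF ai])
    finally show ?thesis .
  qed
  have "integral {0..t} (\<lambda>s. \<integral>x. F s x \<partial>P) = integral {0..t} (\<lambda>t. \<integral>x. g x \<bullet> vel \<nu> t x \<partial>\<nu> t)" if "t \<in> {0..T}" for t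
    by (rule Henstock_Kurzweil_Integration.integral_cong) (use that ie in auto)
  then show ?thesis unfolding caratheodory_def \<nu>_def[symmetric] using ai' main by simp
qed

lemma lagrangian_mean_field_solution:
  assumes P: "prob_space P" "sets P = sets borel" "AE x in P. norm x \<le> R" "0 \<le> R"
    and Zc: "jointly_continuous Z" and Z: "lagrangian UNIV P Z"
  shows "mean_field_solution T H G Y0 P u Y (\<lambda>t. distr P borel (Z t))"
proof -
  have P3: "AE x in P. x \<in> UNIV \<and> norm x \<le> R" using P(3) by simp
  have "msupport (distr P borel (Z t)) \<subseteq> ball 0 (R + Cv * T + 1)" if "t \<in> {0..T}" for t
    using msupport_subset_cball[OF _ lagrangian_bound[OF P(2) P3 Z that]] by auto
  moreover have "R + Cv * T + 1 > 0" using P(4) Cv_nonneg T_pos by (simp add: add_nonneg_pos)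
  ultimately have R: "\<exists>R>0. \<forall>t\<in>{0..T}. msupport (distr P borel (Z t)) \<subseteq> ball 0 R" by blast
  have Z0: "distr P borel (Z 0) = P"
    by (rule distr_cong_id[OF P(2)]) (use Z in \<open>auto simp: lagrangian_def intro: flow_line_0\<close>)
  show ?thesis unfolding mean_field_solution_def
    using lagrangian_P1[OF P(1,2) P3 Z] R lagrangian_chi_curve[OF P(1,2) _ Z] Z0
      lagrangian_weak_form[OF P(1,2) Zc Z] u_abs_int Y_eq
    by (auto simp: caratheodory_def)
qed

end

section \<open>Test functions and mollification\<close>

lemma C_k_mono: "C_k (Suc n) f \<Longrightarrow> C_k n f"
proof (induction n arbitrary: f)
  case 0
  then show ?case using C_k_continuous[OF 0] by simp
next
  case (Suc n)
  then obtain g where g: "\<forall>x. GDERIV f x :> g x" "\<forall>i. C_k (Suc n) (\<lambda>x. g x $ i)"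
    by (metis C_k.simps(2))
  then have "\<forall>i. C_k n (\<lambda>x. g x $ i)" using Suc.IH by blast
  then show ?case using g(1) by auto
qed

lemma C_k_const: "C_k n (\<lambda>x. c)"
proof (induction n arbitrary: c)
  case (Suc n)
  show ?case unfolding C_k.simps by (intro exI[of _ "\<lambda>_. 0"]) (simp add: GDERIV_const Suc)
qed simp

lemma C_k_add: "C_k n f \<Longrightarrow> C_k n g \<Longrightarrow> C_k n (\<lambda>x. f x + g x)"
proof (induction n arbitrary: f g)
  case (Suc n)
  obtain f' where f': "\<forall>x. GDERIV f x :> f' x" "\<forall>i. C_k n (\<lambda>x. f' x $ i)" using Suc.prems(1) by auto
  obtain g' where g': "\<forall>x. GDERIV g x :> g' x" "\<forall>i. C_k n (\<lambda>x. g' x $ i)" using Suc.prems(2) by auto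
  have "\<forall>x. GDERIV (\<lambda>x. f x + g x) x :> f' x + g' x" using f' g' by (simp add: GDERIV_add)
  moreover have "\<forall>i. C_k n (\<lambda>x. (f' x + g' x) $ i)" using Suc.IH f'(2) g'(2) by simp
  ultimately show ?case unfolding C_k.simps by (intro exI[of _ "\<lambda>x. f' x + g' x"]) auto
qed (auto intro: continuous_intros)

lemma C_k_mult: "C_k n f \<Longrightarrow> C_k n g \<Longrightarrow> C_k n (\<lambda>x. f x * g x)"
proof (induction n arbitrary: f g)
  case (Suc n)
  obtain f' where f': "\<forall>x. GDERIV f x :> f' x" "\<forall>i. C_k n (\<lambda>x. f' x $ i)" using Suc.prems(1) by auto
  obtain g' where g': "\<forall>x. GDERIV g x :> g' x" "\<forall>i. C_k n (\<lambda>x. g' x $ i)" using Suc.prems(2) by auto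
  have fg: "C_k n f" "C_k n g" using Suc.prems C_k_mono by auto
  have "\<forall>x. GDERIV (\<lambda>x. f x * g x) x :> f x *\<^sub>R g' x + g x *\<^sub>R f' x" using f' g' by (simp add: GDERIV_mult)
  moreover have "C_k n (\<lambda>x. (f x *\<^sub>R g' x + g x *\<^sub>R f' x) $ i)" for i
    using C_k_add[OF Suc.IH[OF fg(1)] Suc.IH[OF fg(2)]] f'(2) g'(2) by simp
  ultimately show ?case unfolding C_k.simps by (intro exI[of _ "\<lambda>x. f x *\<^sub>R g' x + g x *\<^sub>R f' x"]) auto
qed (auto intro: continuous_intros)

lemma C_k_coord: "C_k n (\<lambda>x. x $ i)"
proof (cases n)
  case (Suc m)
  have "GDERIV (\<lambda>x. x $ i) x :> axis i 1" for x :: "real^'a"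
    unfolding gderiv_def inner_axis inner_real_def
    by (auto intro!: bounded_linear_imp_has_derivative bounded_linear_vec_nth)
  moreover have "C_k m (\<lambda>x. axis i 1 $ j)" for j by (rule C_k_const)
  ultimately show ?thesis unfolding Suc C_k.simps by (intro exI[of _ "\<lambda>x. axis i 1"]) auto
qed (auto intro: continuous_intros)

text \<open>The functions \<open>exp (- 1 / s) / s ^ j\<close>, extended by zero. Derivatives of members of this family are linear
combinations of members, so all of them are smooth by a single induction.\<close>

definition flat :: "nat \<Rightarrow> real \<Rightarrow> real" where
  "flat j s = (if s > 0 then exp (- inverse s) * inverse s ^ j else 0)"

lemma flat_le: "\<exists>c. \<forall>s. \<bar>flat j s\<bar> \<le> c * s\<^sup>2"
proof -
  define n where "n = j + 2"
  have "\<bar>flat j s\<bar> \<le> real n ^ n * s\<^sup>2" for s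
  proof (cases "s > 0")
    case True
    have np: "real n > 0" unfolding n_def by simp
    define w where "w = inverse s"
    have w: "w > 0" "s = inverse w" using True unfolding w_def by auto
    have "w / real n \<le> exp (w / real n)"
      using exp_ge_add_one_self[of "w / real n"] by linarith
    then have "(w / real n) ^ n \<le> exp (w / real n) ^ n" using w by (intro power_mono) auto
    also have "\<dots> = exp w" using np by (simp add: exp_of_nat_mult[symmetric])
    finally have 1: "w ^ n \<le> exp w * real n ^ n" using np by (simp add: power_divide field_simps)
    have "flat j s = w ^ j * exp (- w)" using True unfolding flat_def w_def by simp
    also have "\<dots> = w ^ j * exp (- w) * ((w * s) * (w * s))" using w by simp
    also have "\<dots> = w ^ n * exp (- w) * s\<^sup>2" unfolding n_def by (simp add: power_add power2_eq_square mult_ac)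
    also have "\<dots> \<le> (exp w * real n ^ n) * exp (- w) * s\<^sup>2" using 1 by (intro mult_right_mono) auto
    also have "\<dots> = real n ^ n * s\<^sup>2" by (simp add: exp_minus)
    finally show ?thesis using True unfolding flat_def by simp
  next
    case False
    then show ?thesis unfolding flat_def by simp
  qed
  then show ?thesis by blast
qed

lemma flat_deriv: "(flat j has_real_derivative flat (j + 2) s - real j * flat (j + 1) s) (at s)"
proof -
  consider "s > 0" | "s < 0" | "s = 0" by linarith
  then show ?thesis
  proof cases
    case 1
    have i: "(inverse has_real_derivative - (inverse s * inverse s)) (at s)"
      using DERIV_inverse[of s] 1 by (simp add: power2_eq_square)
    have e: "((\<lambda>s. exp (- inverse s)) has_real_derivative exp (- inverse s) * (inverse s * inverse s)) (at s)"
      using DERIV_chain2[OF DERIV_exp DERIV_minus[OF i]] by simp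
    have p: "((\<lambda>s. inverse s ^ j) has_real_derivative - (real j * inverse s ^ (j + 1))) (at s)"
      by (rule DERIV_cong[OF DERIV_power[OF i]]) (cases j; simp)
    have "((\<lambda>s. exp (- inverse s) * inverse s ^ j) has_real_derivative flat (j + 2) s - real j * flat (j + 1) s) (at s)"
      by (rule DERIV_cong[OF DERIV_mult[OF e p]]) (use 1 in \<open>simp add: flat_def algebra_simps\<close>)
    then show ?thesis
      by (rule has_field_derivative_transform_within_open[where S="{0<..}"]) (use 1 in \<open>auto simp: flat_def\<close>)
  next
    case 2
    have "((\<lambda>s. 0) has_real_derivative 0) (at s)" by simp
    then have "(flat j has_real_derivative 0) (at s)"
      by (rule has_field_derivative_transform_within_open[where S="{..<0}"]) (use 2 in \<open>auto simp: flat_def\<close>)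
    then show ?thesis using 2 unfolding flat_def by simp
  next
    case 3
    obtain c where c: "\<And>s. \<bar>flat j s\<bar> \<le> c * s\<^sup>2" using flat_le by blast
    have "(flat j has_derivative (\<lambda>h. 0)) (at 0)"
      unfolding has_derivative_at_alt
    proof (intro conjI allI impI)
      fix e :: real assume e: "e > 0"
      have "norm (flat j y - flat j 0 - 0) \<le> e * norm (y - 0)" if y: "norm (y - 0) < e / (\<bar>c\<bar> + 1)" for y
      proof -
        have "\<bar>flat j y\<bar> \<le> c * y\<^sup>2" by (rule c)
        also have "\<dots> \<le> (\<bar>c\<bar> + 1) * (\<bar>y\<bar> * \<bar>y\<bar>)" by (simp add: power2_eq_square mult_right_mono)
        also have "\<dots> \<le> e * \<bar>y\<bar>"
        proof -
          have "(\<bar>c\<bar> + 1) * \<bar>y\<bar> \<le> e" using y by (simp add: field_simps)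
          from mult_right_mono[OF this, of "\<bar>y\<bar>"] show ?thesis by (simp only: mult.assoc abs_ge_zero)
        qed
        finally show ?thesis unfolding flat_def by simp
      qed
      then show "\<exists>d>0. \<forall>y. norm (y - 0) < d \<longrightarrow> norm (flat j y - flat j 0 - 0) \<le> e * norm (y - 0)"
        using e by (intro exI[of _ "e / (\<bar>c\<bar> + 1)"]) (auto simp: add_nonneg_pos)
    qed simp
    then show ?thesis unfolding 3 has_field_derivative_def flat_def lambda_zero by simp
  qed
qed

definition bump :: "real \<Rightarrow> real^'d \<Rightarrow> real" where
  "bump r x = flat 0 (r\<^sup>2 - x \<bullet> x)"

lemma GDERIV_sq: "GDERIV (\<lambda>x. r\<^sup>2 - x \<bullet> x) x :> - 2 *\<^sub>R x"
  unfolding gderiv_def by (auto intro!: derivative_eq_intros simp: inner_commute)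

lemma C_k_flat: "C_k n (\<lambda>x. flat j (r\<^sup>2 - x \<bullet> x))"
proof (induction n arbitrary: j)
  case 0
  have "continuous_on UNIV (flat j)" using flat_deriv by (intro continuous_at_imp_continuous_on) (blast intro: DERIV_isCont)
  then show ?case by (auto intro!: continuous_on_compose2[of UNIV "flat j"] continuous_intros)
next
  case (Suc n)
  let ?g = "\<lambda>x::real^'a. (flat (j + 2) (r\<^sup>2 - x \<bullet> x) - real j * flat (j + 1) (r\<^sup>2 - x \<bullet> x)) *\<^sub>R (- 2 *\<^sub>R x)"
  have "\<forall>x. GDERIV (\<lambda>x. flat j (r\<^sup>2 - x \<bullet> x)) x :> ?g x"
    using GDERIV_DERIV_compose[OF GDERIV_sq flat_deriv] by blast
  moreover have "C_k n (\<lambda>x. ?g x $ i)" for i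
  proof -
    have "C_k n (\<lambda>x::real^'a. (flat (j + 2) (r\<^sup>2 - x \<bullet> x) + (- real j) * flat (j + 1) (r\<^sup>2 - x \<bullet> x)) * ((- 2) * x $ i))"
      by (intro C_k_mult C_k_add Suc C_k_const C_k_coord)
    then show ?thesis by (rule back_subst[of "C_k n"]) (auto simp: fun_eq_iff algebra_simps)
  qed
  ultimately show ?case unfolding C_k.simps by (intro exI[of _ ?g]) auto
qed

lemma bump_nonneg: "0 \<le> bump r x" unfolding bump_def flat_def by simp

lemma bump_zero:
  assumes "r > 0" "norm x \<ge> r" shows "bump r x = 0"
proof -
  have "r\<^sup>2 \<le> (norm x)\<^sup>2" using assms by (intro power_mono) auto
  then show ?thesis unfolding bump_def flat_def by (simp add: power2_norm_eq_inner)
qed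

lemma bump_pos:
  assumes "r > 0" "norm x < r" shows "bump r x > 0"
proof -
  have "(norm x)\<^sup>2 < r\<^sup>2" using assms by (intro power_strict_mono) auto
  then show ?thesis unfolding bump_def flat_def by (simp add: power2_norm_eq_inner)
qed

lemma test_function_bump:
  assumes r: "r > 0" shows "test_function (bump r)"
proof -
  have C: "C_k n (bump r)" for n unfolding bump_def by (rule C_k_flat)
  have "{x. bump r x \<noteq> 0} \<subseteq> cball (0::real^'a) r" using bump_zero[OF r] by (force simp: not_le)
  then have "closure {x. bump r x \<noteq> 0} \<subseteq> cball (0::real^'a) r" by (rule closure_minimal) simp
  then have "compact (closure {x::real^'a. bump r x \<noteq> 0})"
    by (meson bounded_cball bounded_subset closed_closure compact_eq_bounded_closed)
  then show ?thesis unfolding test_function_def using C by blast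
qed

lemma test_function_partial:
  assumes \<phi>: "test_function \<phi>" and g: "\<And>x. GDERIV \<phi> x :> g x"
  shows "test_function (\<lambda>x. g x $ i)"
proof -
  have "C_k n (\<lambda>x. g x $ i)" for n
  proof -
    have "C_k (Suc n) \<phi>" using \<phi> unfolding test_function_def by blast
    then obtain g' where g': "\<And>x. GDERIV \<phi> x :> g' x" "\<And>i. C_k n (\<lambda>x. g' x $ i)" by auto
    have "g' = g" using GDERIV_unique[OF g'(1) g] by auto
    then show ?thesis using g'(2) by simp
  qed
  moreover define K where "K = closure {x. \<phi> x \<noteq> 0}"
  have K: "compact K" using \<phi> unfolding test_function_def K_def by simp
  have z: "g x = 0" if "x \<notin> K" for x
  proof (rule GDERIV_unique[OF g])
    have "open (- K)" using K by (simp add: compact_imp_closed open_Compl)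
    moreover have "\<phi> y = 0" if "y \<in> - K" for y
      using that closure_subset[of "{x. \<phi> x \<noteq> 0}"] unfolding K_def by blast
    ultimately have "(\<phi> has_derivative (\<lambda>h. 0)) (at x)"
      using that by (intro has_derivative_transform_within_open[of "\<lambda>_. 0" "\<lambda>h. 0" x UNIV "- K" \<phi>]) auto
    then show "GDERIV \<phi> x :> 0" unfolding gderiv_def by simp
  qed
  have "{x. g x $ i \<noteq> 0} \<subseteq> K" using z by force
  then have "closure {x. g x $ i \<noteq> 0} \<subseteq> K" using K by (intro closure_minimal) (auto simp: compact_imp_closed)
  then have "compact (closure {x. g x $ i \<noteq> 0})"
    using K by (meson bounded_subset closed_closure compact_eq_bounded_closed)
  ultimately show ?thesis unfolding test_function_def by blast
qed

lemma GDERIV_bound_lip: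
  fixes \<phi> :: "'a::euclidean_space \<Rightarrow> real"
  assumes g: "\<And>x. GDERIV \<phi> x :> g x" and b: "\<And>x. norm (g x) \<le> b"
  shows "\<bar>\<phi> x - \<phi> y\<bar> \<le> b * norm (x - y)"
proof -
  have "norm (\<phi> x - \<phi> y) \<le> b * norm (x - y)"
  proof (rule differentiable_bound[of UNIV \<phi> "\<lambda>x h. h \<bullet> g x"])
    show "(\<phi> has_derivative (\<lambda>h. h \<bullet> g x)) (at x within UNIV)" for x using g unfolding gderiv_def by simp
    show "onorm (\<lambda>h. h \<bullet> g x) \<le> b" for x
    proof (rule onorm_le)
      fix h
      have "norm (h \<bullet> g x) \<le> norm h * norm (g x)" by (simp add: Cauchy_Schwarz_ineq2)
      also have "\<dots> \<le> norm h * b" using b by (intro mult_left_mono) auto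
      finally show "norm (h \<bullet> g x) \<le> b * norm h" by (simp add: mult.commute)
    qed
  qed auto
  then show ?thesis by simp
qed

lemma test_function_gradient_lip:
  assumes \<phi>: "test_function \<phi>" and g: "\<And>x. GDERIV \<phi> x :> g x"
  shows "\<exists>L\<ge>0. \<forall>x y. norm (g x - g y) \<le> L * norm (x - y)"
proof -
  have "\<exists>L. \<forall>x y. \<bar>g x $ i - g y $ i\<bar> \<le> L * norm (x - y)" for i
  proof -
    have t: "test_function (\<lambda>x. g x $ i)" by (rule test_function_partial[OF \<phi> g])
    then have "C_k (Suc 0) (\<lambda>x. g x $ i)" unfolding test_function_def by blast
    then obtain g' where g': "\<And>x. GDERIV (\<lambda>x. g x $ i) x :> g' x" by auto
    obtain b where "\<And>x. norm (g' x) \<le> b" using test_function_gradient(2)[OF t g'] by blast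
    then show ?thesis using GDERIV_bound_lip[OF g'] by blast
  qed
  then obtain L where L: "\<And>i x y. \<bar>g x $ i - g y $ i\<bar> \<le> L i * norm (x - y)" by metis
  have "norm (g x - g y) \<le> (\<Sum>i\<in>UNIV. \<bar>L i\<bar>) * norm (x - y)" for x y
  proof -
    have "norm (g x - g y) \<le> (\<Sum>i\<in>UNIV. \<bar>(g x - g y) $ i\<bar>)" by (rule norm_le_l1_cart)
    also have "\<dots> \<le> (\<Sum>i\<in>UNIV. \<bar>L i\<bar> * norm (x - y))"
    proof (rule sum_mono)
      fix i
      have "\<bar>(g x - g y) $ i\<bar> \<le> L i * norm (x - y)" using L by simp
      also have "\<dots> \<le> \<bar>L i\<bar> * norm (x - y)" by (intro mult_right_mono) auto
      finally show "\<bar>(g x - g y) $ i\<bar> \<le> \<bar>L i\<bar> * norm (x - y)" .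
    qed
    finally show ?thesis by (simp add: sum_distrib_right)
  qed
  moreover have "(\<Sum>i\<in>UNIV. \<bar>L i\<bar>) \<ge> 0" by (intro sum_nonneg) auto
  ultimately show ?thesis by blast
qed

lemma GDERIV_remainder:
  fixes \<phi> :: "'a::euclidean_space \<Rightarrow> real"
  assumes g: "\<And>x. GDERIV \<phi> x :> g x" and L: "\<And>x y. norm (g x - g y) \<le> L * norm (x - y)" and L0: "0 \<le> L"
  shows "\<bar>\<phi> y - \<phi> x - (y - x) \<bullet> g x\<bar> \<le> L * (norm (y - x))\<^sup>2"
proof -
  have "norm (\<phi> y - \<phi> x - (y - x) \<bullet> g x) \<le> norm (y - x) * (L * norm (y - x))"
  proof (rule differentiable_bound_linearization[of x y "closed_segment x y" \<phi> "\<lambda>x h. h \<bullet> g x" x])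
    show "x + t *\<^sub>R (y - x) \<in> closed_segment x y" if "t \<in> {0..1}" for t
      using that unfolding closed_segment_def by (auto intro!: exI[of _ t] simp: algebra_simps)
    show "(\<phi> has_derivative (\<lambda>h. h \<bullet> g z)) (at z within closed_segment x y)" for z
      using g unfolding gderiv_def by (rule has_derivative_at_withinI)
    show "onorm ((\<lambda>h. h \<bullet> g z) - (\<lambda>h. h \<bullet> g x)) \<le> L * norm (y - x)" if z: "z \<in> closed_segment x y" for z
    proof (rule onorm_le)
      fix h
      have "norm (h \<bullet> g z - h \<bullet> g x) \<le> norm h * norm (g z - g x)"
        unfolding inner_diff_right[symmetric] by (simp add: Cauchy_Schwarz_ineq2)
      also have "\<dots> \<le> norm h * (L * norm (z - x))" using L by (intro mult_left_mono) auto
      also have "\<dots> \<le> norm h * (L * norm (y - x))"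
        using segment_bound1[OF z] L0 by (intro mult_left_mono) auto
      finally show "norm (((\<lambda>h. h \<bullet> g z) - (\<lambda>h. h \<bullet> g x)) h) \<le> L * norm (y - x) * norm h" by (simp add: algebra_simps)
    qed
  qed auto
  then show ?thesis by (simp add: power2_eq_square algebra_simps)
qed

lemma lborel_reflect: "distr lborel borel (\<lambda>y. x - y) = (lborel :: 'a::euclidean_space measure)"
proof -
  have "(lborel :: 'a measure) = density (distr lborel borel (\<lambda>y. x - y)) (\<lambda>_. 1)"
    using lborel_affine[of "-1" x] by simp
  also have "\<dots> = distr lborel borel (\<lambda>y. x - y)" by (simp add: density_1)
  finally show ?thesis by simp
qed

lemma compact_support_integrable:
  fixes \<psi> :: "'a::euclidean_space \<Rightarrow> real" and f :: "'a \<Rightarrow> 'b::euclidean_space"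
  assumes \<psi>: "\<psi> \<in> borel_measurable borel" "\<And>z. \<bar>\<psi> z\<bar> \<le> b" "\<And>z. norm z > r \<Longrightarrow> \<psi> z = 0"
    and f: "f \<in> borel_measurable borel" "\<And>y. norm (f y) \<le> B"
  shows "integrable lborel (\<lambda>y. \<psi> (x - y) *\<^sub>R f y)"
proof (rule Bochner_Integration.integrable_bound[where f="\<lambda>y. indicator (cball x r) y *\<^sub>R (b * B)"])
  have "integrable lborel (\<lambda>y. indicator (cball x r) y *\<^sub>R (b * B) :: real)"
    by (rule borel_integrable_compact) auto
  then show "integrable lborel (\<lambda>y. indicator (cball x r) y *\<^sub>R (b * B) :: real)" .
  have "(\<lambda>y. \<psi> (x - y)) \<in> borel_measurable borel" using \<psi>(1) by measurable
  then show "(\<lambda>y. \<psi> (x - y) *\<^sub>R f y) \<in> borel_measurable lborel" using f(1) by simp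
  have b: "0 \<le> b" using \<psi>(2) abs_ge_zero order_trans by blast
  have B: "0 \<le> B" using f(2) norm_ge_zero order_trans by blast
  have "norm (\<psi> (x - y) *\<^sub>R f y) \<le> norm (indicator (cball x r) y *\<^sub>R (b * B) :: real)" for y
  proof (cases "y \<in> cball x r")
    case True
    have "\<bar>\<psi> (x - y)\<bar> * norm (f y) \<le> b * B" using \<psi>(2) f(2) b by (intro mult_mono) auto
    then show ?thesis using True b B by simp
  next
    case False
    then show ?thesis using \<psi>(3)[of "x - y"] by (simp add: dist_norm)
  qed
  then show "AE y in lborel. norm (\<psi> (x - y) *\<^sub>R f y) \<le> norm (indicator (cball x r) y *\<^sub>R (b * B) :: real)" by simp
qed

definition convolve :: "('a::euclidean_space \<Rightarrow> real) \<Rightarrow> ('a \<Rightarrow> 'b::euclidean_space) \<Rightarrow> 'a \<Rightarrow> 'b" where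
  "convolve \<eta> f x = (\<integral>y. \<eta> (x - y) *\<^sub>R f y \<partial>lborel)"

text \<open>The expansion of the smooth factor gives the gradient of the convolution and, at the same time, a remainder that is
quadratic uniformly in x. The latter is what \<open>mollify_smooth\<close> uses.\<close>

lemma convolve_remainder:
  fixes f :: "real^'d \<Rightarrow> 'b::euclidean_space"
  assumes \<eta>: "test_function \<eta>" and g: "\<And>x. GDERIV \<eta> x :> g x"
    and f: "f \<in> borel_measurable borel" "\<And>y. norm (f y) \<le> B"
  shows "\<exists>C\<ge>0. \<forall>x k. integrable lborel (\<lambda>y. (k \<bullet> g (x - y)) *\<^sub>R f y) \<and>
    norm (convolve \<eta> f (x + k) - convolve \<eta> f x - (\<integral>y. (k \<bullet> g (x - y)) *\<^sub>R f y \<partial>lborel)) \<le> C * (norm k)\<^sup>2"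
proof -
  obtain L where L: "L \<ge> 0" "\<And>x y. norm (g x - g y) \<le> L * norm (x - y)" using test_function_gradient_lip[OF \<eta> g] by blast
  obtain b r0 where b: "\<And>x. \<bar>\<eta> x\<bar> \<le> b" and r0: "\<And>x. norm x > r0 \<Longrightarrow> \<eta> x = 0" using test_function_bounds[OF \<eta>] by blast
  obtain b' where b': "\<And>x. norm (g x) \<le> b'" using test_function_gradient(2)[OF \<eta> g] by blast
  define r where "r = max r0 0 + 1"
  have \<eta>r: "\<eta> x = 0" if "norm x > r" for x using r0[of x] that unfolding r_def by simp
  have gr: "g x = 0" if "norm x > r" for x
  proof (rule GDERIV_unique[OF g])
    have "open (- cball 0 r :: (real^'d) set)" by (simp add: open_Compl)
    then have "(\<eta> has_derivative (\<lambda>h. 0)) (at x)"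
      using that \<eta>r by (intro has_derivative_transform_within_open[of "\<lambda>_. 0" "\<lambda>h. 0" x UNIV "- cball 0 r" \<eta>]) auto
    then show "GDERIV \<eta> x :> 0" unfolding gderiv_def by simp
  qed
  have \<eta>m: "\<eta> \<in> borel_measurable borel" by (rule borel_measurable_continuous_onI[OF GDERIV_continuous[OF g]])
  have gm: "g \<in> borel_measurable borel" by (rule borel_measurable_continuous_onI[OF test_function_gradient(1)[OF \<eta> g]])
  have B: "0 \<le> B" using f(2) norm_ge_zero order_trans by blast
  define V where "V = measure lborel (cball 0 r :: (real^'d) set)"
  have Vc: "measure lborel (cball c r :: (real^'d) set) = V" for c
    unfolding V_def by (simp add: content_cball r_def)
  have "integrable lborel (\<lambda>y. (k \<bullet> g (x - y)) *\<^sub>R f y) \<and>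
    norm (convolve \<eta> f (x + k) - convolve \<eta> f x - (\<integral>y. (k \<bullet> g (x - y)) *\<^sub>R f y \<partial>lborel)) \<le> (2 * V * L * B) * (norm k)\<^sup>2" for x k
  proof -
    have ic: "integrable lborel (indicat_real (cball c r))" for c :: "real^'d"
      by (intro integrable_real_indicator emeasure_bounded_finite bounded_cball) simp
    have i1: "integrable lborel (\<lambda>y. \<eta> (x + k - y) *\<^sub>R f y)" "integrable lborel (\<lambda>y. \<eta> (x - y) *\<^sub>R f y)"
      by (rule compact_support_integrable[OF \<eta>m b \<eta>r f]; assumption)+
    have i2: "integrable lborel (\<lambda>y. (k \<bullet> g (x - y)) *\<^sub>R f y)"
    proof (rule compact_support_integrable[where b="norm k * b'" and \<psi>="\<lambda>z. k \<bullet> g z", OF _ _ _ f])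
      show "(\<lambda>z. k \<bullet> g z) \<in> borel_measurable borel" using gm by measurable
      show "\<bar>k \<bullet> g z\<bar> \<le> norm k * b'" for z
        using order_trans[OF Cauchy_Schwarz_ineq2 mult_left_mono[OF b' norm_ge_zero]] .
      show "k \<bullet> g z = 0" if "norm z > r" for z using gr[OF that] by simp
    qed
    define h where "h y = \<eta> (x + k - y) - \<eta> (x - y) - k \<bullet> g (x - y)" for y
    have "convolve \<eta> f (x + k) - convolve \<eta> f x - (\<integral>y. (k \<bullet> g (x - y)) *\<^sub>R f y \<partial>lborel) = (\<integral>y. h y *\<^sub>R f y \<partial>lborel)"
      unfolding convolve_def h_def scaleR_diff_left using i1 i2 by simp
    also have "norm \<dots> \<le> (\<integral>y. (L * (norm k)\<^sup>2 * B) *\<^sub>R (indicator (cball (x + k) r) y + indicator (cball x r) y) \<partial>lborel)"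
    proof (rule Bochner_Integration.integral_norm_bound_integral)
      show "integrable lborel (\<lambda>y. h y *\<^sub>R f y)" unfolding h_def scaleR_diff_left using i1 i2 by simp
      show "integrable lborel (\<lambda>y. (L * (norm k)\<^sup>2 * B) *\<^sub>R (indicator (cball (x + k) r) y + indicator (cball x r) y) :: real)"
        by (intro integrable_scaleR_right Bochner_Integration.integrable_add ic)
      fix y
      have hb: "\<bar>h y\<bar> \<le> L * (norm k)\<^sup>2"
        using GDERIV_remainder[OF g L(2,1), of "x + k - y" "x - y"] unfolding h_def by (simp add: algebra_simps)
      show "norm (h y *\<^sub>R f y) \<le> (L * (norm k)\<^sup>2 * B) *\<^sub>R (indicator (cball (x + k) r) y + indicator (cball x r) y)"
      proof (cases "y \<in> cball (x + k) r \<or> y \<in> cball x r")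
        case True
        then have "1 \<le> (indicator (cball (x + k) r) y + indicator (cball x r) y :: real)" by (auto simp: indicator_def)
        moreover have "norm (h y *\<^sub>R f y) \<le> L * (norm k)\<^sup>2 * B" using hb f(2) L(1) by (auto intro!: mult_mono)
        moreover have "0 \<le> L * (norm k)\<^sup>2 * B" using L B by simp
        ultimately show ?thesis using mult_left_mono[of 1 "indicator (cball (x + k) r) y + indicator (cball x r) y" "L * (norm k)\<^sup>2 * B"] by simp
      next
        case False
        then have "norm (x + k - y) > r" "norm (x - y) > r" by (auto simp: dist_norm)
        then have "h y = 0" unfolding h_def by (simp add: \<eta>r gr)
        then show ?thesis using L B by simp
      qed
    qed
    also have "\<dots> = (L * (norm k)\<^sup>2 * B) * (V + V)"
      by (subst integral_scaleR_right, subst Bochner_Integration.integral_add[OF ic ic]) (simp add: Vc)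
    finally show ?thesis using i2 by (simp add: algebra_simps)
  qed
  moreover have "0 \<le> 2 * V * L * B" unfolding V_def using L B by simp
  ultimately show ?thesis by blast
qed

text \<open>Differentiating replaces \<open>\<eta>\<close> by its partial derivatives, which are test functions again; hence induction on the
order of differentiability.\<close>

lemma convolve_test_function:
  fixes f :: "real^'d \<Rightarrow> real"
  assumes \<eta>: "test_function \<eta>" and f: "f \<in> borel_measurable borel" "\<And>y. norm (f y) \<le> B" and R: "\<And>y. norm y > R \<Longrightarrow> f y = 0"
  shows "test_function (convolve \<eta> f)"
proof -
  have step: "\<exists>g. (\<forall>x. GDERIV \<eta> x :> g x) \<and> (\<forall>x. GDERIV (convolve \<eta> f) x :> (\<chi> i. convolve (\<lambda>x. g x $ i) f x))"
    if \<eta>: "test_function \<eta>" for \<eta> :: "real^'d \<Rightarrow> real"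
  proof -
    have "C_k (Suc 0) \<eta>" using \<eta> unfolding test_function_def by blast
    then obtain g where g: "\<And>x. GDERIV \<eta> x :> g x" by auto
    obtain C where C: "C \<ge> 0" "\<And>x k. norm (convolve \<eta> f (x + k) - convolve \<eta> f x - (\<integral>y. (k \<bullet> g (x - y)) *\<^sub>R f y \<partial>lborel)) \<le> C * (norm k)\<^sup>2"
      using convolve_remainder[OF \<eta> g f] by blast
    have ii: "integrable lborel (\<lambda>y. (g (x - y) $ i) *\<^sub>R f y)" for x i
    proof -
      have t: "test_function (\<lambda>x. g x $ i)" by (rule test_function_partial[OF \<eta> g])
      obtain b r where "\<And>x. \<bar>g x $ i\<bar> \<le> b" "\<And>x. norm x > r \<Longrightarrow> g x $ i = 0" using test_function_bounds[OF t] by blast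
      moreover have "(\<lambda>x. g x $ i) \<in> borel_measurable borel"
        using t C_k_continuous unfolding test_function_def by (intro borel_measurable_continuous_onI) blast
      ultimately show ?thesis using f by (intro compact_support_integrable[where \<psi>="\<lambda>x. g x $ i"]) auto
    qed
    have D: "(\<integral>y. (k \<bullet> g (x - y)) *\<^sub>R f y \<partial>lborel) = k \<bullet> (\<chi> i. convolve (\<lambda>x. g x $ i) f x)" for k x
    proof -
      have "(\<integral>y. (k \<bullet> g (x - y)) *\<^sub>R f y \<partial>lborel) = (\<integral>y. (\<Sum>i\<in>UNIV. k $ i *\<^sub>R ((g (x - y) $ i) *\<^sub>R f y)) \<partial>lborel)"
        by (rule Bochner_Integration.integral_cong) (simp_all add: inner_vec_def sum_distrib_right mult.assoc)
      also have "\<dots> = (\<Sum>i\<in>UNIV. k $ i *\<^sub>R convolve (\<lambda>x. g x $ i) f x)"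
        unfolding convolve_def by (subst Bochner_Integration.integral_sum) (use ii in \<open>auto intro!: integrable_scaleR_right sum.cong\<close>)
      finally show ?thesis by (simp add: inner_vec_def)
    qed
    have "GDERIV (convolve \<eta> f) x :> (\<chi> i. convolve (\<lambda>x. g x $ i) f x)" for x
      unfolding gderiv_def has_derivative_at_alt
    proof (intro conjI allI impI)
      fix e :: real assume e: "e > 0"
      have "norm (convolve \<eta> f y - convolve \<eta> f x - (y - x) \<bullet> (\<chi> i. convolve (\<lambda>x. g x $ i) f x)) \<le> e * norm (y - x)"
        if y: "norm (y - x) < e / (C + 1)" for y
      proof -
        have "norm (convolve \<eta> f y - convolve \<eta> f x - (y - x) \<bullet> (\<chi> i. convolve (\<lambda>x. g x $ i) f x)) \<le> C * (norm (y - x))\<^sup>2"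
          using C(2)[of x "y - x"] unfolding D by simp
        also have "\<dots> = C * norm (y - x) * norm (y - x)" by (simp add: power2_eq_square)
        also have "\<dots> \<le> e * norm (y - x)"
        proof (rule mult_right_mono)
          have "(C + 1) * norm (y - x) \<le> e" using y C(1) by (simp add: field_simps)
          then show "C * norm (y - x) \<le> e" using norm_ge_zero[of "y - x"] unfolding distrib_right mult_1_left by linarith
        qed simp
        finally show ?thesis .
      qed
      then show "\<exists>d>0. \<forall>y. norm (y - x) < d \<longrightarrow> norm (convolve \<eta> f y - convolve \<eta> f x - (y - x) \<bullet> (\<chi> i. convolve (\<lambda>x. g x $ i) f x)) \<le> e * norm (y - x)"
        using e C(1) by (intro exI[of _ "e / (C + 1)"]) auto
    qed (rule bounded_linear_inner_left)
    then show ?thesis using g by blast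
  qed
  have "C_k n (convolve \<eta> f)" if "test_function \<eta>" for n and \<eta> :: "real^'d \<Rightarrow> real"
    using that
  proof (induction n arbitrary: \<eta>)
    case 0
    obtain g where "\<forall>x. GDERIV (convolve \<eta> f) x :> (\<chi> i. convolve (\<lambda>x. g x $ i) f x)" using step[OF 0] by blast
    then have "continuous_on UNIV (convolve \<eta> f)" by (intro GDERIV_continuous) blast
    then show ?case by simp
  next
    case (Suc n)
    obtain g where g: "\<forall>x. GDERIV \<eta> x :> g x" "\<forall>x. GDERIV (convolve \<eta> f) x :> (\<chi> i. convolve (\<lambda>x. g x $ i) f x)"
      using step[OF Suc.prems] by blast
    have "C_k n (convolve (\<lambda>x. g x $ i) f)" for i
      using g(1) by (intro Suc.IH test_function_partial[OF Suc.prems]) auto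
    then show ?case using g(2) unfolding C_k.simps by (intro exI[of _ "\<lambda>x. \<chi> i. convolve (\<lambda>x. g x $ i) f x"]) (auto simp: eta_contract_eq)
  qed
  moreover have "compact (closure {x. convolve \<eta> f x \<noteq> 0})"
  proof -
    obtain b r where b: "\<And>x. \<bar>\<eta> x\<bar> \<le> b" "\<And>x. norm x > r \<Longrightarrow> \<eta> x = 0" using test_function_bounds[OF \<eta>] by blast
    have "convolve \<eta> f x = 0" if x: "norm x > r + R" for x
    proof -
      have fz: "\<eta> (x - y) *\<^sub>R f y = 0" for y
      proof (cases "norm y > R")
        case False
        then have "norm (x - y) > r" using x norm_triangle_sub[of x y] by linarith
        then show ?thesis using b by simp
      qed (simp add: R)
      show ?thesis unfolding convolve_def fz by simp
    qed
    then have "{x. convolve \<eta> f x \<noteq> 0} \<subseteq> cball 0 (r + R)" by (force simp: not_le)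
    then have "closure {x. convolve \<eta> f x \<noteq> 0} \<subseteq> cball 0 (r + R)" by (rule closure_minimal) simp
    then show ?thesis by (meson bounded_cball bounded_subset closed_closure compact_eq_bounded_closed)
  qed
  ultimately show ?thesis unfolding test_function_def[of "convolve \<eta> f"] using \<eta> by blast
qed

definition mollifier_density :: "real \<Rightarrow> real^'d \<Rightarrow> real" where
  "mollifier_density r x = bump r x / (\<integral>y. bump r (y::real^'d) \<partial>lborel)"

definition mollifier :: "real \<Rightarrow> (real^'d) measure" where
  "mollifier r = density lborel (\<lambda>x. ennreal (mollifier_density r x))"

lemma bump_integrable: "r > 0 \<Longrightarrow> integrable lborel (bump r :: real^'d \<Rightarrow> real)"
proof -
  assume r: "r > 0"
  obtain b r0 where b: "\<And>x::real^'d. \<bar>bump r x\<bar> \<le> b" "\<And>x::real^'d. norm x > r0 \<Longrightarrow> bump r x = 0"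
    using test_function_bounds[OF test_function_bump[OF r]] by blast
  have m: "(bump r :: real^'d \<Rightarrow> real) \<in> borel_measurable borel"
    using test_function_bump[OF r] C_k_continuous unfolding test_function_def by (intro borel_measurable_continuous_onI) blast
  have "integrable lborel (\<lambda>y::real^'d. bump r (0 - y) *\<^sub>R (1::real))"
    by (rule compact_support_integrable[OF m b, where f="\<lambda>_. 1" and B=1]) auto
  moreover have "bump r (0 - y) = bump r y" for y :: "real^'d" unfolding bump_def by simp
  ultimately show ?thesis by simp
qed

lemma bump_integral_pos:
  assumes r: "r > 0" shows "(\<integral>y. bump r (y::real^'d) \<partial>lborel) > 0"
proof -
  have "(\<integral>y. bump r (y::real^'d) \<partial>lborel) \<noteq> 0"
  proof
    assume "(\<integral>y. bump r (y::real^'d) \<partial>lborel) = 0"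
    then have "AE y in lborel. bump r (y::real^'d) = 0"
      using integral_nonneg_eq_0_iff_AE[OF bump_integrable[OF r]] bump_nonneg by auto
    then have "AE y in lborel. (y::real^'d) \<notin> ball 0 r"
      by eventually_elim (use bump_pos[OF r] in force)
    then have "emeasure lborel {y \<in> space lborel. (y::real^'d) \<in> ball 0 r} = 0"
      by (intro emeasure_eq_0_AE) auto
    moreover have "{y \<in> space lborel. (y::real^'d) \<in> ball 0 r} = ball 0 r" by auto
    ultimately have "emeasure lborel (ball (0::real^'d) r) = 0" by (simp only:)
    moreover have "emeasure lborel (ball (0::real^'d) r) > 0"
      using r by (simp add: emeasure_ball)
    ultimately show False by simp
  qed
  moreover have "(\<integral>y. bump r (y::real^'d) \<partial>lborel) \<ge> 0" by (rule Bochner_Integration.integral_nonneg) (rule bump_nonneg)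
  ultimately show ?thesis by linarith
qed

lemma mollifier_density_test: "r > 0 \<Longrightarrow> test_function (mollifier_density r)"
proof -
  assume r: "r > 0"
  have "C_k n (\<lambda>x::real^'a. (1 / (\<integral>y. bump r (y::real^'a) \<partial>lborel)) * bump r x)" for n
    using test_function_bump[OF r] unfolding test_function_def by (intro C_k_mult C_k_const) auto
  then have C: "C_k n (mollifier_density r :: real^'a \<Rightarrow> real)" for n
    by (rule back_subst[of "C_k n"]) (auto simp: fun_eq_iff mollifier_density_def)
  have "{x::real^'a. mollifier_density r x \<noteq> 0} = {x. bump r x \<noteq> 0}"
    unfolding mollifier_density_def using bump_integral_pos[OF r, where 'd='a] by auto
  then show ?thesis using C test_function_bump[OF r, where 'a='a] unfolding test_function_def by simp
qed

lemma mollifier_density_props: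
  fixes x :: "real^'d"
  assumes r: "r > 0"
  shows "0 \<le> mollifier_density r x" "norm x > r \<Longrightarrow> mollifier_density r x = 0" "(mollifier_density r :: real^'d \<Rightarrow> real) \<in> borel_measurable borel"
proof -
  show "0 \<le> mollifier_density r x" unfolding mollifier_density_def by (intro divide_nonneg_nonneg bump_nonneg less_imp_le[OF bump_integral_pos[OF r]])
  show "norm x > r \<Longrightarrow> mollifier_density r x = 0" unfolding mollifier_density_def using bump_zero[OF r, of x] by simp
  show "(mollifier_density r :: real^'d \<Rightarrow> real) \<in> borel_measurable borel"
    using mollifier_density_test[OF r] C_k_continuous unfolding test_function_def by (intro borel_measurable_continuous_onI) blast
qed

lemma mollifier_prob:
  assumes r: "r > 0"
  shows "prob_space (mollifier r :: (real^'d) measure)" "sets (mollifier r :: (real^'d) measure) = sets borel"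
    "AE x in (mollifier r :: (real^'d) measure). norm x \<le> r"
proof -
  show "sets (mollifier r :: (real^'d) measure) = sets borel" unfolding mollifier_def by simp
  have i: "integrable lborel (mollifier_density r :: real^'d \<Rightarrow> real)"
    unfolding mollifier_density_def by (intro integrable_divide bump_integrable r)
  have "(\<integral>x. mollifier_density r (x::real^'d) \<partial>lborel) = 1"
    unfolding mollifier_density_def using bump_integral_pos[OF r, where 'd='d] by simp
  then have "(\<integral>\<^sup>+ x. ennreal (mollifier_density r (x::real^'d)) \<partial>lborel) = 1"
    by (subst nn_integral_eq_integral[OF i]) (auto intro: mollifier_density_props(1)[OF r])
  then show "prob_space (mollifier r :: (real^'d) measure)"
    unfolding mollifier_def using mollifier_density_props(3)[OF r, where 'd='d]
    by (intro prob_spaceI) (subst emeasure_density, auto)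
  show "AE x in (mollifier r :: (real^'d) measure). norm x \<le> r"
    unfolding mollifier_def using mollifier_density_props[OF r, where 'd='d]
    by (subst AE_density) (auto simp: not_le[symmetric])
qed

text \<open>An average over a probability measure rather than a convolution of functions, so that bounds, Lipschitz constants and
\<open>c11\<close> estimates pass to the mollification without loss.\<close>

definition mollify :: "real \<Rightarrow> (real^'d \<Rightarrow> 'b::euclidean_space) \<Rightarrow> real^'d \<Rightarrow> 'b" where
  "mollify r f x = (\<integral>z. f (x - z) \<partial>mollifier r)"

lemma mollify_convolve:
  fixes f :: "real^'d \<Rightarrow> 'b::euclidean_space"
  assumes r: "r > 0" and f: "f \<in> borel_measurable borel"
  shows "mollify r f x = convolve (mollifier_density r) f x"
proof -
  have m: "(\<lambda>y. f (x - y)) \<in> borel_measurable borel" using f by measurable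
  have m2: "(\<lambda>z. mollifier_density r z *\<^sub>R f (x - z)) \<in> borel_measurable borel"
    using m mollifier_density_props(3)[OF r] by measurable
  have "mollify r f x = (\<integral>z. mollifier_density r z *\<^sub>R f (x - z) \<partial>lborel)"
    unfolding mollify_def mollifier_def using m mollifier_density_props[OF r]
    by (subst integral_density) auto
  also have "\<dots> = (\<integral>z. mollifier_density r z *\<^sub>R f (x - z) \<partial>distr lborel borel (\<lambda>y. x - y))"
    unfolding lborel_reflect ..
  also have "\<dots> = convolve (mollifier_density r) f x"
    unfolding convolve_def by (subst integral_distr) (use m2 in auto)
  finally show ?thesis .
qed

section \<open>Functions with Lipschitz derivative\<close>

text \<open>Lipschitz constant a, and a linear expansion at every point with remainder \<open>b |y - x|\<^sup>2\<close>: functions of class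
\<open>C\<^sup>1\<^sup>,\<^sup>1\<close> with explicit constants. Only the expansion has to be propagated under
composition and averaging; bounds of the derivative are consequences (\<open>c11_deriv\<close>).\<close>

definition c11 :: "real \<Rightarrow> real \<Rightarrow> ('a::euclidean_space \<Rightarrow> 'b::euclidean_space) \<Rightarrow> bool" where
  "c11 a b f \<longleftrightarrow> 0 \<le> a \<and> 0 \<le> b \<and> (\<forall>x y. norm (f x - f y) \<le> a * norm (x - y)) \<and>
     (\<exists>f'. (\<forall>x. linear (f' x)) \<and> (\<forall>x y. norm (f y - f x - f' x (y - x)) \<le> b * (norm (y - x))\<^sup>2))"

lemma c11_lip: "c11 a b f \<Longrightarrow> norm (f x - f y) \<le> a * norm (x - y)"
  unfolding c11_def by blast

lemma c11_nonneg: "c11 a b f \<Longrightarrow> 0 \<le> a" "c11 a b f \<Longrightarrow> 0 \<le> b"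
  unfolding c11_def by blast+

lemma c11_mono: "c11 a b f \<Longrightarrow> b \<le> b' \<Longrightarrow> c11 a b' f"
  unfolding c11_def by (meson mult_right_mono order_trans zero_le_power2)

text \<open>The bound of f' comes from difference quotients. For its Lipschitz constant, expand f at x and at y to the same point
\<open>y + k\<close> with \<open>|k| = |x - y| = r\<close>. The three remainders are at most \<open>b r\<^sup>2\<close>, \<open>4 b r\<^sup>2\<close> and \<open>b r\<^sup>2\<close>, whence the factor 6.\<close>

lemma c11_deriv:
  assumes f: "c11 a b f"
  obtains f' where "\<And>x. linear (f' x)" "\<And>x y. norm (f y - f x - f' x (y - x)) \<le> b * (norm (y - x))\<^sup>2"
    "\<And>x v. norm (f' x v) \<le> a * norm v" "\<And>x y v. norm (f' x v - f' y v) \<le> 6 * b * norm (x - y) * norm v"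
proof -
  obtain f' where lin: "\<And>x. linear (f' x)" and rem: "\<And>x y. norm (f y - f x - f' x (y - x)) \<le> b * (norm (y - x))\<^sup>2"
    using f unfolding c11_def by blast
  have a: "0 \<le> a" and b: "0 \<le> b" using c11_nonneg[OF f] by auto
  have n: "norm (f' x v) \<le> a * norm v" for x v
  proof (rule field_le_epsilon)
    fix e :: real assume e: "e > 0"
    define t where "t = e / (b * (norm v)\<^sup>2 + 1)"
    have bv: "0 \<le> b * (norm v)\<^sup>2" using b by simp
    have t: "t > 0" "b * (norm v)\<^sup>2 * t \<le> e" using e bv unfolding t_def by (auto simp: field_simps add_nonneg_pos)
    have "norm (f (x + t *\<^sub>R v) - f x - t *\<^sub>R f' x v) \<le> b * (t * norm v)\<^sup>2"
      using rem[of "x + t *\<^sub>R v" x] t by (simp add: linear_scale[OF lin])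
    moreover have "norm (f (x + t *\<^sub>R v) - f x) \<le> a * (t * norm v)"
      using c11_lip[OF f, of "x + t *\<^sub>R v" x] t by simp
    ultimately have "norm (t *\<^sub>R f' x v) \<le> a * (t * norm v) + b * (t * norm v)\<^sup>2"
      using norm_triangle_ineq4[of "f (x + t *\<^sub>R v) - f x" "f (x + t *\<^sub>R v) - f x - t *\<^sub>R f' x v"] by simp
    then have "t * norm (f' x v) \<le> t * (a * norm v + b * (norm v)\<^sup>2 * t)"
      using t by (simp add: power2_eq_square algebra_simps)
    then have "norm (f' x v) \<le> a * norm v + b * (norm v)\<^sup>2 * t" using t by simp
    then show "norm (f' x v) \<le> a * norm v + e" using t by linarith
  qed
  have l: "norm (f' x v - f' y v) \<le> 6 * b * norm (x - y) * norm v" for x y v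
  proof (cases "v = 0 \<or> x = y")
    case True
    then show ?thesis using linear_0[OF lin] by auto
  next
    case False
    define r where "r = norm (x - y)"
    define s where "s = r / norm v"
    define k where "k = s *\<^sub>R v"
    have r: "r > 0" and s: "s > 0" using False unfolding r_def s_def by auto
    have k: "norm k = r" using False s unfolding k_def s_def r_def by simp
    have yx: "norm (y - x) = r" unfolding r_def by (rule norm_minus_commute)
    have ykx: "norm (y + k - x) \<le> 2 * r" using norm_triangle_ineq[of "y - x" k] k yx by (simp add: algebra_simps)
    define e1 where "e1 = f (y + k) - f y - f' y k"
    define e2 where "e2 = f (y + k) - f x - f' x (y + k - x)"
    define e3 where "e3 = f y - f x - f' x (y - x)"
    have "norm e1 \<le> b * r\<^sup>2" using rem[of "y + k" y] k unfolding e1_def by simp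
    moreover have "norm e2 \<le> 4 * (b * r\<^sup>2)"
    proof -
      have "norm e2 \<le> b * (norm (y + k - x))\<^sup>2" unfolding e2_def by (rule rem)
      also have "\<dots> \<le> b * (2 * r)\<^sup>2" using ykx b by (intro mult_left_mono power_mono) auto
      finally show ?thesis by (simp add: power2_eq_square algebra_simps)
    qed
    moreover have "norm e3 \<le> b * r\<^sup>2" using rem[of y x] yx unfolding e3_def by simp
    moreover have "norm (e1 - e2 + e3) \<le> norm e1 + norm e2 + norm e3"
      by (meson add_right_mono norm_triangle_ineq norm_triangle_ineq4 order_trans)
    moreover have E: "f' x k - f' y k = e1 - e2 + e3"
    proof -
      have "f' x (y + k - x) = f' x (y - x) + f' x k"
        using linear_add[OF lin[of x], of "y - x" k] by (simp add: algebra_simps)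
      then show ?thesis unfolding e1_def e2_def e3_def by simp
    qed
    ultimately have "norm (f' x k - f' y k) \<le> 6 * (b * r\<^sup>2)" unfolding E by linarith
    moreover have "f' x k - f' y k = s *\<^sub>R (f' x v - f' y v)"
      unfolding k_def linear_scale[OF lin] by (simp add: scaleR_diff_right)
    ultimately have "s * norm (f' x v - f' y v) \<le> 6 * (b * r\<^sup>2)" using s by simp
    also have "\<dots> = s * (6 * b * r * norm v)" unfolding s_def using False by (simp add: power2_eq_square)
    finally show ?thesis using s unfolding r_def by simp
  qed
  show thesis by (rule that[OF lin rem n l])
qed

text \<open>With \<open>c11_euler_step\<close> this tells how the constants grow when a function is composed with an Euler step of size h:
a is multiplied by \<open>1 + O(h)\<close> and b likewise, up to an additional \<open>O(h)\<close>.\<close>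

lemma c11_comp:
  assumes f: "c11 a b f" and A: "c11 p q A"
  shows "c11 (a * p) (b * p\<^sup>2 + a * q) (\<lambda>x. f (A x))"
proof -
  obtain f' where f': "\<And>x. linear (f' x)" "\<And>x y. norm (f y - f x - f' x (y - x)) \<le> b * (norm (y - x))\<^sup>2"
    "\<And>x v. norm (f' x v) \<le> a * norm v" using c11_deriv[OF f] by metis
  obtain A' where A': "\<And>x. linear (A' x)" "\<And>x y. norm (A y - A x - A' x (y - x)) \<le> q * (norm (y - x))\<^sup>2"
    using c11_deriv[OF A] by metis
  note nn = c11_nonneg[OF f] c11_nonneg[OF A]
  have "norm (f (A y) - f (A x) - f' (A x) (A' x (y - x))) \<le> (b * p\<^sup>2 + a * q) * (norm (y - x))\<^sup>2" for x y
  proof -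
    have "norm (f (A y) - f (A x) - f' (A x) (A y - A x)) \<le> b * (norm (A y - A x))\<^sup>2" by (rule f')
    also have "\<dots> \<le> b * (p * norm (y - x))\<^sup>2" using c11_lip[OF A] nn by (intro mult_left_mono power_mono) auto
    finally have 1: "norm (f (A y) - f (A x) - f' (A x) (A y - A x)) \<le> b * (p * norm (y - x))\<^sup>2" .
    have "norm (f' (A x) (A y - A x - A' x (y - x))) \<le> a * norm (A y - A x - A' x (y - x))" by (rule f')
    also have "\<dots> \<le> a * (q * (norm (y - x))\<^sup>2)" using A' nn by (intro mult_left_mono) auto
    finally have 2: "norm (f' (A x) (A y - A x - A' x (y - x))) \<le> a * (q * (norm (y - x))\<^sup>2)" .
    have "f (A y) - f (A x) - f' (A x) (A' x (y - x)) = (f (A y) - f (A x) - f' (A x) (A y - A x)) + f' (A x) (A y - A x - A' x (y - x))"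
      by (simp add: linear_diff[OF f'(1)])
    then show ?thesis using norm_triangle_mono[OF 1 2] by (simp add: power_mult_distrib algebra_simps)
  qed
  moreover have "linear (\<lambda>v. f' (A x) (A' x v))" for x
    using linear_compose[OF A'(1) f'(1)] by (simp add: comp_def)
  moreover have "norm (f (A x) - f (A y)) \<le> a * p * norm (x - y)" for x y
  proof -
    have "norm (f (A x) - f (A y)) \<le> a * norm (A x - A y)" by (rule c11_lip[OF f])
    also have "\<dots> \<le> a * (p * norm (x - y))" using c11_lip[OF A] nn by (intro mult_left_mono) auto
    finally show ?thesis by (simp add: mult.assoc)
  qed
  ultimately show ?thesis unfolding c11_def using nn
    by (intro conjI exI[of _ "\<lambda>x v. f' (A x) (A' x v)"]) auto
qed

lemma c11_euler_step:
  fixes W :: "'a::euclidean_space \<Rightarrow> 'a"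
  assumes W: "c11 p q W" and h: "0 \<le> h"
  shows "c11 (1 + h * p) (h * q) (\<lambda>x. x + h *\<^sub>R W x)"
proof -
  obtain W' where W': "\<And>x. linear (W' x)" "\<And>x y. norm (W y - W x - W' x (y - x)) \<le> q * (norm (y - x))\<^sup>2"
    using c11_deriv[OF W] by metis
  have "norm ((y + h *\<^sub>R W y) - (x + h *\<^sub>R W x) - ((y - x) + h *\<^sub>R W' x (y - x))) \<le> h * q * (norm (y - x))\<^sup>2" for x y
  proof -
    have "(y + h *\<^sub>R W y) - (x + h *\<^sub>R W x) - ((y - x) + h *\<^sub>R W' x (y - x)) = h *\<^sub>R (W y - W x - W' x (y - x))"
      by (simp add: algebra_simps)
    then show ?thesis using mult_left_mono[OF W'(2)[of y x] h] h by (simp add: mult.assoc)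
  qed
  moreover have "linear (\<lambda>v. v + h *\<^sub>R W' x v)" for x
    using W'(1)[of x] by (auto intro!: linearI simp: linear_add linear_scale algebra_simps)
  moreover have "norm ((x + h *\<^sub>R W x) - (y + h *\<^sub>R W y)) \<le> (1 + h * p) * norm (x - y)" for x y
  proof -
    have eq: "(x + h *\<^sub>R W x) - (y + h *\<^sub>R W y) = (x - y) + h *\<^sub>R (W x - W y)" by (simp add: algebra_simps)
    have "norm ((x + h *\<^sub>R W x) - (y + h *\<^sub>R W y)) \<le> norm (x - y) + h * norm (W x - W y)"
      unfolding eq using norm_triangle_ineq[of "x - y" "h *\<^sub>R (W x - W y)"] h by simp
    also have "\<dots> \<le> norm (x - y) + h * (p * norm (x - y))"
      using c11_lip[OF W] h by (intro add_left_mono mult_left_mono) auto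
    finally show ?thesis by (simp add: algebra_simps)
  qed
  ultimately show ?thesis unfolding c11_def using c11_nonneg[OF W] h
    by (intro conjI exI[of _ "\<lambda>x v. v + h *\<^sub>R W' x v"]) auto
qed

lemma c11_average:
  fixes f :: "'a::euclidean_space \<Rightarrow> 'b::euclidean_space"
  assumes f: "c11 a b f" and \<kappa>: "prob_space \<kappa>" "sets \<kappa> = sets borel" and fi: "\<And>x. integrable \<kappa> (\<lambda>z. f (x - z))"
  shows "c11 a b (\<lambda>x. \<integral>z. f (x - z) \<partial>\<kappa>)"
proof -
  interpret prob_space \<kappa> by fact
  obtain f' where f': "\<And>x. linear (f' x)" "\<And>x y. norm (f y - f x - f' x (y - x)) \<le> b * (norm (y - x))\<^sup>2"
    "\<And>x v. norm (f' x v) \<le> a * norm v" "\<And>x y v. norm (f' x v - f' y v) \<le> 6 * b * norm (x - y) * norm v"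
    using c11_deriv[OF f] by blast
  have i': "integrable \<kappa> (\<lambda>z. f' (x - z) v)" for x v
  proof (rule integrable_const_bound[where B="a * norm v"])
    have "continuous_on UNIV (\<lambda>z. f' (x - z) v)"
    proof (rule lip_continuous_on)
      show "norm (f' (x - z) v - f' (x - z') v) \<le> 6 * b * norm v * norm (z - z')" for z z'
        using f'(4)[of "x - z" v "x - z'"] by (simp add: algebra_simps norm_minus_commute)
    qed
    then show "(\<lambda>z. f' (x - z) v) \<in> borel_measurable \<kappa>"
      unfolding measurable_cong_sets[OF \<kappa>(2) refl] by (rule borel_measurable_continuous_onI)
  qed (use f'(3) in auto)
  have "linear (\<lambda>v. \<integral>z. f' (x - z) v \<partial>\<kappa>)" for x
    by (rule linearI) (simp_all add: linear_add[OF f'(1)] linear_scale[OF f'(1)] i')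
  moreover have "norm ((\<integral>z. f (y - z) \<partial>\<kappa>) - (\<integral>z. f (x - z) \<partial>\<kappa>) - (\<integral>z. f' (x - z) (y - x) \<partial>\<kappa>)) \<le> b * (norm (y - x))\<^sup>2" for x y
  proof -
    have "norm (\<integral>z. f (y - z) - f (x - z) - f' (x - z) (y - x) \<partial>\<kappa>) \<le> b * (norm (y - x))\<^sup>2"
    proof (rule prob_norm_integral_le[OF \<kappa>(1)])
      have "norm (f (y - z) - f (x - z) - f' (x - z) (y - x)) \<le> b * (norm (y - x))\<^sup>2" for z
        using f'(2)[of "y - z" "x - z"] by simp
      then show "AE z in \<kappa>. norm (f (y - z) - f (x - z) - f' (x - z) (y - x)) \<le> b * (norm (y - x))\<^sup>2" by simp
    qed (use fi i' in auto)
    then show ?thesis using fi i' by simp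
  qed
  moreover have "norm ((\<integral>z. f (x - z) \<partial>\<kappa>) - (\<integral>z. f (y - z) \<partial>\<kappa>)) \<le> a * norm (x - y)" for x y
  proof -
    have "norm (\<integral>z. f (x - z) - f (y - z) \<partial>\<kappa>) \<le> a * norm (x - y)"
    proof (rule prob_norm_integral_le[OF \<kappa>(1)])
      have "norm (f (x - z) - f (y - z)) \<le> a * norm (x - y)" for z
        using c11_lip[OF f, of "x - z" "y - z"] by simp
      then show "AE z in \<kappa>. norm (f (x - z) - f (y - z)) \<le> a * norm (x - y)" by simp
    qed (use fi in auto)
    then show ?thesis using fi by simp
  qed
  ultimately show ?thesis unfolding c11_def using c11_nonneg[OF f]
    by (intro conjI exI[of _ "\<lambda>x v. \<integral>z. f' (x - z) v \<partial>\<kappa>"]) auto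
qed

lemma continuous_integrable_bounded_support:
  fixes f :: "'a::euclidean_space \<Rightarrow> 'b::euclidean_space"
  assumes "prob_space \<mu>" "sets \<mu> = sets borel" "AE x in \<mu>. norm x \<le> R" "continuous_on UNIV f"
  shows "integrable \<mu> f"
proof -
  interpret prob_space \<mu> by fact
  have "bounded (f ` cball 0 R)"
    using assms(4) by (intro compact_imp_bounded compact_continuous_image) (auto elim: continuous_on_subset)
  then obtain b where b: "\<forall>x\<in>cball 0 R. norm (f x) \<le> b" unfolding bounded_iff by auto
  show ?thesis
  proof (rule integrable_const_bound[where B=b])
    show "AE x in \<mu>. norm (f x) \<le> b" using assms(3) by eventually_elim (use b in auto)
    show "f \<in> borel_measurable \<mu>" unfolding measurable_cong_sets[OF assms(2) refl]
      using assms(4) by (rule borel_measurable_continuous_onI)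
  qed
qed

lemma mollify_integrable:
  fixes f :: "real^'d \<Rightarrow> 'b::euclidean_space"
  assumes r: "r > 0" and f: "continuous_on UNIV f"
  shows "integrable (mollifier r) (\<lambda>z. f (x - z))"
  by (rule continuous_integrable_bounded_support[OF mollifier_prob[OF r]])
     (intro continuous_on_compose2[OF f] continuous_intros; auto)

lemma mollify_close:
  fixes f :: "real^'d \<Rightarrow> 'b::euclidean_space"
  assumes r: "r > 0" and f: "\<And>x y. norm (f x - f y) \<le> a * norm (x - y)" and a: "0 \<le> a"
  shows "norm (mollify r f x - f x) \<le> a * r"
proof -
  have c: "continuous_on UNIV f" by (rule lip_continuous_on) (rule f)
  note p = mollifier_prob[OF r, where 'd='d]
  interpret prob_space "mollifier r :: (real^'d) measure" by (rule p)
  have "norm (\<integral>z. f (x - z) - f x \<partial>mollifier r) \<le> a * r"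
  proof (rule prob_norm_integral_le[OF p(1)])
    show "AE z in mollifier r. norm (f (x - z) - f x) \<le> a * r"
      using p(3)
    proof eventually_elim
      case (elim z)
      have "norm (f (x - z) - f x) \<le> a * norm z" using f[of "x - z" x] by simp
      also have "\<dots> \<le> a * r" using elim a by (rule mult_left_mono)
      finally show ?case .
    qed
  qed (use mollify_integrable[OF r c] in auto)
  then show ?thesis unfolding mollify_def using mollify_integrable[OF r c] by (simp add: prob_space)
qed

lemma mollify_lip:
  fixes f :: "real^'d \<Rightarrow> 'b::euclidean_space"
  assumes r: "r > 0" and f: "\<And>x y. norm (f x - f y) \<le> a * norm (x - y)"
  shows "norm (mollify r f x - mollify r f y) \<le> a * norm (x - y)"
proof -
  have c: "continuous_on UNIV f" by (rule lip_continuous_on) (rule f)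
  have "norm (\<integral>z. f (x - z) - f (y - z) \<partial>mollifier r) \<le> a * norm (x - y)"
  proof (rule prob_norm_integral_le[OF mollifier_prob(1)[OF r]])
    have "norm (f (x - z) - f (y - z)) \<le> a * norm (x - y)" for z
      using f[of "x - z" "y - z"] by simp
    then show "AE z in mollifier r. norm (f (x - z) - f (y - z)) \<le> a * norm (x - y)" by simp
  qed (use mollify_integrable[OF r c] in auto)
  then show ?thesis unfolding mollify_def using mollify_integrable[OF r c] by simp
qed

lemma mollify_bound:
  fixes f :: "real^'d \<Rightarrow> 'b::euclidean_space"
  assumes r: "r > 0" and f: "continuous_on UNIV f" "\<And>x. norm (f x) \<le> B"
  shows "norm (mollify r f x) \<le> B"
  unfolding mollify_def by (rule prob_norm_integral_le[OF mollifier_prob(1)[OF r] mollify_integrable[OF r f(1)]]) (simp add: f)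

lemma mollify_c11: "r > 0 \<Longrightarrow> c11 a b f \<Longrightarrow> c11 a b (mollify r f)"
  unfolding mollify_def
  by (intro c11_average mollifier_prob mollify_integrable lip_continuous_on[where L=a]) (auto intro: c11_lip)

text \<open>The constant b degenerates as r tends to zero, whereas a is kept; so r has to be fixed while step sizes
tend to zero.\<close>

lemma mollify_smooth:
  fixes f :: "real^'d \<Rightarrow> 'b::euclidean_space"
  assumes r: "r > 0" and f: "\<And>x y. norm (f x - f y) \<le> a * norm (x - y)" "\<And>x. norm (f x) \<le> B" and a: "0 \<le> a"
  shows "\<exists>b. c11 a b (mollify r f)"
proof -
  have t: "test_function (mollifier_density r :: real^'d \<Rightarrow> real)" by (rule mollifier_density_test[OF r])
  then have "C_k (Suc 0) (mollifier_density r :: real^'d \<Rightarrow> real)" unfolding test_function_def by blast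
  then obtain g :: "real^'d \<Rightarrow> real^'d" where g: "\<And>x. GDERIV (mollifier_density r) x :> g x" by auto
  have fm: "f \<in> borel_measurable borel" by (intro borel_measurable_continuous_onI lip_continuous_on) (rule f)
  obtain C where C: "C \<ge> 0" and Ci: "\<And>x k. integrable lborel (\<lambda>y. (k \<bullet> g (x - y)) *\<^sub>R f y)"
    and Cr: "\<And>x k. norm (convolve (mollifier_density r) f (x + k) - convolve (mollifier_density r) f x - (\<integral>y. (k \<bullet> g (x - y)) *\<^sub>R f y \<partial>lborel)) \<le> C * (norm k)\<^sup>2"
    using convolve_remainder[OF t g fm f(2)] by blast
  have "linear (\<lambda>v. \<integral>y. (v \<bullet> g (x - y)) *\<^sub>R f y \<partial>lborel)" for x
  proof (rule linearI)
    fix v w :: "real^'d" and c :: real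
    show "(\<integral>y. ((v + w) \<bullet> g (x - y)) *\<^sub>R f y \<partial>lborel) = (\<integral>y. (v \<bullet> g (x - y)) *\<^sub>R f y \<partial>lborel) + (\<integral>y. (w \<bullet> g (x - y)) *\<^sub>R f y \<partial>lborel)"
      unfolding inner_add_left scaleR_add_left by (rule Bochner_Integration.integral_add[OF Ci Ci])
    have "(\<integral>y. ((c *\<^sub>R v) \<bullet> g (x - y)) *\<^sub>R f y \<partial>lborel) = (\<integral>y. c *\<^sub>R ((v \<bullet> g (x - y)) *\<^sub>R f y) \<partial>lborel)" by simp
    then show "(\<integral>y. ((c *\<^sub>R v) \<bullet> g (x - y)) *\<^sub>R f y \<partial>lborel) = c *\<^sub>R (\<integral>y. (v \<bullet> g (x - y)) *\<^sub>R f y \<partial>lborel)"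
      unfolding integral_scaleR_right .
  qed
  moreover have "norm (mollify r f y - mollify r f x - (\<integral>z. ((y - x) \<bullet> g (x - z)) *\<^sub>R f z \<partial>lborel)) \<le> C * (norm (y - x))\<^sup>2" for x y
    using Cr[of x "y - x"] by (simp add: mollify_convolve[OF r fm])
  ultimately have "c11 a C (mollify r f)" unfolding c11_def using a C mollify_lip[OF r f(1)]
    by (intro conjI exI[of _ "\<lambda>x v. \<integral>y. (v \<bullet> g (x - y)) *\<^sub>R f y \<partial>lborel"]) auto
  then show ?thesis by blast
qed

text \<open>Cutting f off between the radii \<open>R + 1\<close> and \<open>R + 2\<close> leaves its mollification unchanged in the ball of radius R, as \<open>r \<le> 1\<close>.\<close>

lemma mollify_test_function:
  fixes f :: "real^'d \<Rightarrow> real"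
  assumes r: "0 < r" "r \<le> 1" and f: "continuous_on UNIV f"
  obtains \<phi> where "test_function \<phi>" "\<And>x. norm x < R \<Longrightarrow> \<phi> x = mollify r f x"
proof -
  define cf where "cf y = max 0 (min 1 (R + 2 - norm y))" for y :: "real^'d"
  define F where "F y = f y * cf y" for y
  have Fc: "continuous_on UNIV F" unfolding F_def cf_def by (intro continuous_intros f)
  have Fm: "F \<in> borel_measurable borel" by (rule borel_measurable_continuous_onI[OF Fc])
  have F0: "F y = 0" if "norm y > R + 2" for y using that unfolding F_def cf_def by simp
  have F1: "F y = f y" if "norm y \<le> R + 1" for y using that unfolding F_def cf_def by simp
  have "bounded (F ` cball 0 (R + 2))"
    using Fc by (intro compact_imp_bounded compact_continuous_image) (auto elim: continuous_on_subset)
  then obtain b where b: "\<forall>y\<in>cball 0 (R + 2). norm (F y) \<le> b" unfolding bounded_iff by auto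
  have Fb: "norm (F y) \<le> max b 0" for y using bspec[OF b, of y] F0[of y] by (cases "norm y \<le> R + 2") auto
  show thesis
  proof (rule that)
    show "test_function (convolve (mollifier_density r) F)"
      by (rule convolve_test_function[OF mollifier_density_test[OF r(1)] Fm Fb F0])
    fix x :: "real^'d" assume x: "norm x < R"
    have "mollify r F x = mollify r f x"
      unfolding mollify_def
    proof (rule integral_cong_AE)
      show "AE z in mollifier r. F (x - z) = f (x - z)"
        using mollifier_prob(3)[OF r(1)]
      proof eventually_elim
        case (elim z)
        then have "norm (x - z) \<le> R + 1" using norm_triangle_ineq4[of x z] x r by linarith
        then show ?case by (rule F1)
      qed
    qed (use mollify_integrable[OF r(1) Fc] mollify_integrable[OF r(1) f] in auto)
    then show "convolve (mollifier_density r) F x = mollify r f x"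
      by (simp add: mollify_convolve[OF r(1) Fm])
  qed
qed

lemma small_width:
  fixes a e :: real
  assumes a: "0 \<le> a" and e: "e > 0"
  obtains d where "0 < d" "d \<le> 1" "2 * (a * d) \<le> e"
proof (rule that[of "min 1 (e / (2 * (a + 1)))"])
  have "a * min 1 (e / (2 * (a + 1))) \<le> a * (e / (2 * (a + 1)))" using a by (intro mult_left_mono) auto
  also have "\<dots> \<le> e / 2" using a e by (simp add: field_simps)
  finally show "2 * (a * min 1 (e / (2 * (a + 1)))) \<le> e" by simp
qed (use a e in auto)

lemma GDERIV_norm_le:
  fixes \<phi> :: "'a::euclidean_space \<Rightarrow> real"
  assumes g: "GDERIV \<phi> x :> g" and S: "open S" "x \<in> S" and lip: "\<And>y. y \<in> S \<Longrightarrow> \<bar>\<phi> y - \<phi> x\<bar> \<le> a * norm (y - x)" and a: "0 \<le> a"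
  shows "norm g \<le> a"
proof (cases "g = 0")
  case False
  show ?thesis
  proof (rule field_le_epsilon)
    fix e :: real assume e: "e > 0"
    obtain d where d: "d > 0" "\<And>y. norm (y - x) < d \<Longrightarrow> norm (\<phi> y - \<phi> x - (y - x) \<bullet> g) \<le> e * norm (y - x)"
      using g e unfolding gderiv_def has_derivative_at_alt by blast
    obtain d' where d': "d' > 0" "ball x d' \<subseteq> S" using S unfolding open_contains_ball by blast
    define t where "t = min d d' / (2 * norm g)"
    have t: "t > 0" "t * norm g < d" "t * norm g < d'" using d d' False unfolding t_def by (auto simp: min_def)
    define y where "y = x + t *\<^sub>R g"
    have ny: "norm (y - x) = t * norm g" unfolding y_def using t by simp
    have "y \<in> S" using d'(2) t ny by (auto simp: dist_norm norm_minus_commute)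
    then have 1: "\<bar>\<phi> y - \<phi> x\<bar> \<le> a * (t * norm g)" using lip ny by metis
    have 2: "\<bar>\<phi> y - \<phi> x - t * (norm g)\<^sup>2\<bar> \<le> e * (t * norm g)"
      using d(2)[of y] ny t unfolding y_def by (simp add: power2_norm_eq_inner)
    have "t * (norm g)\<^sup>2 \<le> (a + e) * (t * norm g)" using 1 2 by (simp add: distrib_right)
    then have "(t * norm g) * norm g \<le> (t * norm g) * (a + e)" by (simp add: power2_eq_square algebra_simps)
    then show "norm g \<le> a + e" using t False by (simp add: mult_le_cancel_left)
  qed
qed (use a in simp)

lemma remainder_GDERIV:
  fixes f :: "'a::euclidean_space \<Rightarrow> real"
  assumes lin: "linear D" and rem: "\<And>y. \<bar>f y - f x - D (y - x)\<bar> \<le> b * (norm (y - x))\<^sup>2" and b: "0 \<le> b"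
  shows "(f has_derivative D) (at x)"
  unfolding has_derivative_at_alt
proof (intro conjI allI impI)
  show "bounded_linear D" using lin by (simp add: linear_conv_bounded_linear)
  fix e :: real assume e: "e > 0"
  have "norm (f y - f x - D (y - x)) \<le> e * norm (y - x)" if y: "norm (y - x) < e / (b + 1)" for y
  proof -
    have "(b + 1) * norm (y - x) \<le> e" using y b by (simp add: field_simps)
    then have "b * norm (y - x) \<le> e" using norm_ge_zero[of "y - x"] unfolding distrib_right mult_1_left by linarith
    from mult_right_mono[OF this, of "norm (y - x)"] rem[of y] show ?thesis by (simp add: power2_eq_square mult.assoc)
  qed
  then show "\<exists>d>0. \<forall>y. norm (y - x) < d \<longrightarrow> norm (f y - f x - D (y - x)) \<le> e * norm (y - x)"
    using e b by (intro exI[of _ "e / (b + 1)"]) auto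
qed

text \<open>The indicator of a closed set is a limit of bounded Lipschitz functions, and the closed sets are an
intersection-stable generator of the Borel sets.\<close>

lemma measure_eq_lipschitz:
  fixes \<mu> \<nu> :: "'a::euclidean_space measure"
  assumes \<mu>: "prob_space \<mu>" "sets \<mu> = sets borel" and \<nu>: "prob_space \<nu>" "sets \<nu> = sets borel"
    and eq: "\<And>f a. (\<And>x. \<bar>f x\<bar> \<le> 1) \<Longrightarrow> (\<And>x y. \<bar>f x - f y\<bar> \<le> a * norm (x - y)) \<Longrightarrow> 0 \<le> a \<Longrightarrow> (\<integral>x. f x \<partial>\<mu>) = (\<integral>x. f x \<partial>\<nu>)"
  shows "\<mu> = \<nu>"
proof -
  interpret M: prob_space \<mu> by fact
  interpret N: prob_space \<nu> by fact
  have sp: "space \<mu> = UNIV" "space \<nu> = UNIV" using sets_eq_imp_space_eq[OF \<mu>(2)] sets_eq_imp_space_eq[OF \<nu>(2)] by auto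
  have cl: "emeasure \<mu> C = emeasure \<nu> C" if C: "closed C" for C
  proof (cases "C = {}")
    case False
    define f where "f n x = max 0 (1 - real n * infdist x C)" for n x
    have fb: "\<bar>f n x\<bar> \<le> 1" for n x unfolding f_def using infdist_nonneg[of x C] by (auto simp: max_def)
    have fl: "\<bar>f n x - f n y\<bar> \<le> real n * norm (x - y)" for n x y
    proof -
      have "\<bar>f n x - f n y\<bar> \<le> \<bar>real n * infdist x C - real n * infdist y C\<bar>" unfolding f_def by (auto simp: max_def)
      also have "\<dots> = real n * \<bar>infdist x C - infdist y C\<bar>" by (simp add: abs_mult right_diff_distrib[symmetric])
      also have "\<dots> \<le> real n * norm (x - y)"
        using infdist_triangle_abs[of x C y] by (intro mult_left_mono) (auto simp: dist_norm)
      finally show ?thesis .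
    qed
    have fm: "f n \<in> borel_measurable borel" for n
      by (intro borel_measurable_continuous_onI lip_continuous_on[where L="real n"]) (use fl in auto)
    have lim: "(\<lambda>n. f n x) \<longlonglongrightarrow> indicator C x" for x
    proof (cases "x \<in> C")
      case True
      then have "f n x = 1" for n unfolding f_def by simp
      then show ?thesis using True by simp
    next
      case x: False
      then have pos: "infdist x C > 0" using C False infdist_pos_not_in_closed by blast
      then obtain n0 where n0: "1 / infdist x C < real n0" using reals_Archimedean2 by blast
      have "f n x = 0" if "n \<ge> n0" for n
      proof -
        have "1 / infdist x C < real n" using n0 that by (meson less_le_trans of_nat_mono)
        then have "1 < real n * infdist x C" using pos by (simp add: field_simps)
        then show ?thesis unfolding f_def by simp
      qed
      then show ?thesis using x by (intro tendsto_eventually) (auto simp: eventually_sequentially)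
    qed
    have Cm: "C \<in> sets borel" using C by simp
    have "(\<lambda>n. \<integral>x. f n x \<partial>\<mu>) \<longlonglongrightarrow> (\<integral>x. indicator C x \<partial>\<mu>)"
      by (rule integral_dominated_convergence[where w="\<lambda>_. 1"])
         (use fm Cm lim fb in \<open>auto simp: measurable_cong_sets[OF \<mu>(2) refl]\<close>)
    moreover have "(\<lambda>n. \<integral>x. f n x \<partial>\<nu>) \<longlonglongrightarrow> (\<integral>x. indicator C x \<partial>\<nu>)"
      by (rule integral_dominated_convergence[where w="\<lambda>_. 1"])
         (use fm Cm lim fb in \<open>auto simp: measurable_cong_sets[OF \<nu>(2) refl]\<close>)
    moreover have "(\<integral>x. f n x \<partial>\<mu>) = (\<integral>x. f n x \<partial>\<nu>)" for n by (rule eq[OF fb fl]) simp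
    ultimately have "(\<integral>x. indicator C x \<partial>\<mu>) = (\<integral>x. indicator C x \<partial>\<nu> :: real)" using LIMSEQ_unique by simp
    then show ?thesis using sp by (simp add: M.emeasure_eq_measure N.emeasure_eq_measure)
  qed simp
  show ?thesis
  proof (rule measure_eqI_generator_eq[where E="Collect closed" and \<Omega>=UNIV and A="\<lambda>_. UNIV"])
    show "Int_stable (Collect closed :: 'a set set)" by (auto simp: Int_stable_def)
    show "sets \<mu> = sigma_sets UNIV (Collect closed)" "sets \<nu> = sigma_sets UNIV (Collect closed)"
      using \<mu>(2) \<nu>(2) unfolding borel_eq_closed by simp_all
  qed (use cl in auto)
qed

section \<open>Uniqueness for the continuity equation\<close>

context interaction begin

lemma velocity_c11:
  fixes w :: "(real^'d)^'m"
  assumes H: "c11 Lp b H" and G: "\<And>l. c11 Lp b (G l)"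
    and \<nu>: "prob_space \<nu>" "sets \<nu> = sets borel" and w: "norm w \<le> M"
  shows "c11 (vel_lip M) (b + real CARD('d) * M * b) (velocity H G w Y \<nu>)"
proof -
  have M: "0 \<le> M" using w norm_ge_zero order_trans by blast
  have b: "0 \<le> b" using c11_nonneg[OF H] by simp
  have "c11 Lp b (conv H \<nu>)" unfolding conv_def
    by (rule c11_average[OF H \<nu>]) (rule conv_integrable[OF H_bound H_lip \<nu>])
  then obtain D where D: "\<And>x. linear (D x)" "\<And>x y. norm (conv H \<nu> y - conv H \<nu> x - D x (y - x)) \<le> b * (norm (y - x))\<^sup>2"
    unfolding c11_def by blast
  have "\<forall>l. \<exists>E. (\<forall>x. linear (E x)) \<and> (\<forall>x y. norm (G l y - G l x - E x (y - x)) \<le> b * (norm (y - x))\<^sup>2)"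
    using G unfolding c11_def by blast
  then obtain E where E: "\<And>l x. linear (E l x)" "\<And>l x y. norm (G l y - G l x - E l x (y - x)) \<le> b * (norm (y - x))\<^sup>2" by metis
  define F where "F x v = D x v + kernel_sum w (\<lambda>l k. E l (x - Y $ k) v)" for x v
  have lin: "linear (F x)" for x
    unfolding F_def kernel_sum_def
    by (rule linearI) (simp_all add: linear_add[OF D(1)] linear_scale[OF D(1)] linear_add[OF E(1)] linear_scale[OF E(1)]
        scaleR_add_right sum.distrib scaleR_sum_right mult.commute mult.left_commute)
  have "norm (velocity H G w Y \<nu> y - velocity H G w Y \<nu> x - F x (y - x)) \<le> (b + real CARD('d) * M * b) * (norm (y - x))\<^sup>2" for x y
  proof -
    define K where "K = kernel_sum w (\<lambda>l k. G l (y - Y $ k) - G l (x - Y $ k) - E l (x - Y $ k) (y - x))"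
    have eq: "velocity H G w Y \<nu> y - velocity H G w Y \<nu> x - F x (y - x) = (conv H \<nu> y - conv H \<nu> x - D x (y - x)) + K"
      unfolding velocity_eq F_def K_def kernel_sum_diff[symmetric] by simp
    have "norm K \<le> real CARD('d) * norm w * (b * (norm (y - x))\<^sup>2)"
      unfolding K_def
    proof (rule kernel_sum_bound)
      show "norm (G l (y - Y $ k) - G l (x - Y $ k) - E l (x - Y $ k) (y - x)) \<le> b * (norm (y - x))\<^sup>2" for l k
        using E(2)[of l "y - Y $ k" "x - Y $ k"] by simp
    qed
    also have "\<dots> \<le> real CARD('d) * M * (b * (norm (y - x))\<^sup>2)"
      using w b by (intro mult_right_mono mult_left_mono) auto
    finally have K: "norm K \<le> real CARD('d) * M * (b * (norm (y - x))\<^sup>2)" .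
    have "norm (velocity H G w Y \<nu> y - velocity H G w Y \<nu> x - F x (y - x)) \<le> b * (norm (y - x))\<^sup>2 + real CARD('d) * M * (b * (norm (y - x))\<^sup>2)"
      unfolding eq by (rule norm_triangle_mono[OF D(2) K])
    then show ?thesis by (simp add: algebra_simps)
  qed
  moreover have "norm (velocity H G w Y \<nu> x - velocity H G w Y \<nu> y) \<le> vel_lip M * norm (x - y)" for x y
    by (rule velocity_lip[OF \<nu> w])
  moreover have "0 \<le> vel_lip M" unfolding vel_lip_def dim_real_def using Lp_nonneg M by simp
  moreover have "0 \<le> b + real CARD('d) * M * b" using b M by simp
  ultimately show ?thesis unfolding c11_def using lin by (intro conjI exI[of _ F]) auto
qed

lemma mollified_interaction:
  assumes r: "r > 0" shows "interaction (mollify r H) (\<lambda>l. mollify r (G l)) B Lp"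
proof
  show "norm (mollify r H x) \<le> B" for x
    by (rule mollify_bound[OF r lip_continuous_on[where L=Lp]]) (auto intro: H_lip H_bound)
  show "norm (mollify r (G l) x) \<le> B" for l x
    by (rule mollify_bound[OF r continuous_G G_bound])
  show "norm (mollify r H x - mollify r H y) \<le> Lp * norm (x - y)" for x y
    by (rule mollify_lip[OF r H_lip])
  show "norm (mollify r (G l) x - mollify r (G l) y) \<le> Lp * norm (x - y)" for l x y
    by (rule mollify_lip[OF r G_lip])
qed

lemma mollified_c11:
  assumes r: "r > 0" shows "\<exists>b. c11 Lp b (mollify r H) \<and> (\<forall>l. c11 Lp b (mollify r (G l)))"
proof -
  obtain b0 where b0: "c11 Lp b0 (mollify r H)" using mollify_smooth[OF r H_lip H_bound Lp_nonneg] by blast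
  have "\<forall>l. \<exists>b. c11 Lp b (mollify r (G l))" using mollify_smooth[OF r G_lip G_bound Lp_nonneg] by blast
  then obtain b where b: "\<And>l. c11 Lp (b l) (mollify r (G l))" by metis
  define c where "c = b0 + (\<Sum>l\<in>UNIV. b l)"
  have nn: "0 \<le> b0" "\<And>l. 0 \<le> b l" using c11_nonneg b0 b by blast+
  have "b0 \<le> c" unfolding c_def using nn by (simp add: sum_nonneg)
  moreover have "b l \<le> c" for l
  proof -
    have "b l \<le> (\<Sum>l\<in>UNIV. b l)" using nn by (intro member_le_sum) auto
    then show ?thesis unfolding c_def using nn by linarith
  qed
  ultimately show ?thesis using b0 b c11_mono by blast
qed

lemma velocity_mollify_close:
  fixes w :: "(real^'d)^'m"
  assumes r: "r > 0" and \<nu>: "prob_space \<nu>" "sets \<nu> = sets borel" and w: "norm w \<le> M"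
  shows "norm (velocity H G w Y \<nu> x - velocity (mollify r H) (\<lambda>l. mollify r (G l)) w Y \<nu> x) \<le> (1 + real CARD('d) * M) * (Lp * r)"
proof -
  interpret m: interaction "mollify r H" "\<lambda>l. mollify r (G l)" B Lp by (rule mollified_interaction[OF r])
  have i: "integrable \<nu> (\<lambda>\<xi>. H (x - \<xi>))" "integrable \<nu> (\<lambda>\<xi>. mollify r H (x - \<xi>))"
    by (rule conv_integrable[OF H_bound H_lip \<nu>]) (rule conv_integrable[OF m.H_bound m.H_lip \<nu>])
  have "norm (\<integral>\<xi>. H (x - \<xi>) - mollify r H (x - \<xi>) \<partial>\<nu>) \<le> Lp * r"
    by (rule prob_norm_integral_le[OF \<nu>(1)])
       (use i mollify_close[OF r H_lip Lp_nonneg] in \<open>auto simp: norm_minus_commute\<close>)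
  then have 1: "norm (conv H \<nu> x - conv (mollify r H) \<nu> x) \<le> Lp * r" unfolding conv_def using i by simp
  have "norm (control_field w Y x - kernel_sum w (\<lambda>l k. mollify r (G l) (x - Y $ k))) \<le> real CARD('d) * norm w * (Lp * r)"
    unfolding kernel_sum_diff
    by (rule kernel_sum_bound) (use mollify_close[OF r G_lip Lp_nonneg] in \<open>simp add: norm_minus_commute\<close>)
  also have "\<dots> \<le> real CARD('d) * M * (Lp * r)" using w Lp_nonneg r by (intro mult_right_mono mult_left_mono) auto
  finally have 2: "norm (control_field w Y x - kernel_sum w (\<lambda>l k. mollify r (G l) (x - Y $ k))) \<le> real CARD('d) * M * (Lp * r)" .
  have E: "velocity H G w Y \<nu> x - velocity (mollify r H) (\<lambda>l. mollify r (G l)) w Y \<nu> x =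
     (conv H \<nu> x - conv (mollify r H) \<nu> x) + (control_field w Y x - kernel_sum w (\<lambda>l k. mollify r (G l) (x - Y $ k)))"
    unfolding velocity_eq by simp
  show ?thesis unfolding E by (rule order_trans[OF norm_triangle_mono[OF 1 2]]) (simp add: algebra_simps)
qed

end

text \<open>A solution of the continuity equation that is known only through its action on test functions. The aim is to show
that it is transported by the flow of the velocity which it generates. A dual problem with a regular
solution is replaced by a discrete one: the measure and the flow are compared along a fine Euler scheme.\<close>

locale weak_solution = controlled H G B Lp T M u Y Y0
  for H :: "real^'d \<Rightarrow> real^'d" and G :: "'d \<Rightarrow> real^'d \<Rightarrow> real^'d" and B Lp T M :: real
    and u Y :: "real \<Rightarrow> (real^'d)^'m" and Y0 :: "(real^'d)^'m" +
  fixes \<mu> :: "real \<Rightarrow> (real^'d) measure" and R :: real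
  assumes \<mu>_prob: "\<And>t. t \<in> {0..T} \<Longrightarrow> prob_space (\<mu> t)" and \<mu>_sets: "\<And>t. t \<in> {0..T} \<Longrightarrow> sets (\<mu> t) = sets borel"
    and \<mu>_supp: "\<And>t. t \<in> {0..T} \<Longrightarrow> AE x in \<mu> t. norm x < R"
    and weak: "\<And>\<phi> g. test_function \<phi> \<Longrightarrow> (\<And>x. GDERIV \<phi> x :> g x) \<Longrightarrow>
       caratheodory T (\<lambda>t _. \<integral>x. g x \<bullet> velocity H G (u t) (Y t) (\<mu> t) x \<partial>\<mu> t) (\<integral>x. \<phi> x \<partial>\<mu> 0) (\<lambda>t. \<integral>x. \<phi> x \<partial>\<mu> t)"
begin

lemma \<mu>_supp': "t \<in> {0..T} \<Longrightarrow> AE x in \<mu> t. norm x \<le> R"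
  using \<mu>_supp[of t] by auto

lemma cont_int: "t \<in> {0..T} \<Longrightarrow> continuous_on UNIV f \<Longrightarrow> integrable (\<mu> t) (f :: real^'d \<Rightarrow> 'b::euclidean_space)"
  by (rule continuous_integrable_bounded_support[OF \<mu>_prob \<mu>_sets \<mu>_supp'])

lemma velocity_cont: "t \<in> {0..T} \<Longrightarrow> norm w \<le> M \<Longrightarrow> continuous_on UNIV (velocity H G (w::(real^'d)^'m) Y' (\<mu> t))"
  by (rule lip_continuous_on[where L=Kv]) (intro velocity_lip \<mu>_prob \<mu>_sets)

lemma test_gradient_bound:
  fixes \<phi> q :: "real^'d \<Rightarrow> real"
  assumes \<phi>: "\<And>x. GDERIV \<phi> x :> g x" and q: "\<And>x. norm x < R \<Longrightarrow> \<phi> x = q x"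
    and ql: "\<And>x y. \<bar>q x - q y\<bar> \<le> a * norm (x - y)" and a: "0 \<le> a" and x: "norm x < R"
  shows "norm (g x) \<le> a"
proof (rule GDERIV_norm_le[OF \<phi>, of "ball 0 R" x])
  show "\<bar>\<phi> y - \<phi> x\<bar> \<le> a * norm (y - x)" if "y \<in> ball 0 R" for y
    using ql[of y x] q[of y] q[OF x] that by simp
qed (use a x in simp_all)

text \<open>The equation is tested with a mollification of f, whose gradient is bounded by a on the ball carrying the
measures; then the width of the mollifier tends to zero.\<close>

lemma dual_lip:
  assumes f: "\<And>x y. \<bar>f x - f y\<bar> \<le> a * norm (x - y)" and a: "0 \<le> a" and s: "s \<in> {0..T}" and t: "t \<in> {0..T}"
  shows "\<bar>(\<integral>x. f x \<partial>\<mu> t) - (\<integral>x. f x \<partial>\<mu> s)\<bar> \<le> a * Cv * \<bar>t - s\<bar>"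
proof (rule field_le_epsilon)
  fix e :: real assume e: "e > 0"
  obtain d where d: "0 < d" "d \<le> 1" "2 * (a * d) \<le> e" by (rule small_width[OF a e], rule that)
  have fc: "continuous_on UNIV f" by (rule lip_continuous_on[where L=a]) (use f in simp)
  obtain \<phi> where \<phi>: "test_function \<phi>" "\<And>x. norm x < R \<Longrightarrow> \<phi> x = mollify d f x"
    by (rule mollify_test_function[OF d(1,2) fc, where R=R], rule that)
  have "C_k (Suc 0) \<phi>" using \<phi>(1) unfolding test_function_def by blast
  then obtain g where g: "\<And>x. GDERIV \<phi> x :> g x" by auto
  have ml: "\<bar>mollify d f x - mollify d f y\<bar> \<le> a * norm (x - y)" for x y
    using mollify_lip[OF d(1), of f a] f by simp
  have gb: "norm (g x) \<le> a" if "norm x < R" for x by (rule test_gradient_bound[OF g \<phi>(2) ml a that])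
  have gc: "continuous_on UNIV g" by (rule test_function_gradient(1)[OF \<phi>(1) g])
  define J where "J r = (\<integral>x. g x \<bullet> vel \<mu> r x \<partial>\<mu> r)" for r
  have Ji: "J integrable_on {0..T}" and Je: "\<And>t. t \<in> {0..T} \<Longrightarrow> (\<integral>x. \<phi> x \<partial>\<mu> t) = (\<integral>x. \<phi> x \<partial>\<mu> 0) + integral {0..t} J"
    using weak[OF \<phi>(1) g] unfolding caratheodory_def J_def[symmetric] by (blast dest: set_lebesgue_integral_eq_integral(1))+
  have Jb: "norm (J r) \<le> a * Cv" if r: "r \<in> {0..T}" for r
    unfolding J_def
  proof (rule prob_norm_integral_le[OF \<mu>_prob[OF r]])
    show "integrable (\<mu> r) (\<lambda>x. g x \<bullet> vel \<mu> r x)"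
      by (intro cont_int r continuous_on_inner gc velocity_cont u_bound)
    show "AE x in \<mu> r. norm (g x \<bullet> vel \<mu> r x) \<le> a * Cv"
      using \<mu>_supp[OF r]
    proof eventually_elim
      case (elim x)
      have "norm (g x \<bullet> vel \<mu> r x) \<le> norm (g x) * norm (vel \<mu> r x)"
        by (simp add: Cauchy_Schwarz_ineq2)
      also have "\<dots> \<le> a * Cv"
        using gb[OF elim] velocity_bound[OF \<mu>_prob[OF r] \<mu>_sets[OF r] u_bound] a by (intro mult_mono) auto
      finally show ?case .
    qed
  qed
  have 1: "\<bar>(\<integral>x. \<phi> x \<partial>\<mu> t) - (\<integral>x. \<phi> x \<partial>\<mu> s)\<bar> \<le> a * Cv * \<bar>t - s\<bar>"
    using integral_lipschitz[OF Ji Jb s t] Je[OF s] Je[OF t] by simp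
  have 2: "\<bar>(\<integral>x. \<phi> x \<partial>\<mu> r) - (\<integral>x. f x \<partial>\<mu> r)\<bar> \<le> a * d" if r: "r \<in> {0..T}" for r
  proof -
    have i: "integrable (\<mu> r) \<phi>" "integrable (\<mu> r) f" by (intro cont_int r GDERIV_continuous[OF g] fc)+
    have "norm (\<integral>x. \<phi> x - f x \<partial>\<mu> r) \<le> a * d"
    proof (rule prob_norm_integral_le[OF \<mu>_prob[OF r]])
      show "AE x in \<mu> r. norm (\<phi> x - f x) \<le> a * d"
        using \<mu>_supp[OF r] by eventually_elim (use \<phi>(2) mollify_close[OF d(1), of f a] f a in simp)
    qed (use i in auto)
    then show ?thesis using i by simp
  qed
  show "\<bar>(\<integral>x. f x \<partial>\<mu> t) - (\<integral>x. f x \<partial>\<mu> s)\<bar> \<le> a * Cv * \<bar>t - s\<bar> + e"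
    using 1 2[OF s] 2[OF t] d(3) by linarith
qed

text \<open>\<open>dual_lip\<close> for the real function \<open>H (x - \<xi>) \<bullet> v\<close> of \<open>\<xi>\<close>, where v is the very difference to be estimated.\<close>

lemma conv_time_lip:
  assumes s: "s \<in> {0..T}" and t: "t \<in> {0..T}"
  shows "norm (conv H (\<mu> t) x - conv H (\<mu> s) x) \<le> Lp * Cv * \<bar>t - s\<bar>"
proof -
  define v where "v = conv H (\<mu> t) x - conv H (\<mu> s) x"
  have i: "integrable (\<mu> r) (\<lambda>\<xi>. H (x - \<xi>))" if "r \<in> {0..T}" for r
    by (rule conv_integrable[OF H_bound H_lip \<mu>_prob[OF that] \<mu>_sets[OF that]])
  have "\<bar>(\<integral>\<xi>. H (x - \<xi>) \<bullet> v \<partial>\<mu> t) - (\<integral>\<xi>. H (x - \<xi>) \<bullet> v \<partial>\<mu> s)\<bar> \<le> (norm v * Lp) * Cv * \<bar>t - s\<bar>"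
  proof (rule dual_lip[OF _ _ s t])
    fix \<xi> \<eta>
    have "\<bar>H (x - \<xi>) \<bullet> v - H (x - \<eta>) \<bullet> v\<bar> \<le> norm (H (x - \<xi>) - H (x - \<eta>)) * norm v"
      unfolding inner_diff_left[symmetric] by (rule Cauchy_Schwarz_ineq2)
    also have "\<dots> \<le> (Lp * norm (\<xi> - \<eta>)) * norm v"
      using H_lip[of "x - \<xi>" "x - \<eta>"] by (intro mult_right_mono) (auto simp: norm_minus_commute)
    finally show "\<bar>H (x - \<xi>) \<bullet> v - H (x - \<eta>) \<bullet> v\<bar> \<le> norm v * Lp * norm (\<xi> - \<eta>)" by (simp add: mult_ac)
  qed (use Lp_nonneg in simp)
  moreover have "(\<integral>\<xi>. H (x - \<xi>) \<bullet> v \<partial>\<mu> t) - (\<integral>\<xi>. H (x - \<xi>) \<bullet> v \<partial>\<mu> s) = v \<bullet> v"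
    using i[OF s] i[OF t] unfolding v_def conv_def by (simp add: inner_diff_left)
  ultimately have "norm v * norm v \<le> norm v * (Lp * Cv * \<bar>t - s\<bar>)"
    by (simp add: power2_norm_eq_inner[symmetric] power2_eq_square mult.assoc)
  then have "norm v \<le> Lp * Cv * \<bar>t - s\<bar>"
  proof (cases "v = 0")
    case True
    then show ?thesis using Lp_nonneg Cv_nonneg by simp
  qed (simp add: mult_le_cancel_left)
  then show ?thesis unfolding v_def .
qed

lemma good_curve_\<mu>: "good_curve \<mu>"
proof -
  have "continuous_on {0..T} (\<lambda>s. conv H (\<mu> s) x)" for x
    by (rule lip_continuous_on[where L="Lp * Cv"]) (use conv_time_lip in simp)
  then show ?thesis unfolding good_curve_def using \<mu>_prob \<mu>_sets by blast
qed

abbreviation frozen_velocity :: "real \<Rightarrow> (real^'d)^'m \<Rightarrow> real^'d \<Rightarrow> real^'d" where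
  "frozen_velocity s w \<equiv> velocity H G w (Y s) (\<mu> s)"

text \<open>The control is only measurable in time, so it has no value to be frozen at the beginning of an Euler step. As the
velocity is affine in the control, the integral over the step of the velocity with everything else frozen is
exactly h times the velocity for the mean control.\<close>

definition mean_control :: "real \<Rightarrow> real \<Rightarrow> (real^'d)^'m" where
  "mean_control s h = (1 / h) *\<^sub>R integral {s..s + h} u"

lemma mean_control_bound:
  assumes "0 \<le> s" "0 < h" "s + h \<le> T" shows "norm (mean_control s h) \<le> M"
proof -
  have "norm (integral {s..s + h} u) \<le> M * (s + h - s)"
    by (rule integral_norm_le[OF u_int]) (use assms u_bound in auto)
  then have le: "norm (integral {s..s + h} u) \<le> M * h" by simp
  have "norm (mean_control s h) = norm (integral {s..s + h} u) / h" unfolding mean_control_def using assms by simp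
  also have "\<dots> \<le> M" using le assms(2) by (simp add: pos_divide_le_eq)
  finally show ?thesis .
qed

lemma mean_control_integral:
  assumes "0 \<le> s" "0 < h" "s + h \<le> T" and l: "linear (\<Lambda> :: (real^'d)^'m \<Rightarrow> 'b::euclidean_space)"
  shows "((\<lambda>r. \<Lambda> (u r)) has_integral h *\<^sub>R \<Lambda> (mean_control s h)) {s..s + h}"
proof -
  have "u integrable_on {s..s + h}" by (rule integrable_on_subinterval[OF u_int]) (use assms in auto)
  then have "(u has_integral integral {s..s + h} u) {s..s + h}" by (rule integrable_integral)
  from has_integral_linear[OF this linear_conv_bounded_linear[THEN iffD1, OF l]]
  have "((\<lambda>r. \<Lambda> (u r)) has_integral \<Lambda> (integral {s..s + h} u)) {s..s + h}" by (simp only: comp_def)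
  moreover have "\<Lambda> (integral {s..s + h} u) = h *\<^sub>R \<Lambda> (mean_control s h)"
    unfolding mean_control_def linear_scale[OF l] using assms by simp
  ultimately show ?thesis by simp
qed

lemma velocity_freeze:
  assumes s: "s \<in> {0..T}" and r: "r \<in> {0..T}"
  shows "norm (vel \<mu> r x - frozen_velocity s (u r) x)
     \<le> (Lp * Cv + real CARD('d) * M * (Lp * M)) * \<bar>r - s\<bar>"
proof -
  have 1: "norm (conv H (\<mu> r) x - conv H (\<mu> s) x) \<le> Lp * Cv * \<bar>r - s\<bar>" by (rule conv_time_lip[OF s r])
  have "norm (control_field (u r) (Y r) x - control_field (u r) (Y s) x)
     \<le> real CARD('d) * M * (Lp * norm (Y r - Y s))"
    by (rule kernel_sum_Y[OF u_bound])
  also have "\<dots> \<le> real CARD('d) * M * (Lp * (M * \<bar>r - s\<bar>))"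
    using Y_lip[OF s r] M_nonneg Lp_nonneg by (intro mult_left_mono) auto
  finally have 2: "norm (control_field (u r) (Y r) x - control_field (u r) (Y s) x)
     \<le> real CARD('d) * M * (Lp * (M * \<bar>r - s\<bar>))" .
  have E: "vel \<mu> r x - frozen_velocity s (u r) x = (conv H (\<mu> r) x - conv H (\<mu> s) x) +
    (control_field (u r) (Y r) x - control_field (u r) (Y s) x)"
    unfolding velocity_eq by simp
  show ?thesis unfolding E by (rule order_trans[OF norm_triangle_mono[OF 1 2]]) (simp add: algebra_simps)
qed

text \<open>The Lipschitz constant in time of the velocity when the control is kept.\<close>

definition freeze :: real where "freeze = Lp * Cv + real CARD('d) * M * (Lp * M)"

lemma freeze_nonneg: "0 \<le> freeze"
  unfolding freeze_def using Lp_nonneg Cv_nonneg M_nonneg by simp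

definition step_const :: real where "step_const = freeze + 6 * Cv * Cv + Kv * Cv + Cv * Cv + 1"

text \<open>One Euler step of the measure. The time derivative \<open>J r\<close> of the integral of q is replaced by \<open>I r\<close>, in
which the agents and both occurrences of the measure are frozen at time s, at the price of \<open>O(h)\<close>. Since \<open>I r\<close> is affine in
\<open>u r\<close>, its integral is h times its value at the mean control, and this is compared with the expansion of
\<open>q (x + h W x)\<close>. The field W stands for a regularisation of the frozen velocity, at distance at most \<open>\<rho>\<close>.\<close>

lemma one_step_mollified:
  assumes s: "0 \<le> s" "0 < h" "s + h \<le> T" and q: "c11 a b q" and qt: "test_function \<phi>" "\<And>x. norm x < R \<Longrightarrow> \<phi> x = q x"
    and W: "continuous_on UNIV W" "\<And>x. norm (W x) \<le> Cv"
      "\<And>x. norm (frozen_velocity s (mean_control s h) x - W x) \<le> \<rho>" and \<rho>: "0 \<le> \<rho>"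
  shows "\<bar>(\<integral>x. q x \<partial>\<mu> (s + h)) - (\<integral>x. q (x + h *\<^sub>R W x) \<partial>\<mu> s)\<bar> \<le> step_const * ((a + b) * h\<^sup>2 + a * h * \<rho>)"
proof -
  have sT: "s \<in> {0..T}" and shT: "s + h \<in> {0..T}" using s by auto
  have sub: "r \<in> {0..T}" if "r \<in> {s..s + h}" for r using that s by auto
  have a: "0 \<le> a" and b: "0 \<le> b" using c11_nonneg[OF q] by auto
  obtain q' where q': "\<And>x. linear (q' x)" "\<And>x y. norm (q y - q x - q' x (y - x)) \<le> b * (norm (y - x))\<^sup>2"
    "\<And>x v. norm (q' x v) \<le> a * norm v" "\<And>x y v. norm (q' x v - q' y v) \<le> 6 * b * norm (x - y) * norm v"
    by (rule c11_deriv[OF q], rule that)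
  have qc: "continuous_on UNIV q" by (rule lip_continuous_on[where L=a]) (rule c11_lip[OF q])
  have "C_k (Suc 0) \<phi>" using qt(1) unfolding test_function_def by blast
  then obtain g where g: "\<And>x. GDERIV \<phi> x :> g x" by auto
  (* On the ball carrying the measures the gradient of the test function is the derivative of q. *)
  have gq: "v \<bullet> g x = q' x v" if x: "norm x < R" for x v
  proof -
    have "(q has_derivative q' x) (at x)" by (rule remainder_GDERIV[OF q'(1) _ b]) (use q'(2) in simp)
    then have "(\<phi> has_derivative q' x) (at x)"
      by (rule has_derivative_transform_within_open[of q "q' x" x UNIV "ball 0 R" \<phi>]) (use x qt(2) in auto)
    moreover have "(\<phi> has_derivative (\<lambda>v. v \<bullet> g x)) (at x)" using g unfolding gderiv_def .
    ultimately have "q' x = (\<lambda>v. v \<bullet> g x)" by (rule has_derivative_unique)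
    then show ?thesis by simp
  qed
  have lipV: "norm (q' x (V x) - q' y (V y)) \<le> (6 * b * C + a * L) * norm (x - y)"
    if V: "\<And>x y. norm (V x - V y) \<le> L * norm (x - y)" "\<And>x. norm (V x) \<le> C" for V L C x y
  proof -
    have "norm (q' x (V x) - q' y (V x)) \<le> 6 * b * norm (x - y) * norm (V x)" by (rule q'(4))
    also have "\<dots> \<le> 6 * b * norm (x - y) * C" using V(2) b by (intro mult_left_mono) auto
    finally have 1: "norm (q' x (V x) - q' y (V x)) \<le> 6 * b * norm (x - y) * C" .
    have "norm (q' y (V x - V y)) \<le> a * norm (V x - V y)" by (rule q'(3))
    also have "\<dots> \<le> a * (L * norm (x - y))" using V(1) a by (intro mult_left_mono) auto
    finally have 2: "norm (q' y (V x - V y)) \<le> a * (L * norm (x - y))" .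
    have "q' x (V x) - q' y (V y) = (q' x (V x) - q' y (V x)) + q' y (V x - V y)" by (simp add: linear_diff[OF q'(1)])
    then show ?thesis using norm_triangle_mono[OF 1 2] by (simp add: algebra_simps)
  qed
  have q'W: "continuous_on UNIV (\<lambda>x. q' x (V x))" if V: "\<And>x y. norm (V x - V y) \<le> L * norm (x - y)" "\<And>x. norm (V x) \<le> C" for V L C
    by (rule lip_continuous_on) (rule lipV[OF V])
  define Vf where "Vf w x = frozen_velocity s w x" for w x
  have Vf_lip: "norm (Vf w x - Vf w y) \<le> Kv * norm (x - y)" if "norm w \<le> M" for w x y
    unfolding Vf_def by (rule velocity_lip[OF \<mu>_prob[OF sT] \<mu>_sets[OF sT] that])
  have Vf_bd: "norm (Vf w x) \<le> Cv" if "norm w \<le> M" for w x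
    unfolding Vf_def by (rule velocity_bound[OF \<mu>_prob[OF sT] \<mu>_sets[OF sT] that])
  define J where "J r = (\<integral>x. g x \<bullet> vel \<mu> r x \<partial>\<mu> r)" for r
  define I where "I r = (\<integral>x. q' x (Vf (u r) x) \<partial>\<mu> s)" for r
  have Ji: "J integrable_on {0..T}" and Je: "\<And>t. t \<in> {0..T} \<Longrightarrow> (\<integral>x. \<phi> x \<partial>\<mu> t) = (\<integral>x. \<phi> x \<partial>\<mu> 0) + integral {0..t} J"
    using weak[OF qt(1) g] unfolding caratheodory_def J_def[symmetric] by (blast dest: set_lebesgue_integral_eq_integral(1))+
  have Jsub: "J integrable_on {s..s + h}" by (rule integrable_on_subinterval[OF Ji]) (use s in auto)
  have inc: "(\<integral>x. \<phi> x \<partial>\<mu> (s + h)) - (\<integral>x. \<phi> x \<partial>\<mu> s) = integral {s..s + h} J"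
    using Je[OF sT] Je[OF shT] integral_increment[OF Ji, of s "s + h"] s by simp
  define C1 where "C1 = a * freeze + (6 * b * Cv + a * Kv) * Cv"
  have JI: "norm (J r - I r) \<le> C1 * h" if r: "r \<in> {s..s + h}" for r
  proof -
    have rT: "r \<in> {0..T}" and rs: "\<bar>r - s\<bar> \<le> h" using sub[OF r] r by auto
    define V where "V x = vel \<mu> r x" for x
    have V_lip: "norm (V x - V y) \<le> Kv * norm (x - y)" for x y
      unfolding V_def by (rule velocity_lip[OF \<mu>_prob[OF rT] \<mu>_sets[OF rT] u_bound])
    have V_bd: "norm (V x) \<le> Cv" for x
      unfolding V_def by (rule velocity_bound[OF \<mu>_prob[OF rT] \<mu>_sets[OF rT] u_bound])
    have c1: "continuous_on UNIV (\<lambda>x. q' x (V x))" by (rule q'W[OF V_lip V_bd])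
    have c2: "continuous_on UNIV (\<lambda>x. q' x (Vf (u r) x))" by (rule q'W[OF Vf_lip[OF u_bound] Vf_bd[OF u_bound]])
    have "J r = (\<integral>x. q' x (V x) \<partial>\<mu> r)"
      unfolding J_def V_def[symmetric]
    proof (rule integral_cong_AE)
      show "AE x in \<mu> r. g x \<bullet> V x = q' x (V x)"
        using \<mu>_supp[OF rT] by eventually_elim (use gq in \<open>simp add: inner_commute\<close>)
      have gc: "continuous_on UNIV g" by (rule test_function_gradient(1)[OF qt(1) g])
      have "continuous_on UNIV (\<lambda>x. g x \<bullet> V x)"
        by (intro continuous_on_inner gc lip_continuous_on[where L=Kv]) (rule V_lip)
      then show "(\<lambda>x. g x \<bullet> V x) \<in> borel_measurable (\<mu> r)" using cont_int[OF rT] by blast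
      show "(\<lambda>x. q' x (V x)) \<in> borel_measurable (\<mu> r)" using cont_int[OF rT c1] by blast
    qed
    moreover have 1: "norm ((\<integral>x. q' x (V x) \<partial>\<mu> r) - (\<integral>x. q' x (Vf (u r) x) \<partial>\<mu> r)) \<le> a * (freeze * h)"
    proof -
      have "norm (\<integral>x. q' x (V x) - q' x (Vf (u r) x) \<partial>\<mu> r) \<le> a * (freeze * h)"
      proof (rule prob_norm_integral_le[OF \<mu>_prob[OF rT]])
        have "norm (q' x (V x) - q' x (Vf (u r) x)) \<le> a * (freeze * h)" for x
        proof -
          have "norm (q' x (V x) - q' x (Vf (u r) x)) \<le> a * norm (V x - Vf (u r) x)"
            using q'(3)[of x "V x - Vf (u r) x"] by (simp add: linear_diff[OF q'(1)])
          also have "\<dots> \<le> a * (freeze * \<bar>r - s\<bar>)"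
            unfolding V_def Vf_def freeze_def using velocity_freeze[OF sT rT] a by (intro mult_left_mono) auto
          also have "\<dots> \<le> a * (freeze * h)" using a freeze_nonneg rs by (intro mult_left_mono) auto
          finally show ?thesis .
        qed
        then show "AE x in \<mu> r. norm (q' x (V x) - q' x (Vf (u r) x)) \<le> a * (freeze * h)" by simp
      qed (use cont_int[OF rT c1] cont_int[OF rT c2] in auto)
      then show ?thesis using cont_int[OF rT c1] cont_int[OF rT c2] by simp
    qed
    moreover have 2: "norm ((\<integral>x. q' x (Vf (u r) x) \<partial>\<mu> r) - I r) \<le> (6 * b * Cv + a * Kv) * Cv * h"
    proof -
      have "\<bar>(\<integral>x. q' x (Vf (u r) x) \<partial>\<mu> r) - (\<integral>x. q' x (Vf (u r) x) \<partial>\<mu> s)\<bar> \<le> (6 * b * Cv + a * Kv) * Cv * \<bar>r - s\<bar>"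
        by (rule dual_lip[OF _ _ sT rT])
           (use lipV[OF Vf_lip[OF u_bound] Vf_bd[OF u_bound]] a b Cv_nonneg Kv_nonneg in auto)
      also have "\<dots> \<le> (6 * b * Cv + a * Kv) * Cv * h"
        using rs a b Cv_nonneg Kv_nonneg by (intro mult_left_mono) auto
      finally show ?thesis unfolding I_def by simp
    qed
    ultimately show ?thesis using norm_triangle_mono[OF 1 2] unfolding C1_def by (simp add: algebra_simps)
  qed
  define K where "K w x = control_field w (Y s) x" for w x
  have VK: "Vf w x = conv H (\<mu> s) x + K w x" for w x unfolding Vf_def K_def velocity_eq ..
  have Hs: "norm (conv H (\<mu> s) x - conv H (\<mu> s) y) \<le> Lp * norm (x - y)" "norm (conv H (\<mu> s) x) \<le> B" for x y
    by (rule conv_lip[OF H_bound H_lip \<mu>_prob[OF sT] \<mu>_sets[OF sT]]) (rule conv_bound[OF H_bound H_lip \<mu>_prob[OF sT] \<mu>_sets[OF sT]])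
  have iH: "integrable (\<mu> s) (\<lambda>x. q' x (conv H (\<mu> s) x))" by (rule cont_int[OF sT q'W[OF Hs]])
  have iK: "integrable (\<mu> s) (\<lambda>x. q' x (K w x))" for w
  proof (rule cont_int[OF sT q'W])
    show "norm (K w x - K w y) \<le> real CARD('d) * norm w * (Lp) * norm (x - y)" for x y
    proof -
      have "norm (K w x - K w y) \<le> real CARD('d) * norm w * (Lp * norm (x - y))"
        unfolding K_def kernel_sum_diff
      proof (rule kernel_sum_bound)
        show "norm (G l (x - Y s $ k) - G l (y - Y s $ k)) \<le> Lp * norm (x - y)" for l k
          using G_lip[of l "x - Y s $ k" "y - Y s $ k"] by simp
      qed
      then show ?thesis by (simp add: mult.assoc)
    qed
    show "norm (K w x) \<le> real CARD('d) * norm w * B" for x unfolding K_def by (rule kernel_sum_bound) (rule G_bound)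
  qed
  (* The affine dependence of I r on the control: I r = alpha + Lambda (u r). *)
  define \<Lambda> where "\<Lambda> w = (\<integral>x. q' x (K w x) \<partial>\<mu> s)" for w
  define \<alpha> where "\<alpha> = (\<integral>x. q' x (conv H (\<mu> s) x) \<partial>\<mu> s)"
  have IL: "(\<integral>x. q' x (Vf w x) \<partial>\<mu> s) = \<alpha> + \<Lambda> w" for w
    unfolding VK \<alpha>_def \<Lambda>_def linear_add[OF q'(1)] by (rule Bochner_Integration.integral_add[OF iH iK])
  have linL: "linear \<Lambda>"
  proof (rule linearI)
    fix v w and c :: real
    have "K (v + w) x = K v x + K w x" "K (c *\<^sub>R v) x = c *\<^sub>R K v x" for x
      unfolding K_def by (simp_all add: linear_add[OF linear_kernel_sum] linear_scale[OF linear_kernel_sum])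
    then show "\<Lambda> (v + w) = \<Lambda> v + \<Lambda> w" "\<Lambda> (c *\<^sub>R v) = c *\<^sub>R \<Lambda> v"
      unfolding \<Lambda>_def using iK by (simp_all add: linear_add[OF q'(1)] linear_scale[OF q'(1)])
  qed
  define w where "w = mean_control s h"
  have wM: "norm w \<le> M" unfolding w_def by (rule mean_control_bound[OF s])
  have "((\<lambda>r. \<alpha> + \<Lambda> (u r)) has_integral h *\<^sub>R \<alpha> + h *\<^sub>R \<Lambda> w) {s..s + h}"
    unfolding w_def using has_integral_const_real[of \<alpha> s "s + h"] s
    by (intro has_integral_add mean_control_integral[OF s linL]) simp
  then have Iint: "(I has_integral h * (\<alpha> + \<Lambda> w)) {s..s + h}" unfolding I_def IL by (simp add: distrib_left)
  have "norm (integral {s..s + h} (\<lambda>r. J r - I r)) \<le> integral {s..s + h} (\<lambda>r. C1 * h)"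
    by (rule integral_norm_bound_integral) (use Jsub Iint JI in \<open>auto intro!: integrable_diff\<close>)
  then have A: "\<bar>integral {s..s + h} J - h * (\<alpha> + \<Lambda> w)\<bar> \<le> C1 * h * h"
    using Iint s by (simp add: hk_integral_diff[OF Jsub has_integral_integrable[OF Iint]] integral_unique[OF Iint] mult_ac)
  have cW: "continuous_on UNIV (\<lambda>x. q (x + h *\<^sub>R W x))"
    by (intro continuous_on_compose2[OF qc] continuous_intros W(1)) auto
  have cVw: "continuous_on UNIV (\<lambda>x. q' x (Vf w x))" by (rule q'W[OF Vf_lip[OF wM] Vf_bd[OF wM]])
  have Bd: "\<bar>(\<integral>x. q (x + h *\<^sub>R W x) \<partial>\<mu> s) - (\<integral>x. q x \<partial>\<mu> s) - h * (\<alpha> + \<Lambda> w)\<bar> \<le> b * (h * Cv)\<^sup>2 + a * (h * \<rho>)"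
  proof -
    have i: "integrable (\<mu> s) (\<lambda>x. q (x + h *\<^sub>R W x))" "integrable (\<mu> s) q" "integrable (\<mu> s) (\<lambda>x. h * q' x (Vf w x))"
      using cont_int[OF sT cW] cont_int[OF sT qc] cont_int[OF sT cVw] by simp_all
    have "norm (\<integral>x. q (x + h *\<^sub>R W x) - q x - h * q' x (Vf w x) \<partial>\<mu> s) \<le> b * (h * Cv)\<^sup>2 + a * (h * \<rho>)"
    proof (rule prob_norm_integral_le[OF \<mu>_prob[OF sT]])
      have "norm (q (x + h *\<^sub>R W x) - q x - h * q' x (Vf w x)) \<le> b * (h * Cv)\<^sup>2 + a * (h * \<rho>)" for x
      proof -
        have "norm (q (x + h *\<^sub>R W x) - q x - q' x (h *\<^sub>R W x)) \<le> b * (norm (h *\<^sub>R W x))\<^sup>2"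
          using q'(2)[of "x + h *\<^sub>R W x" x] by simp
        also have "\<dots> \<le> b * (h * Cv)\<^sup>2" using W(2)[of x] s b by (intro mult_left_mono power_mono) auto
        finally have 1: "norm (q (x + h *\<^sub>R W x) - q x - q' x (h *\<^sub>R W x)) \<le> b * (h * Cv)\<^sup>2" .
        have "norm (q' x (h *\<^sub>R (W x - Vf w x))) \<le> a * norm (h *\<^sub>R (W x - Vf w x))" by (rule q'(3))
        also have "\<dots> \<le> a * (h * \<rho>)" using W(3)[of x] s a unfolding Vf_def w_def
          by (intro mult_left_mono) (auto simp: norm_minus_commute intro!: mult_left_mono)
        finally have 2: "norm (q' x (h *\<^sub>R (W x - Vf w x))) \<le> a * (h * \<rho>)" .
        have "q (x + h *\<^sub>R W x) - q x - h * q' x (Vf w x) = (q (x + h *\<^sub>R W x) - q x - q' x (h *\<^sub>R W x)) + q' x (h *\<^sub>R (W x - Vf w x))"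
          by (simp add: linear_scale[OF q'(1)] linear_diff[OF q'(1)] algebra_simps)
        then show ?thesis using norm_triangle_mono[OF 1 2] by simp
      qed
      then show "AE x in \<mu> s. norm (q (x + h *\<^sub>R W x) - q x - h * q' x (Vf w x)) \<le> b * (h * Cv)\<^sup>2 + a * (h * \<rho>)" by simp
    qed (use i in auto)
    then show ?thesis using i by (simp add: IL[symmetric])
  qed
  have eqAE: "(\<integral>x. \<phi> x \<partial>\<mu> r) = (\<integral>x. q x \<partial>\<mu> r)" if r: "r \<in> {0..T}" for r
  proof (rule integral_cong_AE)
    show "AE x in \<mu> r. \<phi> x = q x" using \<mu>_supp[OF r] by eventually_elim (rule qt(2))
  qed (use cont_int[OF r qc] cont_int[OF r GDERIV_continuous[OF g]] in auto)
  have "\<bar>(\<integral>x. q x \<partial>\<mu> (s + h)) - (\<integral>x. q (x + h *\<^sub>R W x) \<partial>\<mu> s)\<bar> \<le> C1 * h * h + (b * (h * Cv)\<^sup>2 + a * (h * \<rho>))"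
    using A Bd inc unfolding eqAE[OF sT] eqAE[OF shT] by linarith
  also have "\<dots> = (a * (freeze + Kv * Cv) + b * (6 * Cv * Cv + Cv * Cv)) * h\<^sup>2 + a * (h * \<rho>)"
    unfolding C1_def by (simp add: power2_eq_square algebra_simps)
  also have "\<dots> \<le> (a * step_const + b * step_const) * h\<^sup>2 + step_const * (a * (h * \<rho>))"
  proof (intro add_mono mult_right_mono mult_left_mono)
    show "freeze + Kv * Cv \<le> step_const" "6 * Cv * Cv + Cv * Cv \<le> step_const"
      unfolding step_const_def using freeze_nonneg Cv_nonneg Kv_nonneg by auto
    have "1 \<le> step_const" unfolding step_const_def using freeze_nonneg Cv_nonneg Kv_nonneg by simp
    then show "a * (h * \<rho>) \<le> step_const * (a * (h * \<rho>))"
      using mult_right_mono[of 1 step_const "a * (h * \<rho>)"] a s \<rho> by simp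
  qed (use a b in auto)
  finally show ?thesis by (simp add: algebra_simps)
qed

lemma integral_close:
  fixes p p' :: "real^'d \<Rightarrow> real"
  assumes r: "r \<in> {0..T}" and p: "continuous_on UNIV p" "continuous_on UNIV p'" "\<And>x. norm (p x - p' x) \<le> c"
  shows "\<bar>(\<integral>x. p x \<partial>\<mu> r) - (\<integral>x. p' x \<partial>\<mu> r)\<bar> \<le> c"
proof -
  have i: "integrable (\<mu> r) p" "integrable (\<mu> r) p'" by (intro cont_int r p)+
  have "norm (\<integral>x. p x - p' x \<partial>\<mu> r) \<le> c"
    by (rule prob_norm_integral_le[OF \<mu>_prob[OF r]]) (use i p in auto)
  then show ?thesis using i by simp
qed

text \<open>The mollification of f is of class \<open>c11\<close> with the same constants and agrees with a test function on the ball carrying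
the measures; its width tends to zero.\<close>

lemma one_step:
  assumes s: "0 \<le> s" "0 < h" "s + h \<le> T" and f: "c11 a b f"
    and W: "continuous_on UNIV W" "\<And>x. norm (W x) \<le> Cv"
      "\<And>x. norm (frozen_velocity s (mean_control s h) x - W x) \<le> \<rho>" and \<rho>: "0 \<le> \<rho>"
  shows "\<bar>(\<integral>x. f x \<partial>\<mu> (s + h)) - (\<integral>x. f (x + h *\<^sub>R W x) \<partial>\<mu> s)\<bar> \<le> step_const * ((a + b) * h\<^sup>2 + a * h * \<rho>)"
proof (rule field_le_epsilon)
  fix e :: real assume e: "e > 0"
  have a: "0 \<le> a" using c11_nonneg[OF f] by simp
  have sT: "s \<in> {0..T}" and shT: "s + h \<in> {0..T}" using s by auto
  obtain d where d: "0 < d" "d \<le> 1" "2 * (a * d) \<le> e" by (rule small_width[OF a e], rule that)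
  have fc: "continuous_on UNIV f" by (rule lip_continuous_on[where L=a]) (rule c11_lip[OF f])
  define q where "q = mollify d f"
  have q: "c11 a b q" unfolding q_def by (rule mollify_c11[OF d(1) f])
  have qc: "continuous_on UNIV q" by (rule lip_continuous_on[where L=a]) (rule c11_lip[OF q])
  have qf: "norm (q x - f x) \<le> a * d" for x unfolding q_def by (rule mollify_close[OF d(1) c11_lip[OF f] a])
  obtain \<phi> where \<phi>: "test_function \<phi>" "\<And>x. norm x < R \<Longrightarrow> \<phi> x = mollify d f x"
    by (rule mollify_test_function[OF d(1,2) fc, where R=R], rule that)
  have 1: "\<bar>(\<integral>x. q x \<partial>\<mu> (s + h)) - (\<integral>x. q (x + h *\<^sub>R W x) \<partial>\<mu> s)\<bar> \<le> step_const * ((a + b) * h\<^sup>2 + a * h * \<rho>)"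
    by (rule one_step_mollified[OF s q \<phi>(1) \<phi>(2)[folded q_def] W \<rho>])
  have comp: "continuous_on UNIV (\<lambda>x. p (x + h *\<^sub>R W x))" if "continuous_on UNIV p" for p :: "real^'d \<Rightarrow> real"
    by (intro continuous_on_compose2[OF that] continuous_intros W(1)) auto
  have 2: "\<bar>(\<integral>x. q x \<partial>\<mu> (s + h)) - (\<integral>x. f x \<partial>\<mu> (s + h))\<bar> \<le> a * d" by (rule integral_close[OF shT qc fc qf])
  have 3: "\<bar>(\<integral>x. q (x + h *\<^sub>R W x) \<partial>\<mu> s) - (\<integral>x. f (x + h *\<^sub>R W x) \<partial>\<mu> s)\<bar> \<le> a * d"
    by (rule integral_close[OF sT comp[OF qc] comp[OF fc] qf])
  show "\<bar>(\<integral>x. f x \<partial>\<mu> (s + h)) - (\<integral>x. f (x + h *\<^sub>R W x) \<partial>\<mu> s)\<bar> \<le> step_const * ((a + b) * h\<^sup>2 + a * h * \<rho>) + e"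
    using 1 2 3 d(3) by linarith
qed

lemma velocity_mean:
  assumes s: "0 \<le> s" "0 < h" "s + h \<le> T"
  shows "((\<lambda>r. frozen_velocity s (u r) y) has_integral h *\<^sub>R frozen_velocity s (mean_control s h) y) {s..s + h}"
  unfolding velocity_eq scaleR_add_right
  using has_integral_const_real[of "conv H (\<mu> s) y" s "s + h"] s
  by (intro has_integral_add mean_control_integral[OF s linear_kernel_sum]) simp

lemma flow_step:
  assumes s: "0 \<le> s" "0 < h" "s + h \<le> T" and z: "flow_line \<mu> x z"
  shows "norm (z (s + h) - (z s + h *\<^sub>R frozen_velocity s (mean_control s h) (z s))) \<le> (freeze + Kv * Cv) * h\<^sup>2"
proof -
  have sT: "s \<in> {0..T}" and shT: "s + h \<in> {0..T}" using s by auto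
  define v where "v r = vel \<mu> r (z r)" for r
  have zc: "continuous_on {0..T} z" using z unfolding flow_line_def by simp
  have vi: "v integrable_on {0..T}" unfolding v_def
    using velocity_time[OF good_curve_\<mu> zc] by (simp add: absolutely_integrable_on_def)
  have vs: "v integrable_on {s..s + h}" by (rule integrable_on_subinterval[OF vi]) (use s in auto)
  note fz = velocity_mean[OF s, of "z s"]
  have "z (s + h) - z s = integral {0..s + h} v - integral {0..s} v"
    using z sT shT unfolding flow_line_def v_def by simp
  also have "\<dots> = integral {s..s + h} v" by (rule integral_increment[OF vi]) (use s in auto)
  finally have "z (s + h) - (z s + h *\<^sub>R frozen_velocity s (mean_control s h) (z s)) = integral {s..s + h} (\<lambda>r. v r - frozen_velocity s (u r) (z s))"
    using hk_integral_diff[OF vs has_integral_integrable[OF fz]] integral_unique[OF fz] by (simp add: algebra_simps)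
  also have "norm \<dots> \<le> integral {s..s + h} (\<lambda>r. freeze * h + Kv * (Cv * h))"
  proof (rule integral_norm_bound_integral)
    show "(\<lambda>r. v r - frozen_velocity s (u r) (z s)) integrable_on {s..s + h}"
      by (intro integrable_diff vs has_integral_integrable[OF fz])
    fix r assume r: "r \<in> {s..s + h}"
    then have rT: "r \<in> {0..T}" and rs: "\<bar>r - s\<bar> \<le> h" using s by auto
    have "norm (vel \<mu> r (z r) - frozen_velocity s (u r) (z r)) \<le> freeze * \<bar>r - s\<bar>"
      unfolding freeze_def by (rule velocity_freeze[OF sT rT])
    also have "\<dots> \<le> freeze * h" using rs freeze_nonneg by (rule mult_left_mono)
    finally have 1: "norm (vel \<mu> r (z r) - frozen_velocity s (u r) (z r)) \<le> freeze * h" .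
    have "norm (z r - z s) \<le> Cv * \<bar>r - s\<bar>" by (rule flow_line_lip[OF good_curve_\<mu> z sT rT])
    also have "\<dots> \<le> Cv * h" using rs Cv_nonneg by (rule mult_left_mono)
    finally have zz: "norm (z r - z s) \<le> Cv * h" .
    have "norm (frozen_velocity s (u r) (z r) - frozen_velocity s (u r) (z s)) \<le> Kv * norm (z r - z s)"
      by (rule velocity_lip[OF \<mu>_prob[OF sT] \<mu>_sets[OF sT] u_bound])
    also have "\<dots> \<le> Kv * (Cv * h)" using zz Kv_nonneg by (rule mult_left_mono)
    finally have 2: "norm (frozen_velocity s (u r) (z r) - frozen_velocity s (u r) (z s)) \<le> Kv * (Cv * h)" .
    show "norm (v r - frozen_velocity s (u r) (z s)) \<le> freeze * h + Kv * (Cv * h)"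
      unfolding v_def using norm_triangle_mono[OF 1 2] by simp
  qed auto
  also have "\<dots> = (freeze + Kv * Cv) * h\<^sup>2" using s by (simp add: power2_eq_square algebra_simps)
  finally show ?thesis .
qed

text \<open>Duality in discrete form, by induction on the number of steps: in the last step the function f is replaced by
\<open>f (x + h W x)\<close>, for the measure by \<open>one_step\<close> and for the flow by \<open>flow_step\<close>, and the induction hypothesis is applied to
this function. Hence the statement has to be proved for all \<open>c11\<close> functions at once, and W has to be the mollified field, so
that the class is preserved. Each step contributes \<open>O(h\<^sup>2 + h \<rho>)\<close>, and there are \<open>t / h\<close> of them.\<close>

lemma euler_error:
  assumes \<epsilon>: "\<epsilon> > 0" and N: "N \<ge> (1::nat)" and t: "0 < t" "t \<le> T"
    and \<Phi>: "\<And>x. flow_line \<mu> x (\<lambda>t. \<Phi> t x)" "\<And>t. t \<in> {0..T} \<Longrightarrow> continuous_on UNIV (\<Phi> t)"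
    and q: "c11 Lp q (mollify \<epsilon> H)" "\<And>l. c11 Lp q (mollify \<epsilon> (G l))"
    and f: "c11 a b f"
  defines "\<rho> \<equiv> (1 + real CARD('d) * M) * (Lp * \<epsilon>)" and "q1 \<equiv> q + real CARD('d) * M * q"
    and "K1 \<equiv> step_const + (freeze + Kv * Cv) + 1"
  shows "\<bar>(\<integral>x. f x \<partial>\<mu> t) - (\<integral>x. f (\<Phi> t x) \<partial>\<mu> 0)\<bar> \<le> t * exp (2 * Kv * t) * K1 * ((a + b + a * q1 * t) * (t / real N) + a * \<rho>)"
proof -
  interpret m: interaction "mollify \<epsilon> H" "\<lambda>l. mollify \<epsilon> (G l)" B Lp by (rule mollified_interaction[OF \<epsilon>])
  have mv: "m.vel_bd M = Cv" "m.vel_lip M = Kv"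
    unfolding m.vel_bd_def vel_bd_def m.vel_lip_def vel_lip_def dim_real_def by simp_all
  define h where "h = t / real N"
  define Q where "Q = 1 + h * Kv"
  have h: "h > 0" and Nh: "real N * h = t" using N t unfolding h_def by auto
  have Q: "1 \<le> Q" unfolding Q_def using h Kv_nonneg by simp
  have \<rho>: "0 \<le> \<rho>" unfolding \<rho>_def using M_nonneg Lp_nonneg \<epsilon> by simp
  have q1: "0 \<le> q1" unfolding q1_def using c11_nonneg(2)[OF q(1)] M_nonneg by simp
  have C2: "0 \<le> freeze + Kv * Cv" using freeze_nonneg Kv_nonneg Cv_nonneg by simp
  have sc: "0 \<le> step_const" unfolding step_const_def using freeze_nonneg Cv_nonneg Kv_nonneg by simp
  have K1: "0 \<le> K1" unfolding K1_def using sc C2 by simp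
  (* The error after n steps for functions with constants a and b. *)
  define c where "c n a b = real n * Q ^ (2 * n) * (K1 * ((a + b + real n * a * q1 * h) * h\<^sup>2 + a * h * \<rho>))" for n :: nat and a b
  have main: "n \<le> N \<longrightarrow> (\<forall>a b f. c11 a b f \<longrightarrow> \<bar>(\<integral>x. f x \<partial>\<mu> (real n * h)) - (\<integral>x. f (\<Phi> (real n * h) x) \<partial>\<mu> 0)\<bar> \<le> c n a b)" for n
  proof (induction n)
    case 0
    have "\<Phi> 0 x = x" for x using flow_line_0[OF \<Phi>(1)] .
    then show ?case unfolding c_def by simp
  next
    case (Suc n)
    show ?case
    proof (intro impI allI)
      fix a b and f :: "real^'d \<Rightarrow> real"
      assume n: "Suc n \<le> N" and f: "c11 a b f"
      have a: "0 \<le> a" and b: "0 \<le> b" using c11_nonneg[OF f] by auto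
      define s where "s = real n * h"
      have "s + h = real (Suc n) * h" unfolding s_def by (simp add: algebra_simps)
      also have "\<dots> \<le> real N * h" using n h by (intro mult_right_mono) auto
      finally have s: "0 \<le> s" "0 < h" "s + h \<le> T" using Nh t h unfolding s_def by auto
      have sh: "real (Suc n) * h = s + h" unfolding s_def by (simp add: algebra_simps)
      have sT: "s \<in> {0..T}" and shT: "s + h \<in> {0..T}" and 0: "0 \<in> {0..T}" using s by auto
      define w where "w = mean_control s h"
      have wM: "norm w \<le> M" unfolding w_def by (rule mean_control_bound[OF s])
      define W where "W x = velocity (mollify \<epsilon> H) (\<lambda>l. mollify \<epsilon> (G l)) w (Y s) (\<mu> s) x" for x
      have Wc11: "c11 Kv q1 W" unfolding W_def q1_def
        using m.velocity_c11[OF q \<mu>_prob[OF sT] \<mu>_sets[OF sT] wM] unfolding mv .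
      have Wc: "continuous_on UNIV W" by (rule lip_continuous_on[where L=Kv]) (rule c11_lip[OF Wc11])
      have Wb: "norm (W x) \<le> Cv" for x
        unfolding W_def using m.velocity_bound[OF \<mu>_prob[OF sT] \<mu>_sets[OF sT] wM] unfolding mv .
      have W\<rho>: "norm (frozen_velocity s w x - W x) \<le> \<rho>" for x
        unfolding W_def \<rho>_def by (rule velocity_mollify_close[OF \<epsilon> \<mu>_prob[OF sT] \<mu>_sets[OF sT] wM])
      have A: "\<bar>(\<integral>x. f x \<partial>\<mu> (s + h)) - (\<integral>x. f (x + h *\<^sub>R W x) \<partial>\<mu> s)\<bar> \<le> step_const * ((a + b) * h\<^sup>2 + a * h * \<rho>)"
        by (rule one_step[OF s f Wc Wb W\<rho>[unfolded w_def] \<rho>])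
      have fA: "c11 (a * Q) (b * Q\<^sup>2 + a * (h * q1)) (\<lambda>x. f (x + h *\<^sub>R W x))"
        unfolding Q_def by (rule c11_comp[OF f c11_euler_step[OF Wc11]]) (use h in simp)
      have Bd: "\<bar>(\<integral>x. f (x + h *\<^sub>R W x) \<partial>\<mu> s) - (\<integral>x. f (\<Phi> s x + h *\<^sub>R W (\<Phi> s x)) \<partial>\<mu> 0)\<bar> \<le> c n (a * Q) (b * Q\<^sup>2 + a * (h * q1))"
        using Suc.IH[rule_format, OF _ fA] n unfolding s_def by simp
      have fc: "continuous_on UNIV f" by (rule lip_continuous_on[where L=a]) (rule c11_lip[OF f])
      have c1: "continuous_on UNIV (\<lambda>x. f (\<Phi> s x + h *\<^sub>R W (\<Phi> s x)))"
        by (intro continuous_on_compose2[OF fc] continuous_on_add continuous_on_scaleR continuous_on_const continuous_on_compose2[OF Wc] \<Phi>(2)[OF sT]) auto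
      have c2: "continuous_on UNIV (\<lambda>x. f (\<Phi> (s + h) x))"
        by (intro continuous_on_compose2[OF fc] \<Phi>(2)[OF shT]) auto
      have C: "\<bar>(\<integral>x. f (\<Phi> s x + h *\<^sub>R W (\<Phi> s x)) \<partial>\<mu> 0) - (\<integral>x. f (\<Phi> (s + h) x) \<partial>\<mu> 0)\<bar> \<le> a * ((freeze + Kv * Cv) * h\<^sup>2 + h * \<rho>)"
      proof -
        have "norm (\<integral>x. f (\<Phi> s x + h *\<^sub>R W (\<Phi> s x)) - f (\<Phi> (s + h) x) \<partial>\<mu> 0) \<le> a * ((freeze + Kv * Cv) * h\<^sup>2 + h * \<rho>)"
        proof (rule prob_norm_integral_le[OF \<mu>_prob[OF 0]])
          have "norm (f (\<Phi> s x + h *\<^sub>R W (\<Phi> s x)) - f (\<Phi> (s + h) x)) \<le> a * ((freeze + Kv * Cv) * h\<^sup>2 + h * \<rho>)" for x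
          proof -
            have 1: "norm (\<Phi> (s + h) x - (\<Phi> s x + h *\<^sub>R frozen_velocity s w (\<Phi> s x))) \<le> (freeze + Kv * Cv) * h\<^sup>2"
              unfolding w_def by (rule flow_step[OF s \<Phi>(1)])
            have 2: "norm (h *\<^sub>R (frozen_velocity s w (\<Phi> s x) - W (\<Phi> s x))) \<le> h * \<rho>"
              using W\<rho>[of "\<Phi> s x"] h by simp
            have E: "\<Phi> (s + h) x - (\<Phi> s x + h *\<^sub>R W (\<Phi> s x)) = (\<Phi> (s + h) x - (\<Phi> s x + h *\<^sub>R frozen_velocity s w (\<Phi> s x)))
               + h *\<^sub>R (frozen_velocity s w (\<Phi> s x) - W (\<Phi> s x))" by (simp add: algebra_simps)
            have 3: "norm (\<Phi> (s + h) x - (\<Phi> s x + h *\<^sub>R W (\<Phi> s x))) \<le> (freeze + Kv * Cv) * h\<^sup>2 + h * \<rho>"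
              unfolding E by (rule norm_triangle_mono[OF 1 2])
            have "norm (f (\<Phi> s x + h *\<^sub>R W (\<Phi> s x)) - f (\<Phi> (s + h) x)) \<le> a * norm (\<Phi> s x + h *\<^sub>R W (\<Phi> s x) - \<Phi> (s + h) x)"
              by (rule c11_lip[OF f])
            also have "\<dots> \<le> a * ((freeze + Kv * Cv) * h\<^sup>2 + h * \<rho>)"
              using 3 a by (intro mult_left_mono) (simp_all only: norm_minus_commute)
            finally show ?thesis .
          qed
          then show "AE x in \<mu> 0. norm (f (\<Phi> s x + h *\<^sub>R W (\<Phi> s x)) - f (\<Phi> (s + h) x)) \<le> a * ((freeze + Kv * Cv) * h\<^sup>2 + h * \<rho>)" by simp
        qed (use cont_int[OF 0 c1] cont_int[OF 0 c2] in auto)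
        then show ?thesis using cont_int[OF 0 c1] cont_int[OF 0 c2] by simp
      qed
      define X where "X = (a + b + real (Suc n) * a * q1 * h) * h\<^sup>2 + a * h * \<rho>"
      have X: "0 \<le> X" unfolding X_def using a b q1 h \<rho> by simp
      have e1: "step_const * ((a + b) * h\<^sup>2 + a * h * \<rho>) + a * ((freeze + Kv * Cv) * h\<^sup>2 + h * \<rho>) \<le> K1 * X"
      proof -
        define P where "P = (a + b) * h\<^sup>2 + a * h * \<rho>"
        have "P \<le> X" unfolding P_def X_def using a q1 h by (simp add: distrib_right)
        moreover have "a * h\<^sup>2 \<le> P" "a * (h * \<rho>) \<le> P" unfolding P_def using a b h \<rho> by (simp_all add: distrib_right)
        moreover have "(freeze + Kv * Cv) * (a * h\<^sup>2) \<le> (freeze + Kv * Cv) * P"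
          using calculation(2) C2 by (rule mult_left_mono)
        ultimately have "step_const * P + a * ((freeze + Kv * Cv) * h\<^sup>2 + h * \<rho>) \<le> K1 * P"
          unfolding K1_def by (simp add: algebra_simps)
        also have "\<dots> \<le> K1 * X" using \<open>P \<le> X\<close> K1 by (rule mult_left_mono)
        finally show ?thesis unfolding P_def .
      qed
      have QQ: "Q \<le> Q\<^sup>2" "1 \<le> Q\<^sup>2" using Q by (simp_all add: power2_eq_square mult_ge1_I)
      have e2: "(a * Q + (b * Q\<^sup>2 + a * (h * q1)) + real n * (a * Q) * q1 * h) * h\<^sup>2 + a * Q * h * \<rho> \<le> Q\<^sup>2 * X"
      proof -
        have "a * Q \<le> Q\<^sup>2 * a" using mult_left_mono[OF QQ(1) a] by (simp add: mult.commute)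
        moreover have "a * (h * q1) \<le> Q\<^sup>2 * (a * q1 * h)"
          using mult_right_mono[OF QQ(2), of "a * q1 * h"] a q1 h by (simp add: mult_ac)
        moreover have "real n * (a * Q) * q1 * h \<le> Q\<^sup>2 * (real n * a * q1 * h)"
          using mult_right_mono[OF QQ(1), of "real n * a * q1 * h"] a q1 h by (simp add: mult_ac)
        ultimately have "a * Q + (b * Q\<^sup>2 + a * (h * q1)) + real n * (a * Q) * q1 * h \<le> Q\<^sup>2 * (a + b + real (Suc n) * a * q1 * h)"
          by (simp add: algebra_simps)
        then have "(a * Q + (b * Q\<^sup>2 + a * (h * q1)) + real n * (a * Q) * q1 * h) * h\<^sup>2 \<le> Q\<^sup>2 * (a + b + real (Suc n) * a * q1 * h) * h\<^sup>2"
          by (rule mult_right_mono) simp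
        moreover have "a * Q * h * \<rho> \<le> Q\<^sup>2 * (a * h * \<rho>)"
          using mult_right_mono[OF QQ(1), of "a * h * \<rho>"] a h \<rho> by (simp add: mult_ac)
        ultimately show ?thesis unfolding X_def by (simp add: algebra_simps)
      qed
      have e3: "c n (a * Q) (b * Q\<^sup>2 + a * (h * q1)) \<le> real n * Q ^ (2 * Suc n) * (K1 * X)"
      proof -
        have "c n (a * Q) (b * Q\<^sup>2 + a * (h * q1)) \<le> real n * Q ^ (2 * n) * (K1 * (Q\<^sup>2 * X))"
          unfolding c_def using e2 K1 Q by (intro mult_left_mono) auto
        then show ?thesis by (simp add: power_add power2_eq_square mult_ac)
      qed
      have "K1 * X \<le> Q ^ (2 * Suc n) * (K1 * X)"
        using mult_right_mono[OF one_le_power[OF Q, of "2 * Suc n"], of "K1 * X"] K1 X by simp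
      then have "\<bar>(\<integral>x. f x \<partial>\<mu> (s + h)) - (\<integral>x. f (\<Phi> (s + h) x) \<partial>\<mu> 0)\<bar> \<le> real n * Q ^ (2 * Suc n) * (K1 * X) + Q ^ (2 * Suc n) * (K1 * X)"
        using A Bd C e1 e3 by linarith
      also have "\<dots> = c (Suc n) a b" unfolding c_def X_def by (simp add: algebra_simps)
      finally show "\<bar>(\<integral>x. f x \<partial>\<mu> (real (Suc n) * h)) - (\<integral>x. f (\<Phi> (real (Suc n) * h) x) \<partial>\<mu> 0)\<bar> \<le> c (Suc n) a b"
        unfolding sh .
    qed
  qed
  have a: "0 \<le> a" and b: "0 \<le> b" using c11_nonneg[OF f] by auto
  have "\<bar>(\<integral>x. f x \<partial>\<mu> t) - (\<integral>x. f (\<Phi> t x) \<partial>\<mu> 0)\<bar> \<le> c N a b"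
    using main[of N] f unfolding Nh by simp
  also have "c N a b = t * Q ^ (2 * N) * K1 * ((a + b + a * q1 * t) * h + a * \<rho>)"
    unfolding c_def Nh[symmetric] by (simp add: power2_eq_square algebra_simps)
  also have "\<dots> \<le> t * exp (2 * Kv * t) * K1 * ((a + b + a * q1 * t) * h + a * \<rho>)"
  proof -
    have "Q ^ (2 * N) \<le> exp (h * Kv) ^ (2 * N)"
      unfolding Q_def using h Kv_nonneg by (intro power_mono exp_ge_add_one_self) auto
    also have "\<dots> = exp (2 * Kv * t)" unfolding exp_of_nat_mult[symmetric] Nh[symmetric] by (simp add: algebra_simps)
    finally have "Q ^ (2 * N) \<le> exp (2 * Kv * t)" .
    then show ?thesis using t K1 a b q1 h \<rho> by (intro mult_right_mono mult_left_mono) auto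
  qed
  finally show ?thesis unfolding h_def .
qed

text \<open>In \<open>euler_error\<close> first N tends to infinity for fixed \<open>\<epsilon>\<close>, since q depends on \<open>\<epsilon>\<close>; then \<open>\<epsilon>\<close> tends to zero.\<close>

lemma weak_solution_c11_eq:
  fixes f :: "real^'d \<Rightarrow> real"
  assumes t: "t \<in> {0..T}"
    and \<Phi>: "\<And>x. flow_line \<mu> x (\<lambda>t. \<Phi> t x)" "\<And>t. t \<in> {0..T} \<Longrightarrow> continuous_on UNIV (\<Phi> t)" and f: "c11 a b f"
  shows "(\<integral>x. f x \<partial>\<mu> t) = (\<integral>x. f (\<Phi> t x) \<partial>\<mu> 0)"
proof (cases "t = 0")
  case True
  then show ?thesis using flow_line_0[OF \<Phi>(1)] by simp
next
  case False
  then have t: "0 < t" "t \<le> T" using t by auto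
  define D where "D = \<bar>(\<integral>x. f x \<partial>\<mu> t) - (\<integral>x. f (\<Phi> t x) \<partial>\<mu> 0)\<bar>"
  define A where "A = t * exp (2 * Kv * t) * (step_const + (freeze + Kv * Cv) + 1)"
  define \<beta> where "\<beta> = A * (a * ((1 + real CARD('d) * M) * Lp))"
  have "D \<le> \<beta> * \<epsilon>" if \<epsilon>: "\<epsilon> > 0" for \<epsilon>
  proof -
    obtain q where q: "c11 Lp q (mollify \<epsilon> H)" "\<And>l. c11 Lp q (mollify \<epsilon> (G l))" using mollified_c11[OF \<epsilon>] by blast
    define c1 where "c1 = a + b + a * (q + real CARD('d) * M * q) * t"
    have le: "D \<le> A * (c1 * (t / real N) + a * ((1 + real CARD('d) * M) * (Lp * \<epsilon>)))" if N: "N \<ge> 1" for N :: nat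
      unfolding D_def A_def c1_def by (rule euler_error[OF \<epsilon> N t \<Phi> q f])
    have "(\<lambda>N. A * (c1 * (t / real N) + a * ((1 + real CARD('d) * M) * (Lp * \<epsilon>)))) \<longlonglongrightarrow> A * (c1 * 0 + a * ((1 + real CARD('d) * M) * (Lp * \<epsilon>)))"
      by (intro tendsto_intros lim_const_over_n)
    then have "D \<le> A * (c1 * 0 + a * ((1 + real CARD('d) * M) * (Lp * \<epsilon>)))"
      by (rule LIMSEQ_le_const) (use le in blast)
    then show ?thesis unfolding \<beta>_def by (simp add: algebra_simps)
  qed
  note D = this
  have "D \<le> 0"
  proof (rule field_le_epsilon)
    fix e :: real assume e: "e > 0"
    have "D \<le> \<beta> * (e / (\<bar>\<beta>\<bar> + 1))" using e by (intro D) simp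
    also have "\<dots> \<le> (\<bar>\<beta>\<bar> + 1) * (e / (\<bar>\<beta>\<bar> + 1))" using e by (intro mult_right_mono) auto
    also have "\<dots> = e"
    proof -
      have "\<bar>\<beta>\<bar> + 1 \<noteq> 0" by linarith
      then show ?thesis by simp
    qed
    finally show "D \<le> 0 + e" by simp
  qed
  then show ?thesis unfolding D_def by simp
qed

text \<open>Mollification approximates bounded Lipschitz functions uniformly by functions of class \<open>c11\<close>, and bounded Lipschitz
functions determine a measure.\<close>

theorem weak_solution_unique:
  assumes t: "t \<in> {0..T}"
    and \<Phi>: "\<And>x. flow_line \<mu> x (\<lambda>t. \<Phi> t x)" "\<And>t. t \<in> {0..T} \<Longrightarrow> continuous_on UNIV (\<Phi> t)"
  shows "\<mu> t = distr (\<mu> 0) borel (\<Phi> t)"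
proof -
  have 0: "0 \<in> {0..T}" using T_pos by simp
  interpret P0: prob_space "\<mu> 0" by (rule \<mu>_prob[OF 0])
  have \<Phi>m: "\<Phi> t \<in> borel_measurable (\<mu> 0)"
    unfolding measurable_cong_sets[OF \<mu>_sets[OF 0] refl] by (rule borel_measurable_continuous_onI[OF \<Phi>(2)[OF t]])
  show ?thesis
  proof (rule measure_eq_lipschitz[OF \<mu>_prob[OF t] \<mu>_sets[OF t] P0.prob_space_distr[OF \<Phi>m]])
    fix f :: "real^'d \<Rightarrow> real" and a
    assume f1: "\<And>x. \<bar>f x\<bar> \<le> 1" and fl: "\<And>x y. \<bar>f x - f y\<bar> \<le> a * norm (x - y)" and a: "0 \<le> a"
    have fc: "continuous_on UNIV f" by (rule lip_continuous_on[where L=a]) (use fl in simp)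
    have fm: "f \<in> borel_measurable borel" by (rule borel_measurable_continuous_onI[OF fc])
    have fd: "(\<integral>x. f x \<partial>distr (\<mu> 0) borel (\<Phi> t)) = (\<integral>x. f (\<Phi> t x) \<partial>\<mu> 0)" by (rule integral_distr[OF \<Phi>m fm])
    have "\<bar>(\<integral>x. f x \<partial>\<mu> t) - (\<integral>x. f (\<Phi> t x) \<partial>\<mu> 0)\<bar> \<le> 0"
    proof (rule field_le_epsilon)
      fix e :: real assume e: "e > 0"
      define d where "d = e / (2 * (a + 1))"
      have d: "0 < d" "2 * (a * d) \<le> e" unfolding d_def using e a by (auto simp: field_simps)
      obtain b where q: "c11 a b (mollify d f)" using mollify_smooth[OF d(1), of f a 1] fl f1 a by auto
      have qc: "continuous_on UNIV (mollify d f)" by (rule lip_continuous_on[where L=a]) (rule c11_lip[OF q])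
      have qf: "norm (mollify d f x - f x) \<le> a * d" for x by (rule mollify_close[OF d(1) _ a]) (use fl in simp)
      have comp: "continuous_on UNIV (\<lambda>x. p (\<Phi> t x))" if "continuous_on UNIV p" for p :: "real^'d \<Rightarrow> real"
        by (rule continuous_on_compose2[OF that \<Phi>(2)[OF t]]) auto
      have "\<bar>(\<integral>x. mollify d f x \<partial>\<mu> t) - (\<integral>x. f x \<partial>\<mu> t)\<bar> \<le> a * d" by (rule integral_close[OF t qc fc qf])
      moreover have "\<bar>(\<integral>x. mollify d f (\<Phi> t x) \<partial>\<mu> 0) - (\<integral>x. f (\<Phi> t x) \<partial>\<mu> 0)\<bar> \<le> a * d"
        by (rule integral_close[OF 0 comp[OF qc] comp[OF fc] qf])
      moreover have "(\<integral>x. mollify d f x \<partial>\<mu> t) = (\<integral>x. mollify d f (\<Phi> t x) \<partial>\<mu> 0)"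
        by (rule weak_solution_c11_eq[OF t \<Phi> q])
      ultimately show "\<bar>(\<integral>x. f x \<partial>\<mu> t) - (\<integral>x. f (\<Phi> t x) \<partial>\<mu> 0)\<bar> \<le> 0 + e" using d(2) by linarith
    qed
    then show "(\<integral>x. f x \<partial>\<mu> t) = (\<integral>x. f x \<partial>distr (\<mu> 0) borel (\<Phi> t))" unfolding fd by simp
  qed simp
qed

end

section \<open>Weak-* compactness of the set of controls\<close>

lemma integral_indicator_lborel:
  fixes w :: "real \<Rightarrow> real"
  assumes "w \<in> borel_measurable borel" "\<And>t. \<bar>w t\<bar> \<le> K"
  shows "integrable lborel (\<lambda>t. indicator {a..b} t * w t)" "(\<integral>t. indicator {a..b} t * w t \<partial>lborel) = integral {a..b} w"
proof -
  have "integrable lborel (\<lambda>t. indicator {a..b} t *\<^sub>R K :: real)" by (rule borel_integrable_compact) auto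
  then show i: "integrable lborel (\<lambda>t. indicator {a..b} t * w t)"
    by (rule Bochner_Integration.integrable_bound) (use assms(1) order_trans[OF assms(2) abs_ge_self] in \<open>auto simp: indicator_def\<close>)
  have "set_integrable lborel {a..b} w" unfolding set_integrable_def using i by simp
  from set_borel_integral_eq_integral(2)[OF this] show "(\<integral>t. indicator {a..b} t * w t \<partial>lborel) = integral {a..b} w"
    unfolding set_lebesgue_integral_def by simp
qed

text \<open>A density exceeds K only on a null set, so it can be truncated there.\<close>

lemma radon_nikodym_bounded:
  assumes \<nu>: "finite_measure \<nu>" "sets \<nu> = sets (borel :: real measure)"
    and dom: "\<And>A. A \<in> sets borel \<Longrightarrow> emeasure \<nu> A \<le> ennreal K * emeasure lborel A" and K: "K > 0"
  obtains g where "g \<in> borel_measurable borel" "\<And>t. 0 \<le> g t" "\<And>t. g t \<le> K"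
    "\<And>A. A \<in> sets borel \<Longrightarrow> emeasure \<nu> A = (\<integral>\<^sup>+t. indicator A t * ennreal (g t) \<partial>lborel)"
proof -
  interpret finite_measure \<nu> by fact
  have "absolutely_continuous lborel \<nu>"
    unfolding absolutely_continuous_def null_sets_def using dom \<nu>(2) by fastforce
  then obtain f where fm: "f \<in> borel_measurable lborel" and f: "density lborel f = \<nu>"
    using sigma_finite_measure.Radon_Nikodym[OF sigma_finite_lborel, of \<nu>] \<nu>(2) by auto
  have fm': "f \<in> borel_measurable borel" using fm by simp
  define A where "A = {t. f t > ennreal K}"
  have Am: "A \<in> sets borel"
    using measurable_sets[OF fm', of "{ennreal K<..}"] unfolding A_def by (simp add: vimage_def greaterThan_def)
  have nuA: "emeasure \<nu> A = (\<integral>\<^sup>+t. f t * indicator A t \<partial>lborel)"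
    unfolding f[symmetric] using Am fm by (subst emeasure_density) auto
  have KA: "(\<integral>\<^sup>+t. ennreal K * indicator A t \<partial>lborel) = ennreal K * emeasure lborel A"
    using Am by (simp add: nn_integral_cmult_indicator)
  have "ennreal K * emeasure lborel A \<le> emeasure \<nu> A"
    unfolding KA[symmetric] nuA by (rule nn_integral_mono) (auto simp: A_def indicator_def)
  moreover have nfin: "emeasure \<nu> A < \<infinity>" using emeasure_finite[of A] by (simp add: less_top[symmetric])
  ultimately have fin: "ennreal K * emeasure lborel A < \<infinity>" by (rule order_le_less_trans)
  have "(\<integral>\<^sup>+t. (f t * indicator A t - ennreal K * indicator A t) \<partial>lborel)
     = (\<integral>\<^sup>+t. f t * indicator A t \<partial>lborel) - (\<integral>\<^sup>+t. ennreal K * indicator A t \<partial>lborel)"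
    by (rule nn_integral_diff) (use fm Am fin KA in \<open>auto simp: A_def indicator_def less_top\<close>)
  also have "\<dots> \<le> 0" unfolding KA nuA[symmetric] using dom[OF Am] nfin by (simp add: diff_eq_0_iff_ennreal)
  finally have z: "(\<integral>\<^sup>+t. (f t * indicator A t - ennreal K * indicator A t) \<partial>lborel) = 0" by simp
  have "(\<lambda>t. f t * indicator A t - ennreal K * indicator A t) \<in> borel_measurable lborel"
    using fm' Am by measurable
  from nn_integral_0_iff_AE[OF this] have "AE t in lborel. f t * indicator A t - ennreal K * indicator A t = 0" using z by simp
  then have fK: "AE t in lborel. f t \<le> ennreal K"
  proof eventually_elim
    case (elim t)
    show ?case
    proof (rule ccontr)
      assume n: "\<not> f t \<le> ennreal K"
      then have "t \<in> A" unfolding A_def by simp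
      then have "f t - ennreal K = 0" using elim by simp
      then show False using n by (simp add: diff_eq_0_iff_ennreal)
    qed
  qed
  define g where "g t = enn2real (min (f t) (ennreal K))" for t
  have fin': "min (f t) (ennreal K) < \<infinity>" for t by (simp add: min_less_iff_disj)
  have geq: "ennreal (g t) = min (f t) (ennreal K)" for t unfolding g_def using fin'[of t] by (simp add: ennreal_enn2real_if less_top)
  show thesis
  proof (rule that)
    show gm: "g \<in> borel_measurable borel" unfolding g_def using fm' by measurable
    show "0 \<le> g t" for t unfolding g_def by simp
    show "g t \<le> K" for t using enn2real_mono[of "min (f t) (ennreal K)" "ennreal K"] K unfolding g_def by simp
    fix B :: "real set" assume B: "B \<in> sets borel"
    have "emeasure \<nu> B = (\<integral>\<^sup>+t. f t * indicator B t \<partial>lborel)"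
      unfolding f[symmetric] using B fm by (subst emeasure_density) auto
    also have "\<dots> = (\<integral>\<^sup>+t. indicator B t * ennreal (g t) \<partial>lborel)"
      by (rule nn_integral_cong_AE) (use fK in \<open>eventually_elim, simp add: geq min_absorb1 mult.commute\<close>)
    finally show "emeasure \<nu> B = (\<integral>\<^sup>+t. indicator B t * ennreal (g t) \<partial>lborel)" .
  qed
qed

text \<open>The limit f of the antiderivatives is increasing and Lipschitz, hence the distribution function of a measure \<open>\<nu>\<close>. The
measures \<open>m n\<close> with densities \<open>v n\<close> converge to \<open>\<nu>\<close> on half-lines, and by Dynkin's argument on all Borel sets;
disjoint unions are admitted because \<open>m n\<close> is dominated by K times Lebesgue measure, so that Tannery's theorem applies. This
domination also gives \<open>\<nu>\<close> a density g bounded by K, and convergence on sets extends to integrable functions.\<close>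

lemma scalar_weak_star:
  fixes v :: "nat \<Rightarrow> real \<Rightarrow> real"
  assumes T: "T > 0" and K: "K > 0" and vm: "\<And>n. v n \<in> borel_measurable borel"
    and v0: "\<And>n t. 0 \<le> v n t" and vK: "\<And>n t. v n t \<le> K"
    and lim: "\<And>t. t \<in> {0..T} \<Longrightarrow> (\<lambda>n. integral {0..t} (v n)) \<longlonglongrightarrow> f t"
  obtains g where "g \<in> borel_measurable borel" "\<And>t. 0 \<le> g t" "\<And>t. g t \<le> K"
    "\<And>\<psi>. integrable lborel \<psi> \<Longrightarrow> (\<lambda>n. \<integral>t. (indicator {0..T} t * v n t) * \<psi> t \<partial>lborel) \<longlonglongrightarrow> (\<integral>t. g t * \<psi> t \<partial>lborel)"
proof -
  define w where "w n t = indicator {0..T} t * v n t" for n t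
  have wm: "w n \<in> borel_measurable borel" for n unfolding w_def using vm by measurable
  have w0: "0 \<le> w n t" and wK: "w n t \<le> K" for n t unfolding w_def using v0 vK K by (auto simp: indicator_def)
  have vabs: "\<bar>v n t\<bar> \<le> K" for n t using v0[of n t] vK[of n t] by simp
  define m where "m n = density lborel (\<lambda>t. ennreal (w n t))" for n
  have ms: "sets (m n) = sets borel" for n unfolding m_def by simp
  have wi: "integrable lborel (\<lambda>t. indicator A t * w n t)" if A: "A \<in> sets borel" for A n
  proof -
    have "integrable lborel (\<lambda>t. indicator {0..T} t * v n t)" by (rule integral_indicator_lborel(1)[OF vm vabs])
    then have "integrable lborel (w n)" unfolding w_def .
    from integrable_real_mult_indicator[OF _ this, of A] A show ?thesis by (simp add: mult.commute)
  qed
  have mA: "emeasure (m n) A = ennreal (\<integral>t. indicator A t * w n t \<partial>lborel)" if A: "A \<in> sets borel" for n A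
  proof -
    have "emeasure (m n) A = (\<integral>\<^sup>+t. ennreal (w n t) * indicator A t \<partial>lborel)"
      unfolding m_def using A wm by (subst emeasure_density) auto
    also have "\<dots> = (\<integral>\<^sup>+t. ennreal (indicator A t * w n t) \<partial>lborel)"
      by (rule nn_integral_cong) (auto simp: indicator_def)
    also have "\<dots> = ennreal (\<integral>t. indicator A t * w n t \<partial>lborel)"
      by (rule nn_integral_eq_integral[OF wi[OF A]]) (simp add: w0)
    finally show ?thesis .
  qed
  have mA': "measure (m n) A = (\<integral>t. indicator A t * w n t \<partial>lborel)" if "A \<in> sets borel" for n A
    unfolding measure_def mA[OF that] by (simp add: w0)
  have mdom: "measure (m n) A \<le> K * measure lborel (A \<inter> {0..T})" if A: "A \<in> sets borel" for n A
  proof -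
    have "emeasure lborel (A \<inter> {0..T}) \<le> emeasure lborel {0..T}" by (rule emeasure_mono) auto
    then have fin: "emeasure lborel (A \<inter> {0..T}) < \<infinity>" using T by (simp add: order_le_less_trans)
    have "(\<integral>t. indicator A t * w n t \<partial>lborel) \<le> (\<integral>t. indicator (A \<inter> {0..T}) t * K \<partial>lborel)"
    proof (rule integral_mono[OF wi[OF A]])
      show "integrable lborel (\<lambda>t. indicator (A \<inter> {0..T}) t * K)"
        by (intro integrable_mult_left integrable_real_indicator) (use A fin in auto)
      show "indicator A t * w n t \<le> indicator (A \<inter> {0..T}) t * K" for t
        using vK K unfolding w_def by (auto simp: indicator_def)
    qed
    then show ?thesis unfolding mA'[OF A] by (simp add: mult.commute)
  qed
  have f0: "f 0 = 0" using lim[of 0] T by (simp add: LIMSEQ_const_iff)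
  have vi: "v n integrable_on {0..T}" for n
  proof -
    have "set_integrable lborel {0..T} (v n)" unfolding set_integrable_def using integral_indicator_lborel(1)[OF vm vabs] by simp
    then show ?thesis by (rule set_borel_integral_eq_integral(1))
  qed
  have fl: "\<bar>f t - f s\<bar> \<le> K * \<bar>t - s\<bar>" if "s \<in> {0..T}" "t \<in> {0..T}" for s t
  proof (rule LIMSEQ_le_const2)
    show "(\<lambda>n. \<bar>integral {0..t} (v n) - integral {0..s} (v n)\<bar>) \<longlonglongrightarrow> \<bar>f t - f s\<bar>" by (intro tendsto_intros lim that)
    show "\<exists>N. \<forall>n\<ge>N. \<bar>integral {0..t} (v n) - integral {0..s} (v n)\<bar> \<le> K * \<bar>t - s\<bar>"
      using integral_lipschitz[OF vi, where C=K and s=s and t=t] vabs that by simp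
  qed
  have fmono: "f s \<le> f t" if "s \<in> {0..T}" "t \<in> {0..T}" "s \<le> t" for s t
  proof (rule LIMSEQ_le[OF lim lim])
    have "integral {0..s} (v n) \<le> integral {0..t} (v n)" for n
      by (rule integral_subset_le) (use that v0 in \<open>auto intro: integrable_on_subinterval[OF vi]\<close>)
    then show "\<exists>N. \<forall>n\<ge>N. integral {0..s} (v n) \<le> integral {0..t} (v n)" by blast
  qed (use that in auto)
  define cl where "cl t = max 0 (min T t)" for t
  have cl: "cl t \<in> {0..T}" for t unfolding cl_def using T by auto
  define F where "F t = f (cl t)" for t
  have Fmono: "F s \<le> F t" if "s \<le> t" for s t
    unfolding F_def by (rule fmono[OF cl cl]) (use that in \<open>auto simp: cl_def\<close>)
  have "continuous_on UNIV F"
  proof (rule lip_continuous_on)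
    fix s t :: real
    have "\<bar>F s - F t\<bar> \<le> K * \<bar>cl s - cl t\<bar>" unfolding F_def by (rule fl[OF cl cl])
    also have "\<dots> \<le> K * \<bar>s - t\<bar>" using K by (intro mult_left_mono) (auto simp: cl_def)
    finally show "norm (F s - F t) \<le> K * norm (s - t)" by simp
  qed
  then have Fcont: "continuous (at_right t) F" for t
    by (meson UNIV_I continuous_at_imp_continuous_at_within continuous_on_eq_continuous_at open_UNIV)
  define \<nu>0 where "\<nu>0 = interval_measure F"
  have \<nu>0: "emeasure \<nu>0 {a<..b} = ennreal (F b - F a)" if "a \<le> b" for a b
    unfolding \<nu>0_def by (rule emeasure_interval_measure_Ioc[OF that Fmono Fcont])
  have \<nu>0s: "sets \<nu>0 = sets borel" unfolding \<nu>0_def by simp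
  define \<nu> where "\<nu> = density \<nu>0 (indicator {0<..T})"
  have \<nu>s: "sets \<nu> = sets borel" unfolding \<nu>_def using \<nu>0s by simp
  have \<nu>A: "emeasure \<nu> A = emeasure \<nu>0 (A \<inter> {0<..T})" if "A \<in> sets borel" for A
    unfolding \<nu>_def using emeasure_restricted[of "{0<..T}" \<nu>0 A] that \<nu>0s by (simp add: Int_commute)
  have \<nu>fin: "finite_measure \<nu>"
  proof (rule finite_measureI)
    have "space \<nu> = UNIV" using sets_eq_imp_space_eq[OF \<nu>s] by simp
    then show "emeasure \<nu> (space \<nu>) \<noteq> \<infinity>" using \<nu>A[of UNIV] \<nu>0[of 0 T] T by simp
  qed
  interpret \<nu>: finite_measure \<nu> by fact
  have conv: "(\<lambda>n. measure (m n) A) \<longlonglongrightarrow> measure \<nu> A" if A: "A \<in> sets borel" for A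
  proof -
    have base: "(\<lambda>n. measure (m n) {..c}) \<longlonglongrightarrow> measure \<nu> {..c}" for c
    proof (cases "c < 0")
      case True
      have "{..c} \<inter> {0<..T} = {}" using True by auto
      then have "measure \<nu> {..c} = 0" using \<nu>A[of "{..c}"] by (simp add: measure_def)
      moreover have fz: "indicator {..c} t * w n t = 0" for t n using True unfolding w_def by (auto simp: indicator_def)
      have "measure (m n) {..c} = 0" for n by (subst mA', simp) (simp only: fz Bochner_Integration.integral_zero)
      ultimately show ?thesis by simp
    next
      case False
      define d where "d = min c T"
      have d: "d \<in> {0..T}" using False T unfolding d_def by auto
      have "{..c} \<inter> {0<..T} = {0<..d}" unfolding d_def by auto
      then have "emeasure \<nu> {..c} = ennreal (F d - F 0)" using \<nu>A[of "{..c}"] \<nu>0[of 0 d] d by simp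
      moreover have "F d = f d" "F 0 = 0" using d T f0 unfolding F_def cl_def by (auto simp: max_def min_def)
      ultimately have "measure \<nu> {..c} = f d" using Fmono[of 0 d] d by (simp add: measure_def)
      moreover have "measure (m n) {..c} = integral {0..d} (v n)" for n
      proof -
        have "measure (m n) {..c} = (\<integral>t. indicator {..c} t * w n t \<partial>lborel)" by (rule mA') simp
        also have "\<dots> = (\<integral>t. indicator {0..d} t * v n t \<partial>lborel)"
          by (rule Bochner_Integration.integral_cong) (auto simp: w_def d_def indicator_def)
        also have "\<dots> = integral {0..d} (v n)" by (rule integral_indicator_lborel(2)[OF vm vabs])
        finally show ?thesis .
      qed
      ultimately show ?thesis using lim[OF d] by simp
    qed
    have top: "(\<lambda>n. measure (m n) UNIV) \<longlonglongrightarrow> measure \<nu> UNIV"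
    proof -
      have "measure (m n) UNIV = measure (m n) {..T}" for n
        unfolding mA'[of UNIV, simplified] mA'[of "{..T}", simplified]
        by (rule Bochner_Integration.integral_cong) (auto simp: w_def indicator_def)
      moreover have "{..T} \<inter> {0<..T} = UNIV \<inter> {0<..T}" by auto
      then have "measure \<nu> UNIV = measure \<nu> {..T}" using \<nu>A[of UNIV] \<nu>A[of "{..T}"] by (simp add: measure_def)
      ultimately show ?thesis using base[of T] by simp
    qed
    have mfin: "finite_measure (m n)" for n
      by (rule finite_measureI) (use mA[of UNIV] in \<open>simp add: m_def\<close>)
    have A': "A \<in> sigma_sets UNIV (range (\<lambda>c. {..c}))" using A unfolding borel_eq_atMost by simp
    have Is: "Int_stable (range (\<lambda>c::real. {..c}))" unfolding Int_stable_def by (auto simp: image_iff intro: exI[of _ "min _ _"])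
    have sub: "range (\<lambda>c::real. {..c}) \<subseteq> Pow UNIV" by simp
    from Is sub A' show ?thesis
    proof (induction rule: sigma_sets_induct_disjoint)
      case (basic A)
      then show ?case using base by auto
    next
      case empty
      then show ?case by simp
    next
      case (compl A)
      then have A: "A \<in> sets borel" unfolding borel_eq_atMost by simp
      have "measure (m n) (UNIV - A) = measure (m n) UNIV - measure (m n) A" for n
        using finite_measure.finite_measure_compl[OF mfin, of A n] A ms[of n] sets_eq_imp_space_eq[OF ms[of n]] by simp
      moreover have "measure \<nu> (UNIV - A) = measure \<nu> UNIV - measure \<nu> A"
        using \<nu>.finite_measure_compl[of A] A \<nu>s sets_eq_imp_space_eq[OF \<nu>s] by simp
      ultimately show ?case using compl top by (simp add: tendsto_diff)
    next
      case (union A)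
      then have A: "\<And>i. A i \<in> sets borel" unfolding borel_eq_atMost by auto
      have s1: "(\<lambda>i. measure (m n) (A i)) sums measure (m n) (\<Union>i. A i)" for n
        using A ms[of n] union(1) by (intro finite_measure.finite_measure_UNION[OF mfin]) auto
      have s2: "(\<lambda>i. measure \<nu> (A i)) sums measure \<nu> (\<Union>i. A i)"
        using A \<nu>s union(1) by (intro \<nu>.finite_measure_UNION) auto
      have "(\<lambda>i. measure lborel (A i \<inter> {0..T})) sums measure lborel (\<Union>i. A i \<inter> {0..T})"
      proof (rule measure_UNION)
        show "range (\<lambda>i. A i \<inter> {0..T}) \<subseteq> sets lborel" using A by auto
        show "disjoint_family (\<lambda>i. A i \<inter> {0..T})" using union(1) by (auto simp: disjoint_family_on_def)
        have "emeasure lborel (\<Union>i. A i \<inter> {0..T}) \<le> emeasure lborel {0..T}" by (rule emeasure_mono) auto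
        then show "emeasure lborel (\<Union>i. A i \<inter> {0..T}) \<noteq> \<infinity>" using T by (auto simp: top_unique)
      qed
      then have sm: "summable (\<lambda>i. K * measure lborel (A i \<inter> {0..T}))" by (intro summable_mult) (rule sums_summable)
      have "(\<forall>\<^sub>F n in sequentially. summable (\<lambda>i. norm (measure (m n) (A i)))) \<and> summable (\<lambda>i. norm (measure \<nu> (A i))) \<and>
        (\<lambda>n. suminf (\<lambda>i. measure (m n) (A i))) \<longlonglongrightarrow> suminf (\<lambda>i. measure \<nu> (A i))"
      proof (rule tannerys_theorem[where M="\<lambda>i. K * measure lborel (A i \<inter> {0..T})"])
        show "(\<lambda>n. measure (m n) (A i)) \<longlonglongrightarrow> measure \<nu> (A i)" for i using union by auto
        show "\<forall>\<^sub>F (k, n) in sequentially \<times>\<^sub>F sequentially. norm (measure (m n) (A k)) \<le> K * measure lborel (A k \<inter> {0..T})"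
          by (rule always_eventually) (use mdom A in auto)
      qed (use sm in auto)
      then show ?case using sums_unique[OF s1] sums_unique[OF s2] by simp
    qed
  qed
  have dom: "emeasure \<nu> A \<le> ennreal K * emeasure lborel A" if A: "A \<in> sets borel" for A
  proof (cases "emeasure lborel A = \<infinity>")
    case True
    then show ?thesis using K by (simp add: ennreal_mult_top)
  next
    case False
    have "measure (m n) A \<le> K * measure lborel A" for n
    proof -
      have "measure lborel (A \<inter> {0..T}) \<le> measure lborel A"
        by (rule measure_mono_fmeasurable) (use A False in \<open>auto simp: fmeasurable_def less_top\<close>)
      then show ?thesis using mdom[OF A, of n] K by (meson mult_left_mono less_imp_le order_trans)
    qed
    then have "measure \<nu> A \<le> K * measure lborel A" by (intro LIMSEQ_le_const2[OF conv[OF A]]) auto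
    then have "ennreal (measure \<nu> A) \<le> ennreal (K * measure lborel A)" by (rule ennreal_leI)
    then show ?thesis using False K
      by (simp add: \<nu>.emeasure_eq_measure ennreal_mult emeasure_eq_ennreal_measure)
  qed
  obtain g where g: "g \<in> borel_measurable borel" "\<And>t. 0 \<le> g t" "\<And>t. g t \<le> K"
    "\<And>A. A \<in> sets borel \<Longrightarrow> emeasure \<nu> A = (\<integral>\<^sup>+t. indicator A t * ennreal (g t) \<partial>lborel)"
    by (rule radon_nikodym_bounded[OF \<nu>fin \<nu>s dom K], assumption, rule that)
  have bi: "integrable lborel (\<lambda>t. h t * \<psi> t)" if "h \<in> borel_measurable borel" "\<And>t. 0 \<le> h t" "\<And>t. h t \<le> K" "integrable lborel \<psi>" for h \<psi> :: "real \<Rightarrow> real"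
  proof (rule Bochner_Integration.integrable_bound[where f="\<lambda>t. K * \<bar>\<psi> t\<bar>"])
    show "integrable lborel (\<lambda>t. K * \<bar>\<psi> t\<bar>)" using that(4) by simp
    show "(\<lambda>t. h t * \<psi> t) \<in> borel_measurable lborel" using that by (intro borel_measurable_times) auto
    have "norm (h t * \<psi> t) \<le> norm (K * \<bar>\<psi> t\<bar>)" for t
      using that(2,3)[of t] by (auto simp: abs_mult intro!: mult_right_mono)
    then show "AE t in lborel. norm (h t * \<psi> t) \<le> norm (K * \<bar>\<psi> t\<bar>)" by simp
  qed
  have small: "\<bar>(\<integral>t. h t * \<psi> t \<partial>lborel) - (\<integral>t. h t * \<psi>' t \<partial>lborel)\<bar> \<le> K * (\<integral>t. \<bar>\<psi> t - \<psi>' t\<bar> \<partial>lborel)"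
    if h: "h \<in> borel_measurable borel" "\<And>t. 0 \<le> h t" "\<And>t. h t \<le> K" and p: "integrable lborel \<psi>" "integrable lborel \<psi>'" for h \<psi> \<psi>' :: "real \<Rightarrow> real"
  proof -
    have "(\<integral>t. h t * \<psi> t \<partial>lborel) - (\<integral>t. h t * \<psi>' t \<partial>lborel) = (\<integral>t. h t * (\<psi> t - \<psi>' t) \<partial>lborel)"
      using bi[OF h p(1)] bi[OF h p(2)] by (simp add: right_diff_distrib)
    also have "norm \<dots> \<le> (\<integral>t. K * \<bar>\<psi> t - \<psi>' t\<bar> \<partial>lborel)"
    proof (rule Bochner_Integration.integral_norm_bound_integral)
      show "integrable lborel (\<lambda>t. h t * (\<psi> t - \<psi>' t))" by (rule bi[OF h]) (use p in auto)
      show "norm (h t * (\<psi> t - \<psi>' t)) \<le> K * \<bar>\<psi> t - \<psi>' t\<bar>" for t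
        using h(2,3)[of t] by (auto simp: abs_mult intro!: mult_right_mono)
    qed (use p in auto)
    finally show ?thesis by simp
  qed
  have main: "(\<lambda>n. \<integral>t. w n t * \<psi> t \<partial>lborel) \<longlonglongrightarrow> (\<integral>t. g t * \<psi> t \<partial>lborel)" if "integrable lborel \<psi>" for \<psi> :: "real \<Rightarrow> real"
    using that
  proof (induction rule: integrable_induct)
    case (base A c)
    have A: "A \<in> sets borel" using base by simp
    have "integrable lborel (\<lambda>t. indicator A t :: real)" using base by (intro integrable_real_indicator) auto
    then have gi: "integrable lborel (\<lambda>t. g t * indicator A t)" by (rule bi[OF g(1-3)])
    have "ennreal (measure \<nu> A) = (\<integral>\<^sup>+t. ennreal (g t * indicator A t) \<partial>lborel)"
      unfolding \<nu>.emeasure_eq_measure[symmetric] g(4)[OF A]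
      by (rule nn_integral_cong) (auto simp: indicator_def)
    also have "\<dots> = ennreal (\<integral>t. g t * indicator A t \<partial>lborel)"
      by (rule nn_integral_eq_integral[OF gi]) (simp add: g)
    finally have "measure \<nu> A = (\<integral>t. g t * indicator A t \<partial>lborel)"
      by (subst (asm) ennreal_inj) (auto intro!: Bochner_Integration.integral_nonneg simp: g)
    then have "(\<lambda>n. \<integral>t. indicator A t * w n t \<partial>lborel) \<longlonglongrightarrow> (\<integral>t. g t * indicator A t \<partial>lborel)"
      using conv[OF A] unfolding mA'[OF A] by simp
    then have "(\<lambda>n. (\<integral>t. indicator A t * w n t \<partial>lborel) * c) \<longlonglongrightarrow> (\<integral>t. g t * indicator A t \<partial>lborel) * c"
      by (rule tendsto_mult_right)
    then show ?case unfolding Bochner_Integration.integral_mult_left_zero[symmetric] by (simp add: mult_ac)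
  next
    case (add \<psi> \<psi>')
    have "(\<lambda>n. (\<integral>t. w n t * \<psi> t \<partial>lborel) + (\<integral>t. w n t * \<psi>' t \<partial>lborel)) \<longlonglongrightarrow> (\<integral>t. g t * \<psi> t \<partial>lborel) + (\<integral>t. g t * \<psi>' t \<partial>lborel)"
      by (rule tendsto_add[OF add(3,4)])
    then show ?case
      using bi[OF wm w0 wK add(1)] bi[OF wm w0 wK add(2)] bi[OF g(1-3) add(1)] bi[OF g(1-3) add(2)] by (simp add: distrib_left)
  next
    case (lim \<psi> s)
    have d: "(\<lambda>i. \<integral>t. \<bar>\<psi> t - s i t\<bar> \<partial>lborel) \<longlonglongrightarrow> (\<integral>t. 0 \<partial>(lborel :: real measure))"
    proof (rule integral_dominated_convergence[where w="\<lambda>t. 3 * \<bar>\<psi> t\<bar>"])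
      show "AE t in lborel. (\<lambda>i. \<bar>\<psi> t - s i t\<bar>) \<longlonglongrightarrow> 0"
      proof (rule AE_I2)
        fix t :: real
        have "(\<lambda>i. \<bar>\<psi> t - s i t\<bar>) \<longlonglongrightarrow> \<bar>\<psi> t - \<psi> t\<bar>" by (intro tendsto_intros lim(2)) simp
        then show "(\<lambda>i. \<bar>\<psi> t - s i t\<bar>) \<longlonglongrightarrow> 0" by simp
      qed
      show "AE t in lborel. norm \<bar>\<psi> t - s i t\<bar> \<le> 3 * \<bar>\<psi> t\<bar>" for i
      proof (rule AE_I2)
        fix t :: real
        have "\<bar>s i t\<bar> \<le> 2 * \<bar>\<psi> t\<bar>" using lim(3)[of t i] by simp
        then show "norm \<bar>\<psi> t - s i t\<bar> \<le> 3 * \<bar>\<psi> t\<bar>" using abs_triangle_ineq4[of "\<psi> t" "s i t"] by simp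
      qed
    qed (use lim(1,4) in auto)
    show ?case
    proof (rule LIMSEQ_I)
      fix e :: real assume e: "e > 0"
      have "(\<lambda>i. K * (\<integral>t. \<bar>\<psi> t - s i t\<bar> \<partial>lborel)) \<longlonglongrightarrow> K * 0" using d by (intro tendsto_intros) simp
      then have "\<forall>\<^sub>F i in sequentially. K * (\<integral>t. \<bar>\<psi> t - s i t\<bar> \<partial>lborel) < e / 3"
        by (rule order_tendstoD(2)) (use e in simp)
      then obtain i where i: "K * (\<integral>t. \<bar>\<psi> t - s i t\<bar> \<partial>lborel) < e / 3"
        unfolding eventually_sequentially by blast
      obtain N where N: "\<And>n. n \<ge> N \<Longrightarrow> norm ((\<integral>t. w n t * s i t \<partial>lborel) - (\<integral>t. g t * s i t \<partial>lborel)) < e / 3"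
        using LIMSEQ_D[OF lim(5)[of i], of "e / 3"] e by auto
      have "norm ((\<integral>t. w n t * \<psi> t \<partial>lborel) - (\<integral>t. g t * \<psi> t \<partial>lborel)) < e" if n: "n \<ge> N" for n
        using N[OF n] i small[OF wm[of n] w0 wK lim(4) lim(1)[of i]] small[OF g(1-3) lim(4) lim(1)[of i]]
        by (simp add: abs_if split: if_splits)
      then show "\<exists>N. \<forall>n\<ge>N. norm ((\<integral>t. w n t * \<psi> t \<partial>lborel) - (\<integral>t. g t * \<psi> t \<partial>lborel)) < e" by blast
    qed
  qed
  show thesis by (rule that[OF g(1-3)]) (use main in \<open>simp add: w_def\<close>)
qed

lemma lebesgue_borel_version:
  fixes f :: "real \<Rightarrow> real"
  assumes "time_measurable T f"
  obtains f' where "f' \<in> borel_measurable borel" "AE t in lebesgue. (if t \<in> {0..T} then f t else 0) = f' t"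
proof -
  have "(\<lambda>t. if t \<in> {0..T} then f t else 0) \<in> borel_measurable lebesgue"
    by (subst borel_measurable_if) (use assms in auto)
  then obtain f' where f': "f' \<in> borel_measurable lborel" and ae: "AE t in lborel. (if t \<in> {0..T} then f t else 0) = f' t"
    using completion_ex_borel_measurable_real by blast
  show thesis by (rule that[OF _ AE_completion[OF ae]]) (use f' in simp)
qed

lemma bounded_times_absolutely_integrable:
  fixes x p :: "real \<Rightarrow> real"
  assumes x: "time_measurable T x" "\<And>t. t \<in> {0..T} \<Longrightarrow> \<bar>x t\<bar> \<le> C"
    and p: "p absolutely_integrable_on {0..T}"
  shows "(\<lambda>t. x t * p t) absolutely_integrable_on {0..T}"
proof (rule measurable_bounded_by_integrable_imp_absolutely_integrable[where g="\<lambda>t. C * \<bar>p t\<bar>"])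
  show "time_measurable T (\<lambda>t. x t * p t)"
    using x(1) p by (intro borel_measurable_times) (simp_all add: absolutely_integrable_measurable)
  show "(\<lambda>t. C * \<bar>p t\<bar>) integrable_on {0..T}"
    using p unfolding absolutely_integrable_on_def by (intro integrable_on_mult_right) simp
  show "norm (x t * p t) \<le> C * \<bar>p t\<bar>" if "t \<in> {0..T}" for t
    using x(2)[OF that] by (simp add: abs_mult mult_right_mono)
qed simp

lemma integral_borel_version:
  fixes x v p p' :: "real \<Rightarrow> real"
  assumes v: "v \<in> borel_measurable borel" and xv: "AE t in lebesgue. t \<in> {0..T} \<longrightarrow> x t = v t"
    and x: "time_measurable T x" "\<And>t. t \<in> {0..T} \<Longrightarrow> \<bar>x t\<bar> \<le> C"
    and p: "p absolutely_integrable_on {0..T}" and p': "p' \<in> borel_measurable borel" "AE t in lebesgue. (if t \<in> {0..T} then p t else 0) = p' t"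
  shows "integral {0..T} (\<lambda>t. x t * p t) = (\<integral>t. (indicator {0..T} t * v t) * p' t \<partial>lborel)"
proof -
  have pm: "time_measurable T p" using p by (simp add: absolutely_integrable_measurable)
  have "(\<lambda>t. x t * p t) absolutely_integrable_on {0..T}" by (rule bounded_times_absolutely_integrable[OF x p])
  from set_lebesgue_integral_eq_integral(2)[OF this]
  have "integral {0..T} (\<lambda>t. x t * p t) = (\<integral>t. indicator {0..T} t * (x t * p t) \<partial>lebesgue)"
    unfolding set_lebesgue_integral_def by simp
  also have "\<dots> = (\<integral>t. (indicator {0..T} t * v t) * p' t \<partial>lebesgue)"
  proof (rule integral_cong_AE)
    have "(\<lambda>t. if t \<in> {0..T} then x t * p t else 0) \<in> borel_measurable lebesgue"
      using x(1) pm by (subst borel_measurable_if) (auto intro: borel_measurable_times)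
    moreover have "(\<lambda>t. if t \<in> {0..T} then x t * p t else 0) = (\<lambda>t. indicator {0..T} t * (x t * p t))" by (auto simp: indicator_def)
    ultimately show "(\<lambda>t. indicator {0..T} t * (x t * p t)) \<in> borel_measurable lebesgue" by simp
    have "(\<lambda>t. (indicator {0..T} t * v t) * p' t) \<in> borel_measurable lborel" using v p'(1) by (intro borel_measurable_times) auto
    then show "(\<lambda>t. (indicator {0..T} t * v t) * p' t) \<in> borel_measurable lebesgue" by (rule measurable_completion)
    show "AE t in lebesgue. indicator {0..T} t * (x t * p t) = indicator {0..T} t * v t * p' t"
      using xv p'(2) by eventually_elim (auto simp: indicator_def)
  qed
  also have "\<dots> = (\<integral>t. (indicator {0..T} t * v t) * p' t \<partial>lborel)"
    by (rule integral_completion) (use v p'(1) in \<open>auto intro!: borel_measurable_times\<close>)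
  finally show ?thesis .
qed

text \<open>By Arzela-Ascoli, a subsequence of the antiderivatives converges uniformly, and \<open>scalar_weak_star\<close> turns this into weak-*
convergence of each component, after a shift by M that makes it nonnegative. The limit u0 takes its values in U almost
everywhere: let p be its pointwise projection to the convex set U and test with \<open>u0 - p\<close>. As \<open>(us n - p) \<bullet> (u0 - p) \<le> 0\<close>, the
integral of \<open>|u0 - p|\<^sup>2\<close> is at most zero in the limit.\<close>

theorem weak_star_sequentially_compact:
  fixes us :: "nat \<Rightarrow> real \<Rightarrow> 'a::euclidean_space"
  assumes T: "T > 0" and m: "\<And>n. time_measurable T (us n)"
    and usU: "\<And>n t. us n t \<in> U" and U: "compact U" "convex U"
  obtains r u where "strict_mono (r :: nat \<Rightarrow> nat)" "time_measurable T u" "\<And>t. u t \<in> U"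
    "weak_star_converges T (\<lambda>n. us (r n)) u"
proof -
  have Une: "U \<noteq> {}" using usU[of 0 0] by auto
  obtain M0 where M0: "\<forall>x\<in>U. norm x \<le> M0" using compact_imp_bounded[OF U(1)] unfolding bounded_iff by blast
  define M where "M = \<bar>M0\<bar> + 1"
  have M: "M > 0" unfolding M_def by simp
  have ub: "norm (us n t) \<le> M" for n t using bspec[OF M0 usU[of n t]] unfolding M_def by linarith
  have ai: "us n absolutely_integrable_on {0..T}" for n by (rule abs_integrable_bounded[OF m ub])
  have ui: "us n integrable_on {0..T}" for n using ai by (simp add: absolutely_integrable_on_def)
  define F where "F n t = integral {0..t} (us n)" for n t
  have Fl: "norm (F n t - F n s) \<le> M * \<bar>t - s\<bar>" if "s \<in> {0..T}" "t \<in> {0..T}" for n s t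
    unfolding F_def by (rule integral_lipschitz[OF ui ub that])
  obtain G r where r: "strict_mono (r :: nat \<Rightarrow> nat)"
    and G: "\<And>e. 0 < e \<Longrightarrow> \<exists>N. \<forall>n t. n \<ge> N \<and> t \<in> {0..T} \<longrightarrow> norm (F (r n) t - G t) < e"
  proof (rule Arzela_Ascoli[of "{0..T}" F "M * T"])
    show "norm (F n t) \<le> M * T" if "t \<in> {0..T}" for n t
    proof -
      have "norm (F n t - F n 0) \<le> M * \<bar>t - 0\<bar>" by (rule Fl) (use that T in auto)
      also have "\<dots> \<le> M * T" using that M by (intro mult_left_mono) auto
      finally show ?thesis unfolding F_def by simp
    qed
    show "\<exists>d>0. \<forall>n y. y \<in> {0..T} \<and> norm (t - y) < d \<longrightarrow> norm (F n t - F n y) < e" if t: "t \<in> {0..T}" and e: "0 < e" for t e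
    proof (intro exI[of _ "e / M"] conjI allI impI)
      show "0 < e / M" using e M by simp
      fix n y assume y: "y \<in> {0..T} \<and> norm (t - y) < e / M"
      have "norm (F n t - F n y) \<le> M * \<bar>t - y\<bar>" by (rule Fl) (use y t in auto)
      also have "\<dots> < M * (e / M)" using y M by (intro mult_strict_left_mono) auto
      also have "\<dots> = e" using M by simp
      finally show "norm (F n t - F n y) < e" .
    qed
  qed (auto intro: that)
  have Glim: "(\<lambda>n. F (r n) t) \<longlonglongrightarrow> G t" if "t \<in> {0..T}" for t
    by (rule LIMSEQ_I) (use G that in blast)
  have gex: "\<exists>g. g \<in> borel_measurable borel \<and> (\<forall>t. 0 \<le> g t \<and> g t \<le> 2 * M) \<and>
     (\<forall>p. p absolutely_integrable_on {0..T} \<longrightarrow> (\<lambda>n. integral {0..T} (\<lambda>t. (us (r n) t \<bullet> b) * p t)) \<longlonglongrightarrow> integral {0..T} (\<lambda>t. (g t - M) * p t))"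
    if b: "b \<in> Basis" for b
  proof -
    define x where "x n t = us (r n) t \<bullet> b + M" for n t
    have xb: "0 \<le> x n t" "x n t \<le> 2 * M" for n t
      using Basis_le_norm[OF b, of "us (r n) t"] ub[of "r n" t] unfolding x_def by auto
    have xm: "time_measurable T (x n)" for n
      unfolding x_def using m by (intro borel_measurable_add borel_measurable_inner) auto
    have vex: "\<exists>v. v \<in> borel_measurable borel \<and> (\<forall>t. 0 \<le> v t \<and> v t \<le> 2 * M) \<and> (AE t in lebesgue. t \<in> {0..T} \<longrightarrow> x n t = v t)" for n
    proof -
      obtain f' where f': "f' \<in> borel_measurable borel" "AE t in lebesgue. (if t \<in> {0..T} then x n t else 0) = f' t"
        by (rule lebesgue_borel_version[OF xm], rule that)
      show ?thesis
      proof (intro exI[of _ "\<lambda>t. max 0 (min (2 * M) (f' t))"] conjI allI)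
        show "(\<lambda>t. max 0 (min (2 * M) (f' t))) \<in> borel_measurable borel" using f'(1) by measurable
        show "AE t in lebesgue. t \<in> {0..T} \<longrightarrow> x n t = max 0 (min (2 * M) (f' t))"
          using f'(2)
        proof eventually_elim
          case (elim t)
          then show ?case using xb[of n t] by auto
        qed
      qed (use M in auto)
    qed
    from choice[OF allI[OF vex]]
    obtain v where v: "\<forall>n. v n \<in> borel_measurable borel \<and> (\<forall>t. 0 \<le> v n t \<and> v n t \<le> 2 * M) \<and> (AE t in lebesgue. t \<in> {0..T} \<longrightarrow> x n t = v n t)" by (rule exE)
    have vm: "v n \<in> borel_measurable borel" and v0: "0 \<le> v n t" and vM: "v n t \<le> 2 * M"
      and xv: "AE t in lebesgue. t \<in> {0..T} \<longrightarrow> x n t = v n t" for n t using v by blast+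
    have iv: "integral {0..t} (v n) = F (r n) t \<bullet> b + M * t" if t: "t \<in> {0..T}" for n t
    proof -
      obtain N where N: "negligible N" "{s. \<not> (s \<in> {0..T} \<longrightarrow> x n s = v n s)} \<subseteq> N"
        using xv[of n] unfolding eventually_ae_filter_negligible by blast
      have "integral {0..t} (v n) = integral {0..t} (x n)"
        by (rule integral_spike[OF N(1)]) (use N(2) t in auto)
      also have "\<dots> = integral {0..t} (\<lambda>s. us (r n) s \<bullet> b) + integral {0..t} (\<lambda>s. M)"
      proof -
        have "us (r n) integrable_on {0..t}" by (rule integrable_on_subinterval[OF ui]) (use t in auto)
        from integrable_linear[OF this bounded_linear_inner_left[of b]]
        have "(\<lambda>s. us (r n) s \<bullet> b) integrable_on {0..t}" by (simp add: comp_def)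
        then show ?thesis unfolding x_def by (intro hk_integral_add) auto
      qed
      also have "integral {0..t} (\<lambda>s. us (r n) s \<bullet> b) = F (r n) t \<bullet> b"
      proof -
        have "us (r n) integrable_on {0..t}" by (rule integrable_on_subinterval[OF ui]) (use t in auto)
        from integral_linear[OF this bounded_linear_inner_left[of b]] show ?thesis by (simp add: comp_def F_def)
      qed
      finally show ?thesis using t by (simp add: mult.commute)
    qed
    have lim: "(\<lambda>n. integral {0..t} (v n)) \<longlonglongrightarrow> G t \<bullet> b + M * t" if "t \<in> {0..T}" for t
      unfolding iv[OF that] by (intro tendsto_intros Glim that)
    obtain g where g: "g \<in> borel_measurable borel" "\<And>t. 0 \<le> g t" "\<And>t. g t \<le> 2 * M"
      "\<And>\<psi>. integrable lborel \<psi> \<Longrightarrow> (\<lambda>n. \<integral>t. (indicator {0..T} t * v n t) * \<psi> t \<partial>lborel) \<longlonglongrightarrow> (\<integral>t. g t * \<psi> t \<partial>lborel)"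
      by (rule scalar_weak_star[OF T _ vm v0 vM lim]) (use M that in auto)
    have "(\<lambda>n. integral {0..T} (\<lambda>t. (us (r n) t \<bullet> b) * p t)) \<longlonglongrightarrow> integral {0..T} (\<lambda>t. (g t - M) * p t)"
      if p: "p absolutely_integrable_on {0..T}" for p
    proof -
      have pm: "time_measurable T p" using p by (simp add: absolutely_integrable_measurable)
      obtain p' where p': "p' \<in> borel_measurable borel" "AE t in lebesgue. (if t \<in> {0..T} then p t else 0) = p' t"
        by (rule lebesgue_borel_version[OF pm], rule that)
      have "integrable lebesgue (\<lambda>t. if t \<in> {0..T} then p t else 0)"
      proof -
        have "(\<lambda>t. if t \<in> {0..T} then p t else 0) = (\<lambda>t. indicator {0..T} t *\<^sub>R p t)" by (auto simp: indicator_def)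
        then show ?thesis using p unfolding set_integrable_def by (simp only:)
      qed
      then have "integrable lebesgue p'"
        by (rule Bochner_Integration.integrable_cong_AE_imp) (use p' in \<open>auto intro: measurable_completion elim: eventually_mono\<close>)
      then have p'i: "integrable lborel p'" using p'(1) by (simp add: integrable_completion)
      have gm: "time_measurable T g"
        using g(1) by (intro measurable_restrict_space1 measurable_completion) simp
      have e1: "integral {0..T} (\<lambda>t. x n t * p t) = (\<integral>t. (indicator {0..T} t * v n t) * p' t \<partial>lborel)" for n
        by (rule integral_borel_version[OF vm xv xm _ p p', where C="2 * M"]) (use xb[of n] in simp)
      have e2: "integral {0..T} (\<lambda>t. g t * p t) = (\<integral>t. (indicator {0..T} t * g t) * p' t \<partial>lborel)"
        by (rule integral_borel_version[OF g(1) _ gm _ p p', where C="2 * M"]) (use g(2,3) in \<open>auto simp: abs_of_nonneg\<close>)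
      have "AE t in lebesgue. g t * p' t = (indicator {0..T} t * g t) * p' t"
        using p'(2) by eventually_elim (auto simp: indicator_def split: if_splits)
      then have "AE t in lborel. g t * p' t = (indicator {0..T} t * g t) * p' t"
        by (subst (asm) AE_completion_iff) (use g(1) p'(1) in auto)
      then have e3: "(\<integral>t. g t * p' t \<partial>lborel) = integral {0..T} (\<lambda>t. g t * p t)"
        unfolding e2 by (intro integral_cong_AE) (use g(1) p'(1) in \<open>auto intro!: borel_measurable_times\<close>)
      have L: "(\<lambda>n. integral {0..T} (\<lambda>t. x n t * p t)) \<longlonglongrightarrow> integral {0..T} (\<lambda>t. g t * p t)"
        unfolding e1 e3[symmetric] by (rule g(4)[OF p'i])
      have pi: "p integrable_on {0..T}" using p by (simp add: absolutely_integrable_on_def)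
      have bp: "(\<lambda>t. y t * p t) integrable_on {0..T}" if "time_measurable T y" "\<And>t. \<bar>y t\<bar> \<le> 2 * M" for y
        using bounded_times_absolutely_integrable[OF that p] by (simp add: absolutely_integrable_on_def)
      have shift: "integral {0..T} (\<lambda>t. (y t - M) * p t) = integral {0..T} (\<lambda>t. y t * p t) - M * integral {0..T} p"
        if y: "time_measurable T y" "\<And>t. \<bar>y t\<bar> \<le> 2 * M" for y
        unfolding left_diff_distrib by (simp add: hk_integral_diff[OF bp[OF y] integrable_on_mult_right[OF pi]])
      have "\<bar>x n t\<bar> \<le> 2 * M" "\<bar>g t\<bar> \<le> 2 * M" for n t using xb[of n t] g(2,3)[of t] by simp_all
      note s1 = shift[OF xm this(1), unfolded x_def add_diff_cancel_right', folded x_def] and s2 = shift[OF gm this(2)]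
      show ?thesis unfolding s1 s2 by (intro tendsto_diff L tendsto_const)
    qed
    then show ?thesis using g(1-3) by blast
  qed
  from bchoice[OF ballI[OF gex]]
  obtain g where gg: "\<forall>b\<in>Basis. g b \<in> borel_measurable borel \<and> (\<forall>t. 0 \<le> g b t \<and> g b t \<le> 2 * M) \<and>
     (\<forall>p. p absolutely_integrable_on {0..T} \<longrightarrow> (\<lambda>n. integral {0..T} (\<lambda>t. (us (r n) t \<bullet> b) * p t)) \<longlonglongrightarrow> integral {0..T} (\<lambda>t. (g b t - M) * p t))"
    by (rule exE)
  have gm: "\<And>b. b \<in> Basis \<Longrightarrow> g b \<in> borel_measurable borel"
    and gb: "\<And>b t. b \<in> Basis \<Longrightarrow> 0 \<le> g b t \<and> g b t \<le> 2 * M"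
    and gl: "\<And>b p. b \<in> Basis \<Longrightarrow> p absolutely_integrable_on {0..T} \<Longrightarrow>
      (\<lambda>n. integral {0..T} (\<lambda>t. (us (r n) t \<bullet> b) * p t)) \<longlonglongrightarrow> integral {0..T} (\<lambda>t. (g b t - M) * p t)" using gg by blast+
  define u0 where "u0 t = (\<Sum>b\<in>Basis. (g b t - M) *\<^sub>R b)" for t
  have u0m: "u0 \<in> borel_measurable borel" unfolding u0_def using gm
    by (intro borel_measurable_sum borel_measurable_scaleR borel_measurable_diff) auto
  have u0L: "time_measurable T u0"
    using u0m by (intro measurable_restrict_space1 measurable_completion) simp
  have u0c: "u0 t \<bullet> b = g b t - M" if "b \<in> Basis" for t b unfolding u0_def using that by simp
  have u0b: "norm (u0 t) \<le> real DIM('a) * M" for t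
  proof -
    have "norm (u0 t) \<le> (\<Sum>b\<in>(Basis::'a set). M)" unfolding u0_def
    proof (rule sum_norm_le)
      fix b :: 'a assume "b \<in> Basis"
      then show "norm ((g b t - M) *\<^sub>R b) \<le> M" using gb[of b t] by (simp add: abs_le_iff)
    qed
    then show ?thesis by simp
  qed
  have weak0: "(\<lambda>n. integral {0..T} (\<lambda>t. us (r n) t \<bullet> \<psi> t)) \<longlonglongrightarrow> integral {0..T} (\<lambda>t. u0 t \<bullet> \<psi> t)"
    if \<psi>: "\<psi> absolutely_integrable_on {0..T}" for \<psi>
  proof -
    have \<psi>b: "(\<lambda>t. \<psi> t \<bullet> b) absolutely_integrable_on {0..T}" if "b \<in> Basis" for b
      using \<psi> by (rule absolutely_integrable_component)
    have ex: "integral {0..T} (\<lambda>t. y t \<bullet> \<psi> t) = (\<Sum>b\<in>Basis. integral {0..T} (\<lambda>t. (y t \<bullet> b) * (\<psi> t \<bullet> b)))"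
      if y: "time_measurable T y" "\<And>t. norm (y t) \<le> C" for y :: "real \<Rightarrow> 'a" and C
    proof -
      have "(\<lambda>t. (y t \<bullet> b) * (\<psi> t \<bullet> b)) integrable_on {0..T}" if b: "b \<in> Basis" for b
        using bounded_times_absolutely_integrable[OF borel_measurable_inner[OF y(1) borel_measurable_const] order_trans[OF Basis_le_norm[OF b] y(2)] \<psi>b[OF b]]
        by (simp add: absolutely_integrable_on_def)
      then show ?thesis by (subst euclidean_inner) (rule integral_sum, auto)
    qed
    have "(\<lambda>n. \<Sum>b\<in>Basis. integral {0..T} (\<lambda>t. (us (r n) t \<bullet> b) * (\<psi> t \<bullet> b))) \<longlonglongrightarrow> (\<Sum>b\<in>Basis. integral {0..T} (\<lambda>t. (u0 t \<bullet> b) * (\<psi> t \<bullet> b)))"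
    proof (rule tendsto_sum)
      fix b :: 'a assume b: "b \<in> Basis"
      show "(\<lambda>n. integral {0..T} (\<lambda>t. (us (r n) t \<bullet> b) * (\<psi> t \<bullet> b))) \<longlonglongrightarrow> integral {0..T} (\<lambda>t. (u0 t \<bullet> b) * (\<psi> t \<bullet> b))"
        unfolding u0c[OF b] by (rule gl[OF b \<psi>b[OF b]])
    qed
    then show ?thesis unfolding ex[OF m ub] ex[OF u0L u0b] .
  qed
  define p where "p t = closest_point U (u0 t)" for t
  have cU: "closed U" using U(1) by (rule compact_imp_closed)
  have pU: "p t \<in> U" for t unfolding p_def by (rule closest_point_in_set[OF cU Une])
  have pm: "time_measurable T p"
    unfolding p_def using continuous_on_closest_point[OF U(2) cU Une, of UNIV]
    by (intro measurable_compose[OF u0L] borel_measurable_continuous_onI)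
  have pb: "norm (p t) \<le> M" for t using bspec[OF M0 pU[of t]] unfolding M_def by linarith
  define \<psi> where "\<psi> t = u0 t - p t" for t
  have \<psi>m: "time_measurable T \<psi>" unfolding \<psi>_def using u0L pm by (rule borel_measurable_diff)
  have \<psi>b: "norm (\<psi> t) \<le> real DIM('a) * M + M" for t
    unfolding \<psi>_def using norm_triangle_ineq4[of "u0 t" "p t"] u0b[of t] pb[of t] by linarith
  have \<psi>a: "\<psi> absolutely_integrable_on {0..T}" by (rule abs_integrable_bounded[OF \<psi>m \<psi>b])
  have inn: "(\<lambda>t. y t \<bullet> \<psi> t) integrable_on {0..T}" if y: "time_measurable T y" "\<And>t. norm (y t) \<le> C" for y C
  proof -
    have "(\<lambda>t. y t \<bullet> \<psi> t) absolutely_integrable_on {0..T}"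
    proof (rule abs_integrable_bounded)
      show "time_measurable T (\<lambda>t. y t \<bullet> \<psi> t)" using y(1) \<psi>m by (rule borel_measurable_inner)
      have C: "0 \<le> C" using y(2) norm_ge_zero order_trans by blast
      show "norm (y t \<bullet> \<psi> t) \<le> C * (real DIM('a) * M + M)" for t
        using Cauchy_Schwarz_ineq2[of "y t" "\<psi> t"] mult_mono[OF y(2)[of t] \<psi>b[of t] C norm_ge_zero] by simp
    qed
    then show ?thesis by (simp add: absolutely_integrable_on_def)
  qed
  have "integral {0..T} (\<lambda>t. us (r n) t \<bullet> \<psi> t) \<le> integral {0..T} (\<lambda>t. p t \<bullet> \<psi> t)" for n
  proof (rule integral_le[OF inn[OF m ub] inn[OF pm pb]])
    fix t
    have "(u0 t - closest_point U (u0 t)) \<bullet> (us (r n) t - closest_point U (u0 t)) \<le> 0"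
      by (rule closest_point_dot[OF U(2) cU usU])
    then show "us (r n) t \<bullet> \<psi> t \<le> p t \<bullet> \<psi> t" unfolding \<psi>_def p_def by (simp add: inner_commute inner_diff_left inner_diff_right)
  qed
  then have "integral {0..T} (\<lambda>t. u0 t \<bullet> \<psi> t) \<le> integral {0..T} (\<lambda>t. p t \<bullet> \<psi> t)"
    by (intro LIMSEQ_le_const2[OF weak0[OF \<psi>a]]) auto
  moreover have "integral {0..T} (\<lambda>t. \<psi> t \<bullet> \<psi> t) = integral {0..T} (\<lambda>t. u0 t \<bullet> \<psi> t) - integral {0..T} (\<lambda>t. p t \<bullet> \<psi> t)"
  proof -
    have e: "\<psi> t \<bullet> \<psi> t = u0 t \<bullet> \<psi> t - p t \<bullet> \<psi> t" for t
      using inner_diff_left[of "u0 t" "p t" "\<psi> t"] unfolding \<psi>_def .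
    show ?thesis unfolding e by (rule hk_integral_diff[OF inn[OF u0L u0b] inn[OF pm pb]])
  qed
  ultimately have le: "integral {0..T} (\<lambda>t. \<psi> t \<bullet> \<psi> t) \<le> 0" by simp
  have \<psi>i: "(\<lambda>t. \<psi> t \<bullet> \<psi> t) integrable_on {0..T}" by (rule inn[OF \<psi>m \<psi>b])
  then have \<psi>0: "(\<lambda>t. \<psi> t \<bullet> \<psi> t) absolutely_integrable_on {0..T}" by (rule nonnegative_absolutely_integrable_1) simp
  have "(\<integral>t. \<psi> t \<bullet> \<psi> t \<partial>lebesgue_on {0..T}) = integral {0..T} (\<lambda>t. \<psi> t \<bullet> \<psi> t)"
    by (rule lebesgue_integral_eq_integral) (use \<psi>0 in \<open>auto simp: integrable_restrict_space set_integrable_def\<close>)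
  then have "(\<integral>t. \<psi> t \<bullet> \<psi> t \<partial>lebesgue_on {0..T}) = 0"
    using le Henstock_Kurzweil_Integration.integral_nonneg[OF \<psi>i] by simp
  then have AE0: "AE t in lebesgue_on {0..T}. \<psi> t \<bullet> \<psi> t = 0"
    by (subst (asm) integral_nonneg_eq_0_iff_AE) (use \<psi>0 in \<open>auto simp: integrable_restrict_space set_integrable_def\<close>)
  have "AE t in lebesgue. t \<in> {0..T} \<longrightarrow> u0 t = p t"
    using AE0 by (subst (asm) AE_restrict_space_iff) (auto simp: \<psi>_def elim!: eventually_mono)
  then obtain N where N: "negligible N" "\<And>t. t \<notin> N \<Longrightarrow> t \<in> {0..T} \<Longrightarrow> u0 t = p t"
    unfolding eventually_ae_filter_negligible by blast
  have "weak_star_converges T (\<lambda>n. us (r n)) p"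
    unfolding weak_star_converges_def
  proof (intro allI impI)
    fix \<psi> :: "real \<Rightarrow> 'a" assume "\<psi> absolutely_integrable_on {0..T}"
    moreover have "integral {0..T} (\<lambda>t. u0 t \<bullet> \<psi> t) = integral {0..T} (\<lambda>t. p t \<bullet> \<psi> t)"
      by (rule integral_spike[OF N(1)]) (use N(2) in auto)
    ultimately show "(\<lambda>n. integral {0..T} (\<lambda>t. us (r n) t \<bullet> \<psi> t)) \<longlonglongrightarrow> integral {0..T} (\<lambda>t. p t \<bullet> \<psi> t)"
      using weak0[of \<psi>] by simp
  qed
  then show thesis using that[OF r pm pU] by blast
qed

section \<open>Existence and convergence of optimal controls\<close>

text \<open>Continuous convergence on a compact set is uniform: finitely many of the neighbourhoods in the assumption
cover the set.\<close>

lemma continuous_convergence_uniform: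
  fixes f :: "nat \<Rightarrow> 'a::metric_space \<Rightarrow> real"
  assumes S: "compact S"
    and c: "\<And>s e. s \<in> S \<Longrightarrow> e > 0 \<Longrightarrow> \<exists>d>0. \<exists>N. \<forall>n\<ge>N. \<forall>t\<in>S. dist t s < d \<longrightarrow> \<bar>f n t - g s\<bar> < e"
  shows "uniform_limit S f g sequentially"
proof (rule uniform_limitI)
  fix e :: real assume e: "e > 0"
  have "\<forall>s\<in>S. \<exists>p. fst p > 0 \<and> (\<forall>n\<ge>snd p. \<forall>t\<in>S. dist t s < fst p \<longrightarrow> \<bar>f n t - g s\<bar> < e/4)"
  proof
    fix s assume "s \<in> S"
    from c[OF this, of "e/4"] e obtain d N where "d > 0" "\<forall>n\<ge>N. \<forall>t\<in>S. dist t s < d \<longrightarrow> \<bar>f n t - g s\<bar> < e/4" by auto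
    then show "\<exists>p. fst p > 0 \<and> (\<forall>n\<ge>snd p. \<forall>t\<in>S. dist t s < fst p \<longrightarrow> \<bar>f n t - g s\<bar> < e/4)"
      by (intro exI[of _ "(d, N)"]) auto
  qed
  from bchoice[OF this] obtain p where pp: "\<forall>s\<in>S. fst (p s) > 0 \<and> (\<forall>n\<ge>snd (p s). \<forall>t\<in>S. dist t s < fst (p s) \<longrightarrow> \<bar>f n t - g s\<bar> < e/4)"
    by (rule exE)
  have p: "fst (p s) > 0" if "s \<in> S" for s using pp that by simp
  have q: "\<bar>f n t - g s\<bar> < e/4" if "s \<in> S" "n \<ge> snd (p s)" "t \<in> S" "dist t s < fst (p s)" for s n t using pp that by simp
  have "S \<subseteq> (\<Union>s\<in>S. ball s (fst (p s)))" using p by force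
  then obtain C where C: "C \<subseteq> S" "finite C" "S \<subseteq> (\<Union>s\<in>C. ball s (fst (p s)))"
    by (rule compactE_image[OF S, rotated]) auto
  define N where "N = Max (insert 0 ((\<lambda>s. snd (p s)) ` C))"
  have N: "snd (p s) \<le> N" if "s \<in> C" for s unfolding N_def using C(2) that by (intro Max_ge) auto
  have "dist (f n t) (g t) < e" if n: "n \<ge> N" and t: "t \<in> S" for n t
  proof -
    obtain s where s: "s \<in> C" "dist t s < fst (p s)" using C(3) t by (auto simp: dist_commute)
    have sS: "s \<in> S" using s C by auto
    have 1: "\<bar>f k t - g s\<bar> < e/4" if "k \<ge> N" for k using q[OF sS _ t s(2), of k] N[OF s(1)] that by simp
    from c[OF t, of "e/4"] e obtain d N' where d: "d > 0" "\<forall>n\<ge>N'. \<forall>r\<in>S. dist r t < d \<longrightarrow> \<bar>f n r - g t\<bar> < e/4" by auto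
    have 2: "\<bar>f (max N N') t - g t\<bar> < e/4" using d t by simp
    show ?thesis using 1[of "max N N'"] 1[OF n] 2 unfolding dist_real_def by linarith
  qed
  then show "\<forall>\<^sub>F n in sequentially. \<forall>t\<in>S. dist (f n t) (g t) < e" unfolding eventually_sequentially by blast
qed

text \<open>Convexity in the form \<open>us n \<bullet> us n \<ge> 2 (us n \<bullet> u) - u \<bullet> u\<close>, whose right-hand side converges when integrated.\<close>

lemma weak_star_energy:
  fixes u :: "real \<Rightarrow> 'a::euclidean_space"
  assumes w: "weak_star_converges T us u"
    and us: "\<And>n. time_measurable T (us n)" "\<And>n t. norm (us n t) \<le> M"
    and u: "time_measurable T u" "\<And>t. norm (u t) \<le> M" and e: "e > 0"
  shows "\<forall>\<^sub>F n in sequentially. integral {0..T} (\<lambda>t. u t \<bullet> u t) - e < integral {0..T} (\<lambda>t. us n t \<bullet> us n t)"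
proof -
  have ai: "(\<lambda>t. a t \<bullet> b t) integrable_on {0..T}"
    if a: "time_measurable T a" "\<And>t. norm (a t) \<le> M" 
     and b: "time_measurable T b" "\<And>t. norm (b t) \<le> M" for a b :: "real \<Rightarrow> 'a"
  proof -
    have "norm (a t \<bullet> b t) \<le> M * M" for t
    proof -
      have M: "0 \<le> M" using a(2)[of t] norm_ge_zero[of "a t"] by linarith
      have "\<bar>a t \<bullet> b t\<bar> \<le> norm (a t) * norm (b t)" by (rule Cauchy_Schwarz_ineq2)
      also have "\<dots> \<le> M * M" by (rule mult_mono[OF a(2) b(2) M norm_ge_zero])
      finally show ?thesis by simp
    qed
    then have "(\<lambda>t. a t \<bullet> b t) absolutely_integrable_on {0..T}"
      by (intro abs_integrable_bounded[where C="M*M"] borel_measurable_inner a(1) b(1))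
    then show ?thesis by (rule set_lebesgue_integral_eq_integral)
  qed
  have "u absolutely_integrable_on {0..T}" by (rule abs_integrable_bounded[where C=M]) (use u in auto)
  then have "(\<lambda>n. integral {0..T} (\<lambda>t. us n t \<bullet> u t)) \<longlonglongrightarrow> integral {0..T} (\<lambda>t. u t \<bullet> u t)"
    by (rule w[unfolded weak_star_converges_def, rule_format])
  then have "\<forall>\<^sub>F n in sequentially. integral {0..T} (\<lambda>t. us n t \<bullet> u t) > integral {0..T} (\<lambda>t. u t \<bullet> u t) - e/2"
    by (rule order_tendstoD) (use e in auto)
  then show ?thesis
  proof (rule eventually_mono)
    fix n assume n: "integral {0..T} (\<lambda>t. us n t \<bullet> u t) > integral {0..T} (\<lambda>t. u t \<bullet> u t) - e/2"
    have i1: "(\<lambda>t. us n t \<bullet> u t) integrable_on {0..T}" by (rule ai) (rule us u)+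
    have i2: "(\<lambda>t. u t \<bullet> u t) integrable_on {0..T}" by (rule ai) (rule us u)+
    have i3: "(\<lambda>t. us n t \<bullet> us n t) integrable_on {0..T}" by (rule ai) (rule us u)+
    have i4: "(\<lambda>t. 2 * (us n t \<bullet> u t)) integrable_on {0..T}" by (rule integrable_on_mult_right[OF i1])
    have "integral {0..T} (\<lambda>t. 2 * (us n t \<bullet> u t) - u t \<bullet> u t) \<le> integral {0..T} (\<lambda>t. us n t \<bullet> us n t)"
    proof (rule integral_le)
      show "2 * (us n t \<bullet> u t) - u t \<bullet> u t \<le> us n t \<bullet> us n t" for t
        using inner_ge_zero[of "us n t - u t"] by (simp add: inner_diff inner_commute)
    qed (rule Henstock_Kurzweil_Integration.integrable_diff[OF i4 i2] i3)+
    also have "integral {0..T} (\<lambda>t. 2 * (us n t \<bullet> u t) - u t \<bullet> u t) = 2 * integral {0..T} (\<lambda>t. us n t \<bullet> u t) - integral {0..T} (\<lambda>t. u t \<bullet> u t)"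
      by (simp add: hk_integral_diff[OF i4 i2])
    finally show "integral {0..T} (\<lambda>t. u t \<bullet> u t) - e < integral {0..T} (\<lambda>t. us n t \<bullet> us n t)" using n by linarith
  qed
qed

locale control_problem = interaction H G B Lp
  for H :: "real^'d \<Rightarrow> real^'d" and G :: "'d \<Rightarrow> real^'d \<Rightarrow> real^'d" and B Lp :: real +
  fixes T M R0 :: real and U :: "((real^'d)^'m) set" and Y0 :: "(real^'d)^'m"
    and L :: "(real^'d)^'m \<Rightarrow> (real^'d) measure \<Rightarrow> real"
  assumes T_pos: "T > 0" and R0_nonneg: "0 \<le> R0" and U_ne: "U \<noteq> {}" and U_compact: "compact U" and U_convex: "convex U"
    and U_bound: "\<And>w. w \<in> U \<Longrightarrow> norm w \<le> M"
    and L_nonneg: "\<And>Y \<mu>. \<mu> \<in> P1 \<Longrightarrow> 0 \<le> L Y \<mu>" and L_cont: "chi_continuous L"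
begin

definition admissible :: "(real \<Rightarrow> (real^'d)^'m) \<Rightarrow> bool" where
  "admissible u \<longleftrightarrow> time_measurable T u \<and> (\<forall>t. u t \<in> U)"

text \<open>A representative of v with values in U at every time, so that it is bounded everywhere as
\<open>controlled\<close> asks.\<close>

definition reg :: "(real \<Rightarrow> (real^'d)^'m) \<Rightarrow> real \<Rightarrow> (real^'d)^'m" where
  "reg v t = (if t \<in> {0..T} \<and> v t \<in> U then v t else (SOME w. w \<in> U))"

definition pos :: "(real \<Rightarrow> (real^'d)^'m) \<Rightarrow> real \<Rightarrow> (real^'d)^'m" where
  "pos u t = Y0 + integral {0..t} u"

definition datum :: "(real^'d) measure \<Rightarrow> bool" where
  "datum P \<longleftrightarrow> prob_space P \<and> sets P = sets borel \<and> (AE x in P. norm x \<le> R0)"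

abbreviation "lag u \<equiv> controlled.lagrangian H G T u (pos u) (cball 0 R0)"

lemma admissible_controlled: "admissible u \<Longrightarrow> controlled H G B Lp T M u (pos u) Y0"
  by unfold_locales (simp_all add: T_pos admissible_def pos_def U_bound)

lemma some_U: "(SOME w. w \<in> U) \<in> U" using U_ne by (rule some_in_eq[THEN iffD2])

lemma reg_admissible:
  assumes "v \<in> Linf T U"
  shows "admissible (reg v)"
  unfolding admissible_def
proof (intro conjI allI)
  show "reg v t \<in> U" for t unfolding reg_def using some_U by simp
  have [measurable]: "time_measurable T v" using assms by (simp add: Linf_def)
  have [measurable]: "U \<in> sets borel" by (intro borel_closed compact_imp_closed U_compact)
  have "time_measurable T (\<lambda>t. if v t \<in> U then v t else (SOME w. w \<in> U))" by measurable
  then show "time_measurable T (reg v)"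
    by (rule measurable_cong[THEN iffD1, rotated]) (simp add: reg_def)
qed

lemma reg_negligible:
  assumes "v \<in> Linf T U"
  shows "negligible {t \<in> {0..T}. reg v t \<noteq> v t}"
proof -
  have "AE t in lebesgue_on {0..T}. v t \<in> U" using assms by (simp add: Linf_def)
  then have "AE t in lebesgue. t \<in> {0..T} \<longrightarrow> v t \<in> U" by (simp add: AE_restrict_space_iff)
  then obtain N where N: "negligible N \<and> {t. \<not> (t \<in> {0..T} \<longrightarrow> v t \<in> U)} \<subseteq> N"
    unfolding eventually_ae_filter_negligible by (rule exE)
  then have "{t \<in> {0..T}. reg v t \<noteq> v t} \<subseteq> N" by (auto simp: reg_def)
  then show ?thesis by (rule negligible_subset[OF conjunct1[OF N]])
qed

lemma reg_integral:
  assumes "v \<in> Linf T U" "t \<in> {0..T}"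
  shows "integral {0..t} (\<lambda>s. f s (reg v s)) = integral {0..t} (\<lambda>s. f s (v s))"
  by (rule integral_spike[OF reg_negligible[OF assms(1)]]) (use assms(2) in auto)

lemma admissible_Linf: "admissible u \<Longrightarrow> u \<in> Linf T U"
  unfolding admissible_def Linf_def using U_bound by auto

lemma reg_inner_integral: "v \<in> Linf T U \<Longrightarrow> integral {0..T} (\<lambda>s. reg v s \<bullet> \<psi> s) = integral {0..T} (\<lambda>s. v s \<bullet> \<psi> s)"
  by (rule reg_integral[where f="\<lambda>t w. w \<bullet> \<psi> t"]) (use T_pos in auto)

lemma reg_weak_star:
  assumes "\<And>n. v n \<in> Linf T U"
  shows "weak_star_converges T (\<lambda>n. reg (v n)) u \<longleftrightarrow> weak_star_converges T v u"
  unfolding weak_star_converges_def reg_inner_integral[OF assms] ..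

lemma weak_star_reg:
  assumes "u \<in> Linf T U"
  shows "weak_star_converges T v (reg u) \<longleftrightarrow> weak_star_converges T v u"
  unfolding weak_star_converges_def reg_inner_integral[OF assms] ..

lemma datum_D: 
  assumes "datum P"
  shows "prob_space P" "sets P = sets borel" "AE x in P. x \<in> cball 0 R0" "AE x in P. norm x \<le> R0" "AE x in P. x \<in> cball 0 R0 \<and> norm x \<le> R0" "P \<in> P1"
  using assms unfolding datum_def by (auto intro: P1_bounded_support)

lemma running_cost_continuous:
  assumes u: "admissible u" and P: "datum P" and Z: "lag u P Z"
  shows "continuous_on {0..T} (\<lambda>t. L (pos u t) (distr P borel (Z t)))"
  unfolding continuous_on_iff
proof (intro ballI allI impI)
  interpret c: controlled H G B Lp T M u "pos u" Y0 using u by (rule admissible_controlled)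
  fix t e :: real assume t: "t \<in> {0..T}" and e: "e > 0"
  note D = datum_D[OF P]
  have P1: "distr P borel (Z s) \<in> P1" if "s \<in> {0..T}" for s by (rule c.lagrangian_P1[OF D(1,2,5) Z that])
  from L_cont[unfolded chi_continuous_def, rule_format, OF P1[OF t] e] obtain \<delta> where
    \<delta>: "\<delta> > 0" "\<And>Y' \<mu>'. \<mu>' \<in> P1 \<Longrightarrow> chi_dist Y' \<mu>' (pos u t) (distr P borel (Z t)) < \<delta> \<Longrightarrow> \<bar>L Y' \<mu>' - L (pos u t) (distr P borel (Z t))\<bar> < e"
    by blast
  from c.lagrangian_chi_curve[OF D(1-3) Z, unfolded chi_continuous_curve_def, rule_format, OF t \<delta>(1)]
  obtain d where "d > 0" "\<forall>s\<in>{0..T}. \<bar>s - t\<bar> < d \<longrightarrow> chi_dist (pos u s) (distr P borel (Z s)) (pos u t) (distr P borel (Z t)) < \<delta>" by blast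
  then show "\<exists>d>0. \<forall>s\<in>{0..T}. dist s t < d \<longrightarrow> dist (L (pos u s) (distr P borel (Z s))) (L (pos u t) (distr P borel (Z t))) < e"
    unfolding dist_real_def using \<delta>(2) P1 by blast
qed

text \<open>The trajectory of \<open>us n\<close> at time t is compared with the limit at another time s, in one step through a near-optimal
coupling of the initial measures: \<open>stability\<close> accounts for the change of control and measure at time t, the speed bound of the flow lines
for the change from t to s. This is the form which continuity of L at the limit point of time s can use.\<close>

lemma trajectories_close:
  assumes us: "\<And>n. admissible (us n)" and u: "admissible u" and w: "weak_star_converges T us u"
    and Ps: "\<And>n. datum (Ps n)" and P: "datum P" and W: "(\<lambda>n. W1 (Ps n) P) \<longlonglongrightarrow> 0"
    and Zs: "\<And>n. lag (us n) (Ps n) (Zs n)" and Z: "lag u P Z" and e: "e > 0"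
  shows "\<exists>N. \<forall>n\<ge>N. \<forall>t\<in>{0..T}. \<forall>s\<in>{0..T}.
     chi_dist (pos (us n) t) (distr (Ps n) borel (Zs n t)) (pos u s) (distr P borel (Z s)) \<le> e + (M + vel_bd M) * \<bar>t - s\<bar>"
proof -
  interpret c: controlled H G B Lp T M u "pos u" Y0 using u by (rule admissible_controlled)
  note D = datum_D[OF P]
  have gc: "c.good_curve (\<lambda>t. distr P borel (Z t))" and Zm: "\<And>t. t \<in> {0..T} \<Longrightarrow> Z t \<in> borel_measurable borel"
    and fl: "\<And>x. x \<in> cball 0 R0 \<Longrightarrow> c.flow_line (\<lambda>t. distr P borel (Z t)) x (\<lambda>t. Z t x)"
    using Z unfolding c.lagrangian_def by auto
  (* The coupling costs less than 2 q and the kernel error is less than q: the flows contribute 3 e / 4, the agents e / 4. *)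
  define q where "q = e / (4 * (controlled.stab_const H Lp T M + 1))"
  have sc: "c.stab_const > 0" unfolding c.stab_const_def by simp
  have q: "q > 0" unfolding q_def using e sc by (intro divide_pos_pos) auto
  have scq: "c.stab_const * (3 * q) \<le> 3 * e / 4"
  proof -
    have "c.stab_const / (c.stab_const + 1) \<le> 1" using sc by simp
    then have "(3 * e / 4) * (c.stab_const / (c.stab_const + 1)) \<le> 3 * e / 4" by (intro mult_left_le) (use e in auto)
    moreover have "c.stab_const * (3 * q) = (3 * e / 4) * (c.stab_const / (c.stab_const + 1))" unfolding q_def using sc by (simp add: field_simps)
    ultimately show ?thesis by simp
  qed
  have cs: "controlled H G B Lp T M (us n) (pos (us n)) Y0" for n using us by (rule admissible_controlled)
  have "\<exists>N. \<forall>n\<ge>N. \<forall>t\<in>{0..T}. norm (pos (us n) t - pos u t) < e/4"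
    by (rule c.weak_star_Y_uniform[OF cs w]) (use e in simp)
  then obtain N1 where N1: "\<And>n t. n \<ge> N1 \<Longrightarrow> t \<in> {0..T} \<Longrightarrow> norm (pos (us n) t - pos u t) < e/4" by blast
  have "\<exists>N. \<forall>n\<ge>N. \<forall>t\<in>{0..T}. \<forall>x\<in>cball 0 R0. norm (integral {0..t} (\<lambda>s. control_field (us n s) (pos (us n) s) (Z s x)
          - control_field (u s) (pos u s) (Z s x))) < q"
  proof (rule c.kernel_error_uniform[OF cs w _ _ _ q])
    show "compact (cball (0::real^'d) R0)" by simp
    show "x \<in> cball 0 R0 \<Longrightarrow> continuous_on {0..T} (\<lambda>t. Z t x)" for x using fl unfolding c.flow_line_def by blast
    show "norm (Z t x - Z t y) \<le> (2 * exp (2 * c.Kv * T)) * norm (x - y)" if "t \<in> {0..T}" "x \<in> cball 0 R0" "y \<in> cball 0 R0" for t x y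
      using c.flow_line_close[OF gc fl[OF that(2)] fl[OF that(3)] that(1)] by (simp add: mult_ac)
  qed
  then obtain N2 where N2: "\<And>n t x. n \<ge> N2 \<Longrightarrow> t \<in> {0..T} \<Longrightarrow> x \<in> cball 0 R0 \<Longrightarrow> norm (integral {0..t} (\<lambda>s. control_field (us n s) (pos (us n) s) (Z s x)
          - control_field (u s) (pos u s) (Z s x))) < q" by blast
  obtain N3 where N3: "\<And>n. n \<ge> N3 \<Longrightarrow> W1 (Ps n) P < q"
    using order_tendstoD(2)[OF W q] unfolding eventually_sequentially by blast
  have "chi_dist (pos (us n) t) (distr (Ps n) borel (Zs n t)) (pos u s) (distr P borel (Z s)) \<le> e + (M + vel_bd M) * \<bar>t - s\<bar>"
    if n: "n \<ge> max N1 (max N2 N3)" and t: "t \<in> {0..T}" and s: "s \<in> {0..T}" for n t s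
  proof -
    interpret n: controlled H G B Lp T M "us n" "pos (us n)" Y0 by (rule cs)
    note Dn = datum_D[OF Ps[of n]]
    obtain \<pi> where \<pi>: "\<pi> \<in> couplings (Ps n) P" "integrable \<pi> (\<lambda>z. dist (fst z) (snd z))"
      "(\<integral>z. dist (fst z) (snd z) \<partial>\<pi>) < W1 (Ps n) P + q" by (rule W1_near_optimal_coupling[OF Dn(6) D(6) q])
    have st: "integrable \<pi> (\<lambda>p. norm (Zs n t (fst p) - Z t (snd p)))"
       "(\<integral>p. norm (Zs n t (fst p) - Z t (snd p)) \<partial>\<pi>) \<le> n.stab_const * ((\<integral>p. dist (fst p) (snd p) \<partial>\<pi>) + q)"
      using n.stability[OF c.controlled_axioms Dn(1-3) D(1-3) Zs[of n] Z \<pi>(1,2) less_imp_le[OF q] _ t] N2[of n] n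
      by (auto intro: less_imp_le)
    have fs: "fst \<in> measurable \<pi> borel" "snd \<in> measurable \<pi> borel" and d: "distr \<pi> borel snd = P" by (rule couplings_D[OF \<pi>(1)])+
    interpret p: prob_space \<pi> by (rule couplings_prob[OF \<pi>(1) Dn(1)])
    have "AE x in distr \<pi> borel snd. norm (Z t x - Z s x) \<le> c.Cv * \<bar>t - s\<bar>"
      unfolding d using D(3) by eventually_elim (rule c.flow_line_lip[OF gc fl s t])
    then have ae: "AE p in \<pi>. norm (Z t (snd p) - Z s (snd p)) \<le> c.Cv * \<bar>t - s\<bar>"
      by (subst (asm) AE_distr_iff) (use Zm[OF t] Zm[OF s] fs in auto)
    have zm: "(\<lambda>p. Z t (snd p)) \<in> borel_measurable \<pi>" "(\<lambda>p. Z s (snd p)) \<in> borel_measurable \<pi>"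
      using measurable_compose[OF fs(2) Zm] t s by auto
    have znm: "Zs n t \<in> borel_measurable borel" using Zs[of n] t unfolding n.lagrangian_def by auto
    then have znm': "(\<lambda>p. Zs n t (fst p)) \<in> borel_measurable \<pi>" by (rule measurable_compose[OF fs(1)])
    have i2: "integrable \<pi> (\<lambda>p. norm (Z t (snd p) - Z s (snd p)))"
      by (rule p.integrable_const_bound[where B="c.Cv * \<bar>t - s\<bar>"]) (use ae zm in auto)
    have i3: "integrable \<pi> (\<lambda>p. norm (Zs n t (fst p) - Z s (snd p)))"
      by (rule Bochner_Integration.integrable_bound[OF Bochner_Integration.integrable_add[OF st(1) i2]])
         (use zm znm' in \<open>auto intro!: AE_I2 intro: norm_diff_triangle_le[OF order_refl order_refl]\<close>)
    have "W1 (distr (Ps n) borel (Zs n t)) (distr P borel (Z s)) \<le> (\<integral>p. norm (Zs n t (fst p) - Z s (snd p)) \<partial>\<pi>)"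
      by (rule W1_distr_le[OF \<pi>(1) znm Zm[OF s] i3])
    also have "\<dots> \<le> (\<integral>p. norm (Zs n t (fst p) - Z t (snd p)) + norm (Z t (snd p) - Z s (snd p)) \<partial>\<pi>)"
      by (rule integral_mono[OF i3 Bochner_Integration.integrable_add[OF st(1) i2]]) (auto intro: norm_diff_triangle_le)
    also have "\<dots> = (\<integral>p. norm (Zs n t (fst p) - Z t (snd p)) \<partial>\<pi>) + (\<integral>p. norm (Z t (snd p) - Z s (snd p)) \<partial>\<pi>)"
      by (rule Bochner_Integration.integral_add[OF st(1) i2])
    also have "\<dots> \<le> 3 * e / 4 + c.Cv * \<bar>t - s\<bar>"
    proof (rule add_mono)
      have "(\<integral>p. dist (fst p) (snd p) \<partial>\<pi>) + q \<le> 3 * q" using \<pi>(3) N3[of n] n by simp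
      then have "n.stab_const * ((\<integral>p. dist (fst p) (snd p) \<partial>\<pi>) + q) \<le> n.stab_const * (3 * q)" by (intro mult_left_mono) (use sc in auto)
      then show "(\<integral>p. norm (Zs n t (fst p) - Z t (snd p)) \<partial>\<pi>) \<le> 3 * e / 4" using st(2) scq by linarith
      have "(\<integral>p. norm (Z t (snd p) - Z s (snd p)) \<partial>\<pi>) \<le> (\<integral>p. c.Cv * \<bar>t - s\<bar> \<partial>\<pi>)"
        by (rule integral_mono_AE[OF i2 _ ae]) simp
      then show "(\<integral>p. norm (Z t (snd p) - Z s (snd p)) \<partial>\<pi>) \<le> c.Cv * \<bar>t - s\<bar>" by (simp add: p.prob_space)
    qed
    finally have 1: "W1 (distr (Ps n) borel (Zs n t)) (distr P borel (Z s)) \<le> 3 * e / 4 + c.Cv * \<bar>t - s\<bar>" .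
    have "norm (pos (us n) t - pos u s) \<le> norm (pos (us n) t - pos u t) + norm (pos u t - pos u s)" by (rule norm_diff_triangle_le) auto
    also have "\<dots> \<le> e/4 + M * \<bar>t - s\<bar>" by (rule add_mono) (use N1[of n t] n t in auto, rule c.Y_lip[OF s t])
    finally show ?thesis using chi_dist_le[OF _ 1] by (force simp: algebra_simps)
  qed
  then show ?thesis by blast
qed

lemma running_cost_tendsto:
  assumes us: "\<And>n. admissible (us n)" and u: "admissible u" and w: "weak_star_converges T us u"
    and Ps: "\<And>n. datum (Ps n)" and P: "datum P" and W: "(\<lambda>n. W1 (Ps n) P) \<longlonglongrightarrow> 0"
    and Zs: "\<And>n. lag (us n) (Ps n) (Zs n)" and Z: "lag u P Z"
  shows "(\<lambda>n. integral {0..T} (\<lambda>t. L (pos (us n) t) (distr (Ps n) borel (Zs n t)))) \<longlonglongrightarrow> integral {0..T} (\<lambda>t. L (pos u t) (distr P borel (Z t)))"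
proof -
  define l where "l n t = L (pos (us n) t) (distr (Ps n) borel (Zs n t))" for n t
  define l0 where "l0 t = L (pos u t) (distr P borel (Z t))" for t
  interpret c: controlled H G B Lp T M u "pos u" Y0 using u by (rule admissible_controlled)
  note D = datum_D[OF P]
  have P1: "distr P borel (Z s) \<in> P1" if "s \<in> {0..T}" for s by (rule c.lagrangian_P1[OF D(1,2,5) Z that])
  have P1n: "distr (Ps n) borel (Zs n s) \<in> P1" if "s \<in> {0..T}" for s n
    by (rule controlled.lagrangian_P1[OF admissible_controlled[OF us] datum_D(1,2,5)[OF Ps] Zs that])
  have V: "0 \<le> M + c.Cv" using c.M_nonneg c.Cv_nonneg by simp
  have ul: "uniform_limit {0..T} (\<lambda>n t. l n t) (\<lambda>t. l0 t) sequentially"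
  proof (rule continuous_convergence_uniform)
    fix s e :: real assume s: "s \<in> {0..T}" and e: "e > 0"
    from L_cont[unfolded chi_continuous_def, rule_format, OF P1[OF s] e] obtain \<delta> where
      \<delta>: "\<delta> > 0" "\<And>Y' \<mu>'. \<mu>' \<in> P1 \<Longrightarrow> chi_dist Y' \<mu>' (pos u s) (distr P borel (Z s)) < \<delta> \<Longrightarrow> \<bar>L Y' \<mu>' - l0 s\<bar> < e"
      unfolding l0_def by blast
    have "\<delta>/2 > 0" using \<delta> by simp
    from trajectories_close[OF us u w Ps P W Zs Z this] obtain N where N0: "\<forall>n\<ge>N. \<forall>t\<in>{0..T}. \<forall>s\<in>{0..T}.
     chi_dist (pos (us n) t) (distr (Ps n) borel (Zs n t)) (pos u s) (distr P borel (Z s)) \<le> \<delta>/2 + (M + c.Cv) * \<bar>t - s\<bar>" by (rule exE)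
    have N: "chi_dist (pos (us n) t) (distr (Ps n) borel (Zs n t)) (pos u s) (distr P borel (Z s)) \<le> \<delta>/2 + (M + c.Cv) * \<bar>t - s\<bar>"
      if "n \<ge> N" "t \<in> {0..T}" for n t using N0 s that by simp
    define d where "d = \<delta> / (2 * (M + c.Cv + 1))"
    have d: "d > 0" unfolding d_def using \<delta>(1) V by (intro divide_pos_pos) auto
    have "\<bar>l n t - l0 s\<bar> < e"
      if n: "n \<ge> N" and t: "t \<in> {0..T}" and ts: "dist t s < d" for n t
      unfolding l_def
    proof (rule \<delta>(2)[OF P1n[OF t]])
      have "(M + c.Cv) * \<bar>t - s\<bar> \<le> (M + c.Cv + 1) * \<bar>t - s\<bar>" by (intro mult_right_mono) auto
      also have "\<dots> < (M + c.Cv + 1) * d" by (intro mult_strict_left_mono) (use ts V in \<open>auto simp: dist_real_def\<close>)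
      also have "\<dots> = \<delta>/2" unfolding d_def using V by (simp add: field_simps)
      finally show "chi_dist (pos (us n) t) (distr (Ps n) borel (Zs n t)) (pos u s) (distr P borel (Z s)) < \<delta>" using N[OF n t] by linarith
    qed
    then show "\<exists>d>0. \<exists>N. \<forall>n\<ge>N. \<forall>t\<in>{0..T}. dist t s < d \<longrightarrow> \<bar>l n t - l0 s\<bar> < e"
      using d by blast
  qed simp
  obtain I J where
    I: "\<And>n. ((\<lambda>t. l n t) has_integral I n) {0..T}"
    and J: "((\<lambda>t. l0 t) has_integral J) {0..T}" and IJ: "I \<longlonglongrightarrow> J"
    by (rule uniform_limit_integral[OF ul running_cost_continuous[OF us Ps Zs, folded l_def] sequentially_bot], rule that)
  show ?thesis unfolding l_def[symmetric] l0_def[symmetric] using IJ unfolding integral_unique[OF J] integral_unique[OF I] .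
qed

definition run_cost :: "(real \<Rightarrow> (real^'d)^'m) \<Rightarrow> (real^'d) measure \<Rightarrow> (real \<Rightarrow> real^'d \<Rightarrow> real^'d) \<Rightarrow> real" where
  "run_cost u P Z = integral {0..T} (\<lambda>t. L (pos u t) (distr P borel (Z t))) + integral {0..T} (\<lambda>t. u t \<bullet> u t)"

text \<open>The arguments on optimality see a system S only through this property: every admissible control has a
trajectory, and every trajectory is Lagrangian with initial measure P.\<close>

definition represents where
  "represents S P \<longleftrightarrow> datum P \<and> (\<forall>v\<in>Linf T U. \<exists>Y \<mu>. S v Y \<mu>) \<and>
     (\<forall>v\<in>Linf T U. \<forall>Y \<mu>. S v Y \<mu> \<longrightarrow>
        (\<exists>Z. lag (reg v) P Z \<and> (\<forall>t\<in>{0..T}. Y t = pos (reg v) t \<and> \<mu> t = distr P borel (Z t))))"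

lemma energy_integrable:
  assumes u: "admissible u"
  shows "(\<lambda>t. u t \<bullet> u t) integrable_on {0..T}"
proof -
  have um: "time_measurable T u" and uU: "\<And>t. u t \<in> U" using u unfolding admissible_def by auto
  have "norm (u t \<bullet> u t) \<le> M * M" for t
  proof -
    have n: "norm (u t) \<le> M" by (rule U_bound[OF uU])
    then have M: "0 \<le> M" using norm_ge_zero[of "u t"] by linarith
    have "\<bar>u t \<bullet> u t\<bar> \<le> norm (u t) * norm (u t)" by (rule Cauchy_Schwarz_ineq2)
    also have "\<dots> \<le> M * M" by (rule mult_mono[OF n n M norm_ge_zero])
    finally show ?thesis by simp
  qed
  then have "(\<lambda>t. u t \<bullet> u t) absolutely_integrable_on {0..T}"
    by (intro abs_integrable_bounded[where C="M*M"] borel_measurable_inner um)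
  then show ?thesis by (rule set_lebesgue_integral_eq_integral)
qed

lemma sum_norm_square: "(\<Sum>k\<in>UNIV. (norm (w $ k))\<^sup>2) = w \<bullet> w" for w :: "(real^'d)^'m"
  by (simp add: inner_vec_def power2_norm_eq_inner)

lemma cost_eq_run_cost:
  assumes v: "v \<in> Linf T U" and P: "datum P" and Z: "lag (reg v) P Z"
    and Y: "\<And>t. t \<in> {0..T} \<Longrightarrow> Y t = pos (reg v) t" and \<mu>: "\<And>t. t \<in> {0..T} \<Longrightarrow> \<mu> t = distr P borel (Z t)"
  shows "cost T L v Y \<mu> = run_cost (reg v) P Z"
proof -
  have T: "T \<in> {0..T}" using T_pos by simp
  note ad = reg_admissible[OF v]
  have "cost T L v Y \<mu> = integral {0..T} (\<lambda>t. L (pos (reg v) t) (distr P borel (Z t)) + v t \<bullet> v t)"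
    unfolding cost_def sum_norm_square by (rule Henstock_Kurzweil_Integration.integral_cong) (simp add: Y \<mu>)
  also have "\<dots> = integral {0..T} (\<lambda>t. L (pos (reg v) t) (distr P borel (Z t)) + reg v t \<bullet> reg v t)"
    by (rule reg_integral[OF v T, symmetric, where f="\<lambda>t w. L (pos (reg v) t) (distr P borel (Z t)) + w \<bullet> w"])
  also have "\<dots> = run_cost (reg v) P Z"
    unfolding run_cost_def
    by (rule hk_integral_add[OF integrable_continuous_interval[OF running_cost_continuous[OF ad P Z]] energy_integrable[OF ad]])
  finally show ?thesis .
qed

lemma run_cost_nonneg:
  assumes u: "admissible u" and P: "datum P" and Z: "lag u P Z"
  shows "0 \<le> run_cost u P Z"
proof -
  interpret c: controlled H G B Lp T M u "pos u" Y0 using u by (rule admissible_controlled)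
  have "0 \<le> integral {0..T} (\<lambda>t. L (pos u t) (distr P borel (Z t)))"
    by (rule Henstock_Kurzweil_Integration.integral_nonneg[OF integrable_continuous_interval[OF running_cost_continuous[OF u P Z]]])
       (rule L_nonneg[OF c.lagrangian_P1[OF datum_D(1,2,5)[OF P] Z]])
  moreover have "0 \<le> integral {0..T} (\<lambda>t. u t \<bullet> u t)"
    by (rule Henstock_Kurzweil_Integration.integral_nonneg[OF energy_integrable[OF u]]) simp
  ultimately show ?thesis unfolding run_cost_def by simp
qed

lemma W1_self:
  assumes P: "datum P" shows "W1 P P = 0"
proof -
  have "W1 (distr P borel (\<lambda>x. x)) (distr P borel (\<lambda>x. x)) \<le> 0"
    by (rule W1_distr_same[OF datum_D(1,2)[OF P]]) auto
  then show ?thesis unfolding distr_cong_id[OF datum_D(2)[OF P] refl] using W1_nonneg[of P P] by simp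
qed

lemma weak_star_const: "weak_star_converges T (\<lambda>_. u) u"
  unfolding weak_star_converges_def by simp

lemma run_cost_tendsto:
  assumes u: "admissible u" and Ps: "\<And>n. datum (Ps n)" and P: "datum P" and W: "(\<lambda>n. W1 (Ps n) P) \<longlonglongrightarrow> 0"
    and Zs: "\<And>n. lag u (Ps n) (Zs n)" and Z: "lag u P Z"
  shows "(\<lambda>n. run_cost u (Ps n) (Zs n)) \<longlonglongrightarrow> run_cost u P Z"
  unfolding run_cost_def
  by (rule tendsto_add[OF running_cost_tendsto[OF u u weak_star_const Ps P W Zs Z] tendsto_const])

text \<open>\<open>run_cost_tendsto\<close> for constant sequences: the constant cost of Z tends to the cost of Z'.\<close>

lemma run_cost_unique:
  assumes u: "admissible u" and P: "datum P" and Z: "lag u P Z" "lag u P Z'"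
  shows "run_cost u P Z = run_cost u P Z'"
proof -
  have "(\<lambda>n. W1 P P) \<longlonglongrightarrow> 0" unfolding W1_self[OF P] by simp
  from run_cost_tendsto[OF u P P this Z] have "(\<lambda>n::nat. run_cost u P Z) \<longlonglongrightarrow> run_cost u P Z'" .
  from LIMSEQ_unique[OF tendsto_const this] show ?thesis .
qed

lemma representsD:
  assumes "represents S P" "v \<in> Linf T U" "S v Y \<mu>"
  obtains Z where "lag (reg v) P Z" "cost T L v Y \<mu> = run_cost (reg v) P Z"
proof -
  have P: "datum P" using assms(1) unfolding represents_def by simp
  obtain Z where Z: "lag (reg v) P Z \<and> (\<forall>t\<in>{0..T}. Y t = pos (reg v) t \<and> \<mu> t = distr P borel (Z t))"
    using assms(1)[unfolded represents_def, THEN conjunct2, THEN conjunct2, rule_format, OF assms(2,3)] by (rule exE)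
  then have "cost T L v Y \<mu> = run_cost (reg v) P Z" by (intro cost_eq_run_cost[OF assms(2) P]) auto
  with Z show ?thesis by (intro that) auto
qed

definition nearly_optimal where
  "nearly_optimal S \<epsilon> u \<longleftrightarrow> u \<in> Linf T U \<and>
     (\<forall>v\<in>Linf T U. \<forall>Y \<mu> Y' \<mu>'. S u Y \<mu> \<longrightarrow> S v Y' \<mu>' \<longrightarrow> cost T L u Y \<mu> \<le> cost T L v Y' \<mu>' + \<epsilon>)"

text \<open>The common core of the two parts of the main theorem. With \<open>Sn n = S\<close> and \<open>\<epsilon> n > 0\<close> it says that minimising sequences
have subsequences converging to an optimal control, with particle systems for Sn and \<open>\<epsilon> n = 0\<close> the same of the optimal controls of these. A competitor
v is kept fixed: its cost for \<open>Sn n\<close> tends to its cost for S, while the cost of \<open>us n\<close> is lower semicontinuous.\<close>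

theorem nearly_optimal_compactness:
  assumes Sn: "\<And>n. represents (Sn n) (Ps n)" and S: "represents S P"
    and W: "(\<lambda>n. W1 (Ps n) P) \<longlonglongrightarrow> 0" and \<epsilon>: "\<epsilon> \<longlonglongrightarrow> 0" and no: "\<And>n. nearly_optimal (Sn n) (\<epsilon> n) (us n)"
  shows "\<exists>r u. strict_mono r \<and> weak_star_converges T (\<lambda>n. us (r n)) u \<and> optimal_control T L U S u"
proof -
  have usL: "us n \<in> Linf T U" for n using no unfolding nearly_optimal_def by simp
  have ad: "admissible (reg (us n))" for n by (rule reg_admissible[OF usL])
  have regm: "time_measurable T (reg (us n))" "reg (us n) t \<in> U" for n t
    using ad[of n] unfolding admissible_def by auto
  obtain r u where r: "strict_mono (r :: nat \<Rightarrow> nat)" and u: "time_measurable T u" "\<And>t. u t \<in> U"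
    and w: "weak_star_converges T (\<lambda>n. reg (us (r n))) u"
    by (rule weak_star_sequentially_compact[OF T_pos regm U_compact U_convex], rule that)
  have uL: "u \<in> Linf T U" by (rule admissible_Linf) (simp add: admissible_def u)
  have w': "weak_star_converges T (\<lambda>n. reg (us (r n))) (reg u)" using w weak_star_reg[OF uL] by simp
  have P: "datum P" and Ps: "datum (Ps n)" for n using S Sn unfolding represents_def by auto
  have Wr: "(\<lambda>n. W1 (Ps (r n)) P) \<longlonglongrightarrow> 0" using LIMSEQ_subseq_LIMSEQ[OF W r] by (simp add: o_def)
  have \<epsilon>r: "(\<lambda>n. \<epsilon> (r n)) \<longlonglongrightarrow> 0" using LIMSEQ_subseq_LIMSEQ[OF \<epsilon> r] by (simp add: o_def)
  have ex: "\<exists>Z. lag (reg v) (Ps n) Z \<and> (\<exists>Y \<mu>. Sn n v Y \<mu> \<and> cost T L v Y \<mu> = run_cost (reg v) (Ps n) Z)"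
    if v: "v \<in> Linf T U" for v n
  proof -
    have "\<exists>Y \<mu>. Sn n v Y \<mu>" using Sn[of n] v unfolding represents_def by simp
    then obtain Y \<mu> where Y: "Sn n v Y \<mu>" by (elim exE)
    obtain Z where "lag (reg v) (Ps n) Z" "cost T L v Y \<mu> = run_cost (reg v) (Ps n) Z"
      by (rule representsD[OF Sn v Y], rule that)
    then show ?thesis using Y by (intro exI conjI)
  qed
  have le: "cost T L u Y \<mu> \<le> cost T L v Y' \<mu>'" if v: "v \<in> Linf T U" and SY: "S u Y \<mu>" and SY': "S v Y' \<mu>'" for v Y \<mu> Y' \<mu>'
  proof -
    obtain Z where Z: "lag (reg u) P Z" "cost T L u Y \<mu> = run_cost (reg u) P Z" by (rule representsD[OF S uL SY], rule that)
    obtain Z' where Z': "lag (reg v) P Z'" "cost T L v Y' \<mu>' = run_cost (reg v) P Z'" by (rule representsD[OF S v SY'], rule that)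
    (* Flows for the near-optimal control and for the competitor, in the n-th system. *)
    define Q where "Q n p \<longleftrightarrow> lag (reg (us (r n))) (Ps (r n)) (fst p) \<and> lag (reg v) (Ps (r n)) (snd p) \<and>
       run_cost (reg (us (r n))) (Ps (r n)) (fst p) \<le> run_cost (reg v) (Ps (r n)) (snd p) + \<epsilon> (r n)" for n p
    have "\<forall>n. \<exists>p. Q n p"
    proof
      fix n
      obtain Z1 Y1 \<mu>1 where 1: "lag (reg (us (r n))) (Ps (r n)) Z1" "Sn (r n) (us (r n)) Y1 \<mu>1" "cost T L (us (r n)) Y1 \<mu>1 = run_cost (reg (us (r n))) (Ps (r n)) Z1"
        using ex[OF usL, of "r n" "r n"] by (elim exE conjE)
      obtain Z2 Y2 \<mu>2 where 2: "lag (reg v) (Ps (r n)) Z2" "Sn (r n) v Y2 \<mu>2" "cost T L v Y2 \<mu>2 = run_cost (reg v) (Ps (r n)) Z2"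
        using ex[OF v, of "r n"] by (elim exE conjE)
      have "cost T L (us (r n)) Y1 \<mu>1 \<le> cost T L v Y2 \<mu>2 + \<epsilon> (r n)"
        using no[of "r n", unfolded nearly_optimal_def, THEN conjunct2, rule_format, OF v 1(2) 2(2)] .
      then show "\<exists>p. Q n p"
        unfolding Q_def using 1 2 by (intro exI[of _ "(Z1, Z2)"]) simp
    qed
    from choice[OF this] obtain p where p: "\<forall>n. Q n (p n)" by (rule exE)
    have p1: "lag (reg (us (r n))) (Ps (r n)) (fst (p n))" and p2: "lag (reg v) (Ps (r n)) (snd (p n))"
      and p3: "run_cost (reg (us (r n))) (Ps (r n)) (fst (p n)) \<le> run_cost (reg v) (Ps (r n)) (snd (p n)) + \<epsilon> (r n)" for n
      using p unfolding Q_def by auto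
    note J = running_cost_tendsto[OF ad reg_admissible[OF uL] w' Ps P Wr p1 Z(1)]
    note K = tendsto_add[OF run_cost_tendsto[OF reg_admissible[OF v] Ps P Wr p2 Z'(1)] \<epsilon>r]
    show ?thesis
    proof (rule field_le_epsilon)
      fix e :: real assume e: "e > 0"
      have um: "time_measurable T (reg u)" "norm (reg u t) \<le> M" for t
        using reg_admissible[OF uL] U_bound unfolding admissible_def by auto
      have nb: "norm (reg (us n) t) \<le> M" for n t by (rule U_bound[OF regm(2)])
      have "integral {0..T} (\<lambda>t. L (pos (reg u) t) (distr P borel (Z t))) + (integral {0..T} (\<lambda>t. reg u t \<bullet> reg u t) - e) \<le> run_cost (reg v) P Z' + 0"
      proof (rule tendsto_le[OF sequentially_bot K tendsto_add[OF J tendsto_const]])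
        show "\<forall>\<^sub>F n in sequentially. integral {0..T} (\<lambda>t. L (pos (reg (us (r n))) t) (distr (Ps (r n)) borel (fst (p n) t))) +
           (integral {0..T} (\<lambda>t. reg u t \<bullet> reg u t) - e) \<le> run_cost (reg v) (Ps (r n)) (snd (p n)) + \<epsilon> (r n)"
          using weak_star_energy[OF w' regm(1) nb um e]
        proof (rule eventually_mono)
          fix n assume "integral {0..T} (\<lambda>t. reg u t \<bullet> reg u t) - e < integral {0..T} (\<lambda>t. reg (us (r n)) t \<bullet> reg (us (r n)) t)"
          then show "integral {0..T} (\<lambda>t. L (pos (reg (us (r n))) t) (distr (Ps (r n)) borel (fst (p n) t))) +
           (integral {0..T} (\<lambda>t. reg u t \<bullet> reg u t) - e) \<le> run_cost (reg v) (Ps (r n)) (snd (p n)) + \<epsilon> (r n)"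
            using p3[of n] unfolding run_cost_def[of "reg (us (r n))"] by linarith
        qed
      qed
      then show "cost T L u Y \<mu> \<le> cost T L v Y' \<mu>' + e" unfolding Z(2) Z'(2) run_cost_def[of "reg u"] by linarith
    qed
  qed
  have "optimal_control T L U S u" unfolding optimal_control_def
  proof (intro conjI ballI allI impI)
    show "u \<in> Linf T U" by (rule uL)
    show "\<exists>Y \<mu>. S v Y \<mu>" if "v \<in> Linf T U" for v using S that unfolding represents_def by simp
    show "cost T L u Y \<mu> \<le> cost T L v Y' \<mu>'" if "v \<in> Linf T U" "S u Y \<mu>" "S v Y' \<mu>'" for v Y \<mu> Y' \<mu>' by (rule le[OF that])
  qed
  moreover have "weak_star_converges T (\<lambda>n. us (r n)) u" using w reg_weak_star[where v="\<lambda>n. us (r n)" and u=u] usL by simp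
  ultimately show ?thesis using r by (intro exI[of _ r] exI[of _ u] conjI)
qed

text \<open>The cost does not depend on the trajectory by \<open>run_cost_unique\<close>, so a control is \<open>\<epsilon>\<close>-optimal as soon as one of its trajectories
has cost within \<open>\<epsilon>\<close> of the infimum.\<close>

theorem optimal_control_exists:
  assumes S: "represents S P"
  shows "\<exists>u. optimal_control T L U S u"
proof -
  have P: "datum P" using S unfolding represents_def by simp
  define C where "C = {c. \<exists>v\<in>Linf T U. \<exists>Y \<mu>. S v Y \<mu> \<and> c = cost T L v Y \<mu>}"
  have "(\<lambda>t. SOME w. w \<in> U) \<in> Linf T U" by (rule admissible_Linf) (simp add: admissible_def some_U)
  then have "\<exists>Y \<mu>. S (\<lambda>t. SOME w. w \<in> U) Y \<mu>" using S unfolding represents_def by simp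
  then have ne: "C \<noteq> {}" unfolding C_def using \<open>(\<lambda>t. SOME w. w \<in> U) \<in> Linf T U\<close> by (elim exE) auto
  have nn: "0 \<le> c" if cC: "c \<in> C" for c
  proof -
    obtain v Y \<mu> where v: "v \<in> Linf T U" "S v Y \<mu>" "c = cost T L v Y \<mu>" using cC unfolding C_def by auto
    obtain Z where "lag (reg v) P Z" "cost T L v Y \<mu> = run_cost (reg v) P Z" by (rule representsD[OF S v(1,2)], rule that)
    then show ?thesis unfolding v(3) using run_cost_nonneg[OF reg_admissible[OF v(1)] P] by simp
  qed
  then have bdd: "bdd_below C" by (intro bdd_belowI)
  have "\<forall>n. \<exists>u. nearly_optimal S (1 / real (Suc n)) u"
  proof
    fix n
    have "Inf C < Inf C + 1 / real (Suc n)" by simp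
    then obtain c where c: "c \<in> C" "c < Inf C + 1 / real (Suc n)" unfolding cInf_less_iff[OF ne bdd] by (elim bexE)
    obtain u Y \<mu> where u: "u \<in> Linf T U" "S u Y \<mu>" "c = cost T L u Y \<mu>" using c(1) unfolding C_def by auto
    have "nearly_optimal S (1 / real (Suc n)) u"
      unfolding nearly_optimal_def
    proof (intro conjI ballI allI impI u(1))
      fix v Y1 \<mu>1 Y2 \<mu>2 assume v: "v \<in> Linf T U" and 1: "S u Y1 \<mu>1" and 2: "S v Y2 \<mu>2"
      obtain Z where Z: "lag (reg u) P Z" "cost T L u Y \<mu> = run_cost (reg u) P Z" by (rule representsD[OF S u(1,2)], rule that)
      obtain Z1 where Z1: "lag (reg u) P Z1" "cost T L u Y1 \<mu>1 = run_cost (reg u) P Z1" by (rule representsD[OF S u(1) 1], rule that)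
      have "cost T L u Y1 \<mu>1 = c" unfolding u(3) Z(2) Z1(2) by (rule run_cost_unique[OF reg_admissible[OF u(1)] P Z1(1) Z(1)])
      moreover have "Inf C \<le> cost T L v Y2 \<mu>2" by (rule cInf_lower[OF _ bdd]) (use v 2 in \<open>auto simp: C_def\<close>)
      ultimately show "cost T L u Y1 \<mu>1 \<le> cost T L v Y2 \<mu>2 + 1 / real (Suc n)" using c(2) by linarith
    qed
    then show "\<exists>u. nearly_optimal S (1 / real (Suc n)) u" by (intro exI)
  qed
  from choice[OF this] obtain us where us: "\<forall>n. nearly_optimal S (1 / real (Suc n)) (us n)" by (rule exE)
  have "(\<lambda>n::nat. W1 P P) \<longlonglongrightarrow> 0" unfolding W1_self[OF P] by simp
  moreover have "(\<lambda>n. 1 / real (Suc n)) \<longlonglongrightarrow> 0" using LIMSEQ_inverse_real_of_nat by (simp add: inverse_eq_divide)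
  ultimately have "\<exists>r u. strict_mono r \<and> weak_star_converges T (\<lambda>n. us (r n)) u \<and> optimal_control T L U S u"
    by (rule nearly_optimal_compactness[where Sn="\<lambda>_. S" and Ps="\<lambda>_. P", OF S S]) (use us in simp)
  then show ?thesis by (elim exE conjE) (intro exI)
qed

lemma optimal_nearly_optimal: "optimal_control T L U S u \<Longrightarrow> nearly_optimal S 0 u"
  unfolding optimal_control_def nearly_optimal_def by simp

end

section \<open>Locally Lipschitz kernels\<close>

text \<open>Composition with the projection to a ball makes a locally Lipschitz field globally Lipschitz, keeps its bounds, and does not
change it in the ball.\<close>

definition cut :: "real \<Rightarrow> (real^'d \<Rightarrow> real^'d) \<Rightarrow> real^'d \<Rightarrow> real^'d" where
  "cut R F x = F (closest_point (cball 0 R) x)"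

lemma cut_eq: "norm x \<le> R \<Longrightarrow> cut R F x = F x"
  unfolding cut_def by (simp add: closest_point_self)

lemma locally_lipschitz_continuous: 
  assumes "locally_lipschitz F" shows "continuous_on UNIV F"
proof (rule continuous_at_imp_continuous_on, rule ballI)
  fix x
  obtain e C where e: "e > 0" "C-lipschitz_on (cball x e) F" using assms unfolding locally_lipschitz_def by (elim allE[of _ x] exE conjE)
  have "continuous_on (ball x e) F"
    by (rule continuous_on_subset[OF lipschitz_on_continuous_on[OF e(2)]]) simp
  then show "isCont F x" using e(1) by (simp add: continuous_on_eq_continuous_at)
qed

lemma locally_lipschitz_compact:
  fixes F :: "'a::metric_space \<Rightarrow> 'b::metric_space"
  assumes F: "locally_lipschitz F" and K: "compact K"
  obtains C where "C-lipschitz_on K F"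
proof -
  have ll: "local_lipschitz {0::real} K (\<lambda>_. F)"
    unfolding local_lipschitz_def
  proof (intro ballI)
    fix x t
    obtain e C where e: "e > 0" "C-lipschitz_on (cball x e) F" using F unfolding locally_lipschitz_def by (elim allE[of _ x] exE conjE)
    have "C-lipschitz_on (cball x e \<inter> K) F" by (rule lipschitz_on_subset[OF e(2)]) simp
    then show "\<exists>u>0. \<exists>L. \<forall>t\<in>cball t u \<inter> {0::real}. L-lipschitz_on (cball x u \<inter> K) F" using e(1) by (intro exI[of _ e] conjI exI[of _ C]) simp_all
  qed
  show ?thesis
    by (rule local_lipschitz_compact_implies_lipschitz[OF ll K compact_sing continuous_on_const], rule that) simp
qed

lemma cut_lipschitz:
  assumes F: "locally_lipschitz F" and R: "0 \<le> R"
  shows "\<exists>C\<ge>0. \<forall>x y. norm (cut R F x - cut R F y) \<le> C * norm (x - y)"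
proof -
  obtain C where C: "C-lipschitz_on (cball 0 R) F" by (rule locally_lipschitz_compact[OF F compact_cball], rule that)
  have "norm (cut R F x - cut R F y) \<le> C * norm (x - y)" for x y
  proof -
    have ne: "cball (0::real^'a) R \<noteq> {}" using R by simp
    note cl = closest_point_in_set[OF closed_cball ne]
    have "norm (cut R F x - cut R F y) \<le> C * dist (closest_point (cball 0 R) x) (closest_point (cball 0 R) y)"
      unfolding cut_def using lipschitz_onD[OF C cl cl, of x y] by (simp add: dist_norm)
    also have "\<dots> \<le> C * dist x y"
      by (rule mult_left_mono[OF closest_point_lipschitz[OF convex_cball closed_cball ne] lipschitz_on_nonneg[OF C]])
    finally show ?thesis by (simp add: dist_norm)
  qed
  then show ?thesis using lipschitz_on_nonneg[OF C] by blast
qed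

lemma cut_interaction:
  fixes G :: "'d \<Rightarrow> real^'d \<Rightarrow> real^'d"
  assumes HG: "locally_lipschitz H" "\<And>l. locally_lipschitz (G l)"
    and bd: "\<And>x. norm (H x) \<le> B" "\<And>l x. norm (G l x) \<le> B" and R: "0 \<le> R"
  shows "\<exists>Lp. interaction (cut R H) (\<lambda>l. cut R (G l)) B Lp"
proof -
  obtain C where C: "C \<ge> 0" "\<And>x y. norm (cut R H x - cut R H y) \<le> C * norm (x - y)" using cut_lipschitz[OF HG(1) R] by (elim exE conjE) simp
  have "\<forall>l. \<exists>c. c \<ge> 0 \<and> (\<forall>x y. norm (cut R (G l) x - cut R (G l) y) \<le> c * norm (x - y))" using cut_lipschitz[OF HG(2) R] by simp
  from choice[OF this] obtain c where c0: "\<forall>l. c l \<ge> 0 \<and> (\<forall>x y. norm (cut R (G l) x - cut R (G l) y) \<le> c l * norm (x - y))" by (rule exE)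
  then have c: "0 \<le> c l" "norm (cut R (G l) x - cut R (G l) y) \<le> c l * norm (x - y)" for l x y by auto
  have s: "0 \<le> sum c UNIV" by (rule sum_nonneg) (rule c(1))
  have cs: "c l \<le> sum c UNIV" for l by (rule member_le_sum) (auto simp: c(1))
  have "interaction (cut R H) (\<lambda>l. cut R (G l)) B (C + sum c UNIV)"
  proof
    show "norm (cut R H x) \<le> B" for x unfolding cut_def by (rule bd)
    show "norm (cut R (G l) x) \<le> B" for l x unfolding cut_def by (rule bd)
    show "norm (cut R H x - cut R H y) \<le> (C + sum c UNIV) * norm (x - y)" for x y
      by (rule order_trans[OF C(2) mult_right_mono]) (use s in auto)
    show "norm (cut R (G l) x - cut R (G l) y) \<le> (C + sum c UNIV) * norm (x - y)" for l x y
    proof (rule order_trans[OF c(2) mult_right_mono])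
      show "c l \<le> C + sum c UNIV" using cs[of l] C(1) by linarith
    qed simp
  qed
  then show ?thesis by (rule exI)
qed

lemma velocity_cut:
  fixes G :: "'d \<Rightarrow> real^'d \<Rightarrow> real^'d" and Y :: "(real^'d)^'m" and \<nu> :: "(real^'d) measure"
  assumes H: "continuous_on UNIV H" and \<nu>: "sets \<nu> = sets borel" "AE \<xi> in \<nu>. norm \<xi> \<le> a" and x: "norm x \<le> a" and Y: "norm Y \<le> b"
    and R: "2 * a + b \<le> R"
  shows "velocity (cut R H) (\<lambda>l. cut R (G l)) w Y \<nu> x = velocity H G w Y \<nu> x"
proof -
  have b: "0 \<le> b" using norm_ge_zero[of Y] Y by linarith
  have a: "0 \<le> a" using norm_ge_zero[of x] x by linarith
  have ne: "cball (0::real^'d) R \<noteq> {}" using a b R by simp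
  have 1: "continuous_on UNIV (\<lambda>y. cut R H (x - y))" unfolding cut_def
    by (intro continuous_on_compose2[OF H] continuous_on_compose2[OF continuous_on_closest_point[OF convex_cball closed_cball ne]] continuous_intros) auto
  have 2: "continuous_on UNIV (\<lambda>y. H (x - y))" by (intro continuous_on_compose2[OF H] continuous_intros) auto
  have "conv (cut R H) \<nu> x = conv H \<nu> x" unfolding conv_def
  proof (rule integral_cong_AE)
    show "(\<lambda>y. cut R H (x - y)) \<in> borel_measurable \<nu>" "(\<lambda>y. H (x - y)) \<in> borel_measurable \<nu>"
      using borel_measurable_continuous_onI[OF 1] borel_measurable_continuous_onI[OF 2] by (simp_all add: measurable_cong_sets[OF \<nu>(1) refl])
    show "AE y in \<nu>. cut R H (x - y) = H (x - y)" using \<nu>(2)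
    proof eventually_elim
      fix y :: "real^'d" assume "norm y \<le> a" then show "cut R H (x - y) = H (x - y)"
        using norm_triangle_ineq4[of x y] x R b by (intro cut_eq) linarith
    qed
  qed
  moreover have "cut R (G l) (x - Y $ k) = G l (x - Y $ k)" for l k
    using norm_triangle_ineq4[of x "Y $ k"] Finite_Cartesian_Product.norm_nth_le[of Y k] x Y R a by (intro cut_eq) linarith
  ultimately show ?thesis unfolding velocity_def conv_atomic_def by simp
qed

lemma velocity_measurable:
  fixes G :: "'d \<Rightarrow> real^'d \<Rightarrow> real^'d" and Y :: "(real^'d)^'m" and \<nu> :: "(real^'d) measure"
  assumes HG: "continuous_on UNIV H" "\<And>l. continuous_on UNIV (G l)" and \<nu>: "prob_space \<nu>" "sets \<nu> = sets borel"
  shows "velocity H G w Y \<nu> \<in> borel_measurable borel"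
proof -
  interpret prob_space \<nu> by (rule \<nu>(1))
  have [measurable]: "H \<in> borel_measurable borel" by (rule borel_measurable_continuous_onI[OF HG(1)])
  have [measurable]: "G l \<in> borel_measurable borel" for l by (rule borel_measurable_continuous_onI[OF HG(2)])
  have [measurable_cong]: "sets \<nu> = sets borel" by (rule \<nu>(2))
  have "(\<lambda>x. \<integral>\<xi>. H (x - \<xi>) \<partial>\<nu>) \<in> borel_measurable borel" by (rule borel_measurable_lebesgue_integral) measurable
  moreover have "(\<lambda>x. (1 / real CARD('m)) *\<^sub>R (\<Sum>k\<in>UNIV. ((\<chi> k. w $ k $ l) $ k) *\<^sub>R G l (x - Y $ k))) \<in> borel_measurable borel" for l by measurable
  ultimately show ?thesis unfolding velocity_def[abs_def] conv_def conv_atomic_def by (intro borel_measurable_add borel_measurable_sum)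
qed

lemma caratheodory_spike:
  assumes c: "caratheodory T F z0 z" and N: "negligible N" and eq: "\<And>t. t \<in> {0..T} \<Longrightarrow> t \<notin> N \<Longrightarrow> F' t (z t) = F t (z t)"
  shows "caratheodory T F' z0 z"
  unfolding caratheodory_def
proof
  have i: "(\<lambda>s. F s (z s)) integrable_on {0..T}" "(\<lambda>s. norm (F s (z s))) integrable_on {0..T}"
    using c unfolding caratheodory_def absolutely_integrable_on_def by auto
  have "(\<lambda>s. F' s (z s)) integrable_on {0..T}" by (rule integrable_spike[OF i(1) N]) (use eq in auto)
  moreover have "(\<lambda>s. norm (F' s (z s))) integrable_on {0..T}" by (rule integrable_spike[OF i(2) N]) (use eq in auto)
  ultimately show "(\<lambda>s. F' s (z s)) absolutely_integrable_on {0..T}" unfolding absolutely_integrable_on_def by simp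
  show "\<forall>t\<in>{0..T}. z t = z0 + integral {0..t} (\<lambda>s. F' s (z s))"
  proof
    fix t assume t: "t \<in> {0..T}"
    have e: "integral {0..t} (\<lambda>s. F s (z s)) = integral {0..t} (\<lambda>s. F' s (z s))" by (rule integral_spike[OF N]) (use eq t in auto)
    have "z t = z0 + integral {0..t} (\<lambda>s. F s (z s))" using c t unfolding caratheodory_def by simp
    then show "z t = z0 + integral {0..t} (\<lambda>s. F' s (z s))" unfolding e .
  qed
qed

lemma caratheodory_continuous:
  assumes "caratheodory T F z0 z" shows "continuous_on {0..T} z"
proof -
  have "(\<lambda>s. F s (z s)) integrable_on {0..T}" and e: "\<forall>t\<in>{0..T}. z t = z0 + integral {0..t} (\<lambda>s. F s (z s))"
    using assms unfolding caratheodory_def absolutely_integrable_on_def by auto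
  then have "continuous_on {0..T} (\<lambda>t. z0 + integral {0..t} (\<lambda>s. F s (z s)))"
    by (intro continuous_intros indefinite_integral_continuous_1)
  then show ?thesis by (rule continuous_on_eq) (use e in simp)
qed

text \<open>The radius Rc bounds every difference of positions that the kernels are evaluated at: by the bound B on the
kernels, the mass stays within distance R1 of the origin and the agents within RY, whatever the Lipschitz constants are.\<close>

locale localized_problem = control_problem "cut Rc H" "\<lambda>l. cut Rc (G l)" B Lp T M R0 U Y0 L
  for H :: "real^'d \<Rightarrow> real^'d" and G :: "'d \<Rightarrow> real^'d \<Rightarrow> real^'d" and Rc B Lp T M R0 :: real
    and U :: "((real^'d)^'m) set" and Y0 :: "(real^'d)^'m" and L :: "(real^'d)^'m \<Rightarrow> (real^'d) measure \<Rightarrow> real" +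
  assumes H_ll: "locally_lipschitz H" and G_ll: "\<And>l. locally_lipschitz (G l)"
    and H_bd: "\<And>x. norm (H x) \<le> B" and G_bd: "\<And>l x. norm (G l x) \<le> B"
    and Rc: "2 * (R0 + (B + real CARD('d) * M * B) * T) + (norm Y0 + M * T) \<le> Rc"
begin

abbreviation cut_velocity :: "real \<Rightarrow> (real^'d)^'m \<Rightarrow> (real^'d)^'m \<Rightarrow> (real^'d) measure \<Rightarrow> real^'d \<Rightarrow> real^'d" where
  "cut_velocity R \<equiv> velocity (cut R H) (\<lambda>l. cut R (G l))"

definition R1 :: real where "R1 = R0 + (B + real CARD('d) * M * B) * T"
definition RY :: real where "RY = norm Y0 + M * T"

lemma R1_RY: "2 * R1 + RY \<le> Rc" using Rc unfolding R1_def RY_def .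

lemma H_cont: "continuous_on UNIV H" and G_cont: "continuous_on UNIV (G l)"
  by (rule locally_lipschitz_continuous, rule H_ll G_ll)+

lemma M_nn: "0 \<le> M" using U_bound[OF some_U] norm_ge_zero order_trans by blast
lemma R1_nn: "0 \<le> R1" unfolding R1_def
proof (intro add_nonneg_nonneg R0_nonneg mult_nonneg_nonneg)
  show "0 \<le> T" using T_pos by simp
qed (use M_nn B_nonneg in auto)

lemma pos_bound:
  assumes "admissible u" "t \<in> {0..T}" shows "norm (pos u t) \<le> RY"
proof -
  interpret c: controlled "cut Rc H" "\<lambda>l. cut Rc (G l)" B Lp T M u "pos u" Y0 using assms(1) by (rule admissible_controlled)
  have "norm (pos u t - pos u 0) \<le> M * \<bar>t - 0\<bar>" by (rule c.Y_lip) (use assms(2) in auto)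
  also have "\<dots> \<le> M * T" using assms(2) M_nn by (intro mult_left_mono) auto
  finally have "norm (pos u t - Y0) \<le> M * T" by (simp add: pos_def)
  then show ?thesis unfolding RY_def using norm_triangle_sub[of "pos u t" Y0] by linarith
qed

lemma larger_controlled:
  assumes "interaction (cut R H) (\<lambda>l. cut R (G l)) B Lp'" "admissible u"
  shows "controlled (cut R H) (\<lambda>l. cut R (G l)) B Lp' T M u (pos u) Y0"
  by (rule controlled.intro[OF assms(1) controlled.axioms(2)[OF admissible_controlled[OF assms(2)]]])

text \<open>The a priori bound R1 is the same for all radii R, and within it the kernels cut at R and at Rc give the same
velocity. This brings a solution of unknown size, for which a large R has to be taken at first, back to the fixed
radius Rc.\<close>

lemma lagrangian_of_flow:
  assumes u: "admissible u" and P: "datum P" and c': "controlled (cut R H) (\<lambda>l. cut R (G l)) B Lp' T M u (pos u) Y0" and R: "Rc \<le> R"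
    and \<nu>: "controlled.good_curve (cut R H) T \<nu>" and \<Phi>c: "jointly_continuous \<Phi>"
    and \<Phi>: "\<And>x. controlled.flow_line (cut R H) (\<lambda>l. cut R (G l)) T u (pos u) \<nu> x (\<lambda>t. \<Phi> t x)"
    and eq: "\<And>t. t \<in> {0..T} \<Longrightarrow> \<nu> t = distr P borel (\<Phi> t)"
  shows "lag u P \<Phi>"
proof -
  interpret c: controlled "cut Rc H" "\<lambda>l. cut Rc (G l)" B Lp T M u "pos u" Y0 using u by (rule admissible_controlled)
  interpret c': controlled "cut R H" "\<lambda>l. cut R (G l)" B Lp' T M u "pos u" Y0 by (rule c')
  note D = datum_D[OF P]
  have \<Phi>x: "continuous_on UNIV (\<Phi> t)" for t
    using continuous_on_compose2[OF \<Phi>c, of UNIV "\<lambda>x. (t, x)"] by (simp add: continuous_on_Pair continuous_on_const continuous_on_id)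
  have \<Phi>t: "continuous_on {0..T} (\<lambda>t. \<Phi> t x)" for x using \<Phi>[of x] unfolding c'.flow_line_def by simp
  have \<Phi>m: "\<Phi> t \<in> borel_measurable borel" for t by (rule borel_measurable_continuous_onI[OF \<Phi>x])
  have nb: "norm (\<Phi> t x) \<le> R1" if "t \<in> {0..T}" "x \<in> cball 0 R0" for t x
  proof -
    have "norm (\<Phi> t x) \<le> norm x + c'.Cv * T" by (rule c'.flow_line_norm[OF \<nu> \<Phi> that(1)])
    also have "c'.Cv * T = (B + real CARD('d) * M * B) * T" unfolding c'.vel_bd_def dim_real_def ..
    finally show ?thesis using that(2) unfolding R1_def by simp
  qed
  have ms: "{x. norm x \<le> R1} \<in> sets borel" by measurable
  have ae: "AE \<xi> in \<nu> t. norm \<xi> \<le> R1" if t: "t \<in> {0..T}" for t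
    unfolding eq[OF t] 
  proof (subst AE_distr_iff)
    show "\<Phi> t \<in> measurable P borel" using \<Phi>m by (simp add: measurable_cong_sets[OF D(2) refl])
    show "AE x in P. norm (\<Phi> t x) \<le> R1" using D(3) by eventually_elim (rule nb[OF t])
  qed (use ms in simp)
  have sb: "sets (\<nu> t) = sets borel" if "t \<in> {0..T}" for t using eq[OF that] by simp
  have gc: "c.good_curve (\<lambda>t. distr P borel (\<Phi> t))" by (rule c.good_curve_distr[OF D(1,2) \<Phi>m]) (use \<Phi>t in simp)
  have "c.flow_line (\<lambda>t. distr P borel (\<Phi> t)) x (\<lambda>t. \<Phi> t x)" if x: "x \<in> cball 0 R0" for x
    unfolding c.flow_line_def
  proof (intro conjI ballI \<Phi>t)
    fix t assume t: "t \<in> {0..T}"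
    have "\<Phi> t x = x + integral {0..t} (\<lambda>s. cut_velocity R (u s) (pos u s) (\<nu> s) (\<Phi> s x))"
      using \<Phi>[of x] t unfolding c'.flow_line_def by simp
    also have "integral {0..t} (\<lambda>s. cut_velocity R (u s) (pos u s) (\<nu> s) (\<Phi> s x)) = 
       integral {0..t} (\<lambda>s. cut_velocity Rc (u s) (pos u s) (distr P borel (\<Phi> s)) (\<Phi> s x))"
    proof (rule Henstock_Kurzweil_Integration.integral_cong)
      fix s assume "s \<in> {0..t}"
      then have s: "s \<in> {0..T}" using t by auto
      have R2: "2 * R1 + RY \<le> R" using R1_RY R by linarith
      show "cut_velocity R (u s) (pos u s) (\<nu> s) (\<Phi> s x) = cut_velocity Rc (u s) (pos u s) (distr P borel (\<Phi> s)) (\<Phi> s x)"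
        unfolding eq[OF s, symmetric] velocity_cut[OF H_cont sb[OF s] ae[OF s] nb[OF s x] pos_bound[OF u s] R2]
          velocity_cut[OF H_cont sb[OF s] ae[OF s] nb[OF s x] pos_bound[OF u s] R1_RY] ..
    qed
    finally show "\<Phi> t x = x + integral {0..t} (\<lambda>s. cut_velocity Rc (u s) (pos u s) (distr P borel (\<Phi> s)) (\<Phi> s x))" .
  qed
  then show ?thesis unfolding c.lagrangian_def using gc \<Phi>m by simp
qed

end

lemma cut_continuous:
  assumes F: "continuous_on UNIV F" and R: "0 \<le> R" shows "continuous_on UNIV (cut R F)"
proof -
  have ne: "cball (0::real^'a) R \<noteq> {}" using R by simp
  show ?thesis unfolding cut_def[abs_def]
    by (rule continuous_on_compose2[OF F continuous_on_closest_point[OF convex_cball closed_cball ne]]) simp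
qed

lemma weak_form_transfer:
  fixes G1 G2 :: "'d \<Rightarrow> real^'d \<Rightarrow> real^'d" and u1 u2 Y1 Y2 :: "real \<Rightarrow> (real^'d)^'m" and \<mu> :: "real \<Rightarrow> (real^'d) measure"
  assumes c: "caratheodory T (\<lambda>t _. \<integral>x. g x \<bullet> velocity H1 G1 (u1 t) (Y1 t) (\<mu> t) x \<partial>\<mu> t) a f"
    and N: "negligible N" and u: "\<And>t. t \<in> {0..T} \<Longrightarrow> t \<notin> N \<Longrightarrow> u2 t = u1 t"
    and g: "continuous_on UNIV g"
    and 1: "continuous_on UNIV H1" "\<And>l. continuous_on UNIV (G1 l)" and 2: "continuous_on UNIV H2" "\<And>l. continuous_on UNIV (G2 l)"
    and \<mu>: "\<And>t. t \<in> {0..T} \<Longrightarrow> prob_space (\<mu> t)" "\<And>t. t \<in> {0..T} \<Longrightarrow> sets (\<mu> t) = sets borel"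
    and ae: "\<And>t w. t \<in> {0..T} \<Longrightarrow> AE x in \<mu> t. velocity H2 G2 w (Y2 t) (\<mu> t) x = velocity H1 G1 w (Y1 t) (\<mu> t) x"
  shows "caratheodory T (\<lambda>t _. \<integral>x. g x \<bullet> velocity H2 G2 (u2 t) (Y2 t) (\<mu> t) x \<partial>\<mu> t) a f"
proof (rule caratheodory_spike[OF c N])
  fix t assume t: "t \<in> {0..T}" "t \<notin> N"
  have gm: "g \<in> borel_measurable borel" by (rule borel_measurable_continuous_onI[OF g])
  note m = velocity_measurable[OF 1 \<mu>(1,2)[OF t(1)], where w="u1 t" and Y="Y1 t"] velocity_measurable[OF 2 \<mu>(1,2)[OF t(1)], where w="u1 t" and Y="Y2 t"]
  show "(\<integral>x. g x \<bullet> velocity H2 G2 (u2 t) (Y2 t) (\<mu> t) x \<partial>\<mu> t) = (\<integral>x. g x \<bullet> velocity H1 G1 (u1 t) (Y1 t) (\<mu> t) x \<partial>\<mu> t)"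
    unfolding u[OF t]
  proof (rule integral_cong_AE)
    show "(\<lambda>x. g x \<bullet> velocity H2 G2 (u1 t) (Y2 t) (\<mu> t) x) \<in> borel_measurable (\<mu> t)" 
      "(\<lambda>x. g x \<bullet> velocity H1 G1 (u1 t) (Y1 t) (\<mu> t) x) \<in> borel_measurable (\<mu> t)"
      unfolding measurable_cong_sets[OF \<mu>(2)[OF t(1)] refl] by (intro borel_measurable_inner gm m)+
    show "AE x in \<mu> t. g x \<bullet> velocity H2 G2 (u1 t) (Y2 t) (\<mu> t) x = g x \<bullet> velocity H1 G1 (u1 t) (Y1 t) (\<mu> t) x"
      using ae[OF t(1), of "u1 t"] by eventually_elim simp
  qed
qed

section \<open>Both systems are Lagrangian\<close>

lemma empirical_sets: "sets (empirical N x) = sets borel" unfolding empirical_def by simp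

lemma uniform_count_borel: "x \<in> measurable (uniform_count_measure A) borel"
  by (simp add: measurable_def space_uniform_count_measure sets_uniform_count_measure)

lemma empirical_prob: "N \<ge> 1 \<Longrightarrow> prob_space (empirical N x)" 
  unfolding empirical_def
  by (rule prob_space.prob_space_distr[OF prob_space_uniform_count_measure uniform_count_borel]) auto

lemma AE_empirical:
  assumes "{\<xi>. Q \<xi>} \<in> sets borel"
  shows "(AE \<xi> in empirical N x. Q \<xi>) \<longleftrightarrow> (\<forall>i\<in>{1..N}. Q (x i))"
proof -
  have "(AE \<xi> in empirical N x. Q \<xi>) \<longleftrightarrow> (AE i in uniform_count_measure {1..N}. Q (x i))"
    unfolding empirical_def by (rule AE_distr_iff[OF uniform_count_borel]) (use assms in simp)
  also have "\<dots> \<longleftrightarrow> (\<forall>i\<in>{1..N}. Q (x i))"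
    unfolding uniform_count_measure_def AE_point_measure by (simp add: zero_less_divide_iff)
  finally show ?thesis .
qed

text \<open>Particles moving along a common flow have the image of their initial empirical measure as empirical measure; in this
sense the particle system is the mean-field system with another initial measure.\<close>

lemma empirical_map:
  assumes "f \<in> borel_measurable borel"
  shows "empirical N (\<lambda>i. f (x i)) = distr (empirical N x) borel f"
  unfolding empirical_def by (subst distr_distr[OF assms uniform_count_borel]) (simp add: o_def)

lemma empirical_cong: "(\<And>i. i \<in> {1..N} \<Longrightarrow> x i = y i) \<Longrightarrow> empirical N x = empirical N y"
  unfolding empirical_def by (rule distr_cong) (auto simp: space_uniform_count_measure)

lemma conv_empirical:
  assumes "continuous_on UNIV F"
  shows "conv F (empirical N x) y = (\<Sum>i\<in>{1..N}. (1 / real N) *\<^sub>R F (y - x i))"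
proof -
  have "continuous_on UNIV (\<lambda>\<xi>. F (y - \<xi>))" by (intro continuous_on_compose2[OF assms] continuous_intros) auto
  then have "(\<lambda>\<xi>. F (y - \<xi>)) \<in> borel_measurable borel" by (rule borel_measurable_continuous_onI)
  then show ?thesis unfolding conv_def empirical_def
    by (subst integral_distr[OF uniform_count_borel]) (simp_all add: uniform_count_measure_def lebesgue_integral_point_measure_finite)
qed

context localized_problem begin

lemma Rc_nn: "0 \<le> Rc" and RY_nn: "0 \<le> RY"
proof -
  show RY: "0 \<le> RY" unfolding RY_def using M_nn T_pos by simp
  show "0 \<le> Rc" using RY R1_nn R1_RY by linarith
qed

lemma reg_agrees:
  assumes "v \<in> Linf T U"
  obtains N where "negligible N" "\<And>t. t \<in> {0..T} \<Longrightarrow> t \<notin> N \<Longrightarrow> reg v t = v t"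
  by (rule that[OF reg_negligible[OF assms]]) simp

lemma control_trajectory:
  assumes v: "v \<in> Linf T U"
  shows "caratheodory T (\<lambda>t _. v t) Y0 (pos (reg v))"
    and "caratheodory T (\<lambda>t _. v t) Y0 Y \<Longrightarrow> t \<in> {0..T} \<Longrightarrow> Y t = pos (reg v) t"
proof -
  interpret c: controlled "cut Rc H" "\<lambda>l. cut Rc (G l)" B Lp T M "reg v" "pos (reg v)" Y0 
    by (rule admissible_controlled[OF reg_admissible[OF v]])
  obtain N where N: "negligible N" "\<And>t. t \<in> {0..T} \<Longrightarrow> t \<notin> N \<Longrightarrow> reg v t = v t" by (rule reg_agrees[OF v], rule that)
  have "caratheodory T (\<lambda>t _. reg v t) Y0 (pos (reg v))" unfolding caratheodory_def using c.u_abs_int by (simp add: pos_def)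
  then show "caratheodory T (\<lambda>t _. v t) Y0 (pos (reg v))" by (rule caratheodory_spike[OF _ N(1)]) (simp add: N(2))
  show "Y t = pos (reg v) t" if Y: "caratheodory T (\<lambda>t _. v t) Y0 Y" and t: "t \<in> {0..T}"
    using Y t reg_integral[OF v t, where f="\<lambda>_ w. w"] unfolding caratheodory_def pos_def by simp
qed

text \<open>Existence: the Lagrangian solution for the kernels cut at Rc stays where they agree with H and G. Conversely, a solution
comes with a radius R of its own. For the kernels cut at R', chosen after R, it is a weak solution with globally Lipschitz
data, hence transported by its flow, and \<open>lagrangian_of_flow\<close> applies.\<close>

lemma mean_field_represents:
  assumes P: "datum P"
  shows "represents (mean_field_solution T H G Y0 P) P"
proof -
  note D = datum_D[OF P]
  have ex: "\<exists>Y \<mu>. mean_field_solution T H G Y0 P v Y \<mu>" if v: "v \<in> Linf T U" for v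
  proof -
    note u = reg_admissible[OF v]
    interpret c: controlled "cut Rc H" "\<lambda>l. cut Rc (G l)" B Lp T M "reg v" "pos (reg v)" Y0 by (rule admissible_controlled[OF u])
    obtain N where N: "negligible N" "\<And>t. t \<in> {0..T} \<Longrightarrow> t \<notin> N \<Longrightarrow> reg v t = v t" by (rule reg_agrees[OF v], rule that)
    obtain Z where Zc: "jointly_continuous Z" and Z: "c.lagrangian UNIV P Z" by (rule c.lagrangian_exists[OF D(1,2)], rule that)
    define \<mu> where "\<mu> = (\<lambda>t. distr P borel (Z t))"
    have ms: "mean_field_solution T (cut Rc H) (\<lambda>l. cut Rc (G l)) Y0 P (reg v) (pos (reg v)) \<mu>"
      unfolding \<mu>_def by (rule c.lagrangian_mean_field_solution[OF D(1,2,4) R0_nonneg Zc Z])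
    have cv: "c.Cv = B + real CARD('d) * M * B" unfolding vel_bd_def dim_real_def ..
    have ae: "AE x in \<mu> t. norm x \<le> R1" if t: "t \<in> {0..T}" for t
      unfolding \<mu>_def R1_def cv[symmetric] by (rule c.lagrangian_bound[OF D(2) _ Z t]) (use D(4) in simp)
    have \<mu>P: "prob_space (\<mu> t)" "sets (\<mu> t) = sets borel" if t: "t \<in> {0..T}" for t
      using ms t P1_D[of "\<mu> t"] unfolding mean_field_solution_def by auto
    have "mean_field_solution T H G Y0 P v (pos (reg v)) \<mu>"
      unfolding mean_field_solution_def
    proof (intro conjI allI impI)
      show "\<forall>t\<in>{0..T}. \<mu> t \<in> P1" "\<exists>R>0. \<forall>t\<in>{0..T}. msupport (\<mu> t) \<subseteq> ball 0 R" "chi_continuous_curve T (pos (reg v)) \<mu>" "\<mu> 0 = P"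
        using ms unfolding mean_field_solution_def by simp_all
      show "caratheodory T (\<lambda>t _. v t) Y0 (pos (reg v))" by (rule control_trajectory(1)[OF v])
      fix \<phi> :: "real^'d \<Rightarrow> real" and g assume \<phi>: "test_function \<phi> \<and> (\<forall>x. GDERIV \<phi> x :> g x)"
      have gc: "continuous_on UNIV g" by (rule test_function_gradient) (use \<phi> in auto)
      have w: "caratheodory T (\<lambda>t _. \<integral>x. g x \<bullet> cut_velocity Rc (reg v t) (pos (reg v) t) (\<mu> t) x \<partial>\<mu> t)
          (\<integral>x. \<phi> x \<partial>P) (\<lambda>t. \<integral>x. \<phi> x \<partial>\<mu> t)" using ms \<phi> unfolding mean_field_solution_def by simp
      show "caratheodory T (\<lambda>t _. \<integral>x. g x \<bullet> velocity H G (v t) (pos (reg v) t) (\<mu> t) x \<partial>\<mu> t) (\<integral>x. \<phi> x \<partial>P) (\<lambda>t. \<integral>x. \<phi> x \<partial>\<mu> t)"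
      proof (rule weak_form_transfer[OF w N(1) _ gc cut_continuous[OF H_cont Rc_nn] cut_continuous[OF G_cont Rc_nn] H_cont G_cont \<mu>P])
        show "t \<in> {0..T} \<Longrightarrow> t \<notin> N \<Longrightarrow> v t = reg v t" for t using N(2) by simp
        show "AE x in \<mu> t. velocity H G w (pos (reg v) t) (\<mu> t) x = cut_velocity Rc w (pos (reg v) t) (\<mu> t) x"
          if t: "t \<in> {0..T}" for t w
          using ae[OF t]
          by eventually_elim (rule velocity_cut[OF H_cont \<mu>P(2)[OF t] ae[OF t] _ pos_bound[OF u t] R1_RY, symmetric])
      qed
    qed
    then show ?thesis by (intro exI)
  qed
  have rep: "\<exists>Z. lag (reg v) P Z \<and> (\<forall>t\<in>{0..T}. Y t = pos (reg v) t \<and> \<mu> t = distr P borel (Z t))"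
    if v: "v \<in> Linf T U" and ms: "mean_field_solution T H G Y0 P v Y \<mu>" for v Y \<mu>
  proof -
    note u = reg_admissible[OF v]
    obtain N where N: "negligible N" "\<And>t. t \<in> {0..T} \<Longrightarrow> t \<notin> N \<Longrightarrow> reg v t = v t" by (rule reg_agrees[OF v], rule that)
    have Y: "Y t = pos (reg v) t" if "t \<in> {0..T}" for t
      by (rule control_trajectory(2)[OF v _ that]) (use ms in \<open>simp add: mean_field_solution_def\<close>)
    have \<mu>P: "prob_space (\<mu> t)" "sets (\<mu> t) = sets borel" if t: "t \<in> {0..T}" for t
      using ms t P1_D[of "\<mu> t"] unfolding mean_field_solution_def by auto
    have \<mu>0: "\<mu> 0 = P" using ms unfolding mean_field_solution_def by simp
    obtain R where R: "R > 0" "\<forall>t\<in>{0..T}. msupport (\<mu> t) \<subseteq> ball 0 R" using ms unfolding mean_field_solution_def by (elim conjE exE)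
    have aeR: "AE x in \<mu> t. norm x < R" if t: "t \<in> {0..T}" for t
      using AE_msupport[OF \<mu>P(2)[OF t]] by eventually_elim (use subsetD[OF bspec[OF R(2) t]] in simp)
    define R' where "R' = max Rc (2 * R + RY)"
    have R': "Rc \<le> R'" "2 * R + RY \<le> R'" unfolding R'_def by auto
    have R'0: "0 \<le> R'" using R'(1) Rc_nn by linarith
    obtain Lp' where "interaction (cut R' H) (\<lambda>l. cut R' (G l)) B Lp'" using cut_interaction[OF H_ll G_ll H_bd G_bd R'0] by (rule exE)
    note c' = larger_controlled[OF this u]
    have ws: "weak_solution (cut R' H) (\<lambda>l. cut R' (G l)) B Lp' T M (reg v) (pos (reg v)) Y0 \<mu> R"
    proof (rule weak_solution.intro[OF c' weak_solution_axioms.intro])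
      fix \<phi> :: "real^'d \<Rightarrow> real" and g assume \<phi>: "test_function \<phi>" "\<And>x. GDERIV \<phi> x :> g x"
      have gc: "continuous_on UNIV g" by (rule test_function_gradient[OF \<phi>])
      have w: "caratheodory T (\<lambda>t _. \<integral>x. g x \<bullet> velocity H G (v t) (Y t) (\<mu> t) x \<partial>\<mu> t) (\<integral>x. \<phi> x \<partial>\<mu> 0) (\<lambda>t. \<integral>x. \<phi> x \<partial>\<mu> t)"
        using ms \<phi> \<mu>0 unfolding mean_field_solution_def by simp
      show "caratheodory T (\<lambda>t _. \<integral>x. g x \<bullet> cut_velocity R' (reg v t) (pos (reg v) t) (\<mu> t) x \<partial>\<mu> t) (\<integral>x. \<phi> x \<partial>\<mu> 0) (\<lambda>t. \<integral>x. \<phi> x \<partial>\<mu> t)"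
      proof (rule weak_form_transfer[OF w N(1,2) gc H_cont G_cont cut_continuous[OF H_cont R'0] cut_continuous[OF G_cont R'0] \<mu>P])
        show "AE x in \<mu> t. cut_velocity R' w (pos (reg v) t) (\<mu> t) x = velocity H G w (Y t) (\<mu> t) x"
          if t: "t \<in> {0..T}" for t w
        proof -
          have aeR': "AE x in \<mu> t. norm x \<le> R" using aeR[OF t] by eventually_elim simp
          then show ?thesis unfolding Y[OF t]
            by eventually_elim (rule velocity_cut[OF H_cont \<mu>P(2)[OF t] aeR' _ pos_bound[OF u t] R'(2)])
        qed
      qed
    qed (fact \<mu>P aeR)+
    interpret w: weak_solution "cut R' H" "\<lambda>l. cut R' (G l)" B Lp' T M "reg v" "pos (reg v)" Y0 \<mu> R by (rule ws)
    obtain \<Phi> where \<Phi>: "jointly_continuous \<Phi>" "\<And>x. w.flow_line \<mu> x (\<lambda>t. \<Phi> t x)"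
      by (rule w.linear_flow_exists[OF w.good_curve_\<mu>], rule that)
    have \<Phi>x: "continuous_on UNIV (\<Phi> t)" for t
      using continuous_on_compose2[OF \<Phi>(1), of UNIV "\<lambda>x. (t, x)"] by (simp add: continuous_on_Pair continuous_on_const continuous_on_id)
    have eq: "\<mu> t = distr P borel (\<Phi> t)" if "t \<in> {0..T}" for t
      unfolding \<mu>0[symmetric] by (rule w.weak_solution_unique[OF that \<Phi>(2) \<Phi>x])
    have "lag (reg v) P \<Phi>" by (rule lagrangian_of_flow[OF u P c' R'(1) w.good_curve_\<mu> \<Phi> eq])
    then show ?thesis using Y eq by (intro exI[of _ \<Phi>]) simp
  qed
  show ?thesis unfolding represents_def using P ex rep by simp
qed

text \<open>As for the mean-field system, with a simpler converse: the particle trajectories are continuous, so they remain in some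
ball, and each of them is a flow line of the field which their empirical measure generates; flow lines with the same
starting point coincide.\<close>

lemma particle_represents:
  assumes N: "N \<ge> 1" and X0: "\<And>i. i \<in> {1..N} \<Longrightarrow> norm (X0 i) \<le> R0"
  shows "represents (empirical_solution T H G N Y0 X0) (empirical N X0)"
proof -
  define P where "P = empirical N X0"
  have ms: "{x :: real^'d. norm x \<le> r} \<in> sets borel" for r by measurable
  have P: "datum P" unfolding datum_def P_def using empirical_prob[OF N] X0 by (simp add: empirical_sets AE_empirical[OF ms])
  note D = datum_D[OF P]
  have ex: "\<exists>Y \<mu>. empirical_solution T H G N Y0 X0 v Y \<mu>" if v: "v \<in> Linf T U" for v
  proof -
    note u = reg_admissible[OF v]
    interpret c: controlled "cut Rc H" "\<lambda>l. cut Rc (G l)" B Lp T M "reg v" "pos (reg v)" Y0 by (rule admissible_controlled[OF u])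
    obtain E where E: "negligible E" "\<And>t. t \<in> {0..T} \<Longrightarrow> t \<notin> E \<Longrightarrow> reg v t = v t" by (rule reg_agrees[OF v], rule that)
    obtain Z where Z: "c.lagrangian UNIV P Z" by (rule c.lagrangian_exists[OF D(1,2)], rule that)
    have gc: "c.good_curve (\<lambda>t. distr P borel (Z t))" and Zm: "\<And>t. t \<in> {0..T} \<Longrightarrow> Z t \<in> borel_measurable borel"
      and fl: "\<And>x. c.flow_line (\<lambda>t. distr P borel (Z t)) x (\<lambda>t. Z t x)" using Z unfolding c.lagrangian_def by simp_all
    have e: "distr P borel (Z t) = empirical N (\<lambda>i. Z t (X0 i))" if "t \<in> {0..T}" for t
      unfolding P_def by (rule empirical_map[OF Zm[OF that], symmetric])
    have cv: "c.Cv = B + real CARD('d) * M * B" unfolding vel_bd_def dim_real_def ..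
    have nb: "norm (Z t (X0 i)) \<le> R1" if "t \<in> {0..T}" "i \<in> {1..N}" for t i
      using c.flow_line_norm[OF gc fl that(1), of "X0 i"] X0[OF that(2)] unfolding R1_def cv by linarith
    have "particle_solution T H G N Y0 X0 v (pos (reg v)) (\<lambda>i t. Z t (X0 i))"
      unfolding particle_solution_def
    proof (intro conjI ballI control_trajectory(1)[OF v])
      fix i assume i: "i \<in> {1..N}"
      have Zt: "continuous_on {0..T} (\<lambda>t. Z t (X0 i))" using fl[of "X0 i"] unfolding c.flow_line_def by simp
      have "caratheodory T (\<lambda>t x. cut_velocity Rc (reg v t) (pos (reg v) t) (distr P borel (Z t)) x) (X0 i) (\<lambda>t. Z t (X0 i))"
        unfolding caratheodory_def using c.velocity_time[OF gc Zt] fl[of "X0 i"] unfolding c.flow_line_def by simp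
      then show "caratheodory T (\<lambda>t x. velocity H G (v t) (pos (reg v) t) (empirical N (\<lambda>j. Z t (X0 j))) x) (X0 i) (\<lambda>t. Z t (X0 i))"
      proof (rule caratheodory_spike[OF _ E(1)])
        fix t assume t: "t \<in> {0..T}" "t \<notin> E"
        have ae: "AE \<xi> in empirical N (\<lambda>j. Z t (X0 j)). norm \<xi> \<le> R1" unfolding AE_empirical[OF ms] using nb[OF t(1)] by simp
        show "velocity H G (v t) (pos (reg v) t) (empirical N (\<lambda>j. Z t (X0 j))) (Z t (X0 i)) =
           cut_velocity Rc (reg v t) (pos (reg v) t) (distr P borel (Z t)) (Z t (X0 i))"
          unfolding E(2)[OF t] e[OF t(1)]
          by (rule velocity_cut[OF H_cont empirical_sets ae nb[OF t(1) i] pos_bound[OF u t(1)] R1_RY, symmetric])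
      qed
    qed
    then have "empirical_solution T H G N Y0 X0 v (pos (reg v)) (\<lambda>t. empirical N (\<lambda>i. Z t (X0 i)))"
      unfolding empirical_solution_def by (intro exI[of _ "\<lambda>i t. Z t (X0 i)"]) simp
    then show ?thesis by (intro exI)
  qed
  have rep: "\<exists>Z. lag (reg v) P Z \<and> (\<forall>t\<in>{0..T}. Y t = pos (reg v) t \<and> \<mu> t = distr P borel (Z t))"
    if v: "v \<in> Linf T U" and es: "empirical_solution T H G N Y0 X0 v Y \<mu>" for v Y \<mu>
  proof -
    note u = reg_admissible[OF v]
    obtain E where E: "negligible E" "\<And>t. t \<in> {0..T} \<Longrightarrow> t \<notin> E \<Longrightarrow> reg v t = v t" by (rule reg_agrees[OF v], rule that)
    obtain X where X: "particle_solution T H G N Y0 X0 v Y X" and \<mu>: "\<mu> = (\<lambda>t. empirical N (\<lambda>i. X i t))"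
      using es unfolding empirical_solution_def by (elim exE conjE)
    have Y: "Y t = pos (reg v) t" if "t \<in> {0..T}" for t
      by (rule control_trajectory(2)[OF v _ that]) (use X in \<open>simp add: particle_solution_def\<close>)
    have Xc: "caratheodory T (\<lambda>t x. velocity H G (v t) (Y t) (\<mu> t) x) (X0 i) (X i)" if "i \<in> {1..N}" for i
      using X that unfolding particle_solution_def \<mu> by simp
    have Xcont: "continuous_on {0..T} (X i)" if "i \<in> {1..N}" for i by (rule caratheodory_continuous[OF Xc[OF that]])
    have "compact (\<Union>i\<in>{1..N}. X i ` {0..T})" by (intro compact_UN compact_continuous_image Xcont) auto
    then have "bounded (\<Union>i\<in>{1..N}. X i ` {0..T})" by (rule compact_imp_bounded)
    then obtain a where a: "\<forall>x\<in>(\<Union>i\<in>{1..N}. X i ` {0..T}). norm x \<le> a" unfolding bounded_iff by (rule exE)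
    have nb: "norm (X i t) \<le> a" if "t \<in> {0..T}" "i \<in> {1..N}" for t i using a that by simp
    define R' where "R' = max Rc (2 * a + RY)"
    have R': "Rc \<le> R'" "2 * a + RY \<le> R'" unfolding R'_def by auto
    have R'0: "0 \<le> R'" using R'(1) Rc_nn by linarith
    obtain Lp' where "interaction (cut R' H) (\<lambda>l. cut R' (G l)) B Lp'" using cut_interaction[OF H_ll G_ll H_bd G_bd R'0] by (rule exE)
    note c' = larger_controlled[OF this u]
    interpret c': controlled "cut R' H" "\<lambda>l. cut R' (G l)" B Lp' T M "reg v" "pos (reg v)" Y0 by (rule c')
    have gc: "c'.good_curve \<mu>" unfolding c'.good_curve_def
    proof (intro conjI ballI allI)
      show "prob_space (\<mu> s)" for s unfolding \<mu> by (rule empirical_prob[OF N])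
      show "sets (\<mu> s) = sets borel" for s unfolding \<mu> by (rule empirical_sets)
      show "continuous_on {0..T} (\<lambda>s. conv (cut R' H) (\<mu> s) x)" for x
        unfolding \<mu> conv_empirical[OF cut_continuous[OF H_cont R'0]]
        by (intro continuous_intros continuous_on_compose2[OF cut_continuous[OF H_cont R'0]] Xcont) auto
    qed
    have fl: "c'.flow_line \<mu> (X0 i) (X i)" if i: "i \<in> {1..N}" for i
      unfolding c'.flow_line_def
    proof (intro conjI ballI Xcont i)
      fix t assume t: "t \<in> {0..T}"
      have "X i t = X0 i + integral {0..t} (\<lambda>s. velocity H G (v s) (Y s) (\<mu> s) (X i s))"
        using Xc[OF i] t unfolding caratheodory_def by simp
      also have "integral {0..t} (\<lambda>s. velocity H G (v s) (Y s) (\<mu> s) (X i s)) =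
         integral {0..t} (\<lambda>s. cut_velocity R' (reg v s) (pos (reg v) s) (\<mu> s) (X i s))"
      proof (rule integral_spike[OF E(1)])
        fix s assume "s \<in> {0..t} - E"
        then have s: "s \<in> {0..T}" "s \<notin> E" using t by auto
        have ae: "AE \<xi> in empirical N (\<lambda>j. X j s). norm \<xi> \<le> a" unfolding AE_empirical[OF ms] using nb[OF s(1)] by simp
        show "cut_velocity R' (reg v s) (pos (reg v) s) (\<mu> s) (X i s) = velocity H G (v s) (Y s) (\<mu> s) (X i s)"
          unfolding E(2)[OF s] Y[OF s(1)] \<mu>
          by (rule velocity_cut[OF H_cont empirical_sets ae nb[OF s(1) i] pos_bound[OF u s(1)] R'(2)])
      qed
      finally show "X i t = X0 i + integral {0..t} (\<lambda>s. cut_velocity R' (reg v s) (pos (reg v) s) (\<mu> s) (X i s))" .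
    qed
    obtain \<Phi> where \<Phi>: "jointly_continuous \<Phi>" "\<And>x. c'.flow_line \<mu> x (\<lambda>t. \<Phi> t x)"
      by (rule c'.linear_flow_exists[OF gc], rule that)
    have \<Phi>x: "continuous_on UNIV (\<Phi> t)" for t
      using continuous_on_compose2[OF \<Phi>(1), of UNIV "\<lambda>x. (t, x)"] by (simp add: continuous_on_Pair continuous_on_const continuous_on_id)
    have X\<Phi>: "X i t = \<Phi> t (X0 i)" if "t \<in> {0..T}" "i \<in> {1..N}" for t i
      using c'.flow_line_close[OF gc fl[OF that(2)] \<Phi>(2)[of "X0 i"] that(1)] by simp
    have eq: "\<mu> t = distr P borel (\<Phi> t)" if t: "t \<in> {0..T}" for t
    proof -
      have "\<mu> t = empirical N (\<lambda>i. \<Phi> t (X0 i))" unfolding \<mu> by (rule empirical_cong) (rule X\<Phi>[OF t])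
      also have "\<dots> = distr P borel (\<Phi> t)" unfolding P_def by (rule empirical_map[OF borel_measurable_continuous_onI[OF \<Phi>x]])
      finally show ?thesis .
    qed
    have "lag (reg v) P \<Phi>" by (rule lagrangian_of_flow[OF u P c' R'(1) gc \<Phi> eq])
    then show ?thesis using Y eq by (intro exI[of _ \<Phi>]) simp
  qed
  show ?thesis unfolding represents_def P_def[symmetric] using P ex rep by simp
qed

end

section \<open>Mean-field limit of optimal controls\<close>

lemma localized_problem_exists:
  fixes H :: "real^'d \<Rightarrow> real^'d" and G :: "'d \<Rightarrow> real^'d \<Rightarrow> real^'d" and U :: "((real^'d)^'m) set"
  assumes T: "T > 0" and H: "bounded (range H)" "locally_lipschitz H"
    and G: "\<And>l. bounded (range (G l))" "\<And>l. locally_lipschitz (G l)"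
    and L: "\<And>Y \<mu>. \<mu> \<in> P1 \<Longrightarrow> L Y \<mu> \<ge> 0" "chi_continuous L"
    and U: "U \<noteq> {}" "compact U" "convex U" and R0: "0 \<le> R0"
  shows "\<exists>Rc B Lp M. localized_problem H G Rc B Lp T M R0 U Y0 L"
proof -
  obtain b where b: "\<forall>y\<in>range H. norm y \<le> b" using H(1) unfolding bounded_iff by (rule exE)
  have "\<forall>l. \<exists>c. \<forall>y\<in>range (G l). norm y \<le> c" using G(1) unfolding bounded_iff by simp
  from choice[OF this] obtain c where c: "\<forall>l. \<forall>y\<in>range (G l). norm y \<le> c l" by (rule exE)
  define B where "B = \<bar>b\<bar> + (\<Sum>l\<in>UNIV. \<bar>c l\<bar>)"
  have Hb: "norm (H x) \<le> B" for x
  proof -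
    have "norm (H x) \<le> b" using b by simp
    moreover have "0 \<le> (\<Sum>l\<in>UNIV. \<bar>c l\<bar>)" by (rule sum_nonneg) simp
    ultimately show ?thesis unfolding B_def by linarith
  qed
  have Gb: "norm (G l x) \<le> B" for l x
  proof -
    have "norm (G l x) \<le> c l" using c by simp
    moreover have "\<bar>c l\<bar> \<le> (\<Sum>l\<in>UNIV. \<bar>c l\<bar>)" by (rule member_le_sum) auto
    ultimately show ?thesis unfolding B_def by linarith
  qed
  obtain M where M: "\<forall>w\<in>U. norm w \<le> M" using compact_imp_bounded[OF U(2)] unfolding bounded_iff by (rule exE)
  define Rc where "Rc = max 0 (2 * (R0 + (B + real CARD('d) * M * B) * T) + (norm Y0 + M * T))"
  have Rc0: "0 \<le> Rc" unfolding Rc_def by simp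
  obtain Lp where Lp: "interaction (cut Rc H) (\<lambda>l. cut Rc (G l)) B Lp"
    using cut_interaction[where H=H and G=G, OF H(2) G(2) Hb Gb Rc0] by (rule exE)
  have "localized_problem H G Rc B Lp T M R0 U Y0 L"
  proof (intro localized_problem.intro localized_problem_axioms.intro control_problem.intro control_problem_axioms.intro Lp T R0 U L H(2) G(2) Hb Gb)
    show "w \<in> U \<Longrightarrow> norm w \<le> M" for w using M by simp
    show "2 * (R0 + (B + real CARD('d) * M * B) * T) + (norm Y0 + M * T) \<le> Rc" unfolding Rc_def by simp
  qed
  then show ?thesis by (intro exI)
qed

theorem corollary1:
  fixes T :: real
    and H :: "real^'d \<Rightarrow> real^'d"
    and G :: "'d \<Rightarrow> real^'d \<Rightarrow> real^'d"
    and C\<^sub>H :: real and C\<^sub>G :: "'d \<Rightarrow> real"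
    and L :: "(real^'d)^'m \<Rightarrow> (real^'d) measure \<Rightarrow> real"
    and U :: "((real^'d)^'m) set"
    and Y0 :: "(real^'d)^'m" and \<mu>0 :: "(real^'d) measure"
  assumes "T > 0"
    and "bounded (range H)" and "locally_lipschitz H"
    and "\<And>\<xi>. norm (H \<xi>) \<le> C\<^sub>H * (1 + norm \<xi>)"
    and "\<And>l. bounded (range (G l))" and "\<And>l. locally_lipschitz (G l)"
    and "\<And>l \<xi>. norm (G l \<xi>) \<le> C\<^sub>G l * (1 + norm \<xi>)"
    and "\<And>Y \<mu>. \<mu> \<in> P1 \<Longrightarrow> L Y \<mu> \<ge> 0"
    and "chi_continuous L"
    and "\<And>\<mu>s \<mu>. (\<And>j. \<mu>s j \<in> P1) \<Longrightarrow> \<mu> \<in> P1 \<Longrightarrow> narrow_converges \<mu>s \<mu> \<Longrightarrow>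
           uniform_limit UNIV (\<lambda>j Y. L Y (\<mu>s j)) (\<lambda>Y. L Y \<mu>) sequentially"
    and "U \<noteq> {}" and "compact U" and "convex U"
    and "\<mu>0 \<in> P1" and "compact (msupport \<mu>0)"
  shows "(\<exists>u. optimal_control T L U (mean_field_solution T H G Y0 \<mu>0) u) \<and>
    (\<forall>X0. approximates X0 \<mu>0 \<longrightarrow>
       (\<forall>N\<ge>1. \<exists>u. optimal_control T L U (empirical_solution T H G N Y0 (X0 N)) u) \<and>
       (\<forall>uN. (\<forall>N\<ge>1. optimal_control T L U (empirical_solution T H G N Y0 (X0 N)) (uN N)) \<longrightarrow>
          (\<exists>r ustar. strict_mono r \<and> weak_star_converges T (\<lambda>n. uN (r n)) ustar \<and>
             optimal_control T L U (mean_field_solution T H G Y0 \<mu>0) ustar)))"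
proof -
  obtain a where a: "\<forall>x\<in>msupport \<mu>0. norm x \<le> a" using compact_imp_bounded[OF assms(15)] unfolding bounded_iff by (rule exE)
  note \<mu>0 = P1_D[OF assms(14)]
  have ae: "AE x in \<mu>0. norm x \<le> a" using AE_msupport[OF \<mu>0(2)] by eventually_elim (use a in simp)
  have loc: "\<exists>Rc B Lp M. localized_problem H G Rc B Lp T M R0 U Y0 L" if R0: "0 \<le> R0" for R0
    by (rule localized_problem_exists) (fact assms R0)+
  have part1: "\<exists>u. optimal_control T L U (mean_field_solution T H G Y0 \<mu>0) u"
  proof -
    have a0: "0 \<le> max 0 a" by simp
    obtain Rc B Lp M where "localized_problem H G Rc B Lp T M (max 0 a) U Y0 L" using loc[OF a0] by (elim exE)
    then interpret localized_problem H G Rc B Lp T M "max 0 a" U Y0 L .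
    have "AE x in \<mu>0. norm x \<le> max 0 a" using ae by eventually_elim simp
    then have "datum \<mu>0" unfolding datum_def using \<mu>0 by simp
    then show ?thesis by (rule optimal_control_exists[OF mean_field_represents])
  qed
  have part2: "(\<forall>N\<ge>1. \<exists>u. optimal_control T L U (empirical_solution T H G N Y0 (X0 N)) u) \<and>
       (\<forall>uN. (\<forall>N\<ge>1. optimal_control T L U (empirical_solution T H G N Y0 (X0 N)) (uN N)) \<longrightarrow>
          (\<exists>r ustar. strict_mono r \<and> weak_star_converges T (\<lambda>n. uN (r n)) ustar \<and>
             optimal_control T L U (mean_field_solution T H G Y0 \<mu>0) ustar))" if ap: "approximates X0 \<mu>0" for X0
  proof -
    obtain K where K: "compact K" "\<forall>N\<ge>1. msupport (empirical N (X0 N)) \<subseteq> K" and W: "(\<lambda>N. W1 (empirical N (X0 N)) \<mu>0) \<longlonglongrightarrow> 0"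
      using ap unfolding approximates_def by (elim exE conjE)
    obtain b where b: "\<forall>x\<in>K. norm x \<le> b" using compact_imp_bounded[OF K(1)] unfolding bounded_iff by (rule exE)
    define R0 where "R0 = max 0 (max a b)"
    have R0: "0 \<le> R0" "a \<le> R0" "b \<le> R0" unfolding R0_def by auto
    have ms: "{x. x \<in> K} \<in> sets borel" using borel_closed[OF compact_imp_closed[OF K(1)]] by simp
    have X0: "norm (X0 N i) \<le> R0" if N: "N \<ge> 1" and i: "i \<in> {1..N}" for N i
    proof -
      have "AE x in empirical N (X0 N). x \<in> K" using AE_msupport[OF empirical_sets[of N "X0 N"]] by eventually_elim (use K(2) N in auto)
      then have "X0 N i \<in> K" using i unfolding AE_empirical[OF ms] by simp
      then show ?thesis using b R0(3) by (intro order_trans[OF _ R0(3)]) simp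
    qed
    obtain Rc B Lp M where "localized_problem H G Rc B Lp T M R0 U Y0 L" using loc[OF R0(1)] by (elim exE)
    then interpret localized_problem H G Rc B Lp T M R0 U Y0 L .
    have "AE x in \<mu>0. norm x \<le> R0" using ae by eventually_elim (use R0(2) in simp)
    then have d: "datum \<mu>0" unfolding datum_def using \<mu>0 by simp
    have rep: "represents (empirical_solution T H G N Y0 (X0 N)) (empirical N (X0 N))" if "N \<ge> 1" for N
      by (rule particle_represents[OF that X0[OF that]])
    have "\<exists>r u. strict_mono r \<and> weak_star_converges T (\<lambda>n. uN (r n)) u \<and> optimal_control T L U (mean_field_solution T H G Y0 \<mu>0) u"
      if opt: "\<forall>N\<ge>1. optimal_control T L U (empirical_solution T H G N Y0 (X0 N)) (uN N)" for uN
    proof -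
      have "\<exists>r u. strict_mono r \<and> weak_star_converges T (\<lambda>n. uN (Suc (r n))) u \<and> optimal_control T L U (mean_field_solution T H G Y0 \<mu>0) u"
      proof (rule nearly_optimal_compactness[where us="\<lambda>n. uN (Suc n)" and \<epsilon>="\<lambda>_. 0" and Sn="\<lambda>n. empirical_solution T H G (Suc n) Y0 (X0 (Suc n))"
            and Ps="\<lambda>n. empirical (Suc n) (X0 (Suc n))", OF _ mean_field_represents[OF d]])
        show "represents (empirical_solution T H G (Suc n) Y0 (X0 (Suc n))) (empirical (Suc n) (X0 (Suc n)))" for n by (rule rep) simp
        show "(\<lambda>n. W1 (empirical (Suc n) (X0 (Suc n))) \<mu>0) \<longlonglongrightarrow> 0" using W by (rule LIMSEQ_Suc)
        show "(\<lambda>_::nat. 0::real) \<longlonglongrightarrow> 0" by simp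
        show "nearly_optimal (empirical_solution T H G (Suc n) Y0 (X0 (Suc n))) 0 (uN (Suc n))" for n
          by (rule optimal_nearly_optimal) (use opt in simp)
      qed
      then obtain r u where r: "strict_mono r" "weak_star_converges T (\<lambda>n. uN (Suc (r n))) u" "optimal_control T L U (mean_field_solution T H G Y0 \<mu>0) u"
        by (elim exE conjE)
      (* Particle numbers start at one, so the subsequence is shifted. *)
      have "strict_mono (\<lambda>n. Suc (r n))" using r(1) unfolding strict_mono_def by simp
      then show ?thesis using r(2,3) by (intro exI[of _ "\<lambda>n. Suc (r n)"] exI[of _ u]) simp
    qed
    then show ?thesis using optimal_control_exists[OF rep] by simp
  qed
  show ?thesis using part1 part2 by simp
qed

end
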